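(* Let $s>\frac12$, $T>0$, $R>0$ and $u_0\in H^{s+4}(\mathbb R)$. Let $u_R$ be the mild solution on $[0,T]$ of the truncated equation $$du_R=\mathbf i\,\Delta u_R\circ dW+\mathbf i\,\theta_R(u_R)\,|u_R|^{2\sigma}u_R\,dt,\qquad u_R(0)=u_0,$$ and, for $N\ge1$ and $\delta t=T/N$, let $(u_R^n)_{0\le n\le N}$ be given by $u_R^0=u_0$ and the splitting scheme $$\tilde u_R^n=\exp\!\left(\mathbf i\,\delta t\,\theta_R(u_R^n)\,|u_R^n|^{2\sigma}\right)u_R^n,\qquad u_R^{n+1}=\exp\!\left(\mathbf i\,\delta W_n\,\Delta\right)\tilde u_R^n .$$ Then the scheme has mean square order one, i.e. there is a constant $C=C(T,R,\|u_0\|_{H^{s+4}})$ (not depending on $N$) such that $$\sup_{0\le n\le N}\mathbb E\left(\|u_R^n-u_R(t_n)\|_{H^s}^2\right)\le C(\delta t)^2 .$$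
   Context: $W$ is a one-dimensional real-valued Brownian motion on a stochastic basis $(\Omega,\mathscr F,(\mathscr F_t)_{t\ge0},\mathbb P)$, $\circ\,dW$ denotes the Stratonovich differential, $\mathbf i$ is the imaginary unit, $\sigma\le2$ is a positive integer. The equation is posed on $[0,T]\times\mathbb R$ with complex-valued $u_R$. $H^s=H^s(\mathbb R)$ is the Sobolev space with $\|v\|_{H^s}^2=\int_{\mathbb R}(1+|\xi|^2)^s|\hat v(\xi)|^2\,d\xi$. Truncation: $\theta$ is a fixed smooth function on $[0,\infty)$ with $\operatorname{supp}\theta\subset[0,2]$ and $\theta=1$ on $[0,1]$, and $\theta_R(u):=\theta\!\left(\|u\|_{H^s}/R\right)$. Mild solution: $u_R(t)=S(t,0)u_0+\mathbf i\int_0^tS(t,r)\theta_R(u_R(r))|u_R(r)|^{2\sigma}u_R(r)\,dr$ with $S(t,r)=\exp(\mathbf i(W(t)-W(r))\Delta)$. Discretization: $t_n=n\,\delta t$, $\delta W_n=W(t_{n+1})-W(t_n)$. The fixed data $s,\sigma,\theta$ are not listed among the arguments of the constant $C$. *)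

theory Defs
  imports "HOL-Probability.Probability"
begin

section \<open>Fourier transform on \<open>L\<^sup>2(\<real>)\<close> and the Sobolev spaces \<open>H\<^sup>s(\<real>)\<close>\<close>

text \<open>
  Elements of \<open>L\<^sup>2(\<real>)\<close> and \<open>H\<^sup>s(\<real>)\<close> are represented by Borel functions; two functions that agree
  Lebesgue-almost everywhere represent the same element.
\<close>

definition L2 :: "(real \<Rightarrow> complex) set" where
  "L2 = {f \<in> borel_measurable lborel. integrable lborel (\<lambda>x. (cmod (f x))\<^sup>2)}"

text \<open>
  Fourier--Plancherel transform: the \<open>L\<^sup>2\<close>-limit of the truncated integrals
  \<open>(2\<pi>)\<^sup>-\<^sup>1\<^sup>/\<^sup>2 \<integral>\<^sub>[\<^sub>-\<^sub>n\<^sub>,\<^sub>n\<^sub>] e\<^sup>-\<^sup>i\<^sup>\<xi>\<^sup>x f(x) dx\<close>. With this frequency convention \<open>\<Delta>\<close> is the multiplier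
  \<open>-\<xi>\<^sup>2\<close>, and with this normalisation the transform is unitary. Both components of a pair determine
  each other up to null sets, and every element of \<open>L2\<close> occurs on either side (Plancherel), so the
  choices made in the two definitions that follow are immaterial.
\<close>

definition fourier_pair :: "(real \<Rightarrow> complex) \<Rightarrow> (real \<Rightarrow> complex) \<Rightarrow> bool" where
  "fourier_pair f g \<longleftrightarrow> f \<in> L2 \<and> g \<in> L2 \<and>
     (\<lambda>n::nat. \<integral>\<^sup>+\<xi>. ennreal ((cmod
          (complex_of_real (1 / sqrt (2 * pi)) *
             (CLBINT x:{- real n..real n}. exp (- (\<i> * complex_of_real (\<xi> * x))) * f x)
           - g \<xi>))\<^sup>2) \<partial>lborel) \<longlonglongrightarrow> 0"

definition fourier :: "(real \<Rightarrow> complex) \<Rightarrow> real \<Rightarrow> complex" where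
  "fourier f = (SOME g. fourier_pair f g)"

definition inv_fourier :: "(real \<Rightarrow> complex) \<Rightarrow> real \<Rightarrow> complex" where
  "inv_fourier g = (SOME f. fourier_pair f g)"

text \<open>The following is the Sobolev space for \<open>s \<ge> 0\<close> only, which is all that is needed here.\<close>

definition Hs :: "real \<Rightarrow> (real \<Rightarrow> complex) set" where
  "Hs s = {v \<in> L2. integrable lborel (\<lambda>\<xi>. (1 + \<xi>\<^sup>2) powr s * (cmod (fourier v \<xi>))\<^sup>2)}"

definition Hs_norm :: "real \<Rightarrow> (real \<Rightarrow> complex) \<Rightarrow> real" where
  "Hs_norm s v = sqrt (LBINT \<xi>. (1 + \<xi>\<^sup>2) powr s * (cmod (fourier v \<xi>))\<^sup>2)"

text \<open>\<open>free_flow a\<close> is \<open>exp(i a \<Delta>)\<close>.\<close>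

definition free_flow :: "real \<Rightarrow> (real \<Rightarrow> complex) \<Rightarrow> real \<Rightarrow> complex" where
  "free_flow a v =
     inv_fourier (\<lambda>\<xi>. exp (- (\<i> * complex_of_real (a * \<xi>\<^sup>2))) * fourier v \<xi>)"

text \<open>
  Bochner integral on \<open>[a,b]\<close> of an \<open>H\<^sup>s\<close>-valued function. This is the definition of
  \<^const>\<open>has_bochner_integral\<close> with \<open>H\<^sup>s\<close> as target space; the library constant is not applicable
  because \<open>H\<^sup>s\<close> is not a type. The integral of an \<open>H\<^sup>s\<close>-valued simple function is a finite linear
  combination of its values, so it is computed pointwise in \<open>x\<close>. Measurability of the errors
  \<open>\<parallel>\<Phi> - \<phi>\<^sub>k\<parallel>\<close> together with their \<open>L\<^sup>1\<close>-convergence to \<open>0\<close> gives strong measurability of \<open>\<Phi>\<close>.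
\<close>

definition has_Hs_integral ::
    "real \<Rightarrow> real \<Rightarrow> real \<Rightarrow> (real \<Rightarrow> real \<Rightarrow> complex) \<Rightarrow> (real \<Rightarrow> complex) \<Rightarrow> bool" where
  "has_Hs_integral s a b \<Phi> J \<longleftrightarrow>
     (\<forall>r\<in>{a..b}. \<Phi> r \<in> Hs s) \<and> J \<in> Hs s \<and>
     (\<exists>\<phi> :: nat \<Rightarrow> real \<Rightarrow> real \<Rightarrow> complex.
        (\<forall>k. simple_function (restrict_space lborel {a..b}) (\<phi> k) \<and>
             (\<forall>r\<in>{a..b}. \<phi> k r \<in> Hs s) \<and>
             (\<lambda>r. Hs_norm s (\<lambda>x. \<Phi> r x - \<phi> k r x))
               \<in> borel_measurable (restrict_space lborel {a..b})) \<and>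
        (\<lambda>k. \<integral>\<^sup>+r. ennreal (Hs_norm s (\<lambda>x. \<Phi> r x - \<phi> k r x))
               \<partial>restrict_space lborel {a..b}) \<longlonglongrightarrow> 0 \<and>
        (\<lambda>k. Hs_norm s (\<lambda>x. J x - (\<integral>r. \<phi> k r x \<partial>restrict_space lborel {a..b}))) \<longlonglongrightarrow> 0)"


section \<open>Brownian motion on a stochastic basis\<close>

text \<open>
  The filtration is indexed by all reals in order to use the locale \<^locale>\<open>filtration\<close>; only
  times \<open>t \<ge> 0\<close> matter, since a filtration on \<open>[0,\<infinity>)\<close> extends by \<open>F\<^sub>t = F\<^sub>0\<close> for \<open>t < 0\<close>.
\<close>

locale brownian_motion = prob_space M + filtration "space M" F
  for M :: "'w measure" and F :: "real \<Rightarrow> 'w measure" +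
  fixes W :: "real \<Rightarrow> 'w \<Rightarrow> real"
  assumes subalgebra_F: "\<And>t. subalgebra M (F t)"
    and adapted: "\<And>t. 0 \<le> t \<Longrightarrow> W t \<in> borel_measurable (F t)"
    and initial: "AE \<omega> in M. W 0 \<omega> = 0"
    and continuous_paths: "AE \<omega> in M. continuous_on {0..} (\<lambda>t. W t \<omega>)"
    and gaussian_increments: "\<And>r t. 0 \<le> r \<Longrightarrow> r < t \<Longrightarrow>
        distributed M lborel (\<lambda>\<omega>. W t \<omega> - W r \<omega>) (normal_density 0 (sqrt (t - r)))"
    and independent_increments: "\<And>r t. 0 \<le> r \<Longrightarrow> r < t \<Longrightarrow>
        indep_set (sets (F r)) (sets (vimage_algebra (space M) (\<lambda>\<omega>. W t \<omega> - W r \<omega>) borel))"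


section \<open>Truncated equation and splitting scheme\<close>

definition smooth_halfline :: "(real \<Rightarrow> real) \<Rightarrow> bool" where
  "smooth_halfline \<theta> \<longleftrightarrow> (\<exists>D :: nat \<Rightarrow> real \<Rightarrow> real. (\<forall>x\<ge>0. D 0 x = \<theta> x) \<and>
     (\<forall>k. \<forall>x\<ge>0. (D k has_real_derivative D (Suc k) x) (at x within {0..})))"

definition theta_R :: "real \<Rightarrow> (real \<Rightarrow> real) \<Rightarrow> real \<Rightarrow> (real \<Rightarrow> complex) \<Rightarrow> real" where
  "theta_R s \<theta> R v = \<theta> (Hs_norm s v / R)"

text \<open>
  Adaptedness of the \<open>H\<^sup>s\<close>-valued process is expressed by measurability of all the distances to
  fixed elements, i.e. of the preimages of balls; as \<open>H\<^sup>s\<close> is separable these generate its Borel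
  \<open>\<sigma>\<close>-algebra. The last equation is an equality of elements of \<open>H\<^sup>s\<close>, hence almost everywhere in
  \<open>x\<close>; \<open>free_flow (W t \<omega> - W r \<omega>)\<close> is the random propagator \<open>S(t,r)\<close>.
\<close>

definition mild_solution ::
    "'w measure \<Rightarrow> (real \<Rightarrow> 'w measure) \<Rightarrow> (real \<Rightarrow> 'w \<Rightarrow> real) \<Rightarrow> real \<Rightarrow> nat \<Rightarrow> (real \<Rightarrow> real) \<Rightarrow>
     real \<Rightarrow> real \<Rightarrow> (real \<Rightarrow> complex) \<Rightarrow> (real \<Rightarrow> 'w \<Rightarrow> real \<Rightarrow> complex) \<Rightarrow> bool" where
  "mild_solution M F W s \<sigma> \<theta> R T u0 u \<longleftrightarrow>
     (\<forall>t\<in>{0..T}. \<forall>\<omega>\<in>space M. u t \<omega> \<in> Hs s) \<and>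
     (\<forall>t\<in>{0..T}. \<forall>v\<in>Hs s. (\<lambda>\<omega>. Hs_norm s (\<lambda>x. u t \<omega> x - v x)) \<in> borel_measurable (F t)) \<and>
     (AE \<omega> in M.
        (\<forall>t\<in>{0..T}.
           ((\<lambda>r. Hs_norm s (\<lambda>x. u r \<omega> x - u t \<omega> x)) \<longlongrightarrow> 0) (at t within {0..T})) \<and>
        (\<forall>t\<in>{0..T}. \<exists>J.
           has_Hs_integral s 0 t
             (\<lambda>r. free_flow (W t \<omega> - W r \<omega>)
                (\<lambda>x. complex_of_real (theta_R s \<theta> R (u r \<omega>) * cmod (u r \<omega> x) ^ (2 * \<sigma>)) * u r \<omega> x))
             J \<and>
           (AE x in lborel. u t \<omega> x = free_flow (W t \<omega> - W 0 \<omega>) u0 x + \<i> * J x)))"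

text \<open>The scheme with step \<open>\<delta>\<close> along a fixed path \<open>w\<close> of the Brownian motion.\<close>

primrec splitting ::
    "real \<Rightarrow> nat \<Rightarrow> (real \<Rightarrow> real) \<Rightarrow> real \<Rightarrow> real \<Rightarrow> (real \<Rightarrow> real) \<Rightarrow> (real \<Rightarrow> complex) \<Rightarrow> nat \<Rightarrow>
     real \<Rightarrow> complex" where
  "splitting s \<sigma> \<theta> R \<delta> w u0 0 = u0"
| "splitting s \<sigma> \<theta> R \<delta> w u0 (Suc n) =
     (let v = splitting s \<sigma> \<theta> R \<delta> w u0 n;
          v' = (\<lambda>x. exp (\<i> * complex_of_real (\<delta> * theta_R s \<theta> R v * cmod (v x) ^ (2 * \<sigma>))) * v x)
      in free_flow (w (real (Suc n) * \<delta>) - w (real n * \<delta>)) v')"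

end

theory Submission
  imports Defs
begin

text \<open>In the interaction picture $v(t) = \exp(-\mathbf i W(t)\Delta)\,u(t)$ the equation becomes, path by path, the
  ordinary differential equation $v' = G(W(t), v)$ in $H^s$, whose vector field is globally Lipschitz because of
  the truncation. The splitting scheme becomes its explicit Euler scheme up to a local defect $O(\delta t^2)$.
  One Euler step $h$ is compared with $m$ steps $h/m$. For $v$ in $H^{s+4}$, a class which the scheme preserves,
  $G(a+b,v) - G(a,v) = b\,A(a,v) + O(b^2 + |b|\,h)$ with a difference quotient $A$ that only depends on the past.
  The remainder contributes $O(h)$ in mean square. The linear terms, with $b$ a Brownian increment, are orthogonal
  martingale increments of variance $O(h^3)$, so their sum is $O(h)$ in mean square as well instead of the pathwise
  $O(h^{1/2})$. Finally $m \to \infty$: for every continuous path the fine scheme converges to the mild solution.\<close>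

section \<open>The Hilbert space \<open>L\<^sup>2(\<real>)\<close>\<close>

text \<open>The difficulty is to have Hilbert space values, randomness and adaptedness at once,
  while the solution is known only through measurable distances and a Bochner integral. Comparing
  the scheme with its own refinement confines all probability to continuous functionals of finitely
  many path values, whose adaptedness follows from continuity; the solution enters only pathwise, in
  the limit, and no regularity of order \<open>s + 4\<close> has to be proved for it. The difference
  quotient stands in for the derivative of \<open>G\<close> in its first argument, which would
  involve the unbounded generator. The quotient is defined and continuous everywhere, and the
  exchange costs only the term |b| h. The four extra orders pay for two Laplacians in the b^2
  remainder. Regularity survives N steps with a bound independent of N because the product estimate
  is linear in the higher norm; the cut-off controls nothing beyond the norm of \<open>H^s\<close>.
  Series, continuity and inner products require a type, hence the coordinates in \<open>l2\<close>
  on the Fourier side.\<close>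

lemma measurable_cnj[measurable]: "cnj \<in> borel_measurable borel"
  by (intro borel_measurable_continuous_onI continuous_intros)

lemma L2I:
  assumes "f \<in> borel_measurable borel" "(\<integral>\<^sup>+x. ennreal ((cmod (f x))\<^sup>2) \<partial>lborel) < \<infinity>"
  shows "f \<in> L2"
  unfolding L2_def using assms by (auto intro!: integrableI_bounded)

lemma L2_measurable[measurable_dest]: "f \<in> L2 \<Longrightarrow> f \<in> borel_measurable borel"
  unfolding L2_def by auto

lemma L2_integrable: "f \<in> L2 \<Longrightarrow> integrable lborel (\<lambda>x. (cmod (f x))\<^sup>2)"
  unfolding L2_def by auto

lemma L2_dominated:
  assumes "g \<in> L2" and [measurable]: "f \<in> borel_measurable borel"
    and "AE x in lborel. cmod (f x) \<le> c * cmod (g x)"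
  shows "f \<in> L2"
proof -
  have "integrable lborel (\<lambda>x. c\<^sup>2 * (cmod (g x))\<^sup>2)"
    using L2_integrable[OF assms(1)] by simp
  then have "integrable lborel (\<lambda>x. (cmod (f x))\<^sup>2)"
  proof (rule Bochner_Integration.integrable_bound)
    show "AE x in lborel. norm ((cmod (f x))\<^sup>2) \<le> norm (c\<^sup>2 * (cmod (g x))\<^sup>2)"
      using assms(3)
    proof eventually_elim
      case (elim x)
      then have "(cmod (f x))\<^sup>2 \<le> (c * cmod (g x))\<^sup>2" by (intro power_mono) auto
      then show ?case by (simp add: power_mult_distrib)
    qed
  qed simp
  then show ?thesis unfolding L2_def by simp
qed

lemma L2_zero: "(\<lambda>_. 0) \<in> L2"
  unfolding L2_def by simp

lemma L2_add:
  assumes "f \<in> L2" "g \<in> L2"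
  shows "(\<lambda>x. f x + g x) \<in> L2"
proof -
  have [measurable]: "f \<in> borel_measurable borel" "g \<in> borel_measurable borel"
    using assms by (auto intro: L2_measurable)
  have "integrable lborel (\<lambda>x. 2 * (cmod (f x))\<^sup>2 + 2 * (cmod (g x))\<^sup>2)"
    using assms by (auto intro!: integrable_add L2_integrable)
  then have "integrable lborel (\<lambda>x. (cmod (f x + g x))\<^sup>2)"
  proof (rule Bochner_Integration.integrable_bound)
    show "AE x in lborel. norm ((cmod (f x + g x))\<^sup>2) \<le> norm (2 * (cmod (f x))\<^sup>2 + 2 * (cmod (g x))\<^sup>2)"
    proof (rule AE_I2)
      fix x
      have "(cmod (f x + g x))\<^sup>2 \<le> (cmod (f x) + cmod (g x))\<^sup>2"
        by (intro power_mono norm_triangle_ineq) auto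
      also have "\<dots> \<le> 2 * (cmod (f x))\<^sup>2 + 2 * (cmod (g x))\<^sup>2"
        using sum_squares_bound[of "cmod (f x)" "cmod (g x)"] by (simp add: power2_sum)
      finally show "norm ((cmod (f x + g x))\<^sup>2) \<le> norm (2 * (cmod (f x))\<^sup>2 + 2 * (cmod (g x))\<^sup>2)"
        by simp
    qed
  qed simp
  then show ?thesis unfolding L2_def by simp
qed

lemma L2_cmult: "f \<in> L2 \<Longrightarrow> (\<lambda>x. c * f x) \<in> L2"
  by (rule L2_dominated[where c="cmod c"]) (auto simp: norm_mult)

lemma L2_minus: "f \<in> L2 \<Longrightarrow> (\<lambda>x. - f x) \<in> L2"
  using L2_cmult[of f "-1"] by simp

lemma L2_scaleR: "f \<in> L2 \<Longrightarrow> (\<lambda>x. r *\<^sub>R f x) \<in> L2"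
  using L2_cmult[of f "of_real r"] by (simp add: scaleR_conv_of_real)

lemma L2_diff: "f \<in> L2 \<Longrightarrow> g \<in> L2 \<Longrightarrow> (\<lambda>x. f x - g x) \<in> L2"
  using L2_add[OF _ L2_minus, of f g] by simp

lemma L2_cong_AE:
  assumes "f \<in> L2" "g \<in> borel_measurable borel" "AE x in lborel. f x = g x"
  shows "g \<in> L2"
  using assms by (intro L2_dominated[of f g 1]) auto

lemma L2_prod_integrable:
  assumes "f \<in> L2" "g \<in> L2"
  shows "integrable lborel (\<lambda>x. f x * cnj (g x))"
proof -
  have [measurable]: "f \<in> borel_measurable borel" "g \<in> borel_measurable borel"
    using assms by (auto intro: L2_measurable)
  have "integrable lborel (\<lambda>x. (cmod (f x))\<^sup>2 + (cmod (g x))\<^sup>2)"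
    using assms by (auto intro!: integrable_add L2_integrable)
  then show ?thesis
  proof (rule Bochner_Integration.integrable_bound)
    show "AE x in lborel. norm (f x * cnj (g x)) \<le> norm ((cmod (f x))\<^sup>2 + (cmod (g x))\<^sup>2)"
    proof (rule AE_I2)
      fix x
      have "2 * (cmod (f x) * cmod (g x)) \<le> (cmod (f x))\<^sup>2 + (cmod (g x))\<^sup>2"
        using sum_squares_bound[of "cmod (f x)" "cmod (g x)"] by simp
      moreover have "0 \<le> cmod (f x) * cmod (g x)" by simp
      ultimately have "cmod (f x) * cmod (g x) \<le> (cmod (f x))\<^sup>2 + (cmod (g x))\<^sup>2"
        by linarith
      then show "norm (f x * cnj (g x)) \<le> norm ((cmod (f x))\<^sup>2 + (cmod (g x))\<^sup>2)"
        by (simp add: norm_mult)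
    qed
  qed (measurable)
qed

section \<open>Square integrable functions modulo null sets, as a complete real inner product
  space\<close>

definition l2rel :: "(real \<Rightarrow> complex) \<Rightarrow> (real \<Rightarrow> complex) \<Rightarrow> bool" where
  "l2rel f g \<longleftrightarrow> f \<in> L2 \<and> g \<in> L2 \<and> (AE x in lborel. f x = g x)"

lemma l2rel_part_equivp: "part_equivp l2rel"
proof (rule part_equivpI)
  show "\<exists>x. l2rel x x" by (rule exI[of _ "\<lambda>_. 0"]) (simp add: l2rel_def L2_zero)
  show "symp l2rel"
    by (rule sympI) (auto simp: l2rel_def elim: AE_mp)
  show "transp l2rel"
  proof (rule transpI)
    fix f g h assume "l2rel f g" "l2rel g h"
    then show "l2rel f h" unfolding l2rel_def by auto
  qed
qed

\<comment> \<open>As a type the space can be an instance of \<open>real_inner\<close> and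
  \<open>banach\<close>, which gives access to series, topology and bounded linear maps. The
  relation is partial because a function outside \<open>L2\<close> represents no element.\<close>
quotient_type l2 = "real \<Rightarrow> complex" / partial: l2rel
  by (rule l2rel_part_equivp)

lemma Re_mult_cnj_self: "Re (z * cnj z) = (cmod z)\<^sup>2"
  using cmod_power2[of z] by (simp add: power2_eq_square)

text \<open>The class \<open>real_inner\<close> is over the reals, hence the real part. Complex
  scalars act later as multiplication operators \<open>mop\<close>.\<close>

definition inner_fun :: "(real \<Rightarrow> complex) \<Rightarrow> (real \<Rightarrow> complex) \<Rightarrow> real" where
  "inner_fun f g = (\<integral>x. Re (f x * cnj (g x)) \<partial>lborel)"

lemma inner_fun_integrable: "f \<in> L2 \<Longrightarrow> g \<in> L2 \<Longrightarrow> integrable lborel (\<lambda>x. Re (f x * cnj (g x)))"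
  by (rule integrable_Re) (rule L2_prod_integrable)

instantiation l2 :: real_inner
begin

lift_definition zero_l2 :: l2 is "\<lambda>_. 0"
  by (simp add: l2rel_def L2_zero)

lift_definition plus_l2 :: "l2 \<Rightarrow> l2 \<Rightarrow> l2" is "\<lambda>f g x. f x + g x"
  unfolding l2rel_def by (auto intro!: L2_add)

lift_definition minus_l2 :: "l2 \<Rightarrow> l2 \<Rightarrow> l2" is "\<lambda>f g x. f x - g x"
  unfolding l2rel_def by (auto intro!: L2_diff)

lift_definition uminus_l2 :: "l2 \<Rightarrow> l2" is "\<lambda>f x. - f x"
  unfolding l2rel_def by (auto intro!: L2_minus)

lift_definition scaleR_l2 :: "real \<Rightarrow> l2 \<Rightarrow> l2" is "\<lambda>r f x. r *\<^sub>R f x"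
  unfolding l2rel_def by (auto intro!: L2_scaleR simp del: scaleR_conv_of_real)

lift_definition inner_l2 :: "l2 \<Rightarrow> l2 \<Rightarrow> real" is inner_fun
  unfolding l2rel_def inner_fun_def
  by (rule integral_cong_AE) (auto dest: L2_measurable)

definition norm_l2 :: "l2 \<Rightarrow> real" where "norm_l2 x = sqrt (inner x x)"
definition sgn_l2 :: "l2 \<Rightarrow> l2" where "sgn_l2 x = scaleR (inverse (norm x)) x"
definition dist_l2 :: "l2 \<Rightarrow> l2 \<Rightarrow> real" where "dist_l2 x y = norm (x - y)"
definition uniformity_l2 :: "(l2 \<times> l2) filter" where
  "uniformity_l2 = (INF e\<in>{0 <..}. principal {(x, y). dist x y < e})"
definition open_l2 :: "l2 set \<Rightarrow> bool" where
  "open_l2 S = (\<forall>x\<in>S. \<forall>\<^sub>F (x', y) in uniformity. x' = x \<longrightarrow> y \<in> S)"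

instance
proof
  fix x y z :: l2 and r q :: real
  show "x + y + z = x + (y + z)"
    by transfer (auto simp: l2rel_def algebra_simps intro!: L2_add)
  show "x + y = y + x"
    by transfer (auto simp: l2rel_def algebra_simps intro!: L2_add)
  show "0 + x = x" by transfer (auto simp: l2rel_def)
  show "- x + x = 0" by transfer (auto simp: l2rel_def L2_zero)
  show "x - y = x + - y"
    by transfer (auto simp: l2rel_def intro!: L2_diff)
  show "r *\<^sub>R (x + y) = r *\<^sub>R x + r *\<^sub>R y"
    by transfer (auto simp: l2rel_def algebra_simps scaleR_add_right simp del: scaleR_conv_of_real
        intro!: L2_scaleR L2_add)
  show "(r + q) *\<^sub>R x = r *\<^sub>R x + q *\<^sub>R x"
    by transfer (auto simp: l2rel_def scaleR_add_left simp del: scaleR_conv_of_real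
        intro!: L2_scaleR L2_add)
  show "r *\<^sub>R q *\<^sub>R x = (r * q) *\<^sub>R x"
    by transfer (auto simp: l2rel_def simp del: scaleR_conv_of_real intro!: L2_scaleR)
  show "1 *\<^sub>R x = x" by transfer (auto simp: l2rel_def)
  show "sgn x = inverse (norm x) *\<^sub>R x" by (simp add: sgn_l2_def)
  show "dist x y = norm (x - y)" by (simp add: dist_l2_def)
  show "(uniformity :: (l2 \<times> l2) filter) = (INF e\<in>{0 <..}. principal {(x, y). dist x y < e})"
    by (simp add: uniformity_l2_def)
  show "open U = (\<forall>x\<in>U. \<forall>\<^sub>F (x', y) in uniformity. x' = x \<longrightarrow> y \<in> U)" for U :: "l2 set"
    by (simp add: open_l2_def)
  show "inner x y = inner y x"
    by transfer (auto simp: inner_fun_def algebra_simps)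
  show "inner (x + y) z = inner x z + inner y z"
  proof transfer
    fix f g h :: "real \<Rightarrow> complex"
    assume *: "l2rel f f" "l2rel g g" "l2rel h h"
    show "inner_fun (\<lambda>x. f x + g x) h = inner_fun f h + inner_fun g h"
      unfolding inner_fun_def
      by (subst Bochner_Integration.integral_add[symmetric])
        (use * in \<open>auto simp: l2rel_def distrib_right simp del: times_complex.sel intro!: inner_fun_integrable\<close>)
  qed
  show "inner (r *\<^sub>R x) y = r * inner x y"
    by transfer (simp add: inner_fun_def algebra_simps flip: integral_mult_right_zero)
  show "0 \<le> inner x x"
    by transfer (auto simp: inner_fun_def complex_mult_cnj intro!: integral_nonneg_AE)
  show "inner x x = 0 \<longleftrightarrow> x = 0"
  proof transfer
    fix f assume "l2rel f f"
    then have f: "f \<in> L2" by (simp add: l2rel_def)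
    have "inner_fun f f = (\<integral>x. (cmod (f x))\<^sup>2 \<partial>lborel)"
      by (simp only: inner_fun_def Re_mult_cnj_self)
    also have "\<dots> = 0 \<longleftrightarrow> (AE x in lborel. (cmod (f x))\<^sup>2 = 0)"
      by (rule integral_nonneg_eq_0_iff_AE) (use f in \<open>auto intro: L2_integrable\<close>)
    finally show "(inner_fun f f = 0) = l2rel f (\<lambda>_. 0)"
      using f by (simp add: l2rel_def L2_zero)
  qed
  show "norm x = sqrt (inner x x)" by (simp add: norm_l2_def)
qed

end

definition cls :: "(real \<Rightarrow> complex) \<Rightarrow> l2" where "cls = abs_l2"
text \<open>The representative is an arbitrary choice, so identities between representatives are
  available only almost everywhere.\<close>

definition fn :: "l2 \<Rightarrow> real \<Rightarrow> complex" where "fn = rep_l2"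

lemma l2rel_fn: "l2rel (fn V) (fn V)"
  unfolding fn_def by (rule Quotient3_rep_reflp[OF Quotient3_l2])

lemma fn_L2[simp, intro]: "fn V \<in> L2"
  using l2rel_fn unfolding l2rel_def by simp

lemma fn_measurable[measurable]: "fn V \<in> borel_measurable borel"
  by (rule L2_measurable) simp

lemma cls_fn[simp]: "cls (fn V) = V"
  unfolding cls_def fn_def by (rule Quotient3_abs_rep[OF Quotient3_l2])

lemma cls_eq_iff: "f \<in> L2 \<Longrightarrow> g \<in> L2 \<Longrightarrow> cls f = cls g \<longleftrightarrow> (AE x in lborel. f x = g x)"
  unfolding cls_def using Quotient3_rel[OF Quotient3_l2, of f g] by (auto simp: l2rel_def)

lemma cls_cong: "f \<in> L2 \<Longrightarrow> g \<in> L2 \<Longrightarrow> (AE x in lborel. f x = g x) \<Longrightarrow> cls f = cls g"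
  by (simp add: cls_eq_iff)

lemma fn_cls: "f \<in> L2 \<Longrightarrow> AE x in lborel. fn (cls f) x = f x"
  by (subst cls_eq_iff[symmetric]) auto

lemma cls_add: "f \<in> L2 \<Longrightarrow> g \<in> L2 \<Longrightarrow> cls (\<lambda>x. f x + g x) = cls f + cls g"
  unfolding cls_def by (rule plus_l2.abs_eq[symmetric]) (auto simp: l2rel_def)
lemma cls_diff: "f \<in> L2 \<Longrightarrow> g \<in> L2 \<Longrightarrow> cls (\<lambda>x. f x - g x) = cls f - cls g"
  unfolding cls_def by (rule minus_l2.abs_eq[symmetric]) (auto simp: l2rel_def)
lemma cls_scaleR: "f \<in> L2 \<Longrightarrow> cls (\<lambda>x. r *\<^sub>R f x) = r *\<^sub>R cls f"
  unfolding cls_def by (rule scaleR_l2.abs_eq[symmetric]) (auto simp: l2rel_def)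
lemma inner_cls: "f \<in> L2 \<Longrightarrow> g \<in> L2 \<Longrightarrow> inner (cls f) (cls g) = (\<integral>x. Re (f x * cnj (g x)) \<partial>lborel)"
  unfolding cls_def by (subst inner_l2.abs_eq) (auto simp: l2rel_def inner_fun_def)

lemma fn_add: "AE x in lborel. fn (V + W) x = fn V x + fn W x"
  using fn_cls[OF L2_add[of "fn V" "fn W"]] by (simp add: cls_add)
lemma fn_scaleR: "AE x in lborel. fn (r *\<^sub>R V) x = r *\<^sub>R fn V x"
  using fn_cls[OF L2_scaleR[of "fn V" r]] by (simp add: cls_scaleR)

lemma norm_cls_sq: "f \<in> L2 \<Longrightarrow> (norm (cls f))\<^sup>2 = (\<integral>x. (cmod (f x))\<^sup>2 \<partial>lborel)"
  by (simp only: power2_norm_eq_inner inner_cls Re_mult_cnj_self)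

lemma nn_norm_cls: "f \<in> L2 \<Longrightarrow> (\<integral>\<^sup>+x. ennreal ((cmod (f x))\<^sup>2) \<partial>lborel) = ennreal ((norm (cls f))\<^sup>2)"
  by (subst nn_integral_eq_integral) (auto simp: norm_cls_sq L2_integrable)

lemma norm_sq_fn: "(norm V)\<^sup>2 = (\<integral>x. (cmod (fn V x))\<^sup>2 \<partial>lborel)"
  using norm_cls_sq[of "fn V"] by simp

lemma nn_norm_fn: "(\<integral>\<^sup>+x. ennreal ((cmod (fn V x))\<^sup>2) \<partial>lborel) = ennreal ((norm V)\<^sup>2)"
  using nn_norm_cls[of "fn V"] by simp

lemma norm_cls_le:
  assumes "f \<in> borel_measurable borel" "0 \<le> C"
    "(\<integral>\<^sup>+x. ennreal ((cmod (f x))\<^sup>2) \<partial>lborel) \<le> ennreal (C\<^sup>2)"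
  shows "f \<in> L2" "norm (cls f) \<le> C"
proof -
  show f: "f \<in> L2" using assms by (intro L2I) (auto intro: le_less_trans)
  have "ennreal ((norm (cls f))\<^sup>2) \<le> ennreal (C\<^sup>2)" using assms(3) nn_norm_cls[OF f] by simp
  then have "(norm (cls f))\<^sup>2 \<le> C\<^sup>2" by (simp add: ennreal_le_iff)
  then show "norm (cls f) \<le> C" using assms(2) by (rule power2_le_imp_le)
qed

text \<open>Dominating the squared difference, rather than the functions themselves, suits
  truncations and translates, whose distance to the limit is bounded directly.\<close>

lemma tendsto_cls_dominated:
  assumes f: "\<And>n. f n \<in> L2" "f0 \<in> L2" and w: "integrable lborel w"
    and lim: "AE x in lborel. (\<lambda>n. f n x) \<longlonglongrightarrow> f0 x"
    and dom: "\<And>n. AE x in lborel. (cmod (f n x - f0 x))\<^sup>2 \<le> w x"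
  shows "(\<lambda>n. cls (f n)) \<longlonglongrightarrow> cls f0"
proof -
  have [measurable]: "f n \<in> borel_measurable borel" "f0 \<in> borel_measurable borel" for n
    using f by (auto intro: L2_measurable)
  have "(\<lambda>n. \<integral>x. (cmod (f n x - f0 x))\<^sup>2 \<partial>lborel) \<longlonglongrightarrow> (\<integral>(x::real). 0 \<partial>lborel)"
  proof (rule integral_dominated_convergence[where w=w])
    show "AE x in lborel. (\<lambda>n. (cmod (f n x - f0 x))\<^sup>2) \<longlonglongrightarrow> 0"
      using lim
    proof eventually_elim
      case (elim x)
      then have "(\<lambda>n. (cmod (f n x - f0 x))\<^sup>2) \<longlonglongrightarrow> (cmod (f0 x - f0 x))\<^sup>2"
        by (intro tendsto_intros)
      then show ?case by simp
    qed
  qed (use w dom in \<open>auto\<close>)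
  then have "(\<lambda>n. (norm (cls (f n) - cls f0))\<^sup>2) \<longlonglongrightarrow> 0"
    using f by (simp add: L2_diff norm_cls_sq flip: cls_diff)
  then have "(\<lambda>n. sqrt ((norm (cls (f n) - cls f0))\<^sup>2)) \<longlonglongrightarrow> sqrt 0"
    by (intro tendsto_intros)
  then have "(\<lambda>n. norm (cls (f n) - cls f0)) \<longlonglongrightarrow> 0" by simp
  then show ?thesis using LIM_zero_cancel tendsto_norm_zero_iff by blast
qed

text \<open>Riesz-Fischer: a subsequence with geometrically small increments converges almost
  everywhere, and Fatou's lemma identifies the pointwise limit as the limit in norm.\<close>

instance l2 :: banach
proof
  fix X :: "nat \<Rightarrow> l2" assume X: "Cauchy X"
  have "\<exists>N. \<forall>m\<ge>N. \<forall>n\<ge>N. norm (X m - X n) < (1/2) ^ k" for k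
    using CauchyD[OF X, of "(1/2) ^ k"] by auto
  then obtain N where N: "\<And>k m n. m \<ge> N k \<Longrightarrow> n \<ge> N k \<Longrightarrow> norm (X m - X n) < (1/2) ^ k"
    by metis
  \<comment> \<open>Partial sums of the \<open>N i\<close> are monotone in k and dominate each
    \<open>N k\<close>, so \<open>r k\<close> and \<open>r (Suc k)\<close> both lie beyond
    \<open>N k\<close>.\<close>
  define r where "r k = (\<Sum>i\<le>k. N i)" for k
  have rN1: "N k \<le> r k" for k unfolding r_def by (intro member_le_sum) auto
  have "r k \<le> r (Suc k)" for k unfolding r_def by simp
  then have rN: "r k \<ge> N k" "r (Suc k) \<ge> N k" for k
    using rN1[of k] order_trans by blast+
  define x where "x k = fn (X (r k))" for k
  \<comment> \<open>The weight 2^k leaves the integrals summable, since the squared increments have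
    norm at most 4^(-k), while boundedness of \<open>D k t\<close> in k forces the increments at t
    below a multiple of (1 / sqrt 2)^k.\<close>
  define D where "D k t = (2 ^ k) * (cmod (x (Suc k) t - x k t))\<^sup>2" for k and t :: real
  have [measurable]: "x k \<in> borel_measurable borel" "D k \<in> borel_measurable borel" for k
    unfolding x_def D_def by measurable
  have xL2: "x k \<in> L2" for k unfolding x_def by simp
  have D: "(\<integral>\<^sup>+t. ennreal (D k t) \<partial>lborel) \<le> ennreal ((1/2) ^ k)" for k
  proof -
    have "(\<integral>\<^sup>+t. ennreal (D k t) \<partial>lborel)
        = 2 ^ k * (\<integral>\<^sup>+t. ennreal ((cmod (x (Suc k) t - x k t))\<^sup>2) \<partial>lborel)"
      unfolding D_def by (subst nn_integral_cmult[symmetric]) (auto simp: ennreal_mult ennreal_power[symmetric])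
    also have "\<dots> = ennreal (2 ^ k * (norm (X (r (Suc k)) - X (r k)))\<^sup>2)"
      by (subst nn_norm_cls) (auto simp: x_def cls_diff ennreal_mult ennreal_power[symmetric] intro!: L2_diff)
    also have "\<dots> \<le> ennreal (2 ^ k * ((1/2)^k)\<^sup>2)"
      using N[OF rN(2) rN(1), of k] by (intro ennreal_leI mult_left_mono power_mono) auto
    also have "2 ^ k * ((1/2::real)^k)\<^sup>2 = (1/2)^k"
      by (simp add: power2_eq_square flip: power_mult_distrib mult.assoc)
    finally show ?thesis .
  qed
  have "(\<integral>\<^sup>+t. (\<Sum>k. ennreal (D k t)) \<partial>lborel) = (\<Sum>k. \<integral>\<^sup>+t. ennreal (D k t) \<partial>lborel)"
    by (rule nn_integral_suminf) simp
  also have "\<dots> \<le> (\<Sum>k. ennreal ((1/2) ^ k))"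
    by (intro suminf_le D) auto
  also have "\<dots> = ennreal (\<Sum>k. (1/2) ^ k)"
    by (intro suminf_ennreal2) (auto simp: summable_geometric)
  finally have "(\<integral>\<^sup>+t. (\<Sum>k. ennreal (D k t)) \<partial>lborel) \<noteq> \<infinity>"
    by (auto simp: top_unique)
  then have "AE t in lborel. (\<Sum>k. ennreal (D k t)) \<noteq> \<infinity>"
    by (intro nn_integral_PInf_AE) auto
  then have conv: "AE t in lborel. convergent (\<lambda>k. x k t)"
  proof eventually_elim
    case (elim t)
    then obtain C where C: "(\<Sum>k. ennreal (D k t)) = ennreal C" "C \<ge> 0"
      by (cases "\<Sum>k. ennreal (D k t)") auto
    have DC: "D k t \<le> C" for k
    proof -
      have "ennreal (D k t) \<le> (\<Sum>k. ennreal (D k t))"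
        using sum_le_suminf[of "\<lambda>k. ennreal (D k t)" "{k}"] by auto
      then show ?thesis using C by (simp add: ennreal_le_iff)
    qed
    have "summable (\<lambda>k. sqrt C * (1 / sqrt 2) ^ k)"
      by (intro summable_mult summable_geometric) (simp add: real_less_rsqrt)
    then have "summable (\<lambda>k. x (Suc k) t - x k t)"
    proof (rule summable_comparison_test'[where N=0])
      fix k
      have "(sqrt C * (1 / sqrt 2) ^ k)\<^sup>2 * 2 ^ k = C * ((1 / sqrt 2)\<^sup>2) ^ k * 2 ^ k"
        using C(2) by (simp add: power_mult_distrib power_mult[symmetric] mult.commute)
      also have "\<dots> = C" by (simp add: power_divide)
      finally have "2 ^ k * (cmod (x (Suc k) t - x k t))\<^sup>2 \<le> 2 ^ k * (sqrt C * (1 / sqrt 2) ^ k)\<^sup>2"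
        using DC[of k] unfolding D_def by (simp add: mult.commute)
      then have "(cmod (x (Suc k) t - x k t))\<^sup>2 \<le> (sqrt C * (1 / sqrt 2) ^ k)\<^sup>2"
        by simp
      then show "norm (x (Suc k) t - x k t) \<le> sqrt C * (1 / sqrt 2) ^ k"
        by (rule power2_le_imp_le) (use C in simp)
    qed
    then have "convergent (\<lambda>n. \<Sum>k<n. x (Suc k) t - x k t)"
      by (simp add: summable_iff_convergent)
    then have "convergent (\<lambda>n. (\<Sum>k<n. x (Suc k) t - x k t) + x 0 t)"
      by (intro convergent_add convergent_const)
    moreover have "(\<Sum>k<n. x (Suc k) t - x k t) + x 0 t = x n t" for n
      using sum_lessThan_telescope[of "\<lambda>k. x k t" n] by simp
    ultimately show "convergent (\<lambda>k. x k t)" by simp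
  qed
  define f where "f t = lim (\<lambda>k. x k t)" for t
  have [measurable]: "f \<in> borel_measurable borel" unfolding f_def by measurable
  have lim: "AE t in lborel. (\<lambda>k. x k t) \<longlonglongrightarrow> f t"
    using conv by eventually_elim (simp add: f_def convergent_LIMSEQ_iff)
  \<comment> \<open>Fatou's lemma along the subsequence index j, with n fixed.\<close>
  have key: "(\<integral>\<^sup>+t. ennreal ((cmod (f t - fn (X n) t))\<^sup>2) \<partial>lborel) \<le> ennreal (((1/2)^k)\<^sup>2)"
    if "n \<ge> N k" for n k
  proof -
    have "(\<integral>\<^sup>+t. ennreal ((cmod (f t - fn (X n) t))\<^sup>2) \<partial>lborel)
        = (\<integral>\<^sup>+t. liminf (\<lambda>j. ennreal ((cmod (x j t - fn (X n) t))\<^sup>2)) \<partial>lborel)"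
    proof (rule nn_integral_cong_AE, use lim in eventually_elim)
      case (elim t)
      then have "(\<lambda>j. ennreal ((cmod (x j t - fn (X n) t))\<^sup>2)) \<longlonglongrightarrow> ennreal ((cmod (f t - fn (X n) t))\<^sup>2)"
        by (intro tendsto_intros)
      then show ?case by (rule lim_imp_Liminf[OF trivial_limit_sequentially, symmetric])
    qed
    also have "\<dots> \<le> liminf (\<lambda>j. \<integral>\<^sup>+t. ennreal ((cmod (x j t - fn (X n) t))\<^sup>2) \<partial>lborel)"
      by (rule nn_integral_liminf) simp
    also have "\<dots> \<le> ennreal (((1/2)^k)\<^sup>2)"
    proof (rule Liminf_le)
      show "\<forall>\<^sub>F j in sequentially. (\<integral>\<^sup>+t. ennreal ((cmod (x j t - fn (X n) t))\<^sup>2) \<partial>lborel) \<le> ennreal (((1/2)^k)\<^sup>2)"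
        using eventually_ge_at_top[of k]
      proof eventually_elim
        case (elim j)
        have "r j \<ge> N k" unfolding r_def using elim by (intro member_le_sum) auto
        then have "norm (X (r j) - X n) \<le> (1/2)^k" using N[of k "r j" n] that by simp
        moreover have "(\<integral>\<^sup>+t. ennreal ((cmod (x j t - fn (X n) t))\<^sup>2) \<partial>lborel) = ennreal ((norm (X (r j) - X n))\<^sup>2)"
          by (subst nn_norm_cls) (auto simp: x_def cls_diff intro!: L2_diff)
        ultimately show ?case by (auto intro!: ennreal_leI power_mono)
      qed
    qed simp
    finally show ?thesis .
  qed
  have f: "f \<in> L2"
  proof -
    have "(\<lambda>t. f t - fn (X (N 0)) t) \<in> L2"
      by (rule norm_cls_le(1)[of _ "1"]) (use key[of 0 "N 0"] in auto)
    from L2_add[OF this fn_L2[of "X (N 0)"]] show ?thesis by simp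
  qed
  have "X \<longlonglongrightarrow> cls f"
  proof (rule LIMSEQ_I)
    fix e :: real assume "0 < e"
    then obtain k where k: "(1/2) ^ k < e" using real_arch_pow_inv[of e "1/2"] by auto
    have "norm (X n - cls f) < e" if "n \<ge> N k" for n
    proof -
      have "norm (cls (\<lambda>t. f t - fn (X n) t)) \<le> (1/2)^k"
        by (rule norm_cls_le(2)) (use key[OF that] in auto)
      then show ?thesis using f k by (simp add: cls_diff norm_minus_commute)
    qed
    then show "\<exists>no. \<forall>n\<ge>no. norm (X n - cls f) < e" by blast
  qed
  then show "convergent X" by (auto simp: convergent_def)
qed

section \<open>Bounded multiplication operators\<close>

definition bdd_mult :: "real \<Rightarrow> (real \<Rightarrow> complex) \<Rightarrow> bool" where
  "bdd_mult C m \<longleftrightarrow> m \<in> borel_measurable borel \<and> (\<forall>x. cmod (m x) \<le> C)"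

text \<open>Elements of \<open>l2\<close> will be coordinates on the Fourier side, so these are
  Fourier multipliers. The free group, the smoothing operators and the complex scalars are all of
  this form and therefore commute.\<close>

definition mop :: "(real \<Rightarrow> complex) \<Rightarrow> l2 \<Rightarrow> l2" where
  "mop m V = cls (\<lambda>x. m x * fn V x)"

lemma bdd_mult_L2:
  assumes "bdd_mult C m" "f \<in> L2" shows "(\<lambda>x. m x * f x) \<in> L2"
proof (rule L2_dominated[OF assms(2), where c=C])
  have [measurable]: "f \<in> borel_measurable borel" "m \<in> borel_measurable borel"
    using assms by (auto simp: bdd_mult_def intro: L2_measurable)
  show "(\<lambda>x. m x * f x) \<in> borel_measurable borel" by measurable
qed (use assms in \<open>auto simp: bdd_mult_def norm_mult intro!: mult_right_mono\<close>)

lemma bdd_mult_nonneg: "bdd_mult C m \<Longrightarrow> 0 \<le> C"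
  unfolding bdd_mult_def by (meson norm_ge_zero order_trans)

lemma bdd_mult_mult: "bdd_mult C m \<Longrightarrow> bdd_mult D k \<Longrightarrow> bdd_mult (C * D) (\<lambda>x. m x * k x)"
  using bdd_mult_nonneg[of C m] unfolding bdd_mult_def by (auto simp: norm_mult intro!: mult_mono)

lemma fn_mop: "bdd_mult C m \<Longrightarrow> AE x in lborel. fn (mop m V) x = m x * fn V x"
  unfolding mop_def by (rule fn_cls) (rule bdd_mult_L2, auto)

lemma mop_cls:
  assumes "bdd_mult C m" "f \<in> L2" shows "mop m (cls f) = cls (\<lambda>x. m x * f x)"
  unfolding mop_def
proof (rule cls_cong)
  show "AE x in lborel. m x * fn (cls f) x = m x * f x"
    using fn_cls[OF assms(2)] by eventually_elim simp
qed (use assms in \<open>auto intro: bdd_mult_L2\<close>)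

lemma norm_mop_le:
  assumes m: "bdd_mult C m" shows "norm (mop m V) \<le> C * norm V"
proof -
  have "(norm (mop m V))\<^sup>2 = (\<integral>x. (cmod (m x * fn V x))\<^sup>2 \<partial>lborel)"
    unfolding mop_def by (rule norm_cls_sq) (rule bdd_mult_L2[OF m], simp)
  also have "\<dots> \<le> (\<integral>x. C\<^sup>2 * (cmod (fn V x))\<^sup>2 \<partial>lborel)"
    using m by (intro integral_mono L2_integrable bdd_mult_L2[OF m])
      (auto simp: L2_integrable norm_mult power_mult_distrib bdd_mult_def intro!: mult_right_mono power_mono)
  also have "\<dots> = (C * norm V)\<^sup>2" by (simp add: norm_sq_fn power_mult_distrib)
  finally show ?thesis
    by (rule power2_le_imp_le) (use bdd_mult_nonneg[OF m] in auto)
qed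

lemma mop_add:
  assumes m: "bdd_mult C m" shows "mop m (V + W) = mop m V + mop m W"
proof -
  have "mop m V + mop m W = cls (\<lambda>x. m x * fn V x + m x * fn W x)"
    unfolding mop_def by (subst cls_add) (auto intro!: bdd_mult_L2[OF m])
  also have "\<dots> = mop m (V + W)" unfolding mop_def
  proof (rule cls_cong)
    show "AE x in lborel. m x * fn V x + m x * fn W x = m x * fn (V + W) x"
      using fn_add[of V W] by eventually_elim (simp add: algebra_simps)
  qed (auto intro!: L2_add bdd_mult_L2[OF m])
  finally show ?thesis by simp
qed

lemma mop_scaleR:
  assumes m: "bdd_mult C m" shows "mop m (r *\<^sub>R V) = r *\<^sub>R mop m V"
proof -
  have "r *\<^sub>R mop m V = cls (\<lambda>x. r *\<^sub>R (m x * fn V x))"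
    unfolding mop_def by (subst cls_scaleR) (auto intro!: bdd_mult_L2[OF m])
  also have "\<dots> = mop m (r *\<^sub>R V)" unfolding mop_def
  proof (rule cls_cong)
    show "AE x in lborel. r *\<^sub>R (m x * fn V x) = m x * fn (r *\<^sub>R V) x"
      using fn_scaleR[of r V] by eventually_elim simp
  qed (auto intro!: L2_scaleR bdd_mult_L2[OF m] simp del: scaleR_conv_of_real)
  finally show ?thesis by simp
qed

lemma bounded_linear_mop: "bdd_mult C m \<Longrightarrow> bounded_linear (mop m)"
  using norm_mop_le[of C m] by (intro bounded_linear_intro[where K=C] mop_add mop_scaleR) (auto simp: mult.commute)

lemma mop_diff: "bdd_mult C m \<Longrightarrow> mop m (V - W) = mop m V - mop m W"
  by (rule linear_diff[OF bounded_linear.linear[OF bounded_linear_mop]])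

lemma mop_zero: "bdd_mult C m \<Longrightarrow> mop m 0 = 0"
  by (rule linear_0[OF bounded_linear.linear[OF bounded_linear_mop]])

lemma mop_mop:
  assumes m: "bdd_mult C m" and k: "bdd_mult D k"
  shows "mop m (mop k V) = mop (\<lambda>x. m x * k x) V"
  unfolding mop_def[of k]
  by (subst mop_cls[OF m bdd_mult_L2[OF k]]) (auto simp: mop_def mult.assoc)

lemma mop_one: "mop (\<lambda>_. 1) V = V"
  by (simp add: mop_def)

lemma mop_mult_diff:
  assumes m: "bdd_mult C m" and k: "bdd_mult D k"
  shows "mop (\<lambda>x. m x - k x) V = mop m V - mop k V"
  unfolding mop_def
  by (subst cls_diff[symmetric]) (auto intro!: bdd_mult_L2[OF m] bdd_mult_L2[OF k] simp: left_diff_distrib)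

lemma mop_mult_scaleR:
  assumes m: "bdd_mult C m"
  shows "mop (\<lambda>x. of_real r * m x) V = r *\<^sub>R mop m V"
  unfolding mop_def
  by (subst cls_scaleR[symmetric]) (auto intro!: bdd_mult_L2[OF m] simp: scaleR_conv_of_real mult.assoc)

text \<open>The symbols converge only pointwise, so there is no convergence in operator norm. The
  uniform bound C handles the moving argument, dominated convergence the fixed one.\<close>

lemma tendsto_mop:
  assumes m: "\<And>n. bdd_mult C (m n)" "bdd_mult C m0"
    and lim: "\<And>x. (\<lambda>n. m n x) \<longlonglongrightarrow> m0 x" and V: "V \<longlonglongrightarrow> V0"
  shows "(\<lambda>n. mop (m n) (V n)) \<longlonglongrightarrow> mop m0 V0"
proof -
  have 1: "(\<lambda>n. mop (m n) V0) \<longlonglongrightarrow> mop m0 V0"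
    unfolding mop_def
  proof (rule tendsto_cls_dominated[where w="\<lambda>x. (2 * C)\<^sup>2 * (cmod (fn V0 x))\<^sup>2"])
    show "AE x in lborel. (\<lambda>n. m n x * fn V0 x) \<longlonglongrightarrow> m0 x * fn V0 x"
      by (intro AE_I2 tendsto_intros lim)
    show "AE x in lborel. (cmod (m n x * fn V0 x - m0 x * fn V0 x))\<^sup>2 \<le> (2 * C)\<^sup>2 * (cmod (fn V0 x))\<^sup>2" for n
    proof (rule AE_I2)
      fix x
      have "cmod (m n x - m0 x) \<le> 2 * C"
        using m unfolding bdd_mult_def by (smt (verit) norm_triangle_ineq4)
      then have "(cmod (m n x - m0 x))\<^sup>2 \<le> (2 * C)\<^sup>2" by (rule power_mono) simp
      then show "(cmod (m n x * fn V0 x - m0 x * fn V0 x))\<^sup>2 \<le> (2 * C)\<^sup>2 * (cmod (fn V0 x))\<^sup>2"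
        unfolding left_diff_distrib[symmetric] norm_mult power_mult_distrib
        by (intro mult_right_mono) (auto simp: power_mult_distrib)
    qed
  qed (auto intro!: bdd_mult_L2 m L2_integrable)
  have "(\<lambda>n. mop (m n) (V n - V0)) \<longlonglongrightarrow> 0"
  proof (rule Lim_null_comparison)
    show "\<forall>\<^sub>F n in sequentially. norm (mop (m n) (V n - V0)) \<le> C * norm (V n - V0)"
      by (intro always_eventually allI norm_mop_le m)
    have "(\<lambda>n. C * norm (V n - V0)) \<longlonglongrightarrow> C * norm (V0 - V0)" by (intro tendsto_intros V)
    then show "(\<lambda>n. C * norm (V n - V0)) \<longlonglongrightarrow> 0" by simp
  qed
  from tendsto_add[OF this 1] show ?thesis by (simp add: mop_diff[OF m(1)])
qed

section \<open>Plancherel's theorem\<close>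

definition ek :: "real \<Rightarrow> complex" where "ek r = exp (- (\<i> * complex_of_real r))"

definition ccst :: complex where "ccst = complex_of_real (1 / sqrt (2 * pi))"

definition FT :: "(real \<Rightarrow> complex) \<Rightarrow> real \<Rightarrow> complex" where
  "FT f \<xi> = ccst * (\<integral>x. ek (\<xi> * x) * f x \<partial>lborel)"

lemma cmod_ek[simp]: "cmod (ek r) = 1"
  using norm_exp_i_times[of "- r"] by (simp add: ek_def)

lemma cnj_ek[simp]: "cnj (ek r) = ek (- r)"
  by (simp add: ek_def exp_cnj)

lemma ek_add: "ek (r + t) = ek r * ek t"
  by (simp add: ek_def exp_add[symmetric] algebra_simps)

lemma ek_0[simp]: "ek 0 = 1"
  by (simp add: ek_def)

lemma ek_measurable[measurable]: "ek \<in> borel_measurable borel"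
  unfolding ek_def by measurable

lemma cnj_ccst[simp]: "cnj ccst = ccst" and cmod_ccst: "cmod ccst = 1 / sqrt (2 * pi)"
  by (simp_all add: ccst_def norm_divide)

lemma integrable_kernel:
  assumes "integrable lborel f" shows "integrable lborel (\<lambda>x. ek (\<xi> * x) * f x)"
proof (rule Bochner_Integration.integrable_bound[OF assms])
  have [measurable]: "f \<in> borel_measurable borel" using assms by auto
  show "(\<lambda>x. ek (\<xi> * x) * f x) \<in> borel_measurable lborel"
    by measurable
qed (auto simp: norm_mult)

lemma FT_measurable[measurable]:
  assumes [measurable]: "f \<in> borel_measurable borel" shows "FT f \<in> borel_measurable borel"
  unfolding FT_def by measurable

lemma cmod_FT_le:
  assumes "integrable lborel f"
  shows "cmod (FT f \<xi>) \<le> 1 / sqrt (2 * pi) * (\<integral>x. cmod (f x) \<partial>lborel)"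
proof -
  have "cmod (\<integral>x. ek (\<xi> * x) * f x \<partial>lborel)
      \<le> (\<integral>x. cmod (ek (\<xi> * x) * f x) \<partial>lborel)"
    by (rule integral_norm_bound)
  also have "\<dots> = (\<integral>x. cmod (f x) \<partial>lborel)" by (simp add: norm_mult)
  finally show ?thesis
    unfolding FT_def norm_mult by (intro mult_mono) (auto simp: cmod_ccst)
qed

lemma FT_add: "integrable lborel f \<Longrightarrow> integrable lborel g \<Longrightarrow> FT (\<lambda>x. f x + g x) \<xi> = FT f \<xi> + FT g \<xi>"
  unfolding FT_def distrib_left by (subst Bochner_Integration.integral_add) (auto simp: distrib_left intro: integrable_kernel)

lemma FT_diff: "integrable lborel f \<Longrightarrow> integrable lborel g \<Longrightarrow> FT (\<lambda>x. f x - g x) \<xi> = FT f \<xi> - FT g \<xi>"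
  unfolding FT_def right_diff_distrib by (subst Bochner_Integration.integral_diff) (auto simp: right_diff_distrib intro: integrable_kernel)

lemma FT_cmult: "FT (\<lambda>x. c * f x) \<xi> = c * FT f \<xi>"
proof -
  have "(\<integral>x. ek (\<xi> * x) * (c * f x) \<partial>lborel)
    = c * (\<integral>x. ek (\<xi> * x) * f x \<partial>lborel)"
    by (subst integral_mult_right_zero[symmetric]) (simp add: mult.left_commute)
  then show ?thesis unfolding FT_def by (simp add: algebra_simps)
qed

lemma FT_cong_AE:
  assumes "AE x in lborel. f x = g x" and [measurable]: "f \<in> borel_measurable borel" "g \<in> borel_measurable borel"
  shows "FT f = FT g"
proof -
  have "(\<integral>x. ek (\<xi> * x) * f x \<partial>lborel)
      = (\<integral>x. ek (\<xi> * x) * g x \<partial>lborel)" for \<xi>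
    by (rule integral_cong_AE) (use assms(1) in \<open>auto\<close>)
  then show ?thesis unfolding FT_def fun_eq_iff by simp
qed

lemma lborel_minus_integral: "(\<integral>x. f (- x) \<partial>lborel) = (\<integral>x. f x \<partial>lborel)"
  for f :: "real \<Rightarrow> 'b :: {banach, second_countable_topology}"
  using lborel_integral_real_affine[of "-1" f 0] by simp

lemma lborel_minus_integrable: "integrable lborel f \<Longrightarrow> integrable lborel (\<lambda>x. f (- x))"
  for f :: "real \<Rightarrow> 'b :: {banach, second_countable_topology}"
  using lborel_integrable_real_affine[of f "-1" 0] by simp

lemma lborel_shift_integral: "(\<integral>x. f (x - t) \<partial>lborel) = (\<integral>x. f x \<partial>lborel)"
  for f :: "real \<Rightarrow> 'b :: {banach, second_countable_topology}"
  using lborel_integral_real_affine[of 1 f "-t"] by (simp add: add.commute)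

lemma lborel_shift_integrable: "integrable lborel f \<Longrightarrow> integrable lborel (\<lambda>x. f (x - t))"
  for f :: "real \<Rightarrow> 'b :: {banach, second_countable_topology}"
  using lborel_integrable_real_affine[of f 1 "-t"] by simp

lemma FT_cnj: "cnj (FT f \<xi>) = FT (\<lambda>x. cnj (f (- x))) \<xi>"
proof -
  have "(\<integral>x. ek (\<xi> * x) * cnj (f (- x)) \<partial>lborel)
      = (\<integral>x. ek (- (\<xi> * x)) * cnj (f x) \<partial>lborel)"
    by (subst lborel_minus_integral[symmetric]) simp
  also have "\<dots> = (\<integral>x. cnj (ek (\<xi> * x) * f x) \<partial>lborel)"
    by (intro Bochner_Integration.integral_cong) simp_all
  also have "\<dots> = cnj (\<integral>x. ek (\<xi> * x) * f x \<partial>lborel)"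
    by (rule Bochner_Integration.integral_cnj)
  finally show ?thesis unfolding FT_def by simp
qed

lemma integrable_pair_bound:
  fixes f g :: "real \<Rightarrow> complex" and k :: "real \<times> real \<Rightarrow> complex"
  assumes f: "integrable lborel f" and g: "integrable lborel g"
    and [measurable]: "k \<in> borel_measurable (borel \<Otimes>\<^sub>M borel)"
    and bd: "\<And>x y. cmod (k (x, y)) \<le> cmod (f x) * cmod (g y)"
  shows "integrable (lborel \<Otimes>\<^sub>M lborel) k"
proof (rule lborel_pair.Fubini_integrable)
  have [measurable]: "f \<in> borel_measurable borel" "g \<in> borel_measurable borel" using f g by auto
  show "k \<in> borel_measurable (lborel \<Otimes>\<^sub>M lborel)" by simp
  have int: "integrable lborel (\<lambda>y. k (x, y))" for x
    by (rule Bochner_Integration.integrable_bound[where f="\<lambda>y. cmod (f x) * cmod (g y)"])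
      (use g bd in auto)
  then show "AE x in lborel. integrable lborel (\<lambda>y. k (x, y))" by simp
  show "integrable lborel (\<lambda>x. \<integral>y. norm (k (x, y)) \<partial>lborel)"
  proof (rule Bochner_Integration.integrable_bound[where f="\<lambda>x. cmod (f x) * (\<integral>y. cmod (g y) \<partial>lborel)"])
    show "AE x in lborel. norm (\<integral>y. norm (k (x, y)) \<partial>lborel) \<le> norm (cmod (f x) * (\<integral>y. cmod (g y) \<partial>lborel))"
    proof (rule AE_I2)
      fix x
      have "(\<integral>y. norm (k (x, y)) \<partial>lborel) \<le> (\<integral>y. cmod (f x) * cmod (g y) \<partial>lborel)"
        by (rule integral_mono) (use int g bd in auto)
      moreover have "0 \<le> (\<integral>y. norm (k (x, y)) \<partial>lborel)" by simp
      ultimately show "norm (\<integral>y. norm (k (x, y)) \<partial>lborel) \<le> norm (cmod (f x) * (\<integral>y. cmod (g y) \<partial>lborel))"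
        by simp
    qed
  qed (use f in auto)
qed

text \<open>The kernel \<open>ek (x * y)\<close> is symmetric, so Fubini moves the transform to the
  other factor. The isometry and the inversion below both rest on this.\<close>

lemma FT_mult_formula:
  assumes f: "integrable lborel f" and g: "integrable lborel g"
  shows "(\<integral>x. FT f x * g x \<partial>lborel) = (\<integral>x. f x * FT g x \<partial>lborel)"
proof -
  have [measurable]: "f \<in> borel_measurable borel" "g \<in> borel_measurable borel" using f g by auto
  define K where "K y x = ek (x * y) * f y * g x" for x y
  have int: "integrable (lborel \<Otimes>\<^sub>M lborel) (\<lambda>(y, x). K y x)"
    by (rule integrable_pair_bound[OF f g]) (auto simp: K_def norm_mult)
  have "(\<integral>x. FT f x * g x \<partial>lborel) = ccst * (\<integral>x. (\<integral>y. K y x \<partial>lborel) \<partial>lborel)"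
    unfolding FT_def K_def by (simp add: mult.assoc flip: integral_mult_left_zero)
  also have "(\<integral>x. (\<integral>y. K y x \<partial>lborel) \<partial>lborel) = (\<integral>y. (\<integral>x. K y x \<partial>lborel) \<partial>lborel)"
    by (rule lborel_pair.Fubini_integral[OF int])
  also have "ccst * \<dots> = (\<integral>y. f y * FT g y \<partial>lborel)"
  proof -
    have "(\<integral>x. K y x \<partial>lborel) = f y * (\<integral>x. ek (y * x) * g x \<partial>lborel)" for y
      unfolding K_def by (simp add: mult_ac flip: integral_mult_right_zero)
    then show ?thesis
      unfolding FT_def by (simp add: mult_ac flip: integral_mult_right_zero)
  qed
  finally show ?thesis .
qed

lemma FT_modulate: "FT (\<lambda>y. ek (x * y) * g y) \<xi> = FT g (x + \<xi>)"
  unfolding FT_def by (simp add: distrib_right distrib_left ek_add mult_ac)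

text \<open>The characteristic function of the standard normal law, read as a Fourier integral and
  rescaled by a. The prefactors combine to a probability density of width a, an approximate identity
  as a tends to 0.\<close>

lemma FT_gaussian:
  assumes "0 < a"
  shows "ccst * FT (\<lambda>\<xi>. complex_of_real (exp (- (a * \<xi>)\<^sup>2 / 2))) x
      = complex_of_real (normal_density 0 a x)"
proof -
  define h where "h \<eta> = exp (\<i> * complex_of_real ((- x / a) * \<eta>)) * complex_of_real (std_normal_density \<eta>)" for \<eta>
  have "char std_normal_distribution (- x / a) = (\<integral>\<eta>. h \<eta> \<partial>lborel)"
    unfolding char_def h_def
    by (subst integral_density) (auto simp: scaleR_conv_of_real mult.commute)
  also have "\<dots> = complex_of_real a * (\<integral>\<xi>. h (a * \<xi>) \<partial>lborel)"
    using assms lborel_integral_real_affine[of a h 0] by (simp add: scaleR_conv_of_real)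
  finally have 1: "(\<integral>\<xi>. h (a * \<xi>) \<partial>lborel) = complex_of_real (exp (- (x / a)\<^sup>2 / 2) / a)"
    using assms by (simp add: char_std_normal_distribution field_simps)
  have "ek (x * \<xi>) * complex_of_real (exp (- (a * \<xi>)\<^sup>2 / 2))
      = complex_of_real (sqrt (2 * pi)) * h (a * \<xi>)" for \<xi>
    using assms unfolding h_def std_normal_density_def ek_def by (simp add: field_simps)
  then have "FT (\<lambda>\<xi>. complex_of_real (exp (- (a * \<xi>)\<^sup>2 / 2))) x = (\<integral>\<xi>. h (a * \<xi>) \<partial>lborel)"
    unfolding FT_def ccst_def by (simp flip: integral_mult_right_zero)
  also have "ccst * \<dots> = complex_of_real (normal_density 0 a x)"
    unfolding 1 ccst_def using assms by (simp add: normal_density_def real_sqrt_mult power_divide field_simps)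
  finally show ?thesis .
qed

section \<open>Translations on L2 and their strong continuity\<close>

definition tr :: "real \<Rightarrow> l2 \<Rightarrow> l2" where "tr t V = cls (\<lambda>x. fn V (x - t))"

lemma shift_L2: "f \<in> L2 \<Longrightarrow> (\<lambda>x. f (x - t)) \<in> L2"
  unfolding L2_def using lborel_shift_integrable[of "\<lambda>x. (cmod (f x))\<^sup>2" t] by auto

lemma norm_shift:
  assumes "f \<in> L2" shows "norm (cls (\<lambda>x. f (x - t))) = norm (cls f)"
proof -
  have "(norm (cls (\<lambda>x. f (x - t))))\<^sup>2 = (norm (cls f))\<^sup>2"
    using lborel_shift_integral[of "\<lambda>x. (cmod (f x))\<^sup>2" t]
    by (simp only: norm_cls_sq[OF shift_L2[OF assms]] norm_cls_sq[OF assms])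
  then show ?thesis by simp
qed

lemma AE_shift: "AE x in lborel. P x \<Longrightarrow> AE x in lborel. P (x - t)" for P :: "real \<Rightarrow> bool"
proof -
  assume "AE x in lborel. P x"
  then have "AE x in distr lborel borel ((+) (-t)). P x" unfolding lborel_distr_plus .
  then show ?thesis
    by (auto dest!: AE_distrD[rotated])
qed

lemma tr_cls:
  assumes "f \<in> L2" shows "tr t (cls f) = cls (\<lambda>x. f (x - t))"
  unfolding tr_def by (intro cls_cong shift_L2 AE_shift[OF fn_cls] assms fn_L2)

lemma norm_tr[simp]: "norm (tr t V) = norm V"
  unfolding tr_def by (simp add: norm_shift)

lemma tr_diff: "tr t (V - W) = tr t V - tr t W"
proof -
  have "tr t (V - W) = cls (\<lambda>x. fn V (x - t) - fn W (x - t))"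
    using tr_cls[OF L2_diff[of "fn V" "fn W"], of t] by (simp add: cls_diff)
  then show ?thesis unfolding tr_def by (simp add: cls_diff shift_L2)
qed

lemma integrable_indicator_Icc[simp, intro]: "integrable lborel (indicator {a..b} :: real \<Rightarrow> real)"
  by (intro integrable_real_indicator) (auto simp: emeasure_lborel_Icc_eq)

definition tr_cont :: "l2 \<Rightarrow> bool" where
  "tr_cont V \<longleftrightarrow> (\<forall>t. t \<longlonglongrightarrow> 0 \<longrightarrow> (\<lambda>n. tr (t n) V) \<longlonglongrightarrow> V)"

text \<open>Translations are isometries, so an approximation of the limit is equally good after
  every shift.\<close>

lemma tr_cont_closed:
  assumes V: "\<And>k::nat. tr_cont (V k)" and lim: "V \<longlonglongrightarrow> W"
  shows "tr_cont W"
  unfolding tr_cont_def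
proof (intro allI impI LIMSEQ_I)
  fix t :: "nat \<Rightarrow> real" and e :: real assume t: "t \<longlonglongrightarrow> 0" and e: "0 < e"
  obtain k where k: "norm (V k - W) < e / 3"
    using LIMSEQ_D[OF lim, of "e / 3"] e by auto
  have "(\<lambda>n. tr (t n) (V k)) \<longlonglongrightarrow> V k" using V t unfolding tr_cont_def by blast
  then obtain n0 where n0: "\<And>n. n \<ge> n0 \<Longrightarrow> norm (tr (t n) (V k) - V k) < e / 3"
    using LIMSEQ_D[of _ _ "e / 3"] e by fastforce
  have "norm (tr (t n) W - W) < e" if "n \<ge> n0" for n
  proof -
    have "tr (t n) W - W = tr (t n) (W - V k) + (tr (t n) (V k) - V k) + (V k - W)"
      by (simp add: tr_diff)
    then have "norm (tr (t n) W - W) \<le> norm (W - V k) + norm (tr (t n) (V k) - V k) + norm (V k - W)"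
      by (metis norm_tr norm_triangle_mono order_refl)
    then show ?thesis using k n0[OF that] norm_minus_commute[of W "V k"] by linarith
  qed
  then show "\<exists>no. \<forall>n\<ge>no. norm (tr (t n) W - W) < e" by blast
qed

lemma tr_cont_cutoff_continuous:
  assumes g: "continuous_on UNIV g" and bd: "\<And>x. cmod (g x) \<le> B" "0 \<le> B"
    and f_def: "f = (\<lambda>x. indicator {-B..B} x *\<^sub>R g x)"
  shows "f \<in> L2" "tr_cont (cls f)"
proof -
  have [measurable]: "g \<in> borel_measurable borel" using g by (rule borel_measurable_continuous_onI)
  have fbd: "cmod (f x) \<le> B" for x using bd unfolding f_def by (auto simp: indicator_def)
  have f0: "f x = 0" if "x \<notin> {-B..B}" for x using that unfolding f_def by simp
  show f: "f \<in> L2" unfolding L2_def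
  proof (safe, goal_cases)
    case 2
    show ?case
    proof (rule Bochner_Integration.integrable_bound[where f="\<lambda>x. B\<^sup>2 * indicator {-B..B} x"])
      show "AE x in lborel. norm ((cmod (f x))\<^sup>2) \<le> norm (B\<^sup>2 * indicator {-B..B} x :: real)"
        by (rule AE_I2) (use fbd f0 in \<open>auto simp: indicator_def intro!: power_mono\<close>)
      show "integrable lborel (\<lambda>x. B\<^sup>2 * indicator {-B..B} x :: real)"
        by (intro integrable_mult_right integrable_indicator_Icc)
    qed (auto simp: f_def)
  qed (simp add: f_def)
  show "tr_cont (cls f)"
    unfolding tr_cont_def
  proof (intro allI impI)
    fix t :: "nat \<Rightarrow> real" assume t: "t \<longlonglongrightarrow> 0"
    \<comment> \<open>A common bound for the shifts places all translates in one interval, where a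
      single function dominates them.\<close>
    obtain D where "\<forall>n. norm (t n) \<le> D"
      using convergent_imp_Bseq[OF convergentI[OF t]] by (rule BseqE)
    then have D: "\<And>n. \<bar>t n\<bar> \<le> D" by simp
    have "(\<lambda>n. cls (\<lambda>x. f (x - t n))) \<longlonglongrightarrow> cls f"
    proof (rule tendsto_cls_dominated[where w="\<lambda>x. (2*B)\<^sup>2 * indicator {-(B+D)..B+D} x"])
      \<comment> \<open>The cut-off can jump only at the two end points, which form a null
        set.\<close>
      have "AE x in lborel. x \<noteq> B \<and> x \<noteq> - B" by (auto intro: AE_lborel_singleton)
      then show "AE x in lborel. (\<lambda>n. f (x - t n)) \<longlonglongrightarrow> f x"
      proof eventually_elim
        case (elim x)
        have "(\<lambda>n. x - t n) \<longlonglongrightarrow> x - 0" by (intro tendsto_intros t)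
        then have xt: "(\<lambda>n. x - t n) \<longlonglongrightarrow> x" by simp
        have "isCont f x"
        proof (cases "x \<in> {-B<..<B}")
          case True
          have "isCont g x" using g by (simp add: continuous_on_eq_continuous_at)
          moreover have "\<forall>\<^sub>F y in nhds x. f y = g y"
            using eventually_nhds_in_open[OF open_greaterThanLessThan True]
            by eventually_elim (auto simp: f_def)
          ultimately show ?thesis by (simp add: isCont_cong)
        next
          case False
          then have "x \<in> {..<-B} \<union> {B<..}" using elim by auto
          moreover have "open ({..<-B} \<union> {B<..})" by auto
          ultimately have "\<forall>\<^sub>F y in nhds x. y \<in> {..<-B} \<union> {B<..}"
            by (intro eventually_nhds_in_open)
          then have "\<forall>\<^sub>F y in nhds x. f y = 0"
            by (rule eventually_mono) (auto simp: f_def)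
          then have "isCont f x = isCont (\<lambda>_. 0 :: complex) x" by (rule isCont_cong)
          then show ?thesis by simp
        qed
        then show ?case using isCont_tendsto_compose xt by blast
      qed
      show "AE x in lborel. (cmod (f (x - t n) - f x))\<^sup>2 \<le> (2*B)\<^sup>2 * indicator {-(B+D)..B+D} x" for n
      proof (rule AE_I2)
        fix x
        show "(cmod (f (x - t n) - f x))\<^sup>2 \<le> (2*B)\<^sup>2 * indicator {-(B+D)..B+D} x"
        proof (cases "x \<in> {-(B+D)..B+D}")
          case True
          have "cmod (f (x - t n) - f x) \<le> 2 * B"
            using norm_triangle_ineq4[of "f (x - t n)" "f x"] fbd[of x] fbd[of "x - t n"] by linarith
          then have "(cmod (f (x - t n) - f x))\<^sup>2 \<le> (2 * B)\<^sup>2" by (rule power_mono) simp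
          then show ?thesis unfolding indicator_simps(1)[OF True] by simp
        next
          case False
          have "f (x - t n) = 0" by (rule f0) (use False D[of n] in auto)
          moreover have "f x = 0" by (rule f0) (use False D[of n] in auto)
          ultimately show ?thesis by simp
        qed
      qed
    qed (auto intro: f shift_L2)
    then show "(\<lambda>n. tr (t n) (cls f)) \<longlonglongrightarrow> cls f" by (simp add: tr_cls[OF f])
  qed
qed

lemma tr_cont_bounded:
  assumes f: "f \<in> L2" and bd: "\<And>x. cmod (f x) \<le> B" "0 \<le> B" and supp: "\<And>x. x \<notin> {-B..B} \<Longrightarrow> f x = 0"
  shows "tr_cont (cls f)"
proof -
  have "f \<in> borel_measurable lebesgue" using f by (auto intro!: L2_measurable measurable_completion)
  then have "f measurable_on UNIV" by (rule lebesgue_measurable_imp_measurable_on) auto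
  then obtain N g where N: "negligible N" and g: "\<And>n. continuous_on UNIV (g n)"
    and lim: "\<And>x. x \<notin> N \<Longrightarrow> (\<lambda>n. g n x) \<longlonglongrightarrow> f x"
    unfolding measurable_on_def by auto
  \<comment> \<open>The continuous approximants converge almost everywhere but obey no bound. The
    projection onto the ball of radius B is continuous, fixes the values of f and supplies the bound
    for dominated convergence.\<close>
  define P where "P = closest_point (cball (0::complex) B)"
  have ne: "cball (0::complex) B \<noteq> {}" using bd(2) by simp
  have contP: "continuous_on UNIV P" unfolding P_def
    by (rule continuous_on_closest_point) (use ne in auto)
  have Pbd: "cmod (P z) \<le> B" for z
    using closest_point_in_set[OF closed_cball ne, of z] unfolding P_def by simp
  have Pid: "P z = z" if "cmod z \<le> B" for z
    unfolding P_def by (rule closest_point_self) (use that in auto)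
  define q where "q n = (\<lambda>x. indicator {-B..B} x *\<^sub>R P (g n x))" for n
  have qc: "continuous_on UNIV (\<lambda>x. P (g n x))" for n
    using continuous_on_compose2[OF contP g] by auto
  have q: "q n \<in> L2" "tr_cont (cls (q n))" for n
    using tr_cont_cutoff_continuous[OF qc Pbd bd(2) q_def[of n]] by auto
  have "(\<lambda>n. cls (q n)) \<longlonglongrightarrow> cls f"
  proof (rule tendsto_cls_dominated[where w="\<lambda>x. (2*B)\<^sup>2 * indicator {-B..B} x"])
    have "AE x in lebesgue. x \<notin> N" using N by (auto simp: negligible_iff_null_sets intro: AE_not_in)
    then have "AE x in lborel. x \<notin> N" by (simp add: AE_completion_iff)
    then show "AE x in lborel. (\<lambda>n. q n x) \<longlonglongrightarrow> f x"
    proof eventually_elim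
      case (elim x)
      have "(\<lambda>n. P (g n x)) \<longlonglongrightarrow> P (f x)"
        using contP lim[OF elim] by (auto simp: continuous_on_eq_continuous_at intro: isCont_tendsto_compose)
      then have "(\<lambda>n. q n x) \<longlonglongrightarrow> indicator {-B..B} x *\<^sub>R P (f x)"
        unfolding q_def by (intro tendsto_intros)
      moreover have "indicator {-B..B} x *\<^sub>R P (f x) = f x"
        using supp[of x] bd Pid by (auto simp: indicator_def)
      ultimately show ?case by simp
    qed
    show "AE x in lborel. (cmod (q n x - f x))\<^sup>2 \<le> (2*B)\<^sup>2 * indicator {-B..B} x" for n
    proof (rule AE_I2)
      fix x
      show "(cmod (q n x - f x))\<^sup>2 \<le> (2*B)\<^sup>2 * indicator {-B..B} x"
      proof (cases "x \<in> {-B..B}")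
        case True
        have "cmod (q n x - f x) \<le> 2 * B"
          using norm_triangle_ineq4[of "q n x" "f x"] bd(1)[of x] Pbd[of "g n x"] True unfolding q_def by simp
        then have "(cmod (q n x - f x))\<^sup>2 \<le> (2 * B)\<^sup>2" by (rule power_mono) simp
        then show ?thesis unfolding indicator_simps(1)[OF True] by simp
      qed (simp add: q_def supp)
    qed
  qed (use q f in auto)
  with q(2) show ?thesis by (rule tr_cont_closed)
qed

text \<open>Cutting a representative at level k, in value and in argument, reduces the claim to
  bounded functions of bounded support.\<close>

lemma tr_cont_all: "tr_cont V"
proof -
  define f where "f = fn V"
  have f: "f \<in> L2" unfolding f_def by simp
  define q where "q k x = (if cmod (f x) \<le> real k \<and> \<bar>x\<bar> \<le> real k then f x else 0)" for k :: nat and x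
  have [measurable]: "f \<in> borel_measurable borel" using f by (rule L2_measurable)
  have [measurable]: "q k \<in> borel_measurable borel" for k unfolding q_def by measurable
  have q: "q k \<in> L2" for k
    by (rule L2_dominated[OF f, where c=1]) (auto simp: q_def)
  have "tr_cont (cls (q k))" for k
    by (rule tr_cont_bounded[OF q, where B="real k"]) (auto simp: q_def)
  moreover have "(\<lambda>k. cls (q k)) \<longlonglongrightarrow> cls f"
  proof (rule tendsto_cls_dominated[where w="\<lambda>x. (cmod (f x))\<^sup>2"])
    show "AE x in lborel. (\<lambda>k. q k x) \<longlonglongrightarrow> f x"
    proof (rule AE_I2, rule tendsto_eventually)
      fix x
      show "\<forall>\<^sub>F k in sequentially. q k x = f x"
        using eventually_ge_at_top[of "nat \<lceil>max (cmod (f x)) \<bar>x\<bar>\<rceil>"]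
        by eventually_elim (auto simp: q_def nat_le_iff ceiling_le_iff)
    qed
    show "AE x in lborel. (cmod (q n x - f x))\<^sup>2 \<le> (cmod (f x))\<^sup>2" for n
      by (rule AE_I2) (auto simp: q_def)
  qed (use q f in \<open>auto intro: L2_integrable\<close>)
  ultimately have "tr_cont (cls f)" by (rule tr_cont_closed)
  then show ?thesis unfolding f_def by simp
qed

section \<open>Isometry of the transform on integrable functions in L2\<close>

lemma inner_cls_Re:
  assumes "f \<in> L2" "g \<in> L2" shows "inner (cls f) (cls g) = Re (\<integral>x. f x * cnj (g x) \<partial>lborel)"
  unfolding inner_cls[OF assms] by (rule Bochner_Integration.integral_Re[OF L2_prod_integrable[OF assms]])

lemma FT_diff_fun:
  "integrable lborel f \<Longrightarrow> integrable lborel g \<Longrightarrow> FT (\<lambda>x. f x - g x) = (\<lambda>\<xi>. FT f \<xi> - FT g \<xi>)"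
  by (simp add: fun_eq_iff FT_diff)

lemma FT_refl: "FT (\<lambda>y. h (- y)) (- x) = FT h x"
  unfolding FT_def using lborel_minus_integral[of "\<lambda>y. ek (x * y) * h y"] by simp

text \<open>Fubini turns the Gaussian regularisation of \<open>\<integral>|FT f|\<^sup>2\<close> into a Gaussian average of the
  autocorrelation \<open>H\<close> of \<open>f\<close>, which is continuous at \<open>0\<close>. The width of the Gaussian then tends to \<open>0\<close>.\<close>

lemma FT_isometry:
  assumes f: "integrable lborel f" "f \<in> L2"
  shows "FT f \<in> L2" "norm (cls (FT f)) = norm (cls f)"
proof -
  have [measurable]: "f \<in> borel_measurable borel" using f by auto
  define \<gamma> where "\<gamma> a \<xi> = exp (- (a * \<xi>)\<^sup>2 / 2)" for a \<xi> :: real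
  have [measurable]: "\<gamma> a \<in> borel_measurable borel" for a unfolding \<gamma>_def by measurable
  define H where "H t = (\<integral>x. f x * cnj (f (x - t)) \<partial>lborel)" for t
  have H_meas[measurable]: "H \<in> borel_measurable borel" unfolding H_def by measurable
  have tr_f: "tr t (cls f) = cls (\<lambda>x. f (x - t))" for t by (rule tr_cls[OF f(2)])
  have ReH: "Re (H t) = inner (cls f) (tr t (cls f))" for t
    unfolding H_def tr_f by (simp only: inner_cls_Re[OF f(2) shift_L2[OF f(2)]])
  have ReH_le: "\<bar>Re (H t)\<bar> \<le> (norm (cls f))\<^sup>2" for t
    unfolding ReH using Cauchy_Schwarz_ineq2[of "cls f" "tr t (cls f)"] by (simp add: power2_eq_square)
  have ReH_lim: "(\<lambda>n. Re (H (t n))) \<longlonglongrightarrow> (norm (cls f))\<^sup>2" if "t \<longlonglongrightarrow> 0" for t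
    unfolding ReH power2_norm_eq_inner using tr_cont_all[of "cls f"] that
    by (intro tendsto_inner tendsto_const) (auto simp: tr_cont_def)
  have \<gamma>_int: "integrable lborel (\<gamma> a)" if "0 < a" for a
  proof -
    have "integrable lborel (\<lambda>\<xi>. std_normal_density (0 + a * \<xi>))"
      using that by (intro lborel_integrable_real_affine) auto
    then have "integrable lborel (\<lambda>\<xi>. sqrt (2 * pi) * std_normal_density (a * \<xi>))" by simp
    moreover have "sqrt (2 * pi) * std_normal_density (a * \<xi>) = \<gamma> a \<xi>" for \<xi>
      unfolding \<gamma>_def std_normal_density_def by simp
    ultimately show ?thesis by simp
  qed
  define Bf where "Bf = 1 / sqrt (2 * pi) * (\<integral>x. cmod (f x) \<partial>lborel)"
  have FTf_bd: "cmod (FT f \<xi>) \<le> Bf" for \<xi>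
    unfolding Bf_def by (rule cmod_FT_le[OF f(1)])
  have Bf0: "0 \<le> Bf" using FTf_bd[of 0] norm_ge_zero order_trans by blast
  have main: "integrable lborel (\<lambda>\<xi>. \<gamma> a \<xi> * (cmod (FT f \<xi>))\<^sup>2)"
      "(\<integral>\<xi>. \<gamma> a \<xi> * (cmod (FT f \<xi>))\<^sup>2 \<partial>lborel) = (\<integral>z. std_normal_density z * Re (H (a * z)) \<partial>lborel)"
    if a: "0 < a" for a
  proof -
    define f' where "f' = (\<lambda>y. cnj (f (- y)))"
    have f': "integrable lborel f'" unfolding f'_def
      using lborel_minus_integrable[OF f(1)] by simp
    \<comment> \<open>Up to the Gaussian weight this is the conjugate of \<open>FT f\<close>,
      written as a transform so that the multiplication formula applies twice: to compute
      \<open>FT g\<close>, and to the integral of \<open>FT f * g\<close>.\<close>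
    define g where "g \<xi> = complex_of_real (\<gamma> a \<xi>) * FT f' \<xi>" for \<xi>
    have g_eq: "g \<xi> = complex_of_real (\<gamma> a \<xi>) * cnj (FT f \<xi>)" for \<xi>
      unfolding g_def f'_def FT_cnj ..
    have g: "integrable lborel g"
    proof (rule Bochner_Integration.integrable_bound)
      show "integrable lborel (\<lambda>\<xi>. \<gamma> a \<xi> * Bf)"
        using \<gamma>_int[OF a] by (rule integrable_mult_left)
      show "AE \<xi> in lborel. norm (g \<xi>) \<le> norm (\<gamma> a \<xi> * Bf)"
        by (rule AE_I2) (use FTf_bd Bf0 in \<open>auto simp: g_eq norm_mult \<gamma>_def abs_mult intro!: mult_left_mono\<close>)
      have [measurable]: "f' \<in> borel_measurable borel" unfolding f'_def by measurable
      show "g \<in> borel_measurable lborel" unfolding g_def by measurable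
    qed
    have FTg: "FT g x = (\<integral>z. complex_of_real (std_normal_density z) * cnj (f (x - a * z)) \<partial>lborel)" for x
    proof -
      define h where "h \<xi> = ek (x * \<xi>) * complex_of_real (\<gamma> a \<xi>)" for \<xi>
      have h: "integrable lborel h" unfolding h_def
        by (rule integrable_kernel) (use \<gamma>_int[OF a] in auto)
      have "FT g x = ccst * (\<integral>\<xi>. FT f' \<xi> * h \<xi> \<partial>lborel)"
        unfolding FT_def[of g] g_def h_def by (simp add: mult_ac flip: integral_mult_right_zero)
      also have "(\<integral>\<xi>. FT f' \<xi> * h \<xi> \<partial>lborel) = (\<integral>y. f' y * FT h y \<partial>lborel)"
        by (rule FT_mult_formula[OF f' h])
      also have "ccst * \<dots> = (\<integral>y. f' y * (ccst * FT h y) \<partial>lborel)"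
        by (subst integral_mult_right_zero[symmetric]) (simp add: mult.left_commute)
      also have "\<dots> = (\<integral>y. f' y * complex_of_real (normal_density 0 a (x + y)) \<partial>lborel)"
        unfolding h_def FT_modulate \<gamma>_def FT_gaussian[OF a] by simp
      also have "\<dots> = a *\<^sub>R (\<integral>z. f' (- x + a * z) * complex_of_real (normal_density 0 a (a * z)) \<partial>lborel)"
        using a by (subst lborel_integral_real_affine[of a _ "- x"]) auto
      also have "\<dots> = (\<integral>z. complex_of_real (std_normal_density z) * cnj (f (x - a * z)) \<partial>lborel)"
      proof (subst integral_scaleR_right[symmetric], rule Bochner_Integration.integral_cong)
        fix z
        have "a * normal_density 0 a (a * z) = std_normal_density z"
          using a by (simp add: normal_density_def real_sqrt_mult power_mult_distrib field_simps)
        then show "a *\<^sub>R (f' (- x + a * z) * complex_of_real (normal_density 0 a (a * z)))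
            = complex_of_real (std_normal_density z) * cnj (f (x - a * z))"
          unfolding f'_def scaleR_conv_of_real by (simp add: mult_ac flip: of_real_mult)
      qed simp
      finally show ?thesis .
    qed
    define K where "K x z = complex_of_real (std_normal_density z) * (f x * cnj (f (x - a * z)))" for x z
    have K_meas[measurable]: "(\<lambda>(x, z). K x z) \<in> borel_measurable (borel \<Otimes>\<^sub>M borel)"
      unfolding K_def by measurable
    have K_int_x: "integrable lborel (\<lambda>x. K x z)" for z
      unfolding K_def using f(2)
      by (intro integrable_mult_right L2_prod_integrable[of f "\<lambda>x. f (x - a * z)"] shift_L2)
    \<comment> \<open>Translation invariance makes the bound a multiple of the density in z, which
      is the integrability that Fubini requires.\<close>
    have norm_K: "(\<integral>x. norm (K x z) \<partial>lborel) \<le> std_normal_density z * (norm (cls f))\<^sup>2" for z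
    proof -
      let ?w = "\<lambda>x. std_normal_density z * (((cmod (f x))\<^sup>2 + (cmod (f (x - a * z)))\<^sup>2) / 2)"
      have i: "integrable lborel (\<lambda>x. (cmod (f x))\<^sup>2)" "integrable lborel (\<lambda>x. (cmod (f (x - a * z)))\<^sup>2)"
        using L2_integrable[OF f(2)] L2_integrable[OF shift_L2[OF f(2)]] by auto
      have 1: "integrable lborel ?w"
        by (intro integrable_mult_right integrable_divide Bochner_Integration.integrable_add i)
      have 2: "norm (K x z) \<le> ?w x" for x
      proof -
        have "cmod (f x) * cmod (f (x - a * z)) \<le> ((cmod (f x))\<^sup>2 + (cmod (f (x - a * z)))\<^sup>2) / 2"
          using sum_squares_bound[of "cmod (f x)" "cmod (f (x - a * z))"] by simp
        then have "std_normal_density z * (cmod (f x) * cmod (f (x - a * z))) \<le> ?w x"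
          by (rule mult_left_mono) simp
        then show ?thesis unfolding K_def
          by (simp only: norm_mult complex_mod_cnj norm_of_real abs_of_nonneg[OF normal_density_nonneg])
      qed
      have "(\<integral>x. norm (K x z) \<partial>lborel) \<le> (\<integral>x. ?w x \<partial>lborel)"
        by (rule integral_mono[OF integrable_norm[OF K_int_x] 1 2])
      also have "\<dots> = std_normal_density z * (((\<integral>x. (cmod (f x))\<^sup>2 \<partial>lborel) + (\<integral>x. (cmod (f (x - a * z)))\<^sup>2 \<partial>lborel)) / 2)"
        by (subst Bochner_Integration.integral_add[symmetric, OF i]) simp
      also have "\<dots> = std_normal_density z * (norm (cls f))\<^sup>2"
        unfolding lborel_shift_integral[of "\<lambda>x. (cmod (f x))\<^sup>2"] norm_cls_sq[OF f(2)] by simp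
      finally show ?thesis .
    qed
    have K_int: "integrable (lborel \<Otimes>\<^sub>M lborel) (\<lambda>(z, x). K x z)"
    proof (rule lborel_pair.Fubini_integrable)
      show "integrable lborel (\<lambda>z. \<integral>x. norm (case (z, x) of (z, x) \<Rightarrow> K x z) \<partial>lborel)"
      proof (rule Bochner_Integration.integrable_bound)
        show "integrable lborel (\<lambda>z. std_normal_density z * (norm (cls f))\<^sup>2)" by simp
        show "AE z in lborel. norm (\<integral>x. norm (case (z, x) of (z, x) \<Rightarrow> K x z) \<partial>lborel)
            \<le> norm (std_normal_density z * (norm (cls f))\<^sup>2)"
          by (rule AE_I2) (use norm_K in auto)
        show "(\<lambda>z. \<integral>x. norm (case (z, x) of (z, x) \<Rightarrow> K x z) \<partial>lborel) \<in> borel_measurable lborel"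
          unfolding K_def by measurable
      qed
      show "AE z in lborel. integrable lborel (\<lambda>x. case (z, x) of (z, x) \<Rightarrow> K x z)"
        using K_int_x by simp
      show "(\<lambda>(z, x). K x z) \<in> borel_measurable (lborel \<Otimes>\<^sub>M lborel)"
        unfolding K_def by measurable
    qed
    have "(\<integral>\<xi>. FT f \<xi> * g \<xi> \<partial>lborel) = (\<integral>x. f x * FT g x \<partial>lborel)"
      by (rule FT_mult_formula[OF f(1) g])
    also have "\<dots> = (\<integral>x. \<integral>z. K x z \<partial>lborel \<partial>lborel)"
      unfolding FTg K_def by (simp add: mult_ac flip: integral_mult_right_zero)
    also have "\<dots> = (\<integral>z. \<integral>x. K x z \<partial>lborel \<partial>lborel)"
      by (rule lborel_pair.Fubini_integral[OF K_int])
    also have "\<dots> = (\<integral>z. complex_of_real (std_normal_density z) * H (a * z) \<partial>lborel)"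
      unfolding K_def H_def by simp
    finally have eq: "(\<integral>\<xi>. FT f \<xi> * g \<xi> \<partial>lborel) = (\<integral>z. complex_of_real (std_normal_density z) * H (a * z) \<partial>lborel)" .
    have i1: "integrable lborel (\<lambda>\<xi>. FT f \<xi> * g \<xi>)"
    proof (rule Bochner_Integration.integrable_bound)
      show "integrable lborel (\<lambda>\<xi>. Bf * cmod (g \<xi>))"
        using g by simp
      show "AE \<xi> in lborel. norm (FT f \<xi> * g \<xi>) \<le> norm (Bf * cmod (g \<xi>))"
        by (rule AE_I2) (use FTf_bd Bf0 in \<open>auto simp: norm_mult abs_mult intro!: mult_right_mono\<close>)
    qed (use g in auto)
    have pw: "\<gamma> a \<xi> * (cmod (FT f \<xi>))\<^sup>2 = Re (FT f \<xi> * g \<xi>)" for \<xi>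
    proof -
      have "FT f \<xi> * g \<xi> = complex_of_real (\<gamma> a \<xi> * (cmod (FT f \<xi>))\<^sup>2)"
        unfolding g_eq using complex_norm_square[of "FT f \<xi>"] by (simp add: mult_ac)
      then show ?thesis by (simp only: Re_complex_of_real)
    qed
    show "integrable lborel (\<lambda>\<xi>. \<gamma> a \<xi> * (cmod (FT f \<xi>))\<^sup>2)"
      unfolding pw by (rule Bochner_Integration.integrable_Re[OF i1])
    have i2: "integrable lborel (\<lambda>z. complex_of_real (std_normal_density z) * H (a * z))"
    proof (rule Bochner_Integration.integrable_bound)
      show "integrable lborel (\<lambda>z. std_normal_density z * (norm (cls f))\<^sup>2)" by simp
      show "AE z in lborel. norm (complex_of_real (std_normal_density z) * H (a * z))
          \<le> norm (std_normal_density z * (norm (cls f))\<^sup>2)"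
      proof (rule AE_I2)
        fix z
        have "norm (complex_of_real (std_normal_density z) * H (a * z)) = cmod (\<integral>x. K x z \<partial>lborel)"
          unfolding K_def H_def by simp
        also have "\<dots> \<le> (\<integral>x. norm (K x z) \<partial>lborel)" by (rule integral_norm_bound)
        finally show "norm (complex_of_real (std_normal_density z) * H (a * z))
          \<le> norm (std_normal_density z * (norm (cls f))\<^sup>2)" using norm_K[of z] by simp
      qed
    qed measurable
    have "(\<integral>\<xi>. \<gamma> a \<xi> * (cmod (FT f \<xi>))\<^sup>2 \<partial>lborel) = Re (\<integral>\<xi>. FT f \<xi> * g \<xi> \<partial>lborel)"
      unfolding pw by (rule Bochner_Integration.integral_Re[OF i1])
    also have "\<dots> = (\<integral>z. Re (complex_of_real (std_normal_density z) * H (a * z)) \<partial>lborel)"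
      unfolding eq by (rule Bochner_Integration.integral_Re[symmetric]) (rule i2)
    also have "\<dots> = (\<integral>z. std_normal_density z * Re (H (a * z)) \<partial>lborel)" by simp
    finally show "(\<integral>\<xi>. \<gamma> a \<xi> * (cmod (FT f \<xi>))\<^sup>2 \<partial>lborel) = (\<integral>z. std_normal_density z * Re (H (a * z)) \<partial>lborel)" .
  qed
  define a where "a n = 1 / real (Suc n)" for n
  have a: "0 < a n" for n unfolding a_def by simp
  have a_lim: "a \<longlonglongrightarrow> 0" unfolding a_def by (rule LIMSEQ_Suc[OF lim_1_over_n])
  have "(\<lambda>n. \<integral>z. std_normal_density z * Re (H (a n * z)) \<partial>lborel) \<longlonglongrightarrow> (\<integral>z. std_normal_density z * (norm (cls f))\<^sup>2 \<partial>lborel)"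
  proof (rule integral_dominated_convergence[where w="\<lambda>z. std_normal_density z * (norm (cls f))\<^sup>2"])
    show "AE z in lborel. (\<lambda>n. std_normal_density z * Re (H (a n * z))) \<longlonglongrightarrow> std_normal_density z * (norm (cls f))\<^sup>2"
    proof (intro AE_I2 tendsto_mult tendsto_const ReH_lim)
      fix z
      have "(\<lambda>n. a n * z) \<longlonglongrightarrow> 0 * z" by (intro tendsto_mult a_lim tendsto_const)
      then show "(\<lambda>n. a n * z) \<longlonglongrightarrow> 0" by simp
    qed
    show "AE z in lborel. norm (std_normal_density z * Re (H (a n * z))) \<le> std_normal_density z * (norm (cls f))\<^sup>2" for n
      by (rule AE_I2) (use ReH_le in \<open>auto simp: abs_mult intro!: mult_left_mono\<close>)
  qed auto
  then have lim1: "(\<lambda>n. \<integral>\<xi>. \<gamma> (a n) \<xi> * (cmod (FT f \<xi>))\<^sup>2 \<partial>lborel) \<longlonglongrightarrow> (norm (cls f))\<^sup>2"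
    using main(2)[OF a] by simp
  \<comment> \<open>Integrability of the limit is still open, so monotone convergence is used: the
    weights increase to 1 as \<open>a n\<close> decreases to 0.\<close>
  have "(\<lambda>n. \<integral>\<^sup>+\<xi>. ennreal (\<gamma> (a n) \<xi> * (cmod (FT f \<xi>))\<^sup>2) \<partial>lborel) \<longlonglongrightarrow> (\<integral>\<^sup>+\<xi>. ennreal ((cmod (FT f \<xi>))\<^sup>2) \<partial>lborel)"
  proof (rule nn_integral_LIMSEQ)
    have "\<gamma> (a m) \<xi> \<le> \<gamma> (a n) \<xi>" if "m \<le> n" for m n \<xi>
    proof -
      have "a n \<le> a m" using that unfolding a_def by (simp add: frac_le)
      then have "(a n)\<^sup>2 * \<xi>\<^sup>2 \<le> (a m)\<^sup>2 * \<xi>\<^sup>2" using a[of n] by (intro mult_right_mono power_mono) auto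
      then show ?thesis unfolding \<gamma>_def by (simp add: power_mult_distrib)
    qed
    then show "mono (\<lambda>n \<xi>. ennreal (\<gamma> (a n) \<xi> * (cmod (FT f \<xi>))\<^sup>2))"
      by (auto intro!: monoI le_funI ennreal_leI mult_right_mono)
    show "(\<lambda>n. ennreal (\<gamma> (a n) \<xi> * (cmod (FT f \<xi>))\<^sup>2)) \<longlonglongrightarrow> ennreal ((cmod (FT f \<xi>))\<^sup>2)" for \<xi>
    proof -
      have "(\<lambda>n. \<gamma> (a n) \<xi> * (cmod (FT f \<xi>))\<^sup>2) \<longlonglongrightarrow> exp (- (0 * \<xi>)\<^sup>2 / 2) * (cmod (FT f \<xi>))\<^sup>2"
        unfolding \<gamma>_def by (intro tendsto_intros a_lim) auto
      then show ?thesis by (intro tendsto_ennrealI) simp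
    qed
  qed simp
  moreover have "(\<integral>\<^sup>+\<xi>. ennreal (\<gamma> (a n) \<xi> * (cmod (FT f \<xi>))\<^sup>2) \<partial>lborel)
      = ennreal (\<integral>\<xi>. \<gamma> (a n) \<xi> * (cmod (FT f \<xi>))\<^sup>2 \<partial>lborel)" for n
    by (rule nn_integral_eq_integral[OF main(1)[OF a]]) (auto simp: \<gamma>_def)
  ultimately have eq: "(\<integral>\<^sup>+\<xi>. ennreal ((cmod (FT f \<xi>))\<^sup>2) \<partial>lborel) = ennreal ((norm (cls f))\<^sup>2)"
    using LIMSEQ_unique[OF _ tendsto_ennrealI[OF lim1]] by simp
  show *: "FT f \<in> L2" by (rule L2I) (use eq in auto)
  have "ennreal ((norm (cls (FT f)))\<^sup>2) = ennreal ((norm (cls f))\<^sup>2)"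
    using nn_norm_cls[OF *] eq by simp
  then show "norm (cls (FT f)) = norm (cls f)" by simp
qed

section \<open>The transform on all of L2 and its inversion\<close>

definition trunc :: "nat \<Rightarrow> (real \<Rightarrow> complex) \<Rightarrow> real \<Rightarrow> complex" where
  "trunc n f x = indicator {- real n..real n} x *\<^sub>R f x"

lemma trunc_measurable[measurable]: "f \<in> borel_measurable borel \<Longrightarrow> trunc n f \<in> borel_measurable borel"
  unfolding trunc_def by measurable

lemma trunc_L2: "f \<in> L2 \<Longrightarrow> trunc n f \<in> L2"
  by (rule L2_dominated[where c=1]) (auto simp: trunc_def indicator_def)

lemma trunc_L1: 
  assumes "f \<in> L2" shows "integrable lborel (trunc n f)"
proof (rule Bochner_Integration.integrable_bound)
  show "integrable lborel (\<lambda>x. indicator {- real n..real n} x + (cmod (f x))\<^sup>2)"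
    using L2_integrable[OF assms] by (auto intro!: integrable_real_indicator)
  have le: "cmod (f x) \<le> 1 + (cmod (f x))\<^sup>2" for x
  proof -
    have "2 * cmod (f x) \<le> 1 + (cmod (f x))\<^sup>2" using sum_squares_bound[of 1 "cmod (f x)"] by simp
    then show ?thesis using norm_ge_zero[of "f x"] by linarith
  qed
  show "AE x in lborel. norm (trunc n f x) \<le> norm (indicator {- real n..real n} x + (cmod (f x))\<^sup>2)"
  proof (rule AE_I2)
    fix x
    show "norm (trunc n f x) \<le> norm (indicator {- real n..real n} x + (cmod (f x))\<^sup>2)"
      using le[of x] by (cases "x \<in> {- real n..real n}") (simp_all add: trunc_def)
  qed
qed (use assms in auto)

lemma trunc_tendsto:
  assumes f: "f \<in> L2" shows "(\<lambda>n. cls (trunc n f)) \<longlonglongrightarrow> cls f"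
proof (rule tendsto_cls_dominated[where w="\<lambda>x. (cmod (f x))\<^sup>2"])
  show "AE x in lborel. (\<lambda>n. trunc n f x) \<longlonglongrightarrow> f x"
  proof (rule AE_I2, rule tendsto_eventually)
    fix x
    show "\<forall>\<^sub>F n in sequentially. trunc n f x = f x"
      using eventually_ge_at_top[of "nat \<lceil>\<bar>x\<bar>\<rceil>"]
      by eventually_elim (auto simp: trunc_def indicator_def nat_le_iff ceiling_le_iff)
  qed
  show "AE x in lborel. (cmod (trunc n f x - f x))\<^sup>2 \<le> (cmod (f x))\<^sup>2" for n
    by (rule AE_I2) (auto simp: trunc_def indicator_def)
qed (use f trunc_L2 in \<open>auto intro: L2_integrable\<close>)

text \<open>Recasts the definition by integrals as convergence in a normed space, where completeness
  and uniqueness of limits apply.\<close>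

lemma fourier_pair_iff:
  assumes f: "f \<in> L2" and g: "g \<in> L2"
  shows "fourier_pair f g \<longleftrightarrow> (\<lambda>n. cls (FT (trunc n f))) \<longlonglongrightarrow> cls g"
proof -
  have FTL2: "FT (trunc n f) \<in> L2" for n
    by (rule FT_isometry(1)) (use f in \<open>auto intro: trunc_L1 trunc_L2\<close>)
  have FT: "complex_of_real (1 / sqrt (2 * pi)) *
      (CLBINT x:{- real n..real n}. exp (- (\<i> * complex_of_real (\<xi> * x))) * f x) = FT (trunc n f) \<xi>" for n \<xi>
    unfolding FT_def ek_def ccst_def set_lebesgue_integral_def trunc_def by (simp only: mult_scaleR_right)
  have "(\<integral>\<^sup>+\<xi>. ennreal ((cmod (FT (trunc n f) \<xi> - g \<xi>))\<^sup>2) \<partial>lborel)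
     = ennreal ((norm (cls (FT (trunc n f)) - cls g))\<^sup>2)" for n
    using nn_norm_cls[OF L2_diff[OF FTL2 g], of n] by (simp add: cls_diff[OF FTL2 g])
  then have "fourier_pair f g \<longleftrightarrow> (\<lambda>n. ennreal ((norm (cls (FT (trunc n f)) - cls g))\<^sup>2)) \<longlonglongrightarrow> 0"
    unfolding fourier_pair_def FT using f g by simp
  also have "\<dots> \<longleftrightarrow> (\<lambda>n. (norm (cls (FT (trunc n f)) - cls g))\<^sup>2) \<longlonglongrightarrow> 0"
    by (subst ennreal_0[symmetric], subst tendsto_ennreal_iff) auto
  also have "\<dots> \<longleftrightarrow> (\<lambda>n. norm (cls (FT (trunc n f)) - cls g)) \<longlonglongrightarrow> 0"
  proof
    assume "(\<lambda>n. (norm (cls (FT (trunc n f)) - cls g))\<^sup>2) \<longlonglongrightarrow> 0"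
    then have "(\<lambda>n. sqrt ((norm (cls (FT (trunc n f)) - cls g))\<^sup>2)) \<longlonglongrightarrow> sqrt 0" by (intro tendsto_intros)
    then show "(\<lambda>n. norm (cls (FT (trunc n f)) - cls g)) \<longlonglongrightarrow> 0" by simp
  next
    assume "(\<lambda>n. norm (cls (FT (trunc n f)) - cls g)) \<longlonglongrightarrow> 0"
    then have "(\<lambda>n. (norm (cls (FT (trunc n f)) - cls g))\<^sup>2) \<longlonglongrightarrow> 0\<^sup>2" by (intro tendsto_intros)
    then show "(\<lambda>n. (norm (cls (FT (trunc n f)) - cls g))\<^sup>2) \<longlonglongrightarrow> 0" by simp
  qed
  also have "\<dots> \<longleftrightarrow> (\<lambda>n. cls (FT (trunc n f))) \<longlonglongrightarrow> cls g"
    using tendsto_norm_zero_iff[of "\<lambda>n. cls (FT (trunc n f)) - cls g"] LIM_zero_iff by auto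
  finally show ?thesis .
qed

lemma fourier_pair_L2: "fourier_pair f g \<Longrightarrow> f \<in> L2" "fourier_pair f g \<Longrightarrow> g \<in> L2"
  unfolding fourier_pair_def by auto

lemma fourier_pair_tendsto: "fourier_pair f g \<Longrightarrow> (\<lambda>n. cls (FT (trunc n f))) \<longlonglongrightarrow> cls g"
  using fourier_pair_iff[of f g] fourier_pair_L2[of f g] by simp

lemma FT_trunc_L2: "f \<in> L2 \<Longrightarrow> FT (trunc n f) \<in> L2"
  by (rule FT_isometry(1)[OF trunc_L1 trunc_L2])

lemma norm_FT_trunc: "f \<in> L2 \<Longrightarrow> norm (cls (FT (trunc n f))) = norm (cls (trunc n f))"
  by (rule FT_isometry(2)[OF trunc_L1 trunc_L2])

lemma fourier_pair_norm:
  assumes "fourier_pair f g" shows "norm (cls f) = norm (cls g)"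
proof (rule LIMSEQ_unique)
  note L2 = fourier_pair_L2[OF assms]
  show "(\<lambda>n. norm (cls (trunc n f))) \<longlonglongrightarrow> norm (cls f)"
    by (intro tendsto_norm trunc_tendsto L2)
  show "(\<lambda>n. norm (cls (trunc n f))) \<longlonglongrightarrow> norm (cls g)"
    using tendsto_norm[OF fourier_pair_tendsto[OF assms]] by (simp add: norm_FT_trunc[OF L2(1)])
qed

text \<open>The isometry, applied to differences of truncations, carries the Cauchy property over to
  the transforms, and \<open>l2\<close> is complete.\<close>

lemma fourier_pair_exists:
  assumes f: "f \<in> L2" shows "\<exists>g. fourier_pair f g"
proof -
  have *: "norm (cls (FT (trunc n f)) - cls (FT (trunc m f))) = norm (cls (trunc n f) - cls (trunc m f))" for n m
  proof -
    have "cls (FT (trunc n f)) - cls (FT (trunc m f)) = cls (FT (\<lambda>x. trunc n f x - trunc m f x))"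
      using f by (simp add: cls_diff[symmetric] FT_trunc_L2 FT_diff_fun trunc_L1)
    then show ?thesis
      using FT_isometry(2)[of "\<lambda>x. trunc n f x - trunc m f x"] f by (simp add: trunc_L1 trunc_L2 L2_diff cls_diff)
  qed
  have "Cauchy (\<lambda>n. cls (trunc n f))" using trunc_tendsto[OF f] LIMSEQ_imp_Cauchy by blast
  then have "Cauchy (\<lambda>n. cls (FT (trunc n f)))"
    unfolding Cauchy_def dist_norm * .
  then obtain V where "(\<lambda>n. cls (FT (trunc n f))) \<longlonglongrightarrow> V"
    using Cauchy_convergent_iff convergent_def by blast
  then have "fourier_pair f (fn V)" using fourier_pair_iff[OF f fn_L2[of V]] by simp
  then show ?thesis by blast
qed

lemma fourier_pair_unique:
  assumes "fourier_pair f g" "fourier_pair f g'" shows "AE x in lborel. g x = g' x"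
  using LIMSEQ_unique[OF fourier_pair_tendsto[OF assms(1)] fourier_pair_tendsto[OF assms(2)]]
  by (simp add: cls_eq_iff fourier_pair_L2(2)[OF assms(1)] fourier_pair_L2(2)[OF assms(2)])

lemma fourier_pair_cong:
  assumes "AE x in lborel. f x = f' x" "f' \<in> borel_measurable borel" "f \<in> L2"
  shows "fourier_pair f g \<longleftrightarrow> fourier_pair f' g"
proof -
  have f': "f' \<in> L2" by (rule L2_cong_AE[OF assms(3,2,1)])
  have "FT (trunc n f) = FT (trunc n f')" for n
  proof (rule FT_cong_AE)
    show "AE x in lborel. trunc n f x = trunc n f' x"
      using assms(1) by eventually_elim (simp add: trunc_def)
  qed (use assms f' in \<open>auto intro: L2_measurable\<close>)
  then show ?thesis
    using fourier_pair_iff[OF assms(3), of g] fourier_pair_iff[OF f', of g] fourier_pair_L2(2)[of _ g] by auto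
qed

lemma fourier_pair_diff:
  assumes 1: "fourier_pair f g" and 2: "fourier_pair f' g'"
  shows "fourier_pair (\<lambda>x. f x - f' x) (\<lambda>x. g x - g' x)"
proof -
  note L2 = fourier_pair_L2[OF 1] fourier_pair_L2[OF 2]
  have tr: "trunc n (\<lambda>x. f x - f' x) = (\<lambda>x. trunc n f x - trunc n f' x)" for n
    unfolding trunc_def by (auto simp: scaleR_diff_right simp del: scaleR_conv_of_real)
  have "(\<lambda>n. cls (FT (trunc n (\<lambda>x. f x - f' x)))) \<longlonglongrightarrow> cls g - cls g'"
    using tendsto_diff[OF fourier_pair_tendsto[OF 1] fourier_pair_tendsto[OF 2]] L2
    by (simp add: tr cls_diff[symmetric] FT_trunc_L2 FT_diff_fun trunc_L1)
  then show ?thesis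
    using L2 by (subst fourier_pair_iff) (auto intro: L2_diff simp: cls_diff)
qed

text \<open>The isometry is applied to the difference of the two pairs. This makes the choice in
  \<open>inv_fourier\<close> harmless.\<close>

lemma fourier_pair_inj:
  assumes "fourier_pair f g" "fourier_pair f' g'" "AE x in lborel. g x = g' x"
  shows "AE x in lborel. f x = f' x"
proof -
  have d: "fourier_pair (\<lambda>x. f x - f' x) (\<lambda>x. g x - g' x)" by (rule fourier_pair_diff) fact+
  have "cls g = cls g'" using assms fourier_pair_L2 by (intro cls_cong) auto
  then have "norm (cls (\<lambda>x. f x - f' x)) = 0"
    using fourier_pair_norm[OF d] assms fourier_pair_L2 by (simp add: cls_diff)
  then have "cls f = cls f'" using assms fourier_pair_L2 by (simp add: cls_diff)
  then show ?thesis
    by (simp add: cls_eq_iff fourier_pair_L2(1)[OF assms(1)] fourier_pair_L2(1)[OF assms(2)])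
qed

lemma refl_L2: "f \<in> L2 \<Longrightarrow> (\<lambda>x. f (- x)) \<in> L2"
  unfolding L2_def using lborel_minus_integrable[of "\<lambda>x. (cmod (f x))\<^sup>2"] by auto

lemma norm_refl:
  assumes "f \<in> L2" shows "norm (cls (\<lambda>x. f (- x))) = norm (cls f)"
proof -
  have "(norm (cls (\<lambda>x. f (- x))))\<^sup>2 = (norm (cls f))\<^sup>2"
    using lborel_minus_integral[of "\<lambda>x. (cmod (f x))\<^sup>2"]
    by (simp only: norm_cls_sq[OF refl_L2[OF assms]] norm_cls_sq[OF assms])
  then show ?thesis by simp
qed

text \<open>With f the reflected transform of A, the multiplication formula gives
  \<open>FT (trunc n f)\<close> the inner product |trunc n f|^2 with A. The squared distance to A
  thus reduces to |A|^2 - |trunc n f|^2, which tends to 0 by isometry. Integrable A suffice because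
  the weighted coordinates \<open>hat V\<close> are integrable.\<close>

lemma fourier_pair_inversion:
  assumes A: "integrable lborel A" "A \<in> L2"
  shows "fourier_pair (\<lambda>x. FT A (- x)) A"
proof -
  define f where "f = (\<lambda>x. FT A (- x))"
  have f: "f \<in> L2" unfolding f_def by (intro refl_L2 FT_isometry A)
  have nf: "norm (cls f) = norm (cls A)"
    unfolding f_def using norm_refl[OF FT_isometry(1)[OF A]] FT_isometry(2)[OF A] by simp
  have cA: "FT (\<lambda>\<xi>. cnj (A \<xi>)) x = cnj (f x)" for x
    unfolding f_def FT_cnj[of A "-x"] by (rule FT_refl[symmetric])
  have inner: "inner (cls (FT (trunc n f))) (cls A) = (norm (cls (trunc n f)))\<^sup>2" for n
  proof -
    have "inner (cls (FT (trunc n f))) (cls A) = Re (\<integral>\<xi>. FT (trunc n f) \<xi> * cnj (A \<xi>) \<partial>lborel)"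
      by (rule inner_cls_Re) (use A f in \<open>auto intro: FT_trunc_L2\<close>)
    also have "(\<integral>\<xi>. FT (trunc n f) \<xi> * cnj (A \<xi>) \<partial>lborel) = (\<integral>x. trunc n f x * cnj (f x) \<partial>lborel)"
      using A f by (subst FT_mult_formula) (auto simp: cA intro: trunc_L1)
    also have "Re \<dots> = (\<integral>x. Re (trunc n f x * cnj (f x)) \<partial>lborel)"
      by (rule Bochner_Integration.integral_Re[symmetric]) (intro L2_prod_integrable trunc_L2 f)
    also have "\<dots> = (\<integral>x. (cmod (trunc n f x))\<^sup>2 \<partial>lborel)"
    proof (rule Bochner_Integration.integral_cong)
      fix x
      show "Re (trunc n f x * cnj (f x)) = (cmod (trunc n f x))\<^sup>2"
        using Re_mult_cnj_self[of "f x"] by (auto simp: trunc_def indicator_def simp del: times_complex.sel)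
    qed simp
    also have "\<dots> = (norm (cls (trunc n f)))\<^sup>2" by (rule norm_cls_sq[symmetric]) (rule trunc_L2[OF f])
    finally show ?thesis .
  qed
  have "(norm (cls (FT (trunc n f)) - cls A))\<^sup>2 = (norm (cls A))\<^sup>2 - (norm (cls (trunc n f)))\<^sup>2" for n
  proof -
    have "(norm (V - U))\<^sup>2 = (norm V)\<^sup>2 - 2 * inner V U + (norm U)\<^sup>2" for V U :: l2
      by (simp add: power2_norm_eq_inner inner_diff_left inner_diff_right inner_commute)
    then show ?thesis using inner[of n] norm_FT_trunc[OF f, of n] by simp
  qed
  moreover have "(\<lambda>n. (norm (cls A))\<^sup>2 - (norm (cls (trunc n f)))\<^sup>2) \<longlonglongrightarrow> (norm (cls A))\<^sup>2 - (norm (cls f))\<^sup>2"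
    by (intro tendsto_intros trunc_tendsto f)
  ultimately have "(\<lambda>n. (norm (cls (FT (trunc n f)) - cls A))\<^sup>2) \<longlonglongrightarrow> 0" using nf by simp
  then have "(\<lambda>n. sqrt ((norm (cls (FT (trunc n f)) - cls A))\<^sup>2)) \<longlonglongrightarrow> sqrt 0" by (intro tendsto_intros)
  then have "(\<lambda>n. norm (cls (FT (trunc n f)) - cls A)) \<longlonglongrightarrow> 0" by simp
  then have "(\<lambda>n. cls (FT (trunc n f))) \<longlonglongrightarrow> cls A"
    using tendsto_norm_zero_iff[of "\<lambda>n. cls (FT (trunc n f)) - cls A"] LIM_zero_iff by auto
  then show ?thesis using fourier_pair_iff[OF f A(2)] unfolding f_def by simp
qed

lemma fourier_pair_fourier: "f \<in> L2 \<Longrightarrow> fourier_pair f (fourier f)"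
  unfolding fourier_def by (rule someI_ex[OF fourier_pair_exists])

section \<open>The algebra property of \<open>H\<^sup>s\<close>\<close>

text \<open>The symbol of (1 - \<Delta>)^(r/2); its square is the weight of order r in
  \<open>Hs_norm\<close>.\<close>

definition wt :: "real \<Rightarrow> real \<Rightarrow> real" where "wt r \<xi> = (1 + \<xi>\<^sup>2) powr (r / 2)"

lemma one_plus_sq_pos: "0 < 1 + (\<xi>::real)\<^sup>2" by (simp add: add_pos_nonneg)

lemma wt_pos[simp]: "0 < wt r \<xi>"
  unfolding wt_def using one_plus_sq_pos[of \<xi>] by simp

lemma wt_nonneg[simp]: "0 \<le> wt r \<xi>" using wt_pos[of r \<xi>] by linarith

lemma wt_neq0[simp]: "wt r \<xi> \<noteq> 0" using wt_pos[of r \<xi>] by linarith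

lemma wt_add: "wt (r + q) \<xi> = wt r \<xi> * wt q \<xi>"
  unfolding wt_def by (simp add: add_divide_distrib powr_add)

lemma wt_0[simp]: "wt 0 \<xi> = 1" unfolding wt_def using one_plus_sq_pos[of \<xi>] by simp

lemma wt_cancel: "wt (- r) \<xi> * wt r \<xi> = 1" "wt r \<xi> * wt (- r) \<xi> = 1"
  using wt_add[of "-r" r \<xi>] wt_add[of r "-r" \<xi>] by simp_all

lemma wt_ge1: "0 \<le> r \<Longrightarrow> 1 \<le> wt r \<xi>"
  unfolding wt_def by (rule ge_one_powr_ge_zero) auto

lemma wt_neg_le1: "0 \<le> r \<Longrightarrow> wt (- r) \<xi> \<le> 1"
  using wt_ge1[of r \<xi>] wt_cancel(1)[of r \<xi>] wt_pos[of "-r" \<xi>]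
  by (metis mult.right_neutral mult_left_mono wt_nonneg)

lemma wt_minus[simp]: "wt r (- \<xi>) = wt r \<xi>" unfolding wt_def by simp

lemma wt_sq: "(wt r \<xi>)\<^sup>2 = (1 + \<xi>\<^sup>2) powr r"
  unfolding wt_def power2_eq_square by (simp add: powr_add[symmetric])

lemma wt_2: "wt 2 \<xi> = 1 + \<xi>\<^sup>2" and wt_4: "wt 4 \<xi> = (1 + \<xi>\<^sup>2)\<^sup>2"
  unfolding wt_def using one_plus_sq_pos[of \<xi>] by (simp_all add: powr_numeral)

lemma wt_measurable[measurable]: "wt r \<in> borel_measurable borel"
  unfolding wt_def by measurable

text \<open>One of the two frequencies has at least half the modulus of their sum, so 1 + \<xi>^2 is
  at most four times the larger of 1 + \<eta>^2 and 1 + (\<xi> - \<eta>)^2. The constant 2^r is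
  4^(r/2).\<close>

lemma wt_subadd:
  assumes "0 \<le> r" shows "wt r \<xi> \<le> 2 powr r * (wt r \<eta> + wt r (\<xi> - \<eta>))"
proof -
  define m where "m = max (1 + \<eta>\<^sup>2) (1 + (\<xi> - \<eta>)\<^sup>2)"
  have "\<xi>\<^sup>2 \<le> 2 * \<eta>\<^sup>2 + 2 * (\<xi> - \<eta>)\<^sup>2"
    using zero_le_power2[of "\<eta> - (\<xi> - \<eta>)"] by (simp add: power2_eq_square algebra_simps)
  then have "1 + \<xi>\<^sup>2 \<le> 4 * m" unfolding m_def by (auto simp: max_def)
  then have "wt r \<xi> \<le> (4 * m) powr (r / 2)"
    unfolding wt_def using assms by (intro powr_mono2) auto
  also have "\<dots> = 4 powr (r / 2) * m powr (r / 2)"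
    unfolding m_def by (subst powr_mult) (auto simp: max_def)
  also have "(4::real) powr (r / 2) = 2 powr r"
    using powr_powr[of 2 2 "r / 2"] by simp
  also have "m powr (r / 2) \<le> wt r \<eta> + wt r (\<xi> - \<eta>)"
  proof (cases "1 + \<eta>\<^sup>2 \<le> 1 + (\<xi> - \<eta>)\<^sup>2")
    case True
    then have "m powr (r / 2) = wt r (\<xi> - \<eta>)" unfolding m_def wt_def by (simp add: max_def)
    then show ?thesis by simp
  next
    case False
    then have "m powr (r / 2) = wt r \<eta>" unfolding m_def wt_def by (simp add: max_def)
    then show ?thesis by simp
  qed
  finally show ?thesis by (simp add: mult_left_mono)
qed

lemma nn_integral_shift:
  fixes t :: real
  assumes [measurable]: "f \<in> borel_measurable borel"
  shows "(\<integral>\<^sup>+x. f (x - t) \<partial>lborel) = (\<integral>\<^sup>+x. f x \<partial>lborel)"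
  using nn_integral_real_affine[of f 1 "-t"] by simp

lemma nn_integral_reflect:
  fixes t :: real
  assumes [measurable]: "f \<in> borel_measurable borel"
  shows "(\<integral>\<^sup>+x. f (t - x) \<partial>lborel) = (\<integral>\<^sup>+x. f x \<partial>lborel)"
  using nn_integral_real_affine[of f "-1" "t"] by simp

text \<open>For a non-integrable f the integral is 0 by convention and the bound is trivial.
  Convolutions can therefore be estimated before their integrability is known.\<close>

lemma norm_integral_le_nn:
  "ennreal (norm (\<integral>x. f x \<partial>M)) \<le> (\<integral>\<^sup>+x. ennreal (norm (f x)) \<partial>M)"
  for f :: "'a \<Rightarrow> 'b :: {banach, second_countable_topology}"
  by (cases "integrable M f") (auto intro: integral_norm_bound_ennreal simp: not_integrable_integral_eq)

lemma ennreal_square: "0 \<le> x \<Longrightarrow> ennreal (x\<^sup>2) = (ennreal x)\<^sup>2"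
  by (simp add: ennreal_power)

lemma ennreal_sum_sq_le: "(a + b)\<^sup>2 \<le> 2 * (a\<^sup>2 + b\<^sup>2)" for a b :: ennreal
proof (cases "a = \<infinity> \<or> b = \<infinity>")
  case True
  then show ?thesis by (auto simp: power2_eq_square ennreal_mult_top top_add)
next
  case False
  then obtain x y where xy: "a = ennreal x" "b = ennreal y" "0 \<le> x" "0 \<le> y"
    by (cases a; cases b) auto
  have "(x + y)\<^sup>2 \<le> 2 * (x\<^sup>2 + y\<^sup>2)"
    using zero_le_power2[of "x - y"] by (simp add: power2_eq_square algebra_simps)
  then have "ennreal ((x + y)\<^sup>2) \<le> ennreal (2 * (x\<^sup>2 + y\<^sup>2))" by (rule ennreal_leI)
  moreover have "ennreal ((x + y)\<^sup>2) = (a + b)\<^sup>2"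
    using xy by (simp add: ennreal_power flip: ennreal_plus)
  moreover have "ennreal (2 * (x\<^sup>2 + y\<^sup>2)) = 2 * (a\<^sup>2 + b\<^sup>2)"
    using xy by (subst ennreal_mult) (auto simp: ennreal_power)
  ultimately show ?thesis by simp
qed

locale sobolev =
  fixes s :: real
  assumes s_gt: "1 / 2 < s"
begin

text \<open>The threshold 1/2 comes from here: the weight is compared with (1 + |\<xi>|)^(-2s),
  whose antiderivative vanishes at infinity because 1 - 2s is negative.\<close>

lemma wt_finite: "(\<integral>\<^sup>+\<xi>. ennreal (wt (- 2 * s) \<xi>) \<partial>lborel) < \<infinity>"
proof -
  define g where "g x = (1 + x) powr (- 2 * s)" for x :: real
  define G where "G x = (1 + x) powr (1 - 2 * s) / (1 - 2 * s)" for x :: real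
  have le: "wt (- 2 * s) \<xi> \<le> 2 powr s * g \<bar>\<xi>\<bar>" for \<xi>
  proof -
    have "(1 + \<bar>\<xi>\<bar>)\<^sup>2 \<le> 2 * (1 + \<xi>\<^sup>2)"
      using zero_le_power2[of "1 - \<bar>\<xi>\<bar>"] by (simp add: power2_eq_square algebra_simps)
    then have "(2 * (1 + \<xi>\<^sup>2)) powr (- s) \<le> ((1 + \<bar>\<xi>\<bar>)\<^sup>2) powr (- s)"
      using s_gt by (intro powr_mono2') auto
    also have "\<dots> = g \<bar>\<xi>\<bar>"
      unfolding g_def using powr_powr[of "1 + \<bar>\<xi>\<bar>" 2 "- s"] by (simp add: powr_numeral)
    also have "(2 * (1 + \<xi>\<^sup>2)) powr (- s) = 2 powr (- s) * wt (- 2 * s) \<xi>"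
      unfolding wt_def by (subst powr_mult) auto
    finally have "2 powr s * (2 powr (- s) * wt (- 2 * s) \<xi>) \<le> 2 powr s * g \<bar>\<xi>\<bar>"
      by (intro mult_left_mono) auto
    moreover have "2 powr s * (2 powr (- s)) = (1::real)" by (simp add: powr_add[symmetric])
    ultimately show ?thesis by (simp only: mult.assoc[symmetric] mult_1)
  qed
  have half: "(\<integral>\<^sup>+x. ennreal (g x) * indicator {0..} x \<partial>lborel) = ennreal (0 - G 0)"
  proof (rule nn_integral_FTC_atLeast)
    show "g \<in> borel_measurable borel" unfolding g_def by measurable
    show "(G has_real_derivative g x) (at x)" if "0 \<le> x" for x
    proof -
      have "((\<lambda>x. (1 + x) powr (1 - 2 * s)) has_real_derivative (1 - 2 * s) * (1 + x) powr (1 - 2 * s - 1) * 1) (at x)"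
        using that by (intro DERIV_chain2[OF has_real_derivative_powr] derivative_eq_intros) auto
      then have "(G has_real_derivative (1 - 2 * s) * (1 + x) powr (1 - 2 * s - 1) * 1 / (1 - 2 * s)) (at x)"
        unfolding G_def by (rule DERIV_cdivide)
      then show ?thesis using s_gt by (simp add: g_def)
    qed
    show "0 \<le> g x" for x unfolding g_def by simp
    have "((\<lambda>x. (1 + x) powr (1 - 2 * s)) \<longlongrightarrow> 0) at_top"
      using s_gt by (intro tendsto_neg_powr filterlim_tendsto_add_at_top[OF tendsto_const filterlim_ident]) auto
    then show "(G \<longlongrightarrow> 0) at_top" unfolding G_def by (rule tendsto_divide_zero)
  qed
  have [measurable]: "g \<in> borel_measurable borel" unfolding g_def by measurable
  have "(\<integral>\<^sup>+\<xi>. ennreal (wt (- 2 * s) \<xi>) \<partial>lborel)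
      \<le> (\<integral>\<^sup>+\<xi>. ennreal (2 powr s) * (ennreal (g \<xi>) * indicator {0..} \<xi> + ennreal (g (0 - \<xi>)) * indicator {0..} (0 - \<xi>)) \<partial>lborel)"
  proof (rule nn_integral_mono)
    fix \<xi> :: real
    have "ennreal (wt (- 2 * s) \<xi>) \<le> ennreal (2 powr s) * ennreal (g \<bar>\<xi>\<bar>)"
      using le[of \<xi>] by (simp add: g_def flip: ennreal_mult)
    also have "ennreal (g \<bar>\<xi>\<bar>) \<le> ennreal (g \<xi>) * indicator {0..} \<xi> + ennreal (g (0 - \<xi>)) * indicator {0..} (0 - \<xi>)"
      by (cases "0 \<le> \<xi>") auto
    finally show "ennreal (wt (- 2 * s) \<xi>) \<le> ennreal (2 powr s) * (ennreal (g \<xi>) * indicator {0..} \<xi> + ennreal (g (0 - \<xi>)) * indicator {0..} (0 - \<xi>))"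
      by (simp add: mult_left_mono)
  qed
  also have "\<dots> = ennreal (2 powr s) * (ennreal (0 - G 0) + ennreal (0 - G 0))"
    using nn_integral_reflect[of "\<lambda>x. ennreal (g x) * indicator {0..} x" 0] half
    by (simp add: nn_integral_cmult nn_integral_add)
  also have "\<dots> < \<infinity>" by (simp add: ennreal_mult_less_top)
  finally show ?thesis .
qed

definition Q :: real where "Q = enn2real (\<integral>\<^sup>+\<xi>. ennreal (wt (- 2 * s) \<xi>) \<partial>lborel)"

lemma Q: "(\<integral>\<^sup>+\<xi>. ennreal (wt (- 2 * s) \<xi>) \<partial>lborel) = ennreal Q" "0 \<le> Q"
  unfolding Q_def using wt_finite by auto

text \<open>The square of the kernel below is at most 2 * 2^(2s) times a sum of two weights, each of
  integral Q.\<close>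

definition Kc :: real where "Kc = 4 * 2 powr (2 * s) * Q"

lemma Kc_nonneg: "0 \<le> Kc" unfolding Kc_def using Q(2) by simp

text \<open>Cauchy--Schwarz in the inner integral, after \<open>wt s \<xi>\<close> is split between \<open>\<eta>\<close> and
  \<open>\<xi> - \<eta>\<close>: one of the two weights of negative order survives and is square integrable since \<open>s > 1/2\<close>.\<close>

lemma kernel_bound:
  assumes [measurable]: "p \<in> borel_measurable borel" "q \<in> borel_measurable borel"
  shows "(\<integral>\<^sup>+\<xi>. (ennreal (wt s \<xi>) * (\<integral>\<^sup>+\<eta>. (ennreal (wt (- s) \<eta>) * p \<eta>) * (ennreal (wt (- s) (\<xi> - \<eta>)) * q (\<xi> - \<eta>)) \<partial>lborel))\<^sup>2 \<partial>lborel)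
    \<le> ennreal Kc * ((\<integral>\<^sup>+\<xi>. (p \<xi>)\<^sup>2 \<partial>lborel) * (\<integral>\<^sup>+\<xi>. (q \<xi>)\<^sup>2 \<partial>lborel))"
proof -
  define \<kappa> where "\<kappa> \<xi> \<eta> = wt s \<xi> * (wt (- s) \<eta> * wt (- s) (\<xi> - \<eta>))" for \<xi> \<eta>
  have [measurable]: "(\<lambda>\<eta>. \<kappa> \<xi> \<eta>) \<in> borel_measurable borel" for \<xi> unfolding \<kappa>_def by measurable
  have \<kappa>0: "0 \<le> \<kappa> \<xi> \<eta>" for \<xi> \<eta> unfolding \<kappa>_def by simp
  have \<kappa>2: "(\<kappa> \<xi> \<eta>)\<^sup>2 \<le> 2 * 2 powr (2 * s) * (wt (- 2 * s) \<eta> + wt (- 2 * s) (\<xi> - \<eta>))" for \<xi> \<eta>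
  proof -
    have "\<kappa> \<xi> \<eta> \<le> (2 powr s * (wt s \<eta> + wt s (\<xi> - \<eta>))) * (wt (- s) \<eta> * wt (- s) (\<xi> - \<eta>))"
      unfolding \<kappa>_def using s_gt by (intro mult_right_mono wt_subadd) auto
    also have "\<dots> = 2 powr s * ((wt s \<eta> * wt (- s) \<eta>) * wt (- s) (\<xi> - \<eta>) + (wt s (\<xi> - \<eta>) * wt (- s) (\<xi> - \<eta>)) * wt (- s) \<eta>)"
      by (simp add: algebra_simps)
    also have "\<dots> = 2 powr s * (wt (- s) (\<xi> - \<eta>) + wt (- s) \<eta>)"
      by (simp add: wt_cancel)
    finally have "(\<kappa> \<xi> \<eta>)\<^sup>2 \<le> (2 powr s * (wt (- s) (\<xi> - \<eta>) + wt (- s) \<eta>))\<^sup>2"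
      by (rule power_mono) (rule \<kappa>0)
    also have "\<dots> = 2 powr (2 * s) * (wt (- s) (\<xi> - \<eta>) + wt (- s) \<eta>)\<^sup>2"
      by (simp add: power_mult_distrib power2_eq_square powr_add[symmetric])
    also have "(wt (- s) (\<xi> - \<eta>) + wt (- s) \<eta>)\<^sup>2 \<le> 2 * ((wt (- s) \<eta>)\<^sup>2 + (wt (- s) (\<xi> - \<eta>))\<^sup>2)"
      using zero_le_power2[of "wt (- s) \<eta> - wt (- s) (\<xi> - \<eta>)"] by (simp add: power2_eq_square algebra_simps)
    finally have "(\<kappa> \<xi> \<eta>)\<^sup>2 \<le> 2 powr (2 * s) * (2 * ((wt (- s) \<eta>)\<^sup>2 + (wt (- s) (\<xi> - \<eta>))\<^sup>2))"
      by simp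
    moreover have "(wt (- s) x)\<^sup>2 = wt (- 2 * s) x" for x unfolding wt_sq by (simp add: wt_def)
    ultimately show ?thesis by (simp only: mult.assoc mult.left_commute)
  qed
  have \<kappa>int: "(\<integral>\<^sup>+\<eta>. (ennreal (\<kappa> \<xi> \<eta>))\<^sup>2 \<partial>lborel) \<le> ennreal Kc" for \<xi>
  proof -
    have "(\<integral>\<^sup>+\<eta>. (ennreal (\<kappa> \<xi> \<eta>))\<^sup>2 \<partial>lborel)
        \<le> (\<integral>\<^sup>+\<eta>. ennreal (2 * 2 powr (2 * s)) * (ennreal (wt (- 2 * s) \<eta>) + ennreal (wt (- 2 * s) (\<xi> - \<eta>))) \<partial>lborel)"
    proof (rule nn_integral_mono)
      fix \<eta>
      have "(ennreal (\<kappa> \<xi> \<eta>))\<^sup>2 = ennreal ((\<kappa> \<xi> \<eta>)\<^sup>2)" by (simp add: ennreal_square \<kappa>0)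
      also have "\<dots> \<le> ennreal (2 * 2 powr (2 * s) * (wt (- 2 * s) \<eta> + wt (- 2 * s) (\<xi> - \<eta>)))"
        by (rule ennreal_leI[OF \<kappa>2])
      finally show "(ennreal (\<kappa> \<xi> \<eta>))\<^sup>2 \<le> ennreal (2 * 2 powr (2 * s)) * (ennreal (wt (- 2 * s) \<eta>) + ennreal (wt (- 2 * s) (\<xi> - \<eta>)))"
        by (subst (asm) ennreal_mult) (auto simp: ennreal_plus)
    qed
    also have "\<dots> = ennreal (2 * 2 powr (2 * s)) * (ennreal Q + ennreal Q)"
    proof -
      have "(\<integral>\<^sup>+\<eta>. ennreal (wt (- 2 * s) (\<xi> - \<eta>)) \<partial>lborel) = ennreal Q"
        unfolding Q(1)[symmetric] by (rule nn_integral_reflect) measurable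
      then have "(\<integral>\<^sup>+\<eta>. ennreal (wt (- 2 * s) \<eta>) + ennreal (wt (- 2 * s) (\<xi> - \<eta>)) \<partial>lborel) = ennreal Q + ennreal Q"
        using Q(1) by (subst nn_integral_add) auto
      then show ?thesis by (subst nn_integral_cmult) auto
    qed
    also have "\<dots> = ennreal Kc"
      unfolding Kc_def using Q(2) by (simp add: ennreal_plus[symmetric] ennreal_mult[symmetric] del: ennreal_plus)
    finally show ?thesis .
  qed
  have "(\<integral>\<^sup>+\<xi>. (ennreal (wt s \<xi>) * (\<integral>\<^sup>+\<eta>. (ennreal (wt (- s) \<eta>) * p \<eta>) * (ennreal (wt (- s) (\<xi> - \<eta>)) * q (\<xi> - \<eta>)) \<partial>lborel))\<^sup>2 \<partial>lborel)
     \<le> (\<integral>\<^sup>+\<xi>. ennreal Kc * (\<integral>\<^sup>+\<eta>. (p \<eta>)\<^sup>2 * (q (\<xi> - \<eta>))\<^sup>2 \<partial>lborel) \<partial>lborel)"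
  proof (rule nn_integral_mono)
    fix \<xi>
    have "ennreal (wt s \<xi>) * (\<integral>\<^sup>+\<eta>. (ennreal (wt (- s) \<eta>) * p \<eta>) * (ennreal (wt (- s) (\<xi> - \<eta>)) * q (\<xi> - \<eta>)) \<partial>lborel)
        = (\<integral>\<^sup>+\<eta>. ennreal (\<kappa> \<xi> \<eta>) * (p \<eta> * q (\<xi> - \<eta>)) \<partial>lborel)"
      by (subst nn_integral_cmult[symmetric]) (simp_all add: \<kappa>_def ennreal_mult mult_ac)
    then have "(ennreal (wt s \<xi>) * (\<integral>\<^sup>+\<eta>. (ennreal (wt (- s) \<eta>) * p \<eta>) * (ennreal (wt (- s) (\<xi> - \<eta>)) * q (\<xi> - \<eta>)) \<partial>lborel))\<^sup>2
        \<le> (\<integral>\<^sup>+\<eta>. (ennreal (\<kappa> \<xi> \<eta>))\<^sup>2 \<partial>lborel) * (\<integral>\<^sup>+\<eta>. (p \<eta> * q (\<xi> - \<eta>))\<^sup>2 \<partial>lborel)"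
      by (simp add: Cauchy_Schwarz_nn_integral)
    also have "\<dots> \<le> ennreal Kc * (\<integral>\<^sup>+\<eta>. (p \<eta> * q (\<xi> - \<eta>))\<^sup>2 \<partial>lborel)"
      by (rule mult_right_mono[OF \<kappa>int]) simp
    finally show "(ennreal (wt s \<xi>) * (\<integral>\<^sup>+\<eta>. (ennreal (wt (- s) \<eta>) * p \<eta>) * (ennreal (wt (- s) (\<xi> - \<eta>)) * q (\<xi> - \<eta>)) \<partial>lborel))\<^sup>2
        \<le> ennreal Kc * (\<integral>\<^sup>+\<eta>. (p \<eta>)\<^sup>2 * (q (\<xi> - \<eta>))\<^sup>2 \<partial>lborel)"
      by (simp add: power_mult_distrib)
  qed
  also have "\<dots> = ennreal Kc * (\<integral>\<^sup>+\<xi>. (\<integral>\<^sup>+\<eta>. (p \<eta>)\<^sup>2 * (q (\<xi> - \<eta>))\<^sup>2 \<partial>lborel) \<partial>lborel)"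
    by (rule nn_integral_cmult) measurable
  also have "(\<integral>\<^sup>+\<xi>. (\<integral>\<^sup>+\<eta>. (p \<eta>)\<^sup>2 * (q (\<xi> - \<eta>))\<^sup>2 \<partial>lborel) \<partial>lborel)
      = (\<integral>\<^sup>+\<eta>. (\<integral>\<^sup>+\<xi>. (p \<eta>)\<^sup>2 * (q (\<xi> - \<eta>))\<^sup>2 \<partial>lborel) \<partial>lborel)"
    by (rule lborel_pair.Fubini') measurable
  also have "\<dots> = (\<integral>\<^sup>+\<eta>. (p \<eta>)\<^sup>2 * (\<integral>\<^sup>+\<xi>. (q \<xi>)\<^sup>2 \<partial>lborel) \<partial>lborel)"
    by (simp add: nn_integral_cmult nn_integral_shift[of "\<lambda>x. (q x)\<^sup>2"])
  also have "\<dots> = (\<integral>\<^sup>+\<eta>. (p \<eta>)\<^sup>2 \<partial>lborel) * (\<integral>\<^sup>+\<xi>. (q \<xi>)\<^sup>2 \<partial>lborel)"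
    by (rule nn_integral_multc) measurable
  finally show ?thesis .
qed

text \<open>An element \<open>V\<close> of \<open>l2\<close> stands for the function \<open>v = ev V\<close> in \<open>H\<^sup>s\<close> whose Fourier
  transform is \<open>hat V\<close>. In these coordinates the norm of \<open>H\<^sup>s\<close> is the \<open>l2\<close> norm, \<open>prd\<close> is the pointwise product,
  \<open>dag\<close> is complex conjugation, \<open>U a\<close> is \<open>exp (\<i> a \<Delta>)\<close>, and \<open>reg r B V\<close> is a bound \<open>B\<close> for the norm of
  \<open>H\<^bsup>s+r\<^esup>\<close>. Since \<open>hat V\<close> is integrable, \<open>ev V\<close> is defined at every point.\<close>

definition hat :: "l2 \<Rightarrow> real \<Rightarrow> complex" where
  "hat V \<xi> = complex_of_real (wt (- s) \<xi>) * fn V \<xi>"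

lemma hat_measurable[measurable]: "hat V \<in> borel_measurable borel"
  unfolding hat_def by measurable

lemma bdd_wt_neg: "0 \<le> r \<Longrightarrow> bdd_mult 1 (\<lambda>\<xi>. complex_of_real (wt (- r) \<xi>))"
  unfolding bdd_mult_def by (auto simp: wt_neg_le1)

lemma hat_L2: "hat V \<in> L2"
  unfolding hat_def using s_gt by (intro bdd_mult_L2[OF bdd_wt_neg]) auto

lemma wt_neg_L2: "(\<lambda>\<xi>. complex_of_real (wt (- s) \<xi>)) \<in> L2"
proof (rule L2I)
  have "(\<integral>\<^sup>+\<xi>. ennreal ((cmod (complex_of_real (wt (- s) \<xi>)))\<^sup>2) \<partial>lborel) = (\<integral>\<^sup>+\<xi>. ennreal (wt (- 2 * s) \<xi>) \<partial>lborel)"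
    by (simp add: wt_sq) (simp add: wt_def)
  then show "(\<integral>\<^sup>+\<xi>. ennreal ((cmod (complex_of_real (wt (- s) \<xi>)))\<^sup>2) \<partial>lborel) < \<infinity>"
    using wt_finite by simp
qed measurable

lemma hat_L1: "integrable lborel (hat V)"
proof -
  have "integrable lborel (\<lambda>\<xi>. fn V \<xi> * cnj (complex_of_real (wt (- s) \<xi>)))"
    by (rule L2_prod_integrable[OF fn_L2 wt_neg_L2])
  then show ?thesis unfolding hat_def by (simp add: mult.commute)
qed

lemma hat_eq_iff: "(AE \<xi> in lborel. hat V \<xi> = hat W \<xi>) \<longleftrightarrow> V = W"
proof -
  have "(AE \<xi> in lborel. hat V \<xi> = hat W \<xi>) \<longleftrightarrow> (AE \<xi> in lborel. fn V \<xi> = fn W \<xi>)"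
    unfolding hat_def by simp
  then show ?thesis using cls_eq_iff[of "fn V" "fn W"] by simp
qed

definition ev :: "l2 \<Rightarrow> real \<Rightarrow> complex" where
  "ev V x = FT (hat V) (- x)"

lemma ev_pair: "fourier_pair (ev V) (hat V)"
  unfolding ev_def[abs_def] by (rule fourier_pair_inversion[OF hat_L1 hat_L2])

lemma ev_measurable[measurable]: "ev V \<in> borel_measurable borel"
  by (rule L2_measurable[OF fourier_pair_L2(1)[OF ev_pair]])

lemma ev_inj: "AE x in lborel. ev V x = ev W x \<Longrightarrow> V = W"
proof -
  assume "AE x in lborel. ev V x = ev W x"
  then have "fourier_pair (ev W) (hat V)"
    using fourier_pair_cong[of "ev V" "ev W" "hat V"] ev_pair[of V] fourier_pair_L2(1)[OF ev_pair]
    by simp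
  then have "AE \<xi> in lborel. hat V \<xi> = hat W \<xi>" by (rule fourier_pair_unique[OF _ ev_pair])
  then show "V = W" by (simp add: hat_eq_iff)
qed

text \<open>Algebraic identities in \<open>l2\<close> are proved through evaluation at a point,
  where \<open>prd\<close>, \<open>dag\<close> and complex scalars become operations on complex
  numbers.\<close>

lemma ev_eqI: "(\<And>x. ev V x = ev W x) \<Longrightarrow> V = W"
  by (rule ev_inj) simp

lemma ev_hat_cong: "AE \<xi> in lborel. hat V \<xi> = g \<xi> \<Longrightarrow> g \<in> borel_measurable borel \<Longrightarrow> ev V x = FT g (- x)"
  unfolding ev_def using FT_cong_AE[of "hat V" g] by simp

lemma ev_add: "ev (V + W) x = ev V x + ev W x"
proof -
  have "AE \<xi> in lborel. hat (V + W) \<xi> = hat V \<xi> + hat W \<xi>"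
    using fn_add[of V W] by eventually_elim (simp add: hat_def algebra_simps)
  from ev_hat_cong[OF this, of x] show ?thesis by (simp add: FT_add[OF hat_L1 hat_L1] ev_def)
qed

lemma ev_diff: "ev (V - W) x = ev V x - ev W x"
  using ev_add[of "V - W" W x] by simp

lemma ev_mop_const: "ev (mop (\<lambda>_. c) V) x = c * ev V x"
proof -
  have "AE \<xi> in lborel. hat (mop (\<lambda>_. c) V) \<xi> = c * hat V \<xi>"
    using fn_mop[of "cmod c" "\<lambda>_. c" V] by (auto simp: bdd_mult_def hat_def)
  from ev_hat_cong[OF this, of x] show ?thesis by (simp add: FT_cmult ev_def)
qed

lemma mop_of_real: "mop (\<lambda>_. complex_of_real r) V = r *\<^sub>R V"
  using mop_mult_scaleR[of 1 "\<lambda>_. 1" r V] by (simp add: bdd_mult_def mop_one)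

lemma ev_scaleR: "ev (r *\<^sub>R V) x = complex_of_real r * ev V x"
  using ev_mop_const[of "complex_of_real r" V x] by (simp add: mop_of_real)

definition cE :: real where "cE = 1 / sqrt (2 * pi) * norm (cls (\<lambda>\<xi>. complex_of_real (wt (- s) \<xi>)))"

text \<open>Sobolev embedding: \<open>hat V\<close> is the product of a square integrable weight and
  \<open>fn V\<close>, so Cauchy-Schwarz bounds the integral of its modulus.\<close>

lemma cmod_ev_le: "cmod (ev V x) \<le> cE * norm V"
proof -
  have fa: "(\<lambda>\<xi>. complex_of_real (cmod (fn V \<xi>))) \<in> L2"
    by (rule L2_dominated[of "fn V" _ 1]) auto
  have nfa: "norm (cls (\<lambda>\<xi>. complex_of_real (cmod (fn V \<xi>)))) = norm V"
  proof -
    have "(norm (cls (\<lambda>\<xi>. complex_of_real (cmod (fn V \<xi>)))))\<^sup>2 = (norm V)\<^sup>2"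
      using norm_cls_sq[OF fa] norm_sq_fn[of V] by simp
    then show ?thesis by simp
  qed
  have "(\<integral>\<xi>. cmod (hat V \<xi>) \<partial>lborel) = inner (cls (\<lambda>\<xi>. complex_of_real (wt (- s) \<xi>))) (cls (\<lambda>\<xi>. complex_of_real (cmod (fn V \<xi>))))"
    unfolding inner_cls[OF wt_neg_L2 fa] by (simp add: hat_def norm_mult)
  also have "\<dots> \<le> norm (cls (\<lambda>\<xi>. complex_of_real (wt (- s) \<xi>))) * norm V"
    using Cauchy_Schwarz_ineq2 nfa by (metis abs_le_D1)
  finally have *: "(\<integral>\<xi>. cmod (hat V \<xi>) \<partial>lborel) \<le> norm (cls (\<lambda>\<xi>. complex_of_real (wt (- s) \<xi>))) * norm V" .
  have "cmod (ev V x) \<le> 1 / sqrt (2 * pi) * (\<integral>\<xi>. cmod (hat V \<xi>) \<partial>lborel)"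
    unfolding ev_def by (rule cmod_FT_le[OF hat_L1])
  also have "\<dots> \<le> 1 / sqrt (2 * pi) * (norm (cls (\<lambda>\<xi>. complex_of_real (wt (- s) \<xi>))) * norm V)"
    using * by (rule mult_left_mono) simp
  finally show ?thesis unfolding cE_def by (simp only: mult.assoc)
qed

lemma bounded_linear_ev: "bounded_linear (\<lambda>V. ev V x)"
  using cmod_ev_le by (intro bounded_linear_intro[where K=cE])
    (auto simp: ev_add ev_scaleR scaleR_conv_of_real mult.commute)

section \<open>The pointwise product as a convolution of transforms\<close>

definition cv :: "l2 \<Rightarrow> l2 \<Rightarrow> real \<Rightarrow> complex" where
  "cv V W \<xi> = ccst * (\<integral>\<eta>. hat V \<eta> * hat W (\<xi> - \<eta>) \<partial>lborel)"

lemma cv_measurable[measurable]: "cv V W \<in> borel_measurable borel"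
  unfolding cv_def by measurable

text \<open>Defined on the Fourier side, where \<open>kernel_bound\<close> estimates it;
  \<open>ev_prd\<close> recognises it as the pointwise product. The factor \<open>ccst\<close> in
  \<open>cv\<close> belongs to the unitary normalisation.\<close>

definition prd :: "l2 \<Rightarrow> l2 \<Rightarrow> l2" where
  "prd V W = cls (\<lambda>\<xi>. complex_of_real (wt s \<xi>) * cv V W \<xi>)"

text \<open>The factor 2^r is the constant of \<open>wt_subadd\<close>; the 2 under the root comes
  from squaring a sum of two terms.\<close>

definition Kp :: "real \<Rightarrow> real" where "Kp r = sqrt (2 * Kc) * 2 powr r"

lemma Kp_nonneg: "0 \<le> Kp r" unfolding Kp_def using Kc_nonneg by simp

text \<open>Tame product estimate; the norms of V' and W' are the norms of order s + r.
  Subadditivity of the weight charges the extra r orders to one factor at a time, so the bound is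
  linear in the higher norms. This linearity later yields a growth factor of the regularity that
  does not depend on the higher norm itself. The case r = 0 is the algebra property.\<close>

lemma cv_tame:
  assumes r: "0 \<le> r"
    and V: "V = mop (\<lambda>\<xi>. complex_of_real (wt (- r) \<xi>)) V'" and W: "W = mop (\<lambda>\<xi>. complex_of_real (wt (- r) \<xi>)) W'"
  defines "Z \<equiv> \<lambda>\<xi>. complex_of_real (wt (s + r) \<xi>) * cv V W \<xi>"
  shows "Z \<in> L2" "norm (cls Z) \<le> Kp r * (norm V' * norm W + norm V * norm W')"
proof -
  have [measurable]: "Z \<in> borel_measurable borel" unfolding Z_def by measurable
  define k where "k p q \<xi> = ennreal (wt s \<xi>) * (\<integral>\<^sup>+\<eta>. (ennreal (wt (- s) \<eta>) * p \<eta>) * (ennreal (wt (- s) (\<xi> - \<eta>)) * q (\<xi> - \<eta>)) \<partial>lborel)"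
    for p q :: "real \<Rightarrow> ennreal" and \<xi>
  define n where "n U \<xi> = ennreal (cmod (fn U \<xi>))" for U \<xi>
  have n2: "(\<integral>\<^sup>+\<xi>. (n U \<xi>)\<^sup>2 \<partial>lborel) = ennreal ((norm U)\<^sup>2)" for U
    unfolding n_def using nn_norm_fn[of U] by (simp add: ennreal_square)
  have [measurable]: "n U \<in> borel_measurable borel" for U unfolding n_def by measurable
  have k_meas[measurable]: "k (n U) (n U') \<in> borel_measurable borel" for U U'
    unfolding k_def by measurable
  have k_bound: "(\<integral>\<^sup>+\<xi>. (k (n U) (n U') \<xi>)\<^sup>2 \<partial>lborel) \<le> ennreal (Kc * ((norm U)\<^sup>2 * (norm U')\<^sup>2))" for U U'
    using kernel_bound[of "n U" "n U'"] Kc_nonneg unfolding k_def n2 by (simp add: ennreal_mult)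
  have aeV: "AE \<eta> in lborel. n V' \<eta> = ennreal (wt r \<eta>) * n V \<eta>"
    using fn_mop[OF bdd_wt_neg[OF r], of V'] unfolding V
  proof eventually_elim
    case (elim \<eta>)
    have "cmod (fn V' \<eta>) = wt r \<eta> * (wt (- r) \<eta> * cmod (fn V' \<eta>))"
      by (simp add: wt_cancel mult.assoc[symmetric])
    then show ?case unfolding n_def elim by (simp add: norm_mult ennreal_mult[symmetric])
  qed
  have aeW0: "AE \<eta> in lborel. n W' \<eta> = ennreal (wt r \<eta>) * n W \<eta>"
    using fn_mop[OF bdd_wt_neg[OF r], of W'] unfolding W
  proof eventually_elim
    case (elim \<eta>)
    have "cmod (fn W' \<eta>) = wt r \<eta> * (wt (- r) \<eta> * cmod (fn W' \<eta>))"
      by (simp add: wt_cancel mult.assoc[symmetric])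
    then show ?case unfolding n_def elim by (simp add: norm_mult ennreal_mult[symmetric])
  qed
  \<comment> \<open>Null sets are invariant under reflection and translation, so the relation
    between W' and W may be used at the convolution argument.\<close>
  have aeW: "AE \<eta> in lborel. n W' (\<xi> - \<eta>) = ennreal (wt r (\<xi> - \<eta>)) * n W (\<xi> - \<eta>)" for \<xi>
  proof -
    have "AE y in lborel. n W' y = ennreal (wt r y) * n W y" by (rule aeW0)
    then have "AE y in distr lborel borel uminus. n W' y = ennreal (wt r y) * n W y"
      by (subst lborel_distr_uminus)
    then have "AE y in lborel. n W' (- y) = ennreal (wt r (- y)) * n W (- y)"
      by (rule AE_distrD[rotated]) measurable
    from AE_shift[OF this, of \<xi>] show ?thesis by simp
  qed
  have Zle: "ennreal (cmod (Z \<xi>)) \<le> ennreal (2 powr r) * (k (n V') (n W) \<xi> + k (n V) (n W') \<xi>)" for \<xi>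
  proof -
    define h where "h \<eta> = (ennreal (wt (- s) \<eta>) * n V \<eta>) * (ennreal (wt (- s) (\<xi> - \<eta>)) * n W (\<xi> - \<eta>))" for \<eta>
    have [measurable]: "h \<in> borel_measurable borel" unfolding h_def by measurable
    have "ennreal (cmod (\<integral>\<eta>. hat V \<eta> * hat W (\<xi> - \<eta>) \<partial>lborel)) \<le> (\<integral>\<^sup>+\<eta>. ennreal (cmod (hat V \<eta> * hat W (\<xi> - \<eta>))) \<partial>lborel)"
      by (rule norm_integral_le_nn)
    also have "\<dots> = (\<integral>\<^sup>+\<eta>. h \<eta> \<partial>lborel)"
      unfolding h_def n_def hat_def by (simp add: norm_mult ennreal_mult mult_ac)
    finally have 1: "ennreal (cmod (\<integral>\<eta>. hat V \<eta> * hat W (\<xi> - \<eta>) \<partial>lborel)) \<le> (\<integral>\<^sup>+\<eta>. h \<eta> \<partial>lborel)" .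
    have "ennreal (wt r \<xi>) * (\<integral>\<^sup>+\<eta>. h \<eta> \<partial>lborel) = (\<integral>\<^sup>+\<eta>. ennreal (wt r \<xi>) * h \<eta> \<partial>lborel)"
      by (rule nn_integral_cmult[symmetric]) measurable
    also have "\<dots> \<le> (\<integral>\<^sup>+\<eta>. ennreal (2 powr r) * (((ennreal (wt (- s) \<eta>) * n V' \<eta>) * (ennreal (wt (- s) (\<xi> - \<eta>)) * n W (\<xi> - \<eta>)))
        + ((ennreal (wt (- s) \<eta>) * n V \<eta>) * (ennreal (wt (- s) (\<xi> - \<eta>)) * n W' (\<xi> - \<eta>)))) \<partial>lborel)"
    proof (rule nn_integral_mono_AE)
      show "AE \<eta> in lborel. ennreal (wt r \<xi>) * h \<eta> \<le> ennreal (2 powr r) * (((ennreal (wt (- s) \<eta>) * n V' \<eta>) * (ennreal (wt (- s) (\<xi> - \<eta>)) * n W (\<xi> - \<eta>)))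
        + ((ennreal (wt (- s) \<eta>) * n V \<eta>) * (ennreal (wt (- s) (\<xi> - \<eta>)) * n W' (\<xi> - \<eta>))))"
        using aeV aeW[of \<xi>]
      proof eventually_elim
        case (elim \<eta>)
        have "ennreal (wt r \<xi>) \<le> ennreal (2 powr r * (wt r \<eta> + wt r (\<xi> - \<eta>)))"
          by (rule ennreal_leI[OF wt_subadd[OF r]])
        also have "\<dots> = ennreal (2 powr r) * (ennreal (wt r \<eta>) + ennreal (wt r (\<xi> - \<eta>)))"
          by (simp add: ennreal_mult)
        finally have "ennreal (wt r \<xi>) * h \<eta> \<le> ennreal (2 powr r) * (ennreal (wt r \<eta>) + ennreal (wt r (\<xi> - \<eta>))) * h \<eta>"
          by (rule mult_right_mono) simp
        then show ?case unfolding elim h_def by (simp add: distrib_left distrib_right mult_ac)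
      qed
    qed
    also have "\<dots> = ennreal (2 powr r) * ((\<integral>\<^sup>+\<eta>. (ennreal (wt (- s) \<eta>) * n V' \<eta>) * (ennreal (wt (- s) (\<xi> - \<eta>)) * n W (\<xi> - \<eta>)) \<partial>lborel)
        + (\<integral>\<^sup>+\<eta>. (ennreal (wt (- s) \<eta>) * n V \<eta>) * (ennreal (wt (- s) (\<xi> - \<eta>)) * n W' (\<xi> - \<eta>)) \<partial>lborel))"
      by (subst nn_integral_cmult, measurable, subst nn_integral_add) simp_all
    finally have 2: "ennreal (wt r \<xi>) * (\<integral>\<^sup>+\<eta>. h \<eta> \<partial>lborel)
        \<le> ennreal (2 powr r) * ((\<integral>\<^sup>+\<eta>. (ennreal (wt (- s) \<eta>) * n V' \<eta>) * (ennreal (wt (- s) (\<xi> - \<eta>)) * n W (\<xi> - \<eta>)) \<partial>lborel)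
        + (\<integral>\<^sup>+\<eta>. (ennreal (wt (- s) \<eta>) * n V \<eta>) * (ennreal (wt (- s) (\<xi> - \<eta>)) * n W' (\<xi> - \<eta>)) \<partial>lborel))" .
    \<comment> \<open>The normalising factor of the convolution is simply dropped.\<close>
    have pi: "1 / sqrt (2 * pi) \<le> 1"
      using pi_gt3 by (simp add: real_le_rsqrt)
    have "cmod (Z \<xi>) = wt (s + r) \<xi> * (1 / sqrt (2 * pi) * cmod (\<integral>\<eta>. hat V \<eta> * hat W (\<xi> - \<eta>) \<partial>lborel))"
      unfolding Z_def cv_def norm_mult cmod_ccst by simp
    also have "\<dots> \<le> wt (s + r) \<xi> * (1 * cmod (\<integral>\<eta>. hat V \<eta> * hat W (\<xi> - \<eta>) \<partial>lborel))"
      by (intro mult_left_mono mult_right_mono pi) auto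
    finally have "ennreal (cmod (Z \<xi>)) \<le> ennreal (wt s \<xi>) * (ennreal (wt r \<xi>) * ennreal (cmod (\<integral>\<eta>. hat V \<eta> * hat W (\<xi> - \<eta>) \<partial>lborel)))"
      by (simp add: wt_add mult.assoc flip: ennreal_mult)
    also have "\<dots> \<le> ennreal (wt s \<xi>) * (ennreal (wt r \<xi>) * (\<integral>\<^sup>+\<eta>. h \<eta> \<partial>lborel))"
      by (intro mult_left_mono 1) auto
    also have "\<dots> \<le> ennreal (wt s \<xi>) * (ennreal (2 powr r) * ((\<integral>\<^sup>+\<eta>. (ennreal (wt (- s) \<eta>) * n V' \<eta>) * (ennreal (wt (- s) (\<xi> - \<eta>)) * n W (\<xi> - \<eta>)) \<partial>lborel)
        + (\<integral>\<^sup>+\<eta>. (ennreal (wt (- s) \<eta>) * n V \<eta>) * (ennreal (wt (- s) (\<xi> - \<eta>)) * n W' (\<xi> - \<eta>)) \<partial>lborel)))"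
      by (intro mult_left_mono 2) auto
    finally show ?thesis
      unfolding k_def by (simp add: distrib_left mult_ac)
  qed
  define D where "D = norm V' * norm W + norm V * norm W'"
  have "(\<integral>\<^sup>+\<xi>. ennreal ((cmod (Z \<xi>))\<^sup>2) \<partial>lborel)
      \<le> (\<integral>\<^sup>+\<xi>. (ennreal (2 powr r))\<^sup>2 * (2 * ((k (n V') (n W) \<xi>)\<^sup>2 + (k (n V) (n W') \<xi>)\<^sup>2)) \<partial>lborel)"
  proof (rule nn_integral_mono)
    fix \<xi>
    have "ennreal ((cmod (Z \<xi>))\<^sup>2) = (ennreal (cmod (Z \<xi>)))\<^sup>2" by (simp add: ennreal_square)
    also have "\<dots> \<le> (ennreal (2 powr r) * (k (n V') (n W) \<xi> + k (n V) (n W') \<xi>))\<^sup>2"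
      by (intro power_mono Zle) simp
    also have "\<dots> \<le> (ennreal (2 powr r))\<^sup>2 * (2 * ((k (n V') (n W) \<xi>)\<^sup>2 + (k (n V) (n W') \<xi>)\<^sup>2))"
      unfolding power_mult_distrib by (intro mult_left_mono ennreal_sum_sq_le) simp
    finally show "ennreal ((cmod (Z \<xi>))\<^sup>2) \<le> (ennreal (2 powr r))\<^sup>2 * (2 * ((k (n V') (n W) \<xi>)\<^sup>2 + (k (n V) (n W') \<xi>)\<^sup>2))" .
  qed
  also have "\<dots> = (ennreal (2 powr r))\<^sup>2 * (2 * ((\<integral>\<^sup>+\<xi>. (k (n V') (n W) \<xi>)\<^sup>2 \<partial>lborel) + (\<integral>\<^sup>+\<xi>. (k (n V) (n W') \<xi>)\<^sup>2 \<partial>lborel)))"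
    by (subst nn_integral_cmult, measurable, subst nn_integral_cmult, measurable, subst nn_integral_add) simp_all
  also have "\<dots> \<le> (ennreal (2 powr r))\<^sup>2 * (2 * (ennreal (Kc * ((norm V')\<^sup>2 * (norm W)\<^sup>2)) + ennreal (Kc * ((norm V)\<^sup>2 * (norm W')\<^sup>2))))"
    by (intro mult_left_mono add_mono k_bound) auto
  also have "\<dots> = ennreal ((2 powr r)\<^sup>2 * (2 * (Kc * ((norm V')\<^sup>2 * (norm W)\<^sup>2) + Kc * ((norm V)\<^sup>2 * (norm W')\<^sup>2))))"
    using Kc_nonneg by (simp add: ennreal_mult ennreal_square)
  also have "\<dots> \<le> ennreal ((Kp r * D)\<^sup>2)"
  proof (rule ennreal_leI)
    have KpD: "(Kp r * D)\<^sup>2 = (2 powr r)\<^sup>2 * (2 * Kc * D\<^sup>2)"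
      unfolding Kp_def using Kc_nonneg by (simp add: power_mult_distrib)
    have "(norm V')\<^sup>2 * (norm W)\<^sup>2 + (norm V)\<^sup>2 * (norm W')\<^sup>2 \<le> D\<^sup>2"
      unfolding D_def by (simp add: power2_sum power_mult_distrib)
    then have "(2 powr r)\<^sup>2 * (2 * Kc * ((norm V')\<^sup>2 * (norm W)\<^sup>2 + (norm V)\<^sup>2 * (norm W')\<^sup>2)) \<le> (2 powr r)\<^sup>2 * (2 * Kc * D\<^sup>2)"
      using Kc_nonneg by (intro mult_left_mono) auto
    then show "(2 powr r)\<^sup>2 * (2 * (Kc * ((norm V')\<^sup>2 * (norm W)\<^sup>2) + Kc * ((norm V)\<^sup>2 * (norm W')\<^sup>2))) \<le> (Kp r * D)\<^sup>2"
      unfolding KpD by (simp only: distrib_left mult.assoc)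
  qed
  finally have bound: "(\<integral>\<^sup>+\<xi>. ennreal ((cmod (Z \<xi>))\<^sup>2) \<partial>lborel) \<le> ennreal ((Kp r * D)\<^sup>2)" .
  have nn: "0 \<le> Kp r * D" unfolding D_def using Kp_nonneg by simp
  show "Z \<in> L2" by (rule norm_cls_le(1)[OF _ nn bound]) measurable
  show "norm (cls Z) \<le> Kp r * (norm V' * norm W + norm V * norm W')"
    using norm_cls_le(2)[OF _ nn bound] unfolding D_def by simp
qed

lemma wt_cv_L2: "(\<lambda>\<xi>. complex_of_real (wt s \<xi>) * cv V W \<xi>) \<in> L2"
  using cv_tame(1)[of 0 V V W W] by (simp add: mop_one)

lemma norm_prd_le: "norm (prd V W) \<le> 2 * Kp 0 * norm V * norm W"
  using cv_tame(2)[of 0 V V W W] by (simp add: mop_one prd_def algebra_simps)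

lemma hat_prd: "AE \<xi> in lborel. hat (prd V W) \<xi> = cv V W \<xi>"
  using fn_cls[OF wt_cv_L2[of V W]] unfolding prd_def[symmetric]
proof eventually_elim
  case (elim \<xi>)
  have "complex_of_real (wt (- s) \<xi>) * (complex_of_real (wt s \<xi>) * cv V W \<xi>)
      = complex_of_real (wt (- s) \<xi> * wt s \<xi>) * cv V W \<xi>" by simp
  then show ?case unfolding hat_def elim by (simp only: wt_cancel of_real_1 mult_1)
qed

lemma ev_prd: "ev (prd V W) x = ev V x * ev W x"
proof -
  define k where "k \<eta> \<xi> = ek (- x * \<xi>) * (hat V \<eta> * hat W (\<xi> - \<eta>))" for \<eta> \<xi>
  have sh: "integrable lborel (\<lambda>\<xi>. k \<eta> \<xi>)" for \<eta>
    unfolding k_def by (intro integrable_kernel integrable_mult_right lborel_shift_integrable hat_L1)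
  have [measurable]: "(\<lambda>(\<eta>, \<xi>). k \<eta> \<xi>) \<in> borel_measurable (borel \<Otimes>\<^sub>M borel)"
    unfolding k_def by measurable
  have nk: "(\<integral>\<xi>. norm (k \<eta> \<xi>) \<partial>lborel) = cmod (hat V \<eta>) * (\<integral>\<xi>. cmod (hat W \<xi>) \<partial>lborel)" for \<eta>
    unfolding k_def norm_mult by (simp add: lborel_shift_integral[of "\<lambda>\<xi>. cmod (hat W \<xi>)"])
  have int: "integrable (lborel \<Otimes>\<^sub>M lborel) (\<lambda>(\<eta>, \<xi>). k \<eta> \<xi>)"
  proof (rule lborel_pair.Fubini_integrable)
    show "integrable lborel (\<lambda>\<eta>. \<integral>\<xi>. norm (case (\<eta>, \<xi>) of (\<eta>, \<xi>) \<Rightarrow> k \<eta> \<xi>) \<partial>lborel)"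
      using hat_L1 by (simp add: nk integrable_norm)
    show "AE \<eta> in lborel. integrable lborel (\<lambda>\<xi>. case (\<eta>, \<xi>) of (\<eta>, \<xi>) \<Rightarrow> k \<eta> \<xi>)"
      using sh by simp
  qed measurable
  have "ev (prd V W) x = FT (cv V W) (- x)" by (rule ev_hat_cong[OF hat_prd]) measurable
  also have "\<dots> = ccst * (ccst * (\<integral>\<xi>. (\<integral>\<eta>. k \<eta> \<xi> \<partial>lborel) \<partial>lborel))"
    unfolding FT_def cv_def k_def by (simp add: mult_ac flip: integral_mult_right_zero)
  also have "(\<integral>\<xi>. (\<integral>\<eta>. k \<eta> \<xi> \<partial>lborel) \<partial>lborel) = (\<integral>\<eta>. (\<integral>\<xi>. k \<eta> \<xi> \<partial>lborel) \<partial>lborel)"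
    by (rule lborel_pair.Fubini_integral[OF int])
  also have "(\<lambda>\<eta>. \<integral>\<xi>. k \<eta> \<xi> \<partial>lborel) = (\<lambda>\<eta>. (ek (- x * \<eta>) * hat V \<eta>) * (\<integral>\<xi>. ek (- x * \<xi>) * hat W \<xi> \<partial>lborel))"
  proof
    fix \<eta>
    have "(\<integral>\<xi>. k \<eta> \<xi> \<partial>lborel) = (\<integral>\<xi>. (ek (- x * \<eta>) * hat V \<eta>) * (ek (- x * (\<xi> - \<eta>)) * hat W (\<xi> - \<eta>)) \<partial>lborel)"
    proof (rule Bochner_Integration.integral_cong)
      fix \<xi>
      have "ek (- x * \<xi>) = ek (- x * \<eta>) * ek (- x * (\<xi> - \<eta>))"
        unfolding ek_add[symmetric] by (simp add: algebra_simps)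
      then show "k \<eta> \<xi> = (ek (- x * \<eta>) * hat V \<eta>) * (ek (- x * (\<xi> - \<eta>)) * hat W (\<xi> - \<eta>))"
        unfolding k_def by simp
    qed simp
    also have "\<dots> = (ek (- x * \<eta>) * hat V \<eta>) * (\<integral>\<xi>. ek (- x * (\<xi> - \<eta>)) * hat W (\<xi> - \<eta>) \<partial>lborel)"
      by (rule integral_mult_right_zero)
    also have "(\<integral>\<xi>. ek (- x * (\<xi> - \<eta>)) * hat W (\<xi> - \<eta>) \<partial>lborel) = (\<integral>\<xi>. ek (- x * \<xi>) * hat W \<xi> \<partial>lborel)"
      by (rule lborel_shift_integral)
    finally show "(\<integral>\<xi>. k \<eta> \<xi> \<partial>lborel) = (ek (- x * \<eta>) * hat V \<eta>) * (\<integral>\<xi>. ek (- x * \<xi>) * hat W \<xi> \<partial>lborel)" .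
  qed
  also have "(\<integral>\<eta>. (ek (- x * \<eta>) * hat V \<eta>) * (\<integral>\<xi>. ek (- x * \<xi>) * hat W \<xi> \<partial>lborel) \<partial>lborel)
      = (\<integral>\<eta>. ek (- x * \<eta>) * hat V \<eta> \<partial>lborel) * (\<integral>\<xi>. ek (- x * \<xi>) * hat W \<xi> \<partial>lborel)"
    by (rule integral_mult_left_zero)
  also have "ccst * (ccst * \<dots>) = ev V x * ev W x" unfolding ev_def FT_def by (simp only: mult_ac)
  finally show ?thesis .
qed

end

section \<open>Conjugation, the free group and the regularity classes\<close>

lemma AE_minus: 
  fixes P :: "real \<Rightarrow> bool"
  assumes "AE x in lborel. P x" shows "AE x in lborel. P (- x)"
proof -
  have "AE x in distr lborel borel uminus. P x" using assms by (subst lborel_distr_uminus)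
  then show ?thesis by (rule AE_distrD[rotated]) measurable
qed

lemma fourier_pair_cong2:
  assumes "fourier_pair f g" "AE x in lborel. g x = g' x" "g' \<in> borel_measurable borel"
  shows "fourier_pair f g'"
proof -
  note L2 = fourier_pair_L2[OF assms(1)]
  have g': "g' \<in> L2" by (rule L2_cong_AE[OF L2(2) assms(3,2)])
  have "cls g = cls g'" by (rule cls_cong[OF L2(2) g' assms(2)])
  then show ?thesis using fourier_pair_iff[OF L2(1) L2(2)] fourier_pair_iff[OF L2(1) g'] assms(1) by simp
qed

lemma mop_commute:
  assumes m: "bdd_mult C m" and k: "bdd_mult D k" shows "mop m (mop k V) = mop k (mop m V)"
  unfolding mop_mop[OF m k] mop_mop[OF k m] by (simp add: mult.commute)

text \<open>Conjugating a function reflects the frequency of its transform, hence the argument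
  \<open>- \<xi>\<close>; the weight is even and does not interfere.\<close>

definition dag :: "l2 \<Rightarrow> l2" where "dag V = cls (\<lambda>\<xi>. cnj (fn V (- \<xi>)))"

lemma refl_cnj_L2:
  assumes "f \<in> L2" shows "(\<lambda>\<xi>. cnj (f (- \<xi>))) \<in> L2"
proof (rule L2_dominated[OF refl_L2[OF assms], where c=1])
  have [measurable]: "f \<in> borel_measurable borel" by (rule L2_measurable[OF assms])
  show "(\<lambda>\<xi>. cnj (f (- \<xi>))) \<in> borel_measurable borel" by measurable
qed simp

lemma fn_dag: "AE \<xi> in lborel. fn (dag V) \<xi> = cnj (fn V (- \<xi>))"
  unfolding dag_def by (rule fn_cls[OF refl_cnj_L2[OF fn_L2]])

lemma norm_dag[simp]: "norm (dag V) = norm V"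
proof -
  have "(norm (dag V))\<^sup>2 = (norm V)\<^sup>2"
    using norm_cls_sq[OF refl_cnj_L2[OF fn_L2[of V]]] norm_sq_fn[of V]
      lborel_minus_integral[of "\<lambda>x. (cmod (fn V x))\<^sup>2"] by (simp add: dag_def)
  then show ?thesis by simp
qed

lemma dag_mop:
  assumes m: "bdd_mult C m" and k: "bdd_mult D k" and mk: "\<And>\<xi>. k \<xi> = cnj (m (- \<xi>))"
  shows "dag (mop m V) = mop k (dag V)"
proof -
  have "AE \<xi> in lborel. cnj (fn (mop m V) (- \<xi>)) = k \<xi> * fn (dag V) \<xi>"
    using AE_minus[OF fn_mop[OF m, of V]] fn_dag[of V]
    by eventually_elim (simp add: mk)
  then show ?thesis
    unfolding dag_def[of "mop m V"] mop_def[of k]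
    by (intro cls_cong) (auto intro: refl_cnj_L2 bdd_mult_L2[OF k])
qed

definition U :: "real \<Rightarrow> l2 \<Rightarrow> l2" where "U a = mop (\<lambda>\<xi>. ek (a * \<xi>\<^sup>2))"

lemma bdd_ek: "bdd_mult 1 (\<lambda>\<xi>. ek (a * \<xi>\<^sup>2))"
  unfolding bdd_mult_def by auto

lemma bdd_wt: "0 \<le> r \<Longrightarrow> bdd_mult 1 (\<lambda>\<xi>. complex_of_real (wt (- r) \<xi>))"
  unfolding bdd_mult_def by (auto simp: wt_neg_le1)

lemma U_U: "U a (U b V) = U (a + b) V"
  unfolding U_def mop_mop[OF bdd_ek bdd_ek] by (simp add: distrib_right ek_add)

lemma U_0[simp]: "U 0 V = V" unfolding U_def by (simp add: mop_one)

lemma U_cancel[simp]: "U a (U (- a) V) = V" "U (- a) (U a V) = V"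
  by (simp_all add: U_U)

lemma norm_U[simp]: "norm (U a V) = norm V"
  using norm_mop_le[OF bdd_ek, of a V] norm_mop_le[OF bdd_ek, of "-a" "U a V"]
  by (fold U_def) (simp add: U_U)

lemma U_diff: "U a (V - W) = U a V - U a W" unfolding U_def by (rule mop_diff[OF bdd_ek])
lemma U_add: "U a (V + W) = U a V + U a W" unfolding U_def by (rule mop_add[OF bdd_ek])
lemma U_scaleR: "U a (r *\<^sub>R V) = r *\<^sub>R U a V" unfolding U_def by (rule mop_scaleR[OF bdd_ek])

lemma U_mop_const: "U a (mop (\<lambda>_. c) V) = mop (\<lambda>_. c) (U a V)"
  unfolding U_def by (rule mop_commute[OF bdd_ek, of "cmod c"]) (simp add: bdd_mult_def)

lemma tendsto_U: "a \<longlonglongrightarrow> a0 \<Longrightarrow> V \<longlonglongrightarrow> V0 \<Longrightarrow> (\<lambda>n. U (a n) (V n)) \<longlonglongrightarrow> U a0 V0"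
proof -
  assume a: "a \<longlonglongrightarrow> a0" and V: "V \<longlonglongrightarrow> V0"
  have c: "isCont ek r" for r unfolding ek_def by (intro continuous_intros)
  have "(\<lambda>n. ek (a n * \<xi>\<^sup>2)) \<longlonglongrightarrow> ek (a0 * \<xi>\<^sup>2)" for \<xi>
    by (rule isCont_tendsto_compose[OF c]) (intro tendsto_intros a)
  then show ?thesis unfolding U_def by (intro tendsto_mop[OF bdd_ek bdd_ek _ V])
qed

text \<open>The group parameter of the scheme is random, so measurability of the iterates as
  functionals of the path rests on joint continuity.\<close>

lemma continuous_U[continuous_intros]:
  fixes f :: "'a::first_countable_topology \<Rightarrow> real"
  assumes f: "continuous_on S f" and g: "continuous_on S g"
  shows "continuous_on S (\<lambda>x. U (f x) (g x))"
proof -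
  have "continuous_on UNIV (\<lambda>(a, V). U a V)"
    unfolding continuous_on_sequentially
    by (auto intro!: tendsto_U simp: o_def split_def dest: tendsto_fst tendsto_snd)
  from continuous_on_compose2[OF this continuous_on_Pair[OF f g]] show ?thesis by auto
qed

definition J :: "real \<Rightarrow> l2 \<Rightarrow> l2" where "J r = mop (\<lambda>\<xi>. complex_of_real (wt (- r) \<xi>))"

text \<open>Regularity is membership in the image of a ball under \<open>J r\<close>, that is (1 -
  \<Delta>)^(-r/2). No unbounded operator has to be formed, and stability under bounded multipliers
  is immediate because they commute with \<open>J r\<close>.\<close>

definition reg :: "real \<Rightarrow> real \<Rightarrow> l2 \<Rightarrow> bool" where
  "reg r B V \<longleftrightarrow> (\<exists>V'. norm V' \<le> B \<and> V = J r V')"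

lemma norm_J: "0 \<le> r \<Longrightarrow> norm (J r V) \<le> norm V"
  using norm_mop_le[OF bdd_wt, of r V] by (simp add: J_def)

lemma bounded_linear_J: "0 \<le> r \<Longrightarrow> bounded_linear (J r)"
  unfolding J_def by (rule bounded_linear_mop[OF bdd_wt])

lemma wt_cancel_left:
  "complex_of_real (wt (- r) \<xi>) * (complex_of_real (wt (q + r) \<xi>) * z) = complex_of_real (wt q \<xi>) * z"
proof -
  have "wt (- r) \<xi> * wt (q + r) \<xi> = wt q \<xi>" using wt_add[of "- r" "q + r" \<xi>] by simp
  then show ?thesis by (simp only: mult.assoc[symmetric] of_real_mult[symmetric])
qed

lemma reg_norm: "0 \<le> r \<Longrightarrow> reg r B V \<Longrightarrow> norm V \<le> B"
  unfolding reg_def using norm_J order_trans by blast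

lemma reg_mono: "reg r B V \<Longrightarrow> B \<le> C \<Longrightarrow> reg r C V"
  unfolding reg_def by force

lemma regE:
  assumes "reg r B V" obtains V' where "norm V' \<le> B" "V = mop (\<lambda>\<xi>. complex_of_real (wt (- r) \<xi>)) V'"
  using assms unfolding reg_def J_def by blast

lemma regI: "norm V' \<le> B \<Longrightarrow> V = mop (\<lambda>\<xi>. complex_of_real (wt (- r) \<xi>)) V' \<Longrightarrow> reg r B V"
  unfolding reg_def J_def by blast

lemma reg_add:
  assumes r: "0 \<le> r" and "reg r B V" "reg r C W" shows "reg r (B + C) (V + W)"
proof -
  obtain V' where V: "norm V' \<le> B" "V = mop (\<lambda>\<xi>. complex_of_real (wt (- r) \<xi>)) V'" using assms(2) by (rule regE)
  obtain W' where W: "norm W' \<le> C" "W = mop (\<lambda>\<xi>. complex_of_real (wt (- r) \<xi>)) W'" using assms(3) by (rule regE)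
  show ?thesis
    by (rule regI[of "V' + W'"]) (simp_all add: V W mop_add[OF bdd_wt[OF r]] norm_triangle_mono)
qed

lemma reg_scaleR:
  assumes r: "0 \<le> r" and "reg r B V" shows "reg r (\<bar>c\<bar> * B) (c *\<^sub>R V)"
proof -
  obtain V' where V: "norm V' \<le> B" "V = mop (\<lambda>\<xi>. complex_of_real (wt (- r) \<xi>)) V'" using assms(2) by (rule regE)
  show ?thesis
    by (rule regI[of "c *\<^sub>R V'"]) (simp_all add: V mop_scaleR[OF bdd_wt[OF r]] mult_left_mono)
qed

lemma reg_mop:
  assumes r: "0 \<le> r" and m: "bdd_mult C m" and "reg r B V" shows "reg r (C * B) (mop m V)"
proof -
  obtain V' where V: "norm V' \<le> B" "V = mop (\<lambda>\<xi>. complex_of_real (wt (- r) \<xi>)) V'" using assms(3) by (rule regE)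
  have "norm (mop m V') \<le> C * B"
    using norm_mop_le[OF m, of V'] mult_left_mono[OF V(1) bdd_mult_nonneg[OF m]] by linarith
  then show ?thesis
    by (rule regI) (simp add: V(2) mop_commute[OF m bdd_wt[OF r]])
qed

lemma reg_U: "0 \<le> r \<Longrightarrow> reg r B V \<Longrightarrow> reg r B (U a V)"
  using reg_mop[OF _ bdd_ek, of r B V a] by (simp add: U_def)

lemma reg_dag:
  assumes r: "0 \<le> r" and "reg r B V" shows "reg r B (dag V)"
proof -
  obtain V' where V: "norm V' \<le> B" "V = mop (\<lambda>\<xi>. complex_of_real (wt (- r) \<xi>)) V'" using assms(2) by (rule regE)
  have "dag V = mop (\<lambda>\<xi>. complex_of_real (wt (- r) \<xi>)) (dag V')"
    unfolding V(2) by (rule dag_mop[OF bdd_wt[OF r] bdd_wt[OF r]]) simp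
  then show ?thesis by (rule regI[rotated]) (simp add: V)
qed

lemma reg_weaken: "0 \<le> q \<Longrightarrow> q \<le> r \<Longrightarrow> reg r B V \<Longrightarrow> reg q B V"
proof -
  assume q: "0 \<le> q" "q \<le> r" and "reg r B V"
  then obtain V' where V': "norm V' \<le> B" "V = J r V'" unfolding reg_def by auto
  have "V = J q (J (r - q) V')"
    unfolding V'(2) J_def
    by (subst mop_mop[OF bdd_wt bdd_wt]) (use q wt_add[of "-q" "-(r - q)"] in \<open>auto simp flip: of_real_mult\<close>)
  moreover have "norm (J (r - q) V') \<le> B" using norm_J[of "r - q" V'] q V'(1) by simp
  ultimately show ?thesis unfolding reg_def by blast
qed

context sobolev
begin

text \<open>Norm bounds a, b and regularity bounds A, B are kept apart, so that linearity in the
  higher norm survives iteration.\<close>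

lemma reg_prd:
  assumes r: "0 \<le> r" and "reg r A V" "norm V \<le> a" "reg r B W" "norm W \<le> b"
  shows "reg r (Kp r * (A * b + a * B)) (prd V W)"
proof -
  obtain V' W' where V': "norm V' \<le> A" "V = J r V'" and W': "norm W' \<le> B" "W = J r W'"
    using assms unfolding reg_def by auto
  note t = cv_tame[OF r V'(2)[unfolded J_def] W'(2)[unfolded J_def]]
  define Z where "Z = cls (\<lambda>\<xi>. complex_of_real (wt (s + r) \<xi>) * cv V W \<xi>)"
  have "norm Z \<le> Kp r * (norm V' * norm W + norm V * norm W')" using t(2) unfolding Z_def .
  also have "\<dots> \<le> Kp r * (A * b + a * B)"
    using assms V' W' Kp_nonneg[of r] norm_ge_zero[of V] norm_ge_zero[of V']
    by (intro mult_left_mono add_mono mult_mono) (auto intro: order_trans[OF norm_ge_zero])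
  finally have "norm Z \<le> Kp r * (A * b + a * B)" .
  moreover have "J r Z = prd V W"
    unfolding J_def Z_def mop_cls[OF bdd_wt[OF r] t(1)] prd_def
    by (simp only: wt_cancel_left)
  ultimately show ?thesis unfolding reg_def by metis
qed

lemma ev_dag: "ev (dag V) x = cnj (ev V x)"
proof -
  have "AE \<xi> in lborel. hat (dag V) \<xi> = cnj (hat V (- \<xi>))"
    using fn_dag[of V] by eventually_elim (simp add: hat_def)
  from ev_hat_cong[OF this, of x] show ?thesis unfolding ev_def FT_cnj by simp
qed

lemma dag_diff: "dag (V - W) = dag V - dag W"
  by (rule ev_eqI) (simp add: ev_dag ev_diff)

lemma dag_add: "dag (V + W) = dag V + dag W"
  by (rule ev_eqI) (simp add: ev_dag ev_add)

lemma dag_scaleR: "dag (r *\<^sub>R V) = r *\<^sub>R dag V"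
  by (rule ev_eqI) (simp add: ev_dag ev_scaleR)

text \<open>The laws hold pointwise in x and are pulled back by \<open>ev_eqI\<close>. As a bounded
  bilinear map the product inherits its continuity and its rules for differences.\<close>

lemma bounded_bilinear_prd: "bounded_bilinear prd"
proof (rule bounded_bilinear.intro)
  show "\<exists>K. \<forall>a b. norm (prd a b) \<le> norm a * norm b * K"
    using norm_prd_le by (intro exI[of _ "2 * Kp 0"]) (auto simp: mult_ac)
qed (auto intro!: ev_eqI simp: ev_prd ev_add ev_scaleR scaleR_conv_of_real algebra_simps)

sublocale prd: bounded_bilinear prd by (rule bounded_bilinear_prd)

lemma prd_mop_const: "prd (mop (\<lambda>_. c) V) W = mop (\<lambda>_. c) (prd V W)"
  by (rule ev_eqI) (simp add: ev_prd ev_mop_const)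

section \<open>Dictionary between functions in the Sobolev space and elements of
  \<open>l2\<close>\<close>

definition sob :: "(real \<Rightarrow> complex) \<Rightarrow> l2" where
  "sob v = cls (\<lambda>\<xi>. complex_of_real (wt s \<xi>) * fourier v \<xi>)"

lemma fourier_L2: "v \<in> L2 \<Longrightarrow> fourier v \<in> L2"
  by (rule fourier_pair_L2(2)[OF fourier_pair_fourier])

lemma wt_fourier_L2: "v \<in> Hs r \<Longrightarrow> (\<lambda>\<xi>. complex_of_real (wt r \<xi>) * fourier v \<xi>) \<in> L2"
  unfolding Hs_def L2_def[of] using L2_measurable[OF fourier_L2, of v]
  by (auto simp: norm_mult power_mult_distrib wt_sq L2_def)

lemma Hs_L2: "v \<in> Hs r \<Longrightarrow> v \<in> L2" unfolding Hs_def by simp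

lemma norm_wt_fourier: "v \<in> Hs r \<Longrightarrow> norm (cls (\<lambda>\<xi>. complex_of_real (wt r \<xi>) * fourier v \<xi>)) = Hs_norm r v"
proof -
  assume v: "v \<in> Hs r"
  have "(norm (cls (\<lambda>\<xi>. complex_of_real (wt r \<xi>) * fourier v \<xi>)))\<^sup>2 = (LBINT \<xi>. (1 + \<xi>\<^sup>2) powr r * (cmod (fourier v \<xi>))\<^sup>2)"
    unfolding norm_cls_sq[OF wt_fourier_L2[OF v]] by (simp add: norm_mult power_mult_distrib wt_sq)
  then show ?thesis unfolding Hs_norm_def by (metis abs_of_nonneg norm_ge_zero real_sqrt_abs)
qed

lemma Hs_norm_sob: "v \<in> Hs s \<Longrightarrow> Hs_norm s v = norm (sob v)"
  unfolding sob_def by (simp add: norm_wt_fourier)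

lemma hat_sob:
  assumes "v \<in> Hs s" shows "AE \<xi> in lborel. hat (sob v) \<xi> = fourier v \<xi>"
  using fn_cls[OF wt_fourier_L2[OF assms]]
proof eventually_elim
  case (elim \<xi>)
  have "complex_of_real (wt (- s) \<xi>) * (complex_of_real (wt s \<xi>) * fourier v \<xi>)
      = complex_of_real (wt (- s) \<xi> * wt s \<xi>) * fourier v \<xi>" by simp
  then show ?case unfolding hat_def sob_def elim by (simp only: wt_cancel of_real_1 mult_1)
qed

lemma ev_sob: "v \<in> Hs s \<Longrightarrow> AE x in lborel. ev (sob v) x = v x"
  by (rule fourier_pair_inj[OF ev_pair fourier_pair_fourier[OF Hs_L2] hat_sob])

text \<open>By uniqueness of the transform, a measurable function with the values of
  \<open>ev V\<close> needs no Fourier computation of its own. Nonlinear expressions and flows reach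
  \<open>l2\<close> in this way.\<close>

lemma ev_Hs:
  assumes [measurable]: "f \<in> borel_measurable borel" and ae: "AE x in lborel. ev V x = f x"
  shows "f \<in> Hs s" "sob f = V"
proof -
  have p: "fourier_pair f (hat V)"
    using fourier_pair_cong[OF ae assms(1) fourier_pair_L2(1)[OF ev_pair], of "hat V"] ev_pair[of V] by simp
  have fL2: "f \<in> L2" by (rule fourier_pair_L2(1)[OF p])
  have F: "AE \<xi> in lborel. fourier f \<xi> = hat V \<xi>"
    by (rule fourier_pair_unique[OF fourier_pair_fourier[OF fL2] p])
  have [measurable]: "fourier f \<in> borel_measurable borel" by (rule L2_measurable[OF fourier_L2[OF fL2]])
  have G: "AE \<xi> in lborel. fn V \<xi> = complex_of_real (wt s \<xi>) * fourier f \<xi>"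
    using F
  proof eventually_elim
    case (elim \<xi>)
    have "complex_of_real (wt s \<xi>) * (complex_of_real (wt (- s) \<xi>) * fn V \<xi>)
        = complex_of_real (wt s \<xi> * wt (- s) \<xi>) * fn V \<xi>" by simp
    then show ?case unfolding elim hat_def by (simp only: wt_cancel of_real_1 mult_1)
  qed
  have gL2: "(\<lambda>\<xi>. complex_of_real (wt s \<xi>) * fourier f \<xi>) \<in> L2"
    by (rule L2_cong_AE[OF fn_L2 _ G]) measurable
  show "f \<in> Hs s"
    using L2_integrable[OF gL2] fL2 by (simp add: Hs_def norm_mult power_mult_distrib wt_sq)
  show "sob f = V"
    unfolding sob_def using cls_cong[OF fn_L2 gL2 G] by simp
qed

lemma Hs_measurable: "v \<in> Hs r \<Longrightarrow> v \<in> borel_measurable borel"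
  by (rule L2_measurable[OF Hs_L2])

lemma ev_in_Hs: "ev V \<in> Hs s"
  by (rule ev_Hs(1)[of _ V]) simp_all

lemma sob_ev: "sob (ev V) = V"
  by (rule ev_Hs(2)) simp_all

lemma sob_diff:
  assumes "v \<in> Hs s" "w \<in> Hs s"
  shows "(\<lambda>x. v x - w x) \<in> Hs s" "sob (\<lambda>x. v x - w x) = sob v - sob w"
proof -
  have [measurable]: "v \<in> borel_measurable borel" "w \<in> borel_measurable borel"
    using assms Hs_measurable by auto
  have ae: "AE x in lborel. ev (sob v - sob w) x = v x - w x"
    using ev_sob[OF assms(1)] ev_sob[OF assms(2)] by eventually_elim (simp add: ev_diff)
  show "(\<lambda>x. v x - w x) \<in> Hs s" "sob (\<lambda>x. v x - w x) = sob v - sob w"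
    by (rule ev_Hs[OF _ ae]; measurable)+
qed

lemma Hs_norm_diff: "v \<in> Hs s \<Longrightarrow> w \<in> Hs s \<Longrightarrow> Hs_norm s (\<lambda>x. v x - w x) = norm (sob v - sob w)"
  using sob_diff by (simp add: Hs_norm_sob)

lemma free_flow_Hs:
  assumes v: "v \<in> Hs s"
  shows "free_flow a v \<in> Hs s" "sob (free_flow a v) = U a (sob v)"
proof -
  define g where "g \<xi> = exp (- (\<i> * complex_of_real (a * \<xi>\<^sup>2))) * fourier v \<xi>" for \<xi>
  have ff: "free_flow a v = inv_fourier g" unfolding free_flow_def g_def ..
  have [measurable]: "fourier v \<in> borel_measurable borel" by (rule L2_measurable[OF fourier_L2[OF Hs_L2[OF v]]])
  have [measurable]: "g \<in> borel_measurable borel" unfolding g_def by measurable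
  have "AE \<xi> in lborel. hat (U a (sob v)) \<xi> = g \<xi>"
    using fn_mop[OF bdd_ek, of a "sob v"] hat_sob[OF v]
    by eventually_elim (simp add: hat_def U_def g_def ek_def mult.left_commute flip: mult.assoc)
  from fourier_pair_cong2[OF ev_pair this] have p: "fourier_pair (ev (U a (sob v))) g" by simp
  \<comment> \<open>A preimage of g exists, namely \<open>ev (U a (sob v))\<close>, so the choice in
    \<open>inv_fourier\<close> returns a genuine one; \<open>fourier_pair_inj\<close> identifies the
    two.\<close>
  then have "fourier_pair (free_flow a v) g" unfolding ff inv_fourier_def by (rule someI[where P="\<lambda>f. fourier_pair f g"])
  note q = this
  have ae: "AE x in lborel. ev (U a (sob v)) x = free_flow a v x"
    by (rule fourier_pair_inj[OF p q]) simp
  have m: "free_flow a v \<in> borel_measurable borel" by (rule L2_measurable[OF fourier_pair_L2(1)[OF q]])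
  show "free_flow a v \<in> Hs s" "sob (free_flow a v) = U a (sob v)"
    by (rule ev_Hs[OF m ae])+
qed

text \<open>The transform weighted to order s + r is the preimage under \<open>J r\<close>, as
  \<open>J r\<close> removes exactly r orders of weight.\<close>

lemma Hs_reg:
  assumes r: "0 \<le> r" and v: "v \<in> Hs (s + r)"
  shows "v \<in> Hs s" "reg r (Hs_norm (s + r) v) (sob v)"
proof -
  define V where "V = cls (\<lambda>\<xi>. complex_of_real (wt (s + r) \<xi>) * fourier v \<xi>)"
  note L2 = wt_fourier_L2[OF v]
  have JV: "J r V = sob v"
    unfolding J_def V_def mop_cls[OF bdd_wt[OF r] L2] sob_def
    by (simp only: wt_cancel_left)
  have L2': "(\<lambda>\<xi>. complex_of_real (wt s \<xi>) * fourier v \<xi>) \<in> L2"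
  proof (rule L2_dominated[OF L2, where c=1])
    have [measurable]: "fourier v \<in> borel_measurable borel" by (rule L2_measurable[OF fourier_L2[OF Hs_L2[OF v]]])
    show "(\<lambda>\<xi>. complex_of_real (wt s \<xi>) * fourier v \<xi>) \<in> borel_measurable borel" by measurable
    show "AE \<xi> in lborel. cmod (complex_of_real (wt s \<xi>) * fourier v \<xi>) \<le> 1 * cmod (complex_of_real (wt (s + r) \<xi>) * fourier v \<xi>)"
    proof (rule AE_I2)
      fix \<xi>
      have "wt s \<xi> * 1 \<le> wt s \<xi> * wt r \<xi>" by (intro mult_left_mono wt_ge1 r) simp
      then show "cmod (complex_of_real (wt s \<xi>) * fourier v \<xi>) \<le> 1 * cmod (complex_of_real (wt (s + r) \<xi>) * fourier v \<xi>)"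
        using mult_right_mono[OF wt_ge1[OF r, of \<xi>], of "cmod (fourier v \<xi>)"] by (simp add: wt_add norm_mult)
    qed
  qed
  show "v \<in> Hs s"
    using L2_integrable[OF L2'] Hs_L2[OF v] by (simp add: Hs_def norm_mult power_mult_distrib wt_sq)
  show "reg r (Hs_norm (s + r) v) (sob v)"
    unfolding reg_def using JV norm_wt_fourier[OF v] by (intro exI[of _ V]) (simp add: V_def)
qed

end

section \<open>Second-order expansions along the free group\<close>

lemma ek_approx1: "cmod (ek t - 1) \<le> \<bar>t\<bar>"
  using iexp_approx1[of "-t" 0] by (simp add: ek_def)

lemma ek_approx2: "cmod (ek t - 1 + \<i> * complex_of_real t) \<le> t\<^sup>2"
proof -
  have "cmod (ek t - 1 + \<i> * complex_of_real t) \<le> t\<^sup>2 / 2"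
    using iexp_approx1[of "-t" 1] by (simp add: ek_def numeral_2_eq_2 algebra_simps)
  then show ?thesis using zero_le_power2[of t] by linarith
qed

lemma sq_wt_le: "\<xi>\<^sup>2 * wt (- 2) \<xi> \<le> 1" "\<xi>\<^sup>2 * wt (- 4) \<xi> \<le> 1" "(\<xi>\<^sup>2)\<^sup>2 * wt (- 4) \<xi> \<le> 1"
proof -
  have w2: "wt (- 2) \<xi> * (1 + \<xi>\<^sup>2) = 1" using wt_cancel(1)[of 2 \<xi>] by (simp add: wt_2)
  have w4: "wt (- 4) \<xi> = (wt (- 2) \<xi>)\<^sup>2" using wt_add[of "-2" "-2" \<xi>] by (simp add: power2_eq_square)
  show 1: "\<xi>\<^sup>2 * wt (- 2) \<xi> \<le> 1" 
  proof -
    have "wt (- 2) \<xi> + \<xi>\<^sup>2 * wt (- 2) \<xi> = 1" using w2 by (simp add: algebra_simps)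
    then show ?thesis using wt_pos[of "-2" \<xi>] by linarith
  qed
  have 2: "wt (- 2) \<xi> \<le> 1" by (rule wt_neg_le1) simp
  have "(\<xi>\<^sup>2 * wt (- 2) \<xi>) * wt (- 2) \<xi> \<le> 1 * 1" by (intro mult_mono 1 2) auto
  then show "\<xi>\<^sup>2 * wt (- 4) \<xi> \<le> 1" unfolding w4 by (simp add: power2_eq_square mult.assoc)
  have "(\<xi>\<^sup>2 * wt (- 2) \<xi>) * (\<xi>\<^sup>2 * wt (- 2) \<xi>) \<le> 1 * 1" by (intro mult_mono 1) auto
  then show "(\<xi>\<^sup>2)\<^sup>2 * wt (- 4) \<xi> \<le> 1" unfolding w4 by (simp add: power2_eq_square mult_ac)
qed

text \<open>The symbol \<open>ek (b * \<xi>\<^sup>2)\<close> deviates from 1 by at most |b| \<xi>^2,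
  and two orders of regularity absorb \<xi>^2.\<close>

lemma U_expand2:
  assumes "reg 2 B W" shows "norm (U b W - W) \<le> B * \<bar>b\<bar>"
proof -
  obtain V where V: "norm V \<le> B" "W = mop (\<lambda>\<xi>. complex_of_real (wt (- 2) \<xi>)) V"
    using assms unfolding reg_def J_def by auto
  have b0: "bdd_mult 1 (\<lambda>\<xi>. complex_of_real (wt (- 2) \<xi>))" by (rule bdd_wt) simp
  have bd: "bdd_mult \<bar>b\<bar> (\<lambda>\<xi>. ek (b * \<xi>\<^sup>2) * complex_of_real (wt (- 2) \<xi>) - complex_of_real (wt (- 2) \<xi>))"
    unfolding bdd_mult_def
  proof safe
    fix \<xi>
    have "cmod (ek (b * \<xi>\<^sup>2) * complex_of_real (wt (- 2) \<xi>) - complex_of_real (wt (- 2) \<xi>))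
      = cmod ((ek (b * \<xi>\<^sup>2) - 1) * complex_of_real (wt (- 2) \<xi>))" by (simp add: algebra_simps)
    also have "\<dots> \<le> \<bar>b * \<xi>\<^sup>2\<bar> * wt (- 2) \<xi>" unfolding norm_mult by (intro mult_mono ek_approx1) auto
    also have "\<dots> = \<bar>b\<bar> * (\<xi>\<^sup>2 * wt (- 2) \<xi>)" by (simp add: abs_mult)
    also have "\<dots> \<le> \<bar>b\<bar> * 1" by (intro mult_left_mono sq_wt_le) simp
    finally show "cmod (ek (b * \<xi>\<^sup>2) * complex_of_real (wt (- 2) \<xi>) - complex_of_real (wt (- 2) \<xi>)) \<le> \<bar>b\<bar>" by simp
  qed measurable
  have "U b W - W = mop (\<lambda>\<xi>. ek (b * \<xi>\<^sup>2) * complex_of_real (wt (- 2) \<xi>) - complex_of_real (wt (- 2) \<xi>)) V"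
    unfolding V(2) U_def mop_mop[OF bdd_ek b0]
    by (rule mop_mult_diff[OF bdd_mult_mult[OF bdd_ek b0] b0, symmetric])
  then have "norm (U b W - W) \<le> \<bar>b\<bar> * norm V" using norm_mop_le[OF bd] by simp
  also have "\<dots> \<le> \<bar>b\<bar> * B" by (intro mult_left_mono V) simp
  finally show ?thesis by (simp add: mult.commute)
qed

text \<open>The vector z is \<open>\<i> \<Delta> W\<close>, the derivative of the group at b = 0:
  two of the four orders pay for it and two remain. The Taylor remainder is quadratic in b \<xi>^2
  and uses all four.\<close>

lemma U_expand4:
  assumes "reg 4 B W"
  obtains z where "reg 2 B z" "\<And>b. norm (U b W - W) \<le> B * \<bar>b\<bar>" "\<And>b. norm (U b W - W - b *\<^sub>R z) \<le> B * b\<^sup>2"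
proof -
  obtain V where V: "norm V \<le> B" "W = mop (\<lambda>\<xi>. complex_of_real (wt (- 4) \<xi>)) V"
    using assms unfolding reg_def J_def by auto
  \<comment> \<open>The symbol of the generator, made bounded by two orders of smoothing; the other
    two stay outside in \<open>J 2\<close>.\<close>
  define m1 where "m1 \<xi> = - \<i> * complex_of_real (\<xi>\<^sup>2 * wt (- 2) \<xi>)" for \<xi>
  define z where "z = J 2 (mop m1 V)"
  have bm1: "bdd_mult 1 m1"
    unfolding bdd_mult_def m1_def
    using sq_wt_le(1) by (auto simp: norm_mult abs_mult norm_power)
  have b2: "bdd_mult 1 (\<lambda>\<xi>. complex_of_real (wt (- 2) \<xi>))" by (rule bdd_wt) simp
  have b4: "bdd_mult 1 (\<lambda>\<xi>. complex_of_real (wt (- 4) \<xi>))" by (rule bdd_wt) simp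
  have "norm (mop m1 V) \<le> B" using norm_mop_le[OF bm1, of V] V(1) by simp
  then have z: "reg 2 B z" unfolding reg_def z_def by auto
  have w4: "wt (- 4) \<xi> = wt (- 2) \<xi> * wt (- 2) \<xi>" for \<xi> using wt_add[of "-2" "-2" \<xi>] by simp
  have z_eq: "z = mop (\<lambda>\<xi>. - \<i> * complex_of_real (\<xi>\<^sup>2 * wt (- 4) \<xi>)) V"
    unfolding z_def J_def mop_mop[OF b2 bm1] m1_def w4 by (simp add: mult_ac)
  have bz: "bdd_mult 1 (\<lambda>\<xi>. - \<i> * complex_of_real (\<xi>\<^sup>2 * wt (- 4) \<xi>))"
    unfolding bdd_mult_def using sq_wt_le(2) by (auto simp: norm_mult abs_mult norm_power)
  have "norm (U b W - W - b *\<^sub>R z) \<le> B * b\<^sup>2" for b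
  proof -
    let ?d = "\<lambda>\<xi>. ek (b * \<xi>\<^sup>2) * complex_of_real (wt (- 4) \<xi>) - complex_of_real (wt (- 4) \<xi>)"
    let ?e = "\<lambda>\<xi>. complex_of_real b * (- \<i> * complex_of_real (\<xi>\<^sup>2 * wt (- 4) \<xi>))"
    have "bdd_mult (1 * 1) (\<lambda>\<xi>. ek (b * \<xi>\<^sup>2) * complex_of_real (wt (- 4) \<xi>))"
      by (rule bdd_mult_mult[OF bdd_ek b4])
    then have b11: "bdd_mult 1 (\<lambda>\<xi>. ek (b * \<xi>\<^sup>2) * complex_of_real (wt (- 4) \<xi>))" by simp
    have bd: "bdd_mult 2 ?d"
      unfolding bdd_mult_def
    proof safe
      fix \<xi>
      show "cmod (?d \<xi>) \<le> 2"
        using norm_triangle_ineq4[of "ek (b * \<xi>\<^sup>2) * complex_of_real (wt (- 4) \<xi>)" "complex_of_real (wt (- 4) \<xi>)"]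
          b11 b4 unfolding bdd_mult_def by (smt (verit, best))
    qed measurable
    have be: "bdd_mult \<bar>b\<bar> ?e"
      using bdd_mult_mult[of "\<bar>b\<bar>" "\<lambda>_. complex_of_real b", OF _ bz] by (simp add: bdd_mult_def)
    have bde: "bdd_mult (b\<^sup>2) (\<lambda>\<xi>. ?d \<xi> - ?e \<xi>)"
      unfolding bdd_mult_def
    proof safe
      fix \<xi>
      have "?d \<xi> - ?e \<xi> = (ek (b * \<xi>\<^sup>2) - 1 + \<i> * complex_of_real (b * \<xi>\<^sup>2)) * complex_of_real (wt (- 4) \<xi>)"
        by (simp add: algebra_simps)
      then have "cmod (?d \<xi> - ?e \<xi>) \<le> (b * \<xi>\<^sup>2)\<^sup>2 * wt (- 4) \<xi>"
        by (simp only: norm_mult) (intro mult_mono ek_approx2, auto)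
      also have "\<dots> = b\<^sup>2 * ((\<xi>\<^sup>2)\<^sup>2 * wt (- 4) \<xi>)" by (simp add: power_mult_distrib)
      also have "\<dots> \<le> b\<^sup>2 * 1" by (intro mult_left_mono sq_wt_le) simp
      finally show "cmod (?d \<xi> - ?e \<xi>) \<le> b\<^sup>2" by simp
    qed measurable
    have "mop ?d V = U b W - W"
      unfolding V(2) U_def mop_mop[OF bdd_ek b4] by (rule mop_mult_diff[OF b11 b4])
    moreover have "mop ?e V = b *\<^sub>R z" unfolding z_eq by (rule mop_mult_scaleR[OF bz])
    ultimately have "U b W - W - b *\<^sub>R z = mop (\<lambda>\<xi>. ?d \<xi> - ?e \<xi>) V"
      using mop_mult_diff[OF bd be, of V] by simp
    then have "norm (U b W - W - b *\<^sub>R z) \<le> b\<^sup>2 * norm V" using norm_mop_le[OF bde, of V] by simp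
    also have "\<dots> \<le> b\<^sup>2 * B" by (intro mult_left_mono V) simp
    finally show ?thesis by (simp add: mult.commute)
  qed
  moreover have "norm (U b W - W) \<le> B * \<bar>b\<bar>" for b
    by (rule U_expand2[OF reg_weaken[OF _ _ assms]]) auto
  ultimately show thesis using that z by blast
qed

text \<open>A first-order Taylor expansion at \<open>b = 0\<close> which is global in \<open>b\<close>. Each derivative along
  the free group costs two orders of regularity, hence the indices \<open>4\<close> and \<open>2\<close>.\<close>

definition curve :: "real \<Rightarrow> (real \<Rightarrow> l2) \<Rightarrow> bool" where
  "curve B y \<longleftrightarrow> (\<exists>y0 y1. reg 4 B y0 \<and> reg 2 B y1 \<and>
     (\<forall>b. norm (y b) \<le> B \<and> norm (y b - y0) \<le> B * \<bar>b\<bar> \<and> norm (y b - y0 - b *\<^sub>R y1) \<le> B * b\<^sup>2))"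

lemma curveE:
  assumes "curve B y"
  obtains y0 y1 where "reg 4 B y0" "reg 2 B y1" "\<And>b. norm (y b) \<le> B" "\<And>b. norm (y b - y0) \<le> B * \<bar>b\<bar>"
    "\<And>b. norm (y b - y0 - b *\<^sub>R y1) \<le> B * b\<^sup>2"
  using assms unfolding curve_def by blast

lemma curve_nonneg: "curve B y \<Longrightarrow> 0 \<le> B"
  unfolding curve_def by (meson norm_ge_zero order_trans)

lemma curve_mono: "curve B y \<Longrightarrow> B \<le> C \<Longrightarrow> curve C y"
  unfolding curve_def
  by (meson reg_mono order_trans mult_right_mono abs_ge_zero zero_le_power2)

lemma curve_U: "reg 4 B W \<Longrightarrow> curve B (\<lambda>b. U b W)"
  using U_expand4[of B W] reg_norm[of 4 B W] unfolding curve_def by (metis norm_U zero_le_numeral)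

lemma curve_dag:
  assumes "curve B y" and d: "\<And>V W. dag (V - W) = dag V - dag W" "\<And>c V. dag (c *\<^sub>R V) = c *\<^sub>R dag V"
  shows "curve B (\<lambda>b. dag (y b))"
proof -
  obtain y0 y1 where y: "reg 4 B y0" "reg 2 B y1" "\<And>b. norm (y b) \<le> B" "\<And>b. norm (y b - y0) \<le> B * \<bar>b\<bar>"
    "\<And>b. norm (y b - y0 - b *\<^sub>R y1) \<le> B * b\<^sup>2" using assms(1) by (rule curveE) blast
  have 1: "norm (dag (y b) - dag y0) \<le> B * \<bar>b\<bar>" for b using y(4)[of b] by (simp flip: d)
  have 2: "norm (dag (y b) - dag y0 - b *\<^sub>R dag y1) \<le> B * b\<^sup>2" for b using y(5)[of b] by (simp flip: d)
  show ?thesis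
    unfolding curve_def
    by (rule exI[of _ "dag y0"], rule exI[of _ "dag y1"]) (use y 1 2 in \<open>auto intro: reg_dag\<close>)
qed

text \<open>Composition with the inverse group subtracts the generator from the derivative. The term
  b (U (-b) y1 - y1) is of second order only because y1 has two orders of regularity, which is why
  \<open>curve\<close> demands them. The factor 3 counts the terms of the second-order
  remainder.\<close>

lemma curve_U_neg:
  assumes "curve B y" shows "curve (3 * B) (\<lambda>b. U (- b) (y b))"
proof -
  obtain y0 y1 where y: "reg 4 B y0" "reg 2 B y1" "\<And>b. norm (y b) \<le> B" "\<And>b. norm (y b - y0) \<le> B * \<bar>b\<bar>"
    "\<And>b. norm (y b - y0 - b *\<^sub>R y1) \<le> B * b\<^sup>2" using assms(1) by (rule curveE) blast
  have B: "0 \<le> B" by (rule curve_nonneg[OF assms])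
  obtain z where z: "reg 2 B z" "\<And>b. norm (U b y0 - y0) \<le> B * \<bar>b\<bar>" "\<And>b. norm (U b y0 - y0 - b *\<^sub>R z) \<le> B * b\<^sup>2"
    using U_expand4[OF y(1)] by blast
  have r1: "reg 2 (B + B) (y1 + (-1) *\<^sub>R z)"
    using reg_add[OF _ y(2) reg_scaleR[OF _ z(1), of "-1"]] by simp
  have 1: "norm (U (- b) (y b) - y0) \<le> 3 * B * \<bar>b\<bar>" for b
  proof -
    have "U (- b) (y b) - y0 = U (- b) (y b - y0) + (U (- b) y0 - y0)" by (simp add: U_diff)
    then have "norm (U (- b) (y b) - y0) \<le> norm (y b - y0) + norm (U (- b) y0 - y0)"
      by (metis norm_U norm_triangle_ineq)
    also have "\<dots> \<le> B * \<bar>b\<bar> + B * \<bar>b\<bar>" using y(4)[of b] z(2)[of "-b"] by simp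
    also have "\<dots> \<le> 3 * B * \<bar>b\<bar>" using mult_nonneg_nonneg[OF B abs_ge_zero[of b]] by linarith
    finally show ?thesis .
  qed
  have 2: "norm (U (- b) (y b) - y0 - b *\<^sub>R (y1 + (-1) *\<^sub>R z)) \<le> 3 * B * b\<^sup>2" for b
  proof -
    have "U (- b) (y b) - y0 - b *\<^sub>R (y1 + (-1) *\<^sub>R z)
        = U (- b) (y b - y0 - b *\<^sub>R y1) + (U (- b) y0 - y0 - (- b) *\<^sub>R z) + b *\<^sub>R (U (- b) y1 - y1)"
      by (simp add: U_diff U_add U_scaleR algebra_simps)
    then have "norm (U (- b) (y b) - y0 - b *\<^sub>R (y1 + (-1) *\<^sub>R z))
       \<le> norm (y b - y0 - b *\<^sub>R y1) + norm (U (- b) y0 - y0 - (- b) *\<^sub>R z) + norm (b *\<^sub>R (U (- b) y1 - y1))"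
      by (metis norm_U norm_triangle_mono order_refl)
    also have "\<dots> \<le> B * b\<^sup>2 + B * b\<^sup>2 + \<bar>b\<bar> * (B * \<bar>b\<bar>)"
      using y(5)[of b] z(3)[of "-b"] mult_left_mono[OF U_expand2[OF y(2), of "-b"] abs_ge_zero[of b]] by (simp add: mult.commute)
    also have "\<dots> = 3 * B * b\<^sup>2" by (simp add: power2_eq_square abs_mult_self_eq mult.left_commute)
    finally show ?thesis .
  qed
  have 0: "norm (U (- b) (y b)) \<le> 3 * B" for b using y(3)[of b] B by simp
  have "reg 4 (3 * B) y0" by (rule reg_mono[OF y(1)]) (use B in simp)
  moreover have "reg 2 (3 * B) (y1 + (-1) *\<^sub>R z)" by (rule reg_mono[OF r1]) (use B in simp)
  ultimately show ?thesis
    unfolding curve_def using 0 1 2 by blast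
qed

context sobolev
begin

lemma norm_prd_mono: "norm V \<le> a \<Longrightarrow> norm W \<le> b \<Longrightarrow> norm (prd V W) \<le> 2 * Kp 0 * (a * b)"
proof -
  assume "norm V \<le> a" "norm W \<le> b"
  then have "norm V * norm W \<le> a * b" by (intro mult_mono) (auto intro: order_trans[OF norm_ge_zero])
  then have "2 * Kp 0 * (norm V * norm W) \<le> 2 * Kp 0 * (a * b)" using Kp_nonneg[of 0] by (intro mult_left_mono) auto
  then show ?thesis using norm_prd_le[of V W] by (simp add: mult.assoc)
qed

lemma curve_prd:
  assumes y: "curve B y" and z: "curve B z"
  shows "curve ((6 * Kp 0 + 2 * Kp 4 + 4 * Kp 2) * (B * B)) (\<lambda>b. prd (y b) (z b))"
proof -
  define K where "K = 2 * Kp 0 * (B * B)"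
  \<comment> \<open>One constant for all requirements: 6 \<open>Kp 0\<close> for the three
    second-order terms of the Leibniz rule, 2 \<open>Kp 4\<close> for the regularity of the product
    of y0 and z0, and 4 \<open>Kp 2\<close> for that of the two terms of its derivative.\<close>
  define C where "C = (6 * Kp 0 + 2 * Kp 4 + 4 * Kp 2) * (B * B)"
  obtain y0 y1 where y: "reg 4 B y0" "reg 2 B y1" "\<And>b. norm (y b) \<le> B" "\<And>b. norm (y b - y0) \<le> B * \<bar>b\<bar>"
    "\<And>b. norm (y b - y0 - b *\<^sub>R y1) \<le> B * b\<^sup>2" using y by (rule curveE) blast
  obtain z0 z1 where z: "reg 4 B z0" "reg 2 B z1" "\<And>b. norm (z b) \<le> B" "\<And>b. norm (z b - z0) \<le> B * \<bar>b\<bar>"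
    "\<And>b. norm (z b - z0 - b *\<^sub>R z1) \<le> B * b\<^sup>2" using z by (rule curveE) blast
  have ny0: "norm y0 \<le> B" and nz0: "norm z0 \<le> B" and ny1: "norm y1 \<le> B" and nz1: "norm z1 \<le> B"
    by (rule reg_norm[OF _ y(1)] reg_norm[OF _ y(2)] reg_norm[OF _ z(1)] reg_norm[OF _ z(2)], simp)+
  have KK: "0 \<le> Kp 0 * (B * B)" "0 \<le> Kp 2 * (B * B)" "0 \<le> Kp 4 * (B * B)"
    using Kp_nonneg by auto
  have C: "K \<le> C" "2 * K \<le> C" "3 * K \<le> C" "Kp 4 * (B * B + B * B) \<le> C"
      "Kp 2 * (B * B + B * B) + Kp 2 * (B * B + B * B) \<le> C"
    unfolding K_def C_def using KK by (simp_all add: algebra_simps)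
  have r0: "reg 4 C (prd y0 z0)"
    by (rule reg_mono[OF reg_prd[OF _ y(1) ny0 z(1) nz0] C(4)]) simp
  have y02: "reg 2 B y0" "reg 2 B z0" using reg_weaken[of 2 4 B] y(1) z(1) by auto
  have r1: "reg 2 C (prd y1 z0 + prd y0 z1)"
    by (rule reg_mono[OF reg_add[OF _ reg_prd[OF _ y(2) ny1 y02(2) nz0] reg_prd[OF _ y02(1) ny0 z(2) nz1]] C(5)]) simp_all
  have 0: "norm (prd (y b) (z b)) \<le> C" for b
    using norm_prd_mono[OF y(3)[of b] z(3)[of b]] C(1) unfolding K_def by simp
  have 1: "norm (prd (y b) (z b) - prd y0 z0) \<le> C * \<bar>b\<bar>" for b
  proof -
    have "prd (y b) (z b) - prd y0 z0 = prd (y b - y0) (z b) + prd y0 (z b - z0)"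
      by (simp add: prd.diff_left prd.diff_right)
    then have "norm (prd (y b) (z b) - prd y0 z0) \<le> norm (prd (y b - y0) (z b)) + norm (prd y0 (z b - z0))"
      by (metis norm_triangle_ineq)
    also have "\<dots> \<le> 2 * Kp 0 * (B * \<bar>b\<bar> * B) + 2 * Kp 0 * (B * (B * \<bar>b\<bar>))"
      by (intro add_mono norm_prd_mono y z ny0)
    also have "\<dots> = 2 * K * \<bar>b\<bar>" unfolding K_def by (simp add: algebra_simps)
    also have "\<dots> \<le> C * \<bar>b\<bar>" by (intro mult_right_mono C) simp
    finally show ?thesis .
  qed
  have 2: "norm (prd (y b) (z b) - prd y0 z0 - b *\<^sub>R (prd y1 z0 + prd y0 z1)) \<le> C * b\<^sup>2" for b
  proof -
    \<comment> \<open>Keeping \<open>z b\<close> instead of z0 in the outer factors leaves exactly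
      three quadratic pieces, the last being a product of two linear ones.\<close>
    have "prd (y b) (z b) - prd y0 z0 - b *\<^sub>R (prd y1 z0 + prd y0 z1)
        = prd (y b - y0 - b *\<^sub>R y1) (z b) + prd y0 (z b - z0 - b *\<^sub>R z1) + prd (b *\<^sub>R y1) (z b - z0)"
      by (simp add: prd.diff_left prd.diff_right prd.scaleR_left prd.scaleR_right scaleR_add_right)
    then have "norm (prd (y b) (z b) - prd y0 z0 - b *\<^sub>R (prd y1 z0 + prd y0 z1))
       \<le> norm (prd (y b - y0 - b *\<^sub>R y1) (z b)) + norm (prd y0 (z b - z0 - b *\<^sub>R z1)) + norm (prd (b *\<^sub>R y1) (z b - z0))"
      by (metis norm_triangle_mono norm_triangle_ineq order_refl)
    also have "\<dots> \<le> 2 * Kp 0 * (B * b\<^sup>2 * B) + 2 * Kp 0 * (B * (B * b\<^sup>2)) + 2 * Kp 0 * ((\<bar>b\<bar> * B) * (B * \<bar>b\<bar>))"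
      by (intro add_mono norm_prd_mono y z ny0) (auto intro: mult_left_mono ny1)
    also have "\<dots> = 3 * K * b\<^sup>2"
    proof -
      have "\<bar>b\<bar> * \<bar>b\<bar> = b\<^sup>2" by (simp add: power2_eq_square)
      then have "(\<bar>b\<bar> * B) * (B * \<bar>b\<bar>) = B * B * b\<^sup>2" by (metis mult.assoc mult.commute)
      then show ?thesis unfolding K_def by (simp only:) (simp add: algebra_simps)
    qed
    also have "\<dots> \<le> C * b\<^sup>2" by (intro mult_right_mono C) simp
    finally show ?thesis .
  qed
  show ?thesis
    unfolding curve_def C_def[symmetric] using r0 r1 0 1 2 by blast
qed

text \<open>Since \<sigma> is a positive integer, |v|^(2\<sigma>) and |v|^(2\<sigma>) v are
  monomials in v and its conjugate. One induction per estimate then covers every \<sigma>.\<close>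

inductive pol :: "(l2 \<Rightarrow> l2) \<Rightarrow> bool" where
  pol_id: "pol (\<lambda>V. V)"
| pol_dag: "pol f \<Longrightarrow> pol (\<lambda>V. dag (f V))"
| pol_prd: "pol f \<Longrightarrow> pol g \<Longrightarrow> pol (\<lambda>V. prd (f V) (g V))"

text \<open>Expansions are stable under conjugation and products, once two factors are brought to
  the common bound \<open>max B C\<close>; W enters the bound only through \<nu>.\<close>

lemma pol_curve: "pol f \<Longrightarrow> \<exists>B. \<forall>W. reg 4 \<nu> W \<longrightarrow> curve B (\<lambda>b. f (U b W))"
proof (induction rule: pol.induct)
  case pol_id
  then show ?case using curve_U by blast
next
  case (pol_dag f)
  then show ?case using curve_dag dag_diff dag_scaleR by blast
next
  case (pol_prd f g)
  then obtain B C where B: "\<And>W. reg 4 \<nu> W \<Longrightarrow> curve B (\<lambda>b. f (U b W))"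
    and C: "\<And>W. reg 4 \<nu> W \<Longrightarrow> curve C (\<lambda>b. g (U b W))" by blast
  show ?case
    using curve_prd[OF curve_mono[OF B, of _ "max B C"] curve_mono[OF C, of _ "max B C"]] by auto
qed

lemma pol_bound: "pol f \<Longrightarrow> \<exists>B\<ge>0. \<forall>V. norm V \<le> \<rho> \<longrightarrow> norm (f V) \<le> B"
proof (induction rule: pol.induct)
  case pol_id
  then show ?case by (intro exI[of _ "max 0 \<rho>"]) auto
next
  case (pol_dag f)
  then show ?case by simp
next
  case (pol_prd f g)
  then obtain B C where B: "0 \<le> B" "\<And>V. norm V \<le> \<rho> \<Longrightarrow> norm (f V) \<le> B"
    and C: "0 \<le> C" "\<And>V. norm V \<le> \<rho> \<Longrightarrow> norm (g V) \<le> C" by blast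
  then show ?case
    using norm_prd_mono[OF B(2) C(2)] Kp_nonneg[of 0] by (intro exI[of _ "2 * Kp 0 * (B * C)"]) auto
qed

lemma pol_lip: "pol f \<Longrightarrow> \<exists>L\<ge>0. \<forall>V W. norm V \<le> \<rho> \<longrightarrow> norm W \<le> \<rho> \<longrightarrow> norm (f V - f W) \<le> L * norm (V - W)"
proof (induction rule: pol.induct)
  case pol_id
  then show ?case by (intro exI[of _ 1]) auto
next
  case (pol_dag f)
  then show ?case by (simp flip: dag_diff)
next
  case (pol_prd f g)
  obtain B C where B: "0 \<le> B" "\<And>V. norm V \<le> \<rho> \<Longrightarrow> norm (f V) \<le> B"
    and C: "0 \<le> C" "\<And>V. norm V \<le> \<rho> \<Longrightarrow> norm (g V) \<le> C"
    using pol_bound[of f \<rho>] pol_bound[of g \<rho>] pol_prd by blast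
  obtain L M where L: "0 \<le> L" "\<And>V W. norm V \<le> \<rho> \<Longrightarrow> norm W \<le> \<rho> \<Longrightarrow> norm (f V - f W) \<le> L * norm (V - W)"
    and M: "0 \<le> M" "\<And>V W. norm V \<le> \<rho> \<Longrightarrow> norm W \<le> \<rho> \<Longrightarrow> norm (g V - g W) \<le> M * norm (V - W)"
    using pol_prd by blast
  have "norm (prd (f V) (g V) - prd (f W) (g W)) \<le> 2 * Kp 0 * (L * C + B * M) * norm (V - W)"
    if V: "norm V \<le> \<rho>" and W: "norm W \<le> \<rho>" for V W
  proof -
    have "prd (f V) (g V) - prd (f W) (g W) = prd (f V - f W) (g V) + prd (f W) (g V - g W)"
      by (simp add: prd.diff_left prd.diff_right)
    then have "norm (prd (f V) (g V) - prd (f W) (g W)) \<le> norm (prd (f V - f W) (g V)) + norm (prd (f W) (g V - g W))"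
      by (metis norm_triangle_ineq)
    also have "\<dots> \<le> 2 * Kp 0 * (L * norm (V - W) * C) + 2 * Kp 0 * (B * (M * norm (V - W)))"
      by (intro add_mono norm_prd_mono L M B C V W)
    finally show ?thesis by (simp add: algebra_simps)
  qed
  then show ?case using Kp_nonneg[of 0] L M B C by (intro exI[of _ "2 * Kp 0 * (L * C + B * M)"]) auto
qed

text \<open>The constant A depends on the ball of radius \<rho> but not on \<nu>: by
  \<open>reg_prd\<close> every product is linear in the higher norms of its factors.\<close>

lemma pol_tame: "pol f \<Longrightarrow> \<exists>A\<ge>0. \<forall>V \<nu>. norm V \<le> \<rho> \<longrightarrow> reg 4 \<nu> V \<longrightarrow> reg 4 (A * \<nu>) (f V)"
proof (induction rule: pol.induct)
  case pol_id
  then show ?case by (intro exI[of _ 1]) auto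
next
  case (pol_dag f)
  then show ?case using reg_dag[of 4] by (meson zero_le_numeral)
next
  case (pol_prd f g)
  obtain B C where B: "0 \<le> B" "\<And>V. norm V \<le> \<rho> \<Longrightarrow> norm (f V) \<le> B"
    and C: "0 \<le> C" "\<And>V. norm V \<le> \<rho> \<Longrightarrow> norm (g V) \<le> C"
    using pol_bound[of f \<rho>] pol_bound[of g \<rho>] pol_prd by blast
  obtain L M where L: "0 \<le> L" "\<And>V \<nu>. norm V \<le> \<rho> \<Longrightarrow> reg 4 \<nu> V \<Longrightarrow> reg 4 (L * \<nu>) (f V)"
    and M: "0 \<le> M" "\<And>V \<nu>. norm V \<le> \<rho> \<Longrightarrow> reg 4 \<nu> V \<Longrightarrow> reg 4 (M * \<nu>) (g V)"
    using pol_prd by blast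
  have "reg 4 (Kp 4 * (L * C + B * M) * \<nu>) (prd (f V) (g V))" if "norm V \<le> \<rho>" "reg 4 \<nu> V" for V \<nu>
    using reg_prd[OF _ L(2)[OF that] B(2)[OF that(1)] M(2)[OF that] C(2)[OF that(1)]]
    by (simp add: algebra_simps)
  then show ?case using Kp_nonneg[of 4] L M B C by (intro exI[of _ "Kp 4 * (L * C + B * M)"]) auto
qed

lemma pol_continuous: "pol f \<Longrightarrow> continuous_on UNIV f"
proof (induction rule: pol.induct)
  case (pol_dag f)
  have "bounded_linear dag"
    by (rule bounded_linear_intro[where K=1]) (auto simp: dag_add dag_scaleR)
  then show ?case using pol_dag bounded_linear.continuous_on by blast
next
  case (pol_prd f g)
  then show ?case by (intro prd.continuous_on)
qed (rule continuous_on_id)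

end

section \<open>The truncated nonlinearity and its exponential step\<close>

locale truncated_nls = sobolev +
  fixes \<sigma> :: nat and \<theta> :: "real \<Rightarrow> real" and L R :: real
  assumes \<sigma>: "1 \<le> \<sigma>" and R: "0 < R"
    and \<theta>_lip: "\<And>x y. 0 \<le> x \<Longrightarrow> 0 \<le> y \<Longrightarrow> \<bar>\<theta> x - \<theta> y\<bar> \<le> L * \<bar>x - y\<bar>"
    and \<theta>_supp: "\<And>x. 2 < x \<Longrightarrow> \<theta> x = 0"
begin

lemma L_nonneg: "0 \<le> L" using \<theta>_lip[of 0 1] by simp

text \<open>The comparison point 3 lies outside the support and at distance at most 3 from every
  point of [0, 2].\<close>

lemma \<theta>_bound: "0 \<le> x \<Longrightarrow> \<bar>\<theta> x\<bar> \<le> 3 * L"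
proof (cases "x \<le> 2")
  case True
  assume x: "0 \<le> x"
  have "\<bar>\<theta> x - \<theta> 3\<bar> \<le> L * \<bar>x - 3\<bar>" by (rule \<theta>_lip) (use x in auto)
  also have "\<dots> \<le> L * 3" using True x L_nonneg by (intro mult_left_mono) auto
  finally show ?thesis by (simp add: \<theta>_supp)
qed (use \<theta>_supp L_nonneg in auto)

definition th :: "l2 \<Rightarrow> real" where "th V = \<theta> (norm V / R)"

lemma th_bound: "\<bar>th V\<bar> \<le> 3 * L" unfolding th_def using R by (intro \<theta>_bound) simp

lemma th_lip: "\<bar>th V - th W\<bar> \<le> L / R * norm (V - W)"
proof -
  have "\<bar>th V - th W\<bar> \<le> L * \<bar>norm V / R - norm W / R\<bar>"
    unfolding th_def using R by (intro \<theta>_lip) auto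
  also have "\<bar>norm V / R - norm W / R\<bar> = \<bar>norm V - norm W\<bar> / R"
    using R by (simp add: diff_divide_distrib[symmetric])
  also have "L * (\<bar>norm V - norm W\<bar> / R) \<le> L * (norm (V - W) / R)"
    using R L_nonneg norm_triangle_ineq3[of V W] by (intro mult_left_mono divide_right_mono) auto
  finally show ?thesis by simp
qed

lemma th_zero: "2 * R < norm V \<Longrightarrow> th V = 0"
  unfolding th_def using R by (intro \<theta>_supp) (simp add: field_simps)

lemma th_U[simp]: "th (U a V) = th V" unfolding th_def by simp

text \<open>Multiplication by the imaginary unit is an operator here because \<open>l2\<close> is
  only a real vector space.\<close>

definition iV :: "l2 \<Rightarrow> l2" where "iV = mop (\<lambda>_. \<i>)"

lemma bdd_i: "bdd_mult 1 (\<lambda>_. \<i>)" unfolding bdd_mult_def by simp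

lemma norm_iV[simp]: "norm (iV V) = norm V"
proof -
  have i2: "bdd_mult 1 (\<lambda>_. - \<i>)" unfolding bdd_mult_def by simp
  have "mop (\<lambda>_. - \<i>) (iV V) = V" unfolding iV_def mop_mop[OF i2 bdd_i] by (simp add: mop_one)
  then show ?thesis using norm_mop_le[OF bdd_i, of V] norm_mop_le[OF i2, of "iV V"] by (simp add: iV_def)
qed

lemma iV_diff: "iV (V - W) = iV V - iV W" unfolding iV_def by (rule mop_diff[OF bdd_i])
lemma iV_scaleR: "iV (r *\<^sub>R V) = r *\<^sub>R iV V" unfolding iV_def by (rule mop_scaleR[OF bdd_i])
lemma iV_zero: "iV 0 = 0" unfolding iV_def by (rule mop_zero[OF bdd_i])
lemma U_iV: "U a (iV V) = iV (U a V)" unfolding iV_def by (rule U_mop_const)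
lemma prd_iV: "prd (iV V) W = iV (prd V W)" unfolding iV_def by (rule prd_mop_const)
lemma ev_iV: "ev (iV V) x = \<i> * ev V x" unfolding iV_def by (rule ev_mop_const)
lemma bounded_linear_iV: "bounded_linear iV" unfolding iV_def by (rule bounded_linear_mop[OF bdd_i])

lemma reg_iV: "reg 4 B V \<Longrightarrow> reg 4 B (iV V)"
  using reg_mop[OF _ bdd_i, of 4 B V] by (simp add: iV_def)

text \<open>The coordinates of |v|^(2\<sigma>). The iteration starts from |v|^2 and runs \<sigma> -
  1 times, because the constant function 1 is not in \<open>H^s\<close> and the algebra has no
  unit.\<close>

definition Zp :: "l2 \<Rightarrow> l2" where "Zp V = ((prd (prd V (dag V))) ^^ (\<sigma> - 1)) (prd V (dag V))"

definition NL :: "l2 \<Rightarrow> l2" where "NL V = prd (Zp V) V"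

lemma pol_Zp: "pol Zp"
proof -
  have 1: "pol (\<lambda>V. prd V (dag V))" by (intro pol_prd pol_dag pol_id)
  have "pol (\<lambda>V. ((prd (prd V (dag V))) ^^ k) (prd V (dag V)))" for k
    by (induction k) (simp_all add: 1 pol_prd)
  then show ?thesis unfolding Zp_def[abs_def] .
qed

lemma pol_NL: "pol NL" unfolding NL_def[abs_def] by (intro pol_prd pol_Zp pol_id)

lemma ev_Zp: "ev (Zp V) x = complex_of_real (cmod (ev V x) ^ (2 * \<sigma>))"
proof -
  have z: "ev V x * cnj (ev V x) = complex_of_real ((cmod (ev V x))\<^sup>2)"
    by (rule complex_norm_square[symmetric])
  have "ev (((prd (prd V (dag V))) ^^ k) (prd V (dag V))) x = complex_of_real (((cmod (ev V x))\<^sup>2) ^ Suc k)" for k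
    by (induction k) (simp_all add: ev_prd ev_dag z)
  moreover obtain k where "\<sigma> = Suc k" using \<sigma> by (cases \<sigma>) auto
  ultimately show ?thesis unfolding Zp_def by (simp add: power_mult power2_eq_square)
qed

lemma ev_NL: "ev (NL V) x = complex_of_real (cmod (ev V x) ^ (2 * \<sigma>)) * ev V x"
  unfolding NL_def ev_prd ev_Zp ..

definition TF :: "l2 \<Rightarrow> l2" where "TF V = th V *\<^sub>R iV (NL V)"

definition G :: "real \<Rightarrow> l2 \<Rightarrow> l2" where "G a V = U (- a) (TF (U a V))"

lemma TF_lip: "\<exists>K\<ge>0. (\<forall>V W. norm (TF V - TF W) \<le> K * norm (V - W)) \<and> (\<forall>V. norm (TF V) \<le> K)"
proof -
  obtain B where B: "0 \<le> B" "\<And>V. norm V \<le> 2 * R \<Longrightarrow> norm (NL V) \<le> B"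
    using pol_bound[OF pol_NL] by blast
  obtain M where M: "0 \<le> M" "\<And>V W. norm V \<le> 2 * R \<Longrightarrow> norm W \<le> 2 * R \<Longrightarrow> norm (NL V - NL W) \<le> M * norm (V - W)"
    using pol_lip[OF pol_NL] by blast
  define K where "K = L / R * B + 3 * L * M + 3 * L * B"
  have pos: "0 \<le> L / R * B" "0 \<le> 3 * L * M" "0 \<le> 3 * L * B" using B(1) M(1) R L_nonneg by auto
  \<comment> \<open>Only V has to lie in the ball of radius 2R, where \<open>NL\<close> is
    controlled. If W lies outside, its cut-off vanishes and the Lipschitz bound of \<open>th\<close>
    carries the whole difference.\<close>
  have half: "norm (TF V - TF W) \<le> K * norm (V - W)" if V: "norm V \<le> 2 * R" for V W
  proof (cases "norm W \<le> 2 * R")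
    case True
    have "TF V - TF W = (th V - th W) *\<^sub>R iV (NL V) + th W *\<^sub>R iV (NL V - NL W)"
      unfolding TF_def iV_diff by (simp add: algebra_simps)
    then have "norm (TF V - TF W) \<le> norm ((th V - th W) *\<^sub>R iV (NL V)) + norm (th W *\<^sub>R iV (NL V - NL W))"
      by (metis norm_triangle_ineq)
    also have "\<dots> = \<bar>th V - th W\<bar> * norm (NL V) + \<bar>th W\<bar> * norm (NL V - NL W)" by simp
    also have "\<dots> \<le> (L / R * norm (V - W)) * B + 3 * L * (M * norm (V - W))"
      by (intro add_mono mult_mono th_lip th_bound B M V True) (use L_nonneg R in auto)
    also have "\<dots> = (L / R * B + 3 * L * M) * norm (V - W)" by (simp add: algebra_simps)
    also have "\<dots> \<le> K * norm (V - W)" unfolding K_def using pos by (intro mult_right_mono) auto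
    finally show ?thesis .
  next
    case False
    then have W: "th W = 0" by (intro th_zero) simp
    have "norm (TF V - TF W) = \<bar>th V - th W\<bar> * norm (NL V)" unfolding TF_def W by simp
    also have "\<dots> \<le> (L / R * norm (V - W)) * B"
      by (intro mult_mono th_lip B V) (use L_nonneg R in auto)
    also have "\<dots> = (L / R * B) * norm (V - W)" by simp
    also have "\<dots> \<le> K * norm (V - W)" unfolding K_def using pos by (intro mult_right_mono) auto
    finally show ?thesis .
  qed
  have "norm (TF V - TF W) \<le> K * norm (V - W)" for V W
  proof (cases "norm V \<le> 2 * R \<or> norm W \<le> 2 * R")
    case True
    then show ?thesis using half[of V W] half[of W V] by (auto simp: norm_minus_commute)
  next
    case False
    then have "th V = 0" "th W = 0" by (auto intro: th_zero)
    then show ?thesis unfolding TF_def K_def using pos by simp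
  qed
  moreover have "norm (TF V) \<le> K" for V
  proof (cases "norm V \<le> 2 * R")
    case True
    have "norm (TF V) = \<bar>th V\<bar> * norm (NL V)" unfolding TF_def by simp
    also have "\<dots> \<le> 3 * L * B" by (intro mult_mono th_bound B True) (use L_nonneg in auto)
    finally show ?thesis unfolding K_def using pos by linarith
  next
    case False
    then have "th V = 0" by (intro th_zero) simp
    then show ?thesis unfolding TF_def K_def using pos by simp
  qed
  moreover have "0 \<le> K" unfolding K_def using pos by linarith
  ultimately show ?thesis by blast
qed

definition KF :: real where
  "KF = (SOME K. 0 \<le> K \<and> (\<forall>V W. norm (TF V - TF W) \<le> K * norm (V - W)) \<and> (\<forall>V. norm (TF V) \<le> K))"

lemma KF: "0 \<le> KF" "norm (TF V - TF W) \<le> KF * norm (V - W)" "norm (TF V) \<le> KF"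
  using someI_ex[OF TF_lip, folded KF_def] by auto

lemma G_lip: "norm (G a V - G a W) \<le> KF * norm (V - W)"
  unfolding G_def using KF(2)[of "U a V" "U a W"] by (simp flip: U_diff)

lemma norm_G_le: "norm (G a V) \<le> KF" unfolding G_def using KF(3) by simp

lemma TF_continuous: "continuous_on UNIV TF"
  unfolding continuous_on_iff
proof (intro ballI allI impI)
  fix V :: l2 and e :: real assume e: "0 < e"
  \<comment> \<open>The radius uses \<open>KF + 1\<close> in place of \<open>KF\<close>, which may
    be 0.\<close>
  show "\<exists>d>0. \<forall>W\<in>UNIV. dist W V < d \<longrightarrow> dist (TF W) (TF V) < e"
  proof (intro exI[of _ "e / (KF + 1)"] conjI ballI impI)
    show "0 < e / (KF + 1)" using e KF(1) by simp
    fix W assume "dist W V < e / (KF + 1)"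
    then have "(KF + 1) * norm (W - V) < e" using KF(1) by (simp add: dist_norm field_simps)
    moreover have "norm (TF W - TF V) \<le> (KF + 1) * norm (W - V)"
      using KF(2)[of W V] by (simp add: distrib_right add_increasing2)
    ultimately show "dist (TF W) (TF V) < e" by (simp add: dist_norm)
  qed
qed

text \<open>The group preserves the norm, so the cut-off is constant along
  \<open>U (a + b) W\<close> and only the monomial moves. Replacing the derivative by the difference
  quotient with step h costs |b| / h times h^2, whence the mixed term |b| h.\<close>

lemma G_expand:
  "\<exists>B\<ge>0. \<forall>a b h W. reg 4 \<nu> W \<longrightarrow> 0 < h \<longrightarrow>
     norm (G (a + b) W - G a W - (b / h) *\<^sub>R (G (a + h) W - G a W)) \<le> B * (b\<^sup>2 + \<bar>b\<bar> * h) \<and>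
     norm (G (a + h) W - G a W) \<le> B * h"
proof -
  obtain B where B: "\<And>W. reg 4 \<nu> W \<Longrightarrow> curve B (\<lambda>b. NL (U b W))"
    using pol_curve[OF pol_NL] by blast
  define C where "C = max 0 (3 * L * (3 * B))"
  have "norm (G (a + b) W - G a W - (b / h) *\<^sub>R (G (a + h) W - G a W)) \<le> C * (b\<^sup>2 + \<bar>b\<bar> * h) \<and>
     norm (G (a + h) W - G a W) \<le> C * h" if W: "reg 4 \<nu> W" and h: "0 < h" for a b h W
  proof -
    define y where "y b = U (- b) (NL (U b (U a W)))" for b
    have c: "curve (3 * B) y" unfolding y_def
      by (rule curve_U_neg[OF B]) (rule reg_U[OF _ W], simp)
    obtain y0 y1 where y: "\<And>b. norm (y b - y0) \<le> 3 * B * \<bar>b\<bar>" "\<And>b. norm (y b - y0 - b *\<^sub>R y1) \<le> 3 * B * b\<^sup>2"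
      by (rule curveE[OF c]) blast
    have B0: "0 \<le> 3 * B" by (rule curve_nonneg[OF c])
    \<comment> \<open>The linear bound at b = 0 identifies the base point of the expansion, which
      \<open>curve\<close> only asserts to exist.\<close>
    have y0: "y0 = y 0" using y(1)[of 0] by simp
    have CB: "C = 3 * L * (3 * B)" unfolding C_def using B0 L_nonneg by (simp add: max_def)
    have G: "G (a + b) W = th W *\<^sub>R U (- a) (iV (y b))" for b
      unfolding G_def TF_def y_def U_iV[symmetric] by (simp add: U_scaleR U_U add.commute)
    have G0: "G a W = th W *\<^sub>R U (- a) (iV y0)" using G[of 0] y0 by simp
    have d: "G (a + b) W - G a W = th W *\<^sub>R U (- a) (iV (y b - y0))" for b
      unfolding G G0 by (simp add: iV_diff U_diff scaleR_diff_right)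
    have 1: "norm (G (a + h) W - G a W) \<le> C * h"
    proof -
      have "norm (G (a + h) W - G a W) = \<bar>th W\<bar> * norm (y h - y0)" unfolding d by simp
      also have "\<dots> \<le> 3 * L * (3 * B * \<bar>h\<bar>)" by (intro mult_mono th_bound y) (use L_nonneg in auto)
      finally show ?thesis using h CB by simp
    qed
    have "G (a + b) W - G a W - (b / h) *\<^sub>R (G (a + h) W - G a W)
        = th W *\<^sub>R U (- a) (iV ((y b - y0 - b *\<^sub>R y1) - (b / h) *\<^sub>R (y h - y0 - h *\<^sub>R y1)))"
      unfolding d using h by (simp add: iV_diff U_diff iV_scaleR U_scaleR scaleR_diff_right mult.commute)
    then have "norm (G (a + b) W - G a W - (b / h) *\<^sub>R (G (a + h) W - G a W))
        = \<bar>th W\<bar> * norm ((y b - y0 - b *\<^sub>R y1) - (b / h) *\<^sub>R (y h - y0 - h *\<^sub>R y1))" by simp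
    also have "\<dots> \<le> 3 * L * (3 * B * b\<^sup>2 + \<bar>b\<bar> / h * (3 * B * h\<^sup>2))"
    proof (intro mult_mono th_bound)
      have "norm ((y b - y0 - b *\<^sub>R y1) - (b / h) *\<^sub>R (y h - y0 - h *\<^sub>R y1))
          \<le> norm (y b - y0 - b *\<^sub>R y1) + norm ((b / h) *\<^sub>R (y h - y0 - h *\<^sub>R y1))"
        by (rule norm_triangle_ineq4)
      also have "\<dots> \<le> 3 * B * b\<^sup>2 + \<bar>b\<bar> / h * (3 * B * h\<^sup>2)"
        using y(2)[of b] mult_left_mono[OF y(2)[of h], of "\<bar>b\<bar> / h"] h by simp
      finally show "norm ((y b - y0 - b *\<^sub>R y1) - (b / h) *\<^sub>R (y h - y0 - h *\<^sub>R y1)) \<le> 3 * B * b\<^sup>2 + \<bar>b\<bar> / h * (3 * B * h\<^sup>2)" .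
    qed (use L_nonneg in auto)
    also have "\<dots> = C * (b\<^sup>2 + \<bar>b\<bar> * h)" unfolding CB using h by (simp add: power2_eq_square algebra_simps)
    finally show ?thesis using 1 by blast
  qed
  moreover have "0 \<le> C" unfolding C_def by simp
  ultimately show ?thesis by blast
qed

section \<open>The exponential series in the algebra and the nonlinear step\<close>

definition tm :: "l2 \<Rightarrow> l2 \<Rightarrow> nat \<Rightarrow> l2" where "tm Z V k = ((prd Z) ^^ k) V"

lemma tm_simps[simp]: "tm Z V 0 = V" "tm Z V (Suc k) = prd Z (tm Z V k)"
  unfolding tm_def by auto

lemma norm_tm: "norm (tm Z V k) \<le> (2 * Kp 0 * norm Z) ^ k * norm V"
proof (induction k)
  case (Suc k)
  have "norm (prd Z (tm Z V k)) \<le> 2 * Kp 0 * (norm Z * ((2 * Kp 0 * norm Z) ^ k * norm V))"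
    by (rule norm_prd_mono[OF order_refl Suc])
  then show ?case by (simp add: mult_ac)
qed simp

text \<open>Without a unit the exponential of Z is not itself an element of the algebra; its action
  on V is, as a series of the products \<open>tm Z V k\<close>.\<close>

definition expo :: "l2 \<Rightarrow> l2 \<Rightarrow> l2" where "expo Z V = (\<Sum>k. (1 / fact k) *\<^sub>R tm Z V k)"

lemma summable_exp_real: "summable (\<lambda>k. c ^ k / fact k * d)"
  and suminf_exp_real: "(\<Sum>k. c ^ k / fact k * d) = exp c * d" for c d :: real
proof -
  have 1: "summable (\<lambda>k. c ^ k /\<^sub>R fact k)" by (rule summable_exp_generic)
  then have "summable (\<lambda>k. c ^ k /\<^sub>R fact k * d)" by (rule summable_mult2)
  then show "summable (\<lambda>k. c ^ k / fact k * d)" by (simp add: field_simps)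
  have "(\<Sum>k. c ^ k /\<^sub>R fact k) * d = (\<Sum>k. c ^ k /\<^sub>R fact k * d)" by (rule suminf_mult2[OF 1])
  then show "(\<Sum>k. c ^ k / fact k * d) = exp c * d" by (simp add: exp_def field_simps)
qed

lemma norm_expo_term: "norm ((1 / fact k) *\<^sub>R tm Z V k) \<le> (2 * Kp 0 * norm Z) ^ k / fact k * norm V"
  using norm_tm[of Z V k] by (simp add: divide_right_mono)

lemma expo_summable: "summable (\<lambda>k. (1 / fact k) *\<^sub>R tm Z V k)"
  by (rule summable_comparison_test'[OF summable_exp_real, of 0]) (rule norm_expo_term)

lemma ev_expo: "ev (expo Z V) x = exp (ev Z x) * ev V x"
proof -
  interpret e: bounded_linear "\<lambda>V. ev V x" by (rule bounded_linear_ev)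
  have "ev (tm Z V k) x = ev Z x ^ k * ev V x" for k by (induction k) (simp_all add: ev_prd)
  then have t: "ev ((1 / fact k) *\<^sub>R tm Z V k) x = (ev Z x ^ k /\<^sub>R fact k) * ev V x" for k
    by (simp add: ev_scaleR scaleR_conv_of_real field_simps)
  have "ev (expo Z V) x = (\<Sum>k. ev ((1 / fact k) *\<^sub>R tm Z V k) x)"
    unfolding expo_def by (rule e.suminf[OF expo_summable])
  also have "\<dots> = (\<Sum>k. (ev Z x ^ k /\<^sub>R fact k)) * ev V x"
    unfolding t by (rule suminf_mult2[symmetric, OF summable_exp_generic])
  finally show ?thesis by (simp add: exp_def)
qed

lemma expo_zero: "expo 0 V = V"
  by (rule ev_eqI) (simp add: ev_expo ev_diff[of 0 0, simplified])

lemma expo_taylor: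
  "norm (expo Z V - V - prd Z V) \<le> (2 * Kp 0 * norm Z)\<^sup>2 * exp (2 * Kp 0 * norm Z) * norm V"
proof -
  define c where "c = 2 * Kp 0 * norm Z"
  have c: "0 \<le> c" unfolding c_def using Kp_nonneg by simp
  let ?f = "\<lambda>k. (1 / fact k) *\<^sub>R tm Z V k"
  have s2: "summable (\<lambda>k. ?f (k + 2))" using expo_summable[of Z V] summable_ignore_initial_segment by blast
  have "expo Z V = (\<Sum>k. ?f (k + 2)) + sum ?f {..<2}"
    unfolding expo_def by (rule suminf_split_initial_segment[OF expo_summable])
  then have eq: "expo Z V - V - prd Z V = (\<Sum>k. ?f (k + 2))"
    by (simp add: numeral_2_eq_2 lessThan_Suc)
  have tb: "norm (?f (k + 2)) \<le> c ^ k / fact k * (c\<^sup>2 * norm V)" for k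
  proof -
    have "norm (?f (k + 2)) \<le> c ^ (k + 2) / fact (k + 2) * norm V"
      unfolding c_def by (rule norm_expo_term)
    also have "\<dots> \<le> c ^ (k + 2) / fact k * norm V"
      using c by (intro mult_right_mono divide_left_mono fact_mono) auto
    also have "\<dots> = c ^ k / fact k * (c\<^sup>2 * norm V)" by (simp add: power_add power2_eq_square mult_ac)
    finally show ?thesis .
  qed
  have "norm (\<Sum>k. ?f (k + 2)) \<le> (\<Sum>k. c ^ k / fact k * (c\<^sup>2 * norm V))"
    by (rule norm_suminf_le[OF tb summable_exp_real])
  then show ?thesis unfolding eq suminf_exp_real c_def by (simp add: mult_ac)
qed

text \<open>On the open set where both arguments are bounded by \<rho> the series converges
  uniformly. The continuity makes every iterate of the scheme a measurable functional of the
  path.\<close>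

lemma expo_continuous:
  fixes f g :: "'a::t2_space \<Rightarrow> l2"
  assumes f: "continuous_on UNIV f" and g: "continuous_on UNIV g"
  shows "continuous_on UNIV (\<lambda>V. expo (f V) (g V))"
proof -
  have tm_cont: "continuous_on UNIV (\<lambda>V. tm (f V) (g V) k)" for k
    by (induction k) (simp_all add: g prd.continuous_on f)
  have "isCont (\<lambda>V. expo (f V) (g V)) V0" for V0
  proof -
    define \<rho> where "\<rho> = max (norm (f V0)) (norm (g V0)) + 1"
    define S where "S = {V. norm (f V) < \<rho>} \<inter> {V. norm (g V) < \<rho>}"
    have S: "open S" unfolding S_def
      by (intro open_Int open_Collect_less continuous_intros f g)
    have V0: "V0 \<in> S" unfolding S_def \<rho>_def by auto
    have \<rho>: "0 \<le> \<rho>" unfolding \<rho>_def by (smt (verit) norm_ge_zero)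
    have "uniform_limit S (\<lambda>n V. \<Sum>k<n. (1 / fact k) *\<^sub>R tm (f V) (g V) k) (\<lambda>V. expo (f V) (g V)) sequentially"
      unfolding expo_def
    proof (rule Weierstrass_m_test)
      show "summable (\<lambda>k. (2 * Kp 0 * \<rho>) ^ k / fact k * \<rho>)" by (rule summable_exp_real)
      fix k V assume "V \<in> S"
      then have b: "norm (f V) \<le> \<rho>" "norm (g V) \<le> \<rho>" unfolding S_def by auto
      have "norm ((1 / fact k) *\<^sub>R tm (f V) (g V) k) \<le> (2 * Kp 0 * norm (f V)) ^ k / fact k * norm (g V)"
        by (rule norm_expo_term)
      also have "\<dots> \<le> (2 * Kp 0 * \<rho>) ^ k / fact k * \<rho>"
        using b \<rho> Kp_nonneg[of 0] by (intro mult_mono divide_right_mono power_mono) auto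
      finally show "norm ((1 / fact k) *\<^sub>R tm (f V) (g V) k) \<le> (2 * Kp 0 * \<rho>) ^ k / fact k * \<rho>" .
    qed
    then have "continuous_on S (\<lambda>V. expo (f V) (g V))"
      by (rule uniform_limit_theorem[rotated])
        (auto intro!: always_eventually continuous_intros continuous_on_subset[OF tm_cont])
    then show ?thesis using S V0 continuous_on_eq_continuous_at by blast
  qed
  then show ?thesis by (simp add: continuous_at_imp_continuous_on)
qed

text \<open>The modulus of \<open>v\<close> is constant along the nonlinear flow, so that flow is multiplication by the
  exponential of \<open>\<i> \<tau> \<theta>\<^sub>R(v) |v|\<^bsup>2\<sigma>\<^esup>\<close>, here with \<open>Zp V\<close> for \<open>|v|\<^bsup>2\<sigma>\<^esup>\<close>.\<close>

definition step :: "real \<Rightarrow> l2 \<Rightarrow> l2" where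
  "step \<tau> V = expo (iV ((\<tau> * th V) *\<^sub>R Zp V)) V"

lemma ev_step: "ev (step \<tau> V) x = exp (\<i> * complex_of_real (\<tau> * th V * cmod (ev V x) ^ (2 * \<sigma>))) * ev V x"
  unfolding step_def by (simp add: ev_expo ev_iV ev_scaleR ev_Zp)

lemma th_continuous: "continuous_on UNIV th"
  unfolding continuous_on_iff
proof (intro ballI allI impI)
  fix V :: l2 and e :: real assume e: "0 < e"
  have LR: "0 \<le> L / R" using L_nonneg R by simp
  show "\<exists>d>0. \<forall>W\<in>UNIV. dist W V < d \<longrightarrow> dist (th W) (th V) < e"
  proof (intro exI[of _ "e / (L / R + 1)"] conjI ballI impI)
    show "0 < e / (L / R + 1)" using e LR by simp
    fix W assume "dist W V < e / (L / R + 1)"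
    then have "norm (W - V) * (L / R + 1) < e"
      using LR by (simp only: dist_norm pos_less_divide_eq)
    moreover have "\<bar>th W - th V\<bar> \<le> (L / R + 1) * norm (W - V)"
      using th_lip[of W V] by (simp add: distrib_right add_increasing2)
    ultimately show "dist (th W) (th V) < e" by (simp add: dist_real_def mult.commute)
  qed
qed

lemma step_continuous: "continuous_on UNIV (step \<tau>)"
  unfolding step_def[abs_def]
  by (intro expo_continuous continuous_intros bounded_linear.continuous_on[OF bounded_linear_iV]
      pol_continuous[OF pol_Zp] th_continuous)

lemma step_large: "2 * R < norm V \<Longrightarrow> step \<tau> V = V"
  unfolding step_def by (simp add: th_zero iV_zero expo_zero)

text \<open>The constant is uniform in V: inside the ball of radius 2R the exponent is of order
  \<tau>, and outside both the nonlinear step and the Euler step are the identity.\<close>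

lemma step_taylor: "\<exists>C\<ge>0. \<forall>\<tau> V. 0 \<le> \<tau> \<longrightarrow> \<tau> \<le> T \<longrightarrow> norm (step \<tau> V - V - \<tau> *\<^sub>R TF V) \<le> C * \<tau>\<^sup>2"
proof -
  obtain B where B: "0 \<le> B" "\<And>V. norm V \<le> 2 * R \<Longrightarrow> norm (Zp V) \<le> B"
    using pol_bound[OF pol_Zp] by blast
  define D where "D = 2 * Kp 0 * (3 * L * B)"
  have D: "0 \<le> D" unfolding D_def using Kp_nonneg L_nonneg B by simp
  define C where "C = D\<^sup>2 * exp (T * D) * (2 * R)"
  have C: "0 \<le> C" unfolding C_def using R by simp
  have "norm (step \<tau> V - V - \<tau> *\<^sub>R TF V) \<le> C * \<tau>\<^sup>2" if \<tau>: "0 \<le> \<tau>" "\<tau> \<le> T" for \<tau> V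
  proof (cases "norm V \<le> 2 * R")
    case True
    define Z where "Z = iV ((\<tau> * th V) *\<^sub>R Zp V)"
    have Z: "prd Z V = \<tau> *\<^sub>R TF V"
      unfolding Z_def TF_def NL_def by (simp add: prd_iV iV_scaleR prd.scaleR_left)
    have "norm Z = \<tau> * (\<bar>th V\<bar> * norm (Zp V))" unfolding Z_def using \<tau> by (simp add: abs_mult)
    also have "\<dots> \<le> \<tau> * (3 * L * B)"
      using \<tau> L_nonneg by (intro mult_left_mono mult_mono th_bound B True) auto
    finally have "2 * Kp 0 * norm Z \<le> 2 * Kp 0 * (\<tau> * (3 * L * B))"
      using Kp_nonneg[of 0] by (intro mult_left_mono) auto
    then have c: "2 * Kp 0 * norm Z \<le> \<tau> * D" unfolding D_def by (simp add: mult_ac)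
    have c0: "0 \<le> 2 * Kp 0 * norm Z" using Kp_nonneg by simp
    have cT: "2 * Kp 0 * norm Z \<le> T * D" using c mult_right_mono[OF \<tau>(2) D] by linarith
    have "norm (step \<tau> V - V - \<tau> *\<^sub>R TF V) \<le> (2 * Kp 0 * norm Z)\<^sup>2 * exp (2 * Kp 0 * norm Z) * norm V"
      using expo_taylor[of Z V] unfolding step_def Z Z_def[symmetric] .
    also have "\<dots> \<le> (\<tau> * D)\<^sup>2 * exp (T * D) * (2 * R)"
      by (intro mult_mono power_mono c c0 True) (use cT R in auto)
    also have "\<dots> = C * \<tau>\<^sup>2" unfolding C_def by (simp add: power_mult_distrib mult_ac)
    finally show ?thesis .
  next
    case False
    then have "step \<tau> V = V" "th V = 0" using step_large[of V] th_zero[of V] by auto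
    then show ?thesis using C by (simp add: TF_def)
  qed
  then show ?thesis using C by blast
qed

text \<open>The preimages under \<open>J r\<close> again form an absolutely convergent series, and
  \<open>J r\<close> is continuous.\<close>

lemma reg_suminf:
  assumes V: "\<And>k. reg r (B k) (V k)" and B: "summable B" and sV: "summable V" and r: "0 \<le> r"
  shows "reg r (\<Sum>k. B k) (\<Sum>k. V k)"
proof -
  have "\<forall>k. \<exists>V'. norm V' \<le> B k \<and> V k = J r V'" using V unfolding reg_def by blast
  then obtain V' where V': "\<And>k. norm (V' k) \<le> B k" "\<And>k. V k = J r (V' k)" by metis
  have s: "summable V'" by (rule summable_comparison_test'[OF B, of 0]) (use V' in simp)
  interpret J: bounded_linear "J r" by (rule bounded_linear_J[OF r])
  have "norm (\<Sum>k. V' k) \<le> (\<Sum>k. B k)" by (rule norm_suminf_le[OF V'(1) B])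
  moreover have "(\<Sum>k. V k) = J r (\<Sum>k. V' k)"
    unfolding V'(2) by (rule J.suminf[OF s, symmetric])
  ultimately show ?thesis unfolding reg_def by blast
qed

text \<open>Factors exp (c \<tau>) of successive steps multiply to exp (c T) whatever their number,
  provided c is independent of \<nu>. Tameness supplies this: V is in the ball of radius 2R, so all
  lower norms are bounded and each term of the exponential series is linear in \<nu>.\<close>

lemma step_reg: "\<exists>c\<ge>0. \<forall>\<tau> \<nu> V. 0 \<le> \<tau> \<longrightarrow> reg 4 \<nu> V \<longrightarrow> reg 4 (\<nu> * exp (c * \<tau>)) (step \<tau> V)"
proof -
  obtain B where B: "0 \<le> B" "\<And>V. norm V \<le> 2 * R \<Longrightarrow> norm (Zp V) \<le> B"
    using pol_bound[OF pol_Zp] by blast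
  obtain A where A: "0 \<le> A" "\<And>V \<nu>. norm V \<le> 2 * R \<Longrightarrow> reg 4 \<nu> V \<Longrightarrow> reg 4 (A * \<nu>) (Zp V)"
    using pol_tame[OF pol_Zp] by blast
  define \<alpha> where "\<alpha> = 3 * L * (A + B)"
  have \<alpha>: "0 \<le> \<alpha>" unfolding \<alpha>_def using L_nonneg A B by simp
  \<comment> \<open>The summand with \<open>Kp 4\<close> controls the passage from one term of the
    series to the next: 2R when the extra regularity falls on Z, 1 when it falls on the previous
    term. The summand \<open>2 * Kp 0\<close> controls the norms.\<close>
  define M where "M = Kp 4 * (2 * R + 1) + 2 * Kp 0"
  have M: "0 \<le> M" "2 * Kp 0 \<le> M" "Kp 4 * (2 * R + 1) \<le> M"
    unfolding M_def using Kp_nonneg[of 4] Kp_nonneg[of 0] R by auto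
  define c where "c = \<alpha> * M"
  have c: "0 \<le> c" unfolding c_def using \<alpha> M by simp
  have "reg 4 (\<nu> * exp (c * \<tau>)) (step \<tau> V)" if \<tau>: "0 \<le> \<tau>" and V: "reg 4 \<nu> V" for \<tau> \<nu> V
  proof (cases "norm V \<le> 2 * R")
    case True
    have \<nu>: "0 \<le> \<nu>" using reg_norm[OF _ V] norm_ge_zero[of V] by (meson order_trans zero_le_numeral)
    define Z where "Z = iV ((\<tau> * th V) *\<^sub>R Zp V)"
    have t: "\<bar>\<tau> * th V\<bar> \<le> \<tau> * (3 * L)"
      using \<tau> th_bound[of V] by (simp add: abs_mult mult_left_mono)
    have "norm Z = \<bar>\<tau> * th V\<bar> * norm (Zp V)" unfolding Z_def by simp
    also have "\<dots> \<le> (\<tau> * (3 * L)) * B" using \<tau> L_nonneg by (intro mult_mono t B True) auto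
    also have "\<dots> \<le> \<tau> * \<alpha>" unfolding \<alpha>_def using \<tau> L_nonneg A by (simp add: algebra_simps)
    finally have nZ: "norm Z \<le> \<tau> * \<alpha>" .
    have "reg 4 (\<bar>\<tau> * th V\<bar> * (A * \<nu>)) Z"
      unfolding Z_def by (intro reg_iV reg_scaleR A V True) simp
    then have rZ: "reg 4 (\<tau> * \<alpha> * \<nu>) Z"
    proof (rule reg_mono)
      have "\<bar>\<tau> * th V\<bar> * (A * \<nu>) \<le> (\<tau> * (3 * L)) * (A * \<nu>)" using A \<nu> by (intro mult_right_mono t) auto
      also have "\<dots> \<le> \<tau> * \<alpha> * \<nu>" unfolding \<alpha>_def using \<tau> L_nonneg B \<nu> by (simp add: algebra_simps)
      finally show "\<bar>\<tau> * th V\<bar> * (A * \<nu>) \<le> \<tau> * \<alpha> * \<nu>" .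
    qed
    have ct: "0 \<le> c * \<tau>" using c \<tau> by simp
    have "2 * Kp 0 * norm Z \<le> M * (\<tau> * \<alpha>)" using M nZ Kp_nonneg[of 0] by (intro mult_mono) auto
    then have kz: "2 * Kp 0 * norm Z \<le> c * \<tau>" unfolding c_def by (simp add: mult_ac)
    have ntm: "norm (tm Z V k) \<le> (c * \<tau>) ^ k * (2 * R)" for k
    proof -
      have "norm (tm Z V k) \<le> (2 * Kp 0 * norm Z) ^ k * norm V" by (rule norm_tm)
      also have "\<dots> \<le> (c * \<tau>) ^ k * (2 * R)"
        by (rule mult_mono[OF power_mono[OF kz] True]) (use ct Kp_nonneg[of 0] in auto)
      finally show ?thesis .
    qed
    have rtm: "reg 4 (\<nu> * (c * \<tau>) ^ k) (tm Z V k)" for k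
    proof (induction k)
      case 0 then show ?case using V by simp
    next
      case (Suc k)
      have "reg 4 (Kp 4 * ((\<tau> * \<alpha> * \<nu>) * ((c * \<tau>) ^ k * (2 * R)) + (\<tau> * \<alpha>) * (\<nu> * (c * \<tau>) ^ k))) (prd Z (tm Z V k))"
        by (rule reg_prd[OF _ rZ nZ Suc ntm]) simp
      then have "reg 4 (\<nu> * (c * \<tau>) ^ Suc k) (prd Z (tm Z V k))"
      proof (rule reg_mono)
        have "Kp 4 * ((\<tau> * \<alpha> * \<nu>) * ((c * \<tau>) ^ k * (2 * R)) + (\<tau> * \<alpha>) * (\<nu> * (c * \<tau>) ^ k))
            = (Kp 4 * (2 * R + 1)) * (\<tau> * \<alpha> * \<nu> * (c * \<tau>) ^ k)" by (simp add: algebra_simps)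
        also have "\<dots> \<le> M * (\<tau> * \<alpha> * \<nu> * (c * \<tau>) ^ k)"
          using \<tau> \<alpha> \<nu> ct by (intro mult_right_mono M) auto
        also have "\<dots> = \<nu> * (c * \<tau>) ^ Suc k" by (simp add: c_def mult_ac)
        finally show "Kp 4 * ((\<tau> * \<alpha> * \<nu>) * ((c * \<tau>) ^ k * (2 * R)) + (\<tau> * \<alpha>) * (\<nu> * (c * \<tau>) ^ k)) \<le> \<nu> * (c * \<tau>) ^ Suc k" .
      qed
      then show ?case by simp
    qed
    have rk: "reg 4 ((c * \<tau>) ^ k / fact k * \<nu>) ((1 / fact k) *\<^sub>R tm Z V k)" for k
      using reg_scaleR[OF _ rtm[of k], of "1 / fact k"] by (simp add: mult_ac)
    have "reg 4 (\<Sum>k. (c * \<tau>) ^ k / fact k * \<nu>) (expo Z V)"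
      unfolding expo_def by (rule reg_suminf[OF rk summable_exp_real expo_summable]) simp
    then show ?thesis unfolding suminf_exp_real step_def Z_def by (simp add: mult.commute)
  next
    case False
    have \<nu>: "0 \<le> \<nu>" using reg_norm[OF _ V] norm_ge_zero[of V] by (meson order_trans zero_le_numeral)
    have "\<nu> * 1 \<le> \<nu> * exp (c * \<tau>)" using c \<tau> \<nu> by (intro mult_left_mono) auto
    then show ?thesis using step_large[of V \<tau>] False reg_mono[OF V] by simp
  qed
  then show ?thesis using c by blast
qed

section \<open>The scheme in the interaction picture\<close>

text \<open>The sampled path \<open>w j\<close> stands for \<open>W(j \<delta>)\<close>, and the scheme is conjugated by
  \<open>U (w j)\<close>. The initial twist \<open>U (- w 0)\<close> avoids a normalisation of the path at time \<open>0\<close>.\<close>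

primrec tw :: "real \<Rightarrow> (nat \<Rightarrow> real) \<Rightarrow> l2 \<Rightarrow> nat \<Rightarrow> l2" where
  "tw \<delta> w u0 0 = U (- w 0) u0"
| "tw \<delta> w u0 (Suc j) = U (- w j) (step \<delta> (U (w j) (tw \<delta> w u0 j)))"

lemma tw_cong: "(\<And>i. i \<le> j \<Longrightarrow> w i = w' i) \<Longrightarrow> tw \<delta> w u0 j = tw \<delta> w' u0 j"
  by (induction j) auto

lemma tw_continuous: "continuous_on UNIV (\<lambda>w. tw \<delta> w u0 j)"
proof (induction j)
  case 0
  show ?case by (simp, intro continuous_intros continuous_on_product_coordinates)
next
  case (Suc j)
  have "continuous_on UNIV (\<lambda>w. step \<delta> (U (w j) (tw \<delta> w u0 j)))"
    by (rule continuous_on_compose2[OF step_continuous continuous_U]) (auto intro: Suc continuous_on_product_coordinates)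
  then show ?case by (simp, intro continuous_intros continuous_on_product_coordinates)
qed

lemma tw_reg:
  "\<exists>c\<ge>0. \<forall>\<nu> u0 \<delta> w j. reg 4 \<nu> u0 \<longrightarrow> 0 \<le> \<delta> \<longrightarrow> reg 4 (\<nu> * exp (c * (real j * \<delta>))) (tw \<delta> w u0 j)"
proof -
  obtain c where c: "0 \<le> c" "\<And>\<tau> \<nu> V. 0 \<le> \<tau> \<Longrightarrow> reg 4 \<nu> V \<Longrightarrow> reg 4 (\<nu> * exp (c * \<tau>)) (step \<tau> V)"
    using step_reg by blast
  have "reg 4 (\<nu> * exp (c * (real j * \<delta>))) (tw \<delta> w u0 j)" if "reg 4 \<nu> u0" "0 \<le> \<delta>" for \<nu> u0 \<delta> w j
  proof (induction j)
    case 0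
    show ?case using reg_U[OF _ that(1)] by simp
  next
    case (Suc j)
    have "reg 4 (\<nu> * exp (c * (real j * \<delta>)) * exp (c * \<delta>)) (step \<delta> (U (w j) (tw \<delta> w u0 j)))"
      by (intro c that reg_U Suc) simp
    then have "reg 4 (\<nu> * exp (c * (real j * \<delta>)) * exp (c * \<delta>)) (tw \<delta> w u0 (Suc j))"
      by (simp add: reg_U)
    moreover have "\<nu> * exp (c * (real j * \<delta>)) * exp (c * \<delta>) = \<nu> * exp (c * (real (Suc j) * \<delta>))"
      by (simp add: exp_add[symmetric] algebra_simps)
    ultimately show ?case by (simp only:)
  qed
  then show ?thesis using c(1) by blast
qed

text \<open>The change of frame is isometric and already contained in \<open>G\<close>, so the local
  defect of the nonlinear step passes over unchanged.\<close>

lemma tw_increment: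
  assumes C: "\<And>V. norm (step \<delta> V - V - \<delta> *\<^sub>R TF V) \<le> C * \<delta>\<^sup>2"
  shows "norm (tw \<delta> w u0 (Suc j) - tw \<delta> w u0 j - \<delta> *\<^sub>R G (w j) (tw \<delta> w u0 j)) \<le> C * \<delta>\<^sup>2"
proof -
  let ?V = "U (w j) (tw \<delta> w u0 j)"
  have "tw \<delta> w u0 (Suc j) - tw \<delta> w u0 j - \<delta> *\<^sub>R G (w j) (tw \<delta> w u0 j) = U (- w j) (step \<delta> ?V - ?V - \<delta> *\<^sub>R TF ?V)"
    by (simp add: U_diff U_scaleR G_def)
  then show ?thesis using C[of ?V] by simp
qed

text \<open>The group parameter is shifted by the deterministic amount h, not by a future increment
  of the path, so the quotient depends on the past alone as soon as a and V do.\<close>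

definition Adr :: "real \<Rightarrow> real \<Rightarrow> l2 \<Rightarrow> l2" where
  "Adr h a V = (1 / h) *\<^sub>R (G (a + h) V - G a V)"

text \<open>A deterministic estimate: for given T and \<nu> one constant serves all paths, step
  sizes and refinements. The last term is kept as the norm of a sum, since its cancellation is
  probabilistic and would be lost with the norm inside.\<close>

lemma scheme_compare:
  assumes T: "0 < T"
  obtains C where "0 \<le> C"
    "\<And>w u0 h m n. reg 4 \<nu> u0 \<Longrightarrow> 0 < h \<Longrightarrow> h \<le> T \<Longrightarrow> 1 \<le> m \<Longrightarrow> real n * h \<le> T \<Longrightarrow>
       norm (tw (h / real m) w u0 (n * m) - tw h (\<lambda>k. w (k * m)) u0 n)
       \<le> C * h * (\<Sum>k<n. norm (tw (h / real m) w u0 (k * m) - tw h (\<lambda>k. w (k * m)) u0 k))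
         + C * h + C * (\<Sum>k<n. \<Sum>j<m. h / real m * ((w (k * m + j) - w (k * m))\<^sup>2 + \<bar>w (k * m + j) - w (k * m)\<bar> * h))
         + norm (\<Sum>k<n. (\<Sum>j<m. h / real m * (w (k * m + j) - w (k * m))) *\<^sub>R Adr h (w (k * m)) (tw (h / real m) w u0 (k * m)))"
    "\<And>w u0 h m k. reg 4 \<nu> u0 \<Longrightarrow> 0 < h \<Longrightarrow> 1 \<le> m \<Longrightarrow> real k * h \<le> T \<Longrightarrow>
       norm (Adr h (w (k * m)) (tw (h / real m) w u0 (k * m))) \<le> C"
    "\<And>w u0 h n. reg 4 \<nu> u0 \<Longrightarrow> 0 < h \<Longrightarrow> real n * h \<le> T \<Longrightarrow> norm (tw h w u0 n) \<le> C"
proof -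
  obtain c where c: "0 \<le> c" "\<And>\<nu> u0 \<delta> w j. reg 4 \<nu> u0 \<Longrightarrow> 0 \<le> \<delta> \<Longrightarrow> reg 4 (\<nu> * exp (c * (real j * \<delta>))) (tw \<delta> w u0 j)"
    using tw_reg by blast
  define \<mu> where "\<mu> = \<bar>\<nu>\<bar> * exp (c * T)"
  have twreg: "reg 4 \<mu> (tw \<delta> w u0 j)" if "reg 4 \<nu> u0" "0 \<le> \<delta>" "real j * \<delta> \<le> T" for w u0 \<delta> j
  proof (rule reg_mono[OF c(2)[OF that(1,2)]])
    have "c * (real j * \<delta>) \<le> c * T" using that c(1) by (intro mult_left_mono) auto
    then show "\<nu> * exp (c * (real j * \<delta>)) \<le> \<mu>" unfolding \<mu>_def by (intro mult_mono) auto
  qed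
  obtain B where B: "0 \<le> B" "\<And>a b h W. reg 4 \<mu> W \<Longrightarrow> 0 < h \<Longrightarrow>
      norm (G (a + b) W - G a W - (b / h) *\<^sub>R (G (a + h) W - G a W)) \<le> B * (b\<^sup>2 + \<bar>b\<bar> * h)"
    "\<And>a h W. reg 4 \<mu> W \<Longrightarrow> 0 < h \<Longrightarrow> norm (G (a + h) W - G a W) \<le> B * h"
    using G_expand[of \<mu>] by blast
  obtain S where S: "0 \<le> S" "\<And>\<tau> V. 0 \<le> \<tau> \<Longrightarrow> \<tau> \<le> T \<Longrightarrow> norm (step \<tau> V - V - \<tau> *\<^sub>R TF V) \<le> S * \<tau>\<^sup>2"
    using step_taylor[of T] by blast
  \<comment> \<open>Contributions of order h^2 in one coarse step: the Euler defects of both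
    schemes, and the motion of the fine scheme within the step, at speed at most
    \<open>KF + S * T\<close>.\<close>
  define E where "E = 2 * S + KF * (KF + S * T)"
  have E: "0 \<le> E" unfolding E_def using S KF(1) T by simp
  define C where "C = KF + E * T + B + \<mu>"
  have \<mu>0: "0 \<le> \<mu>" unfolding \<mu>_def by simp
  have ET: "0 \<le> E * T" using E T by simp
  have C: "0 \<le> C" "KF \<le> C" "E * T \<le> C" "B \<le> C" "\<mu> \<le> C"
    unfolding C_def using KF(1) ET B(1) \<mu>0 by auto
  show thesis
  proof (rule that[OF C(1)])
    fix w :: "nat \<Rightarrow> real" and u0 h and n :: nat
    assume "reg 4 \<nu> u0" "0 < h" "real n * h \<le> T"
    then have "norm (tw h w u0 n) \<le> \<mu>" using reg_norm[OF _ twreg] by simp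
    then show "norm (tw h w u0 n) \<le> C" using C(5) by simp
  next
    fix w :: "nat \<Rightarrow> real" and u0 h and m k :: nat
    assume a: "reg 4 \<nu> u0" "0 < h" "1 \<le> m" "real k * h \<le> T"
    have r: "reg 4 \<mu> (tw (h / real m) w u0 (k * m))" using a by (intro twreg) auto
    have "norm (Adr h (w (k * m)) (tw (h / real m) w u0 (k * m))) \<le> (1 / h) * (B * h)"
      unfolding Adr_def norm_scaleR using a B(3)[OF r a(2)] by (intro mult_mono) auto
    then show "norm (Adr h (w (k * m)) (tw (h / real m) w u0 (k * m))) \<le> C" using a C(4) by simp
  next
    fix w :: "nat \<Rightarrow> real" and u0 h and m n :: nat
    assume u0: "reg 4 \<nu> u0" and h: "0 < h" "h \<le> T" and m: "1 \<le> m" and nh: "real n * h \<le> T"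
    define \<delta> where "\<delta> = h / real m"
    have \<delta>: "0 < \<delta>" "\<delta> \<le> T" "real m * \<delta> = h" "\<delta> \<le> h"
    proof -
      have "\<delta> \<le> h / 1" unfolding \<delta>_def using h m by (intro divide_left_mono) auto
      then show "0 < \<delta>" "\<delta> \<le> T" "real m * \<delta> = h" "\<delta> \<le> h" using h m unfolding \<delta>_def by auto
    qed
    define V where "V j = tw \<delta> w u0 j" for j
    define v where "v k = tw h (\<lambda>k. w (k * m)) u0 k" for k
    define b where "b k j = w (k * m + j) - w (k * m)" for k j
    define A where "A k = Adr h (w (k * m)) (V (k * m))" for k
    define I where "I k = (\<Sum>j<m. \<delta> * b k j)" for k
    define rem where "rem k = (\<Sum>j<m. \<delta> * ((b k j)\<^sup>2 + \<bar>b k j\<bar> * h))" for k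
    define e where "e k = norm (V (k * m) - v k)" for k
    have Vinc: "norm (V (Suc j) - V j - \<delta> *\<^sub>R G (w j) (V j)) \<le> S * \<delta>\<^sup>2" for j
      unfolding V_def by (rule tw_increment) (use S(2)[of \<delta>] \<delta> in simp)
    have vinc: "norm (v (Suc k) - v k - h *\<^sub>R G (w (k * m)) (v k)) \<le> S * h\<^sup>2" for k
      unfolding v_def by (rule tw_increment[of h S "\<lambda>k. w (k * m)"]) (use S(2)[of h] h in simp)
    have Vstep: "norm (V (Suc j) - V j) \<le> \<delta> * (KF + S * T)" for j
    proof -
      have "norm (V (Suc j) - V j) \<le> norm (V (Suc j) - V j - \<delta> *\<^sub>R G (w j) (V j)) + norm (\<delta> *\<^sub>R G (w j) (V j))"
        using norm_triangle_ineq[of "V (Suc j) - V j - \<delta> *\<^sub>R G (w j) (V j)" "\<delta> *\<^sub>R G (w j) (V j)"] by simp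
      also have "\<dots> \<le> S * \<delta>\<^sup>2 + \<delta> * KF"
        using Vinc[of j] \<delta> by (auto intro!: add_mono mult_left_mono norm_G_le)
      also have "S * \<delta>\<^sup>2 \<le> S * (\<delta> * T)"
        unfolding power2_eq_square using \<delta> S(1) by (intro mult_left_mono) auto
      finally show ?thesis by (simp add: algebra_simps)
    qed
    have Vdist: "norm (V (i + j) - V i) \<le> real j * (\<delta> * (KF + S * T))" for i j
    proof (induction j)
      case (Suc j)
      have "norm (V (i + Suc j) - V i) \<le> norm (V (Suc (i + j)) - V (i + j)) + norm (V (i + j) - V i)"
        using norm_triangle_ineq[of "V (Suc (i + j)) - V (i + j)" "V (i + j) - V i"] by simp
      then show ?case using Vstep[of "i + j"] Suc by (simp add: distrib_right)
    qed simp
    have D: "norm ((V (Suc k * m) - V (k * m)) - (v (Suc k) - v k) - I k *\<^sub>R A k) \<le> E * h\<^sup>2 + B * rem k + h * KF * e k"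
      if k: "k < n" for k
    proof -
      have kh: "real k * h \<le> T" using nh k h by (smt (verit) mult_right_mono of_nat_less_iff)
      have Vreg: "reg 4 \<mu> (V (k * m))" unfolding V_def
        by (rule twreg[OF u0]) (use \<delta> kh in \<open>auto simp: mult.assoc\<close>)
      let ?a = "w (k * m)"
      \<comment> \<open>Five sources of error: the defects of the fine scheme (x1), its motion
        within the coarse step (x2), the remainder of the expansion of \<open>G\<close> along the
        path (x3), the propagated earlier error (x4) and the defect of the coarse scheme (x5). The
        linear part of the expansion is split off as \<open>I k *\<^sub>R A k\<close>.\<close>
      define x1 where "x1 = (\<Sum>j<m. V (Suc (k * m + j)) - V (k * m + j) - \<delta> *\<^sub>R G (w (k * m + j)) (V (k * m + j)))"
      define x2 where "x2 = (\<Sum>j<m. \<delta> *\<^sub>R (G (w (k * m + j)) (V (k * m + j)) - G (w (k * m + j)) (V (k * m))))"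
      define x3 where "x3 = (\<Sum>j<m. \<delta> *\<^sub>R (G (?a + b k j) (V (k * m)) - G ?a (V (k * m)) - (b k j / h) *\<^sub>R (G (?a + h) (V (k * m)) - G ?a (V (k * m)))))"
      define x4 where "x4 = h *\<^sub>R (G ?a (V (k * m)) - G ?a (v k))"
      define x5 where "x5 = v (Suc k) - v k - h *\<^sub>R G ?a (v k)"
      have tele: "V (Suc k * m) - V (k * m) = (\<Sum>j<m. V (Suc (k * m + j)) - V (k * m + j))"
        using sum_lessThan_telescope[of "\<lambda>j. V (k * m + j)" m] by (simp add: add.commute)
      have wb: "w (k * m + j) = ?a + b k j" for j unfolding b_def by simp
      have IA: "I k *\<^sub>R A k = (\<Sum>j<m. \<delta> *\<^sub>R ((b k j / h) *\<^sub>R (G (?a + h) (V (k * m)) - G ?a (V (k * m)))))"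
        unfolding I_def A_def Adr_def by (simp add: scaleR_left.sum sum_divide_distrib)
      have hsum: "h *\<^sub>R G ?a (V (k * m)) = (\<Sum>j<m. \<delta> *\<^sub>R G ?a (V (k * m)))"
        using \<delta>(3) by (simp add: sum_constant_scaleR)
      have "(V (Suc k * m) - V (k * m)) - (v (Suc k) - v k) - I k *\<^sub>R A k = x1 + x2 + x3 + x4 - x5"
      proof -
        have "x1 + x2 + x3 = (\<Sum>j<m. V (Suc (k * m + j)) - V (k * m + j)) - I k *\<^sub>R A k - h *\<^sub>R G ?a (V (k * m))"
          unfolding x1_def x2_def x3_def IA hsum sum.distrib[symmetric] sum_subtractf[symmetric] wb
          by (rule sum.cong) (simp_all add: algebra_simps)
        then show ?thesis unfolding tele x4_def x5_def by (simp add: algebra_simps)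
      qed
      then have "norm ((V (Suc k * m) - V (k * m)) - (v (Suc k) - v k) - I k *\<^sub>R A k)
          \<le> norm x1 + norm x2 + norm x3 + norm x4 + norm x5"
        by (smt (verit) norm_triangle_ineq norm_triangle_ineq4)
      moreover have "norm x1 \<le> S * h\<^sup>2"
      proof -
        have "norm x1 \<le> (\<Sum>j<m. S * \<delta>\<^sup>2)" unfolding x1_def by (rule sum_norm_le) (rule Vinc)
        also have "\<dots> = S * (h * \<delta>)" using \<delta>(3) by (simp add: power2_eq_square mult_ac)
        also have "\<dots> \<le> S * (h * h)" using \<delta> h S(1) by (intro mult_left_mono) auto
        finally show ?thesis by (simp add: power2_eq_square)
      qed
      moreover have "norm x2 \<le> KF * (KF + S * T) * h\<^sup>2"
      proof -
        have "norm x2 \<le> (\<Sum>j<m. \<delta> * (KF * (h * (KF + S * T))))" unfolding x2_def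
        proof (rule sum_norm_le)
          fix j assume j: "j \<in> {..<m}"
          have "norm (V (k * m + j) - V (k * m)) \<le> real j * (\<delta> * (KF + S * T))" by (rule Vdist)
          also have "\<dots> \<le> real m * (\<delta> * (KF + S * T))"
            using j \<delta> KF(1) S(1) T by (intro mult_right_mono) auto
          also have "\<dots> = h * (KF + S * T)" using \<delta>(3) by (simp add: mult.assoc[symmetric])
          finally have 1: "norm (V (k * m + j) - V (k * m)) \<le> h * (KF + S * T)" .
          have "norm (G (w (k * m + j)) (V (k * m + j)) - G (w (k * m + j)) (V (k * m))) \<le> KF * norm (V (k * m + j) - V (k * m))"
            by (rule G_lip)
          also have "\<dots> \<le> KF * (h * (KF + S * T))" by (intro mult_left_mono 1 KF(1))
          finally show "norm (\<delta> *\<^sub>R (G (w (k * m + j)) (V (k * m + j)) - G (w (k * m + j)) (V (k * m)))) \<le> \<delta> * (KF * (h * (KF + S * T)))"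
            using \<delta>(1) by (simp add: mult_left_mono)
        qed
        also have "\<dots> = (real m * \<delta>) * (KF * (h * (KF + S * T)))" by simp
        also have "\<dots> = KF * (KF + S * T) * h\<^sup>2" unfolding \<delta>(3) by (simp add: power2_eq_square mult_ac)
        finally show ?thesis .
      qed
      moreover have "norm x3 \<le> B * rem k"
      proof -
        have "norm x3 \<le> (\<Sum>j<m. B * (\<delta> * ((b k j)\<^sup>2 + \<bar>b k j\<bar> * h)))" unfolding x3_def
        proof (rule sum_norm_le)
          fix j
          show "norm (\<delta> *\<^sub>R (G (?a + b k j) (V (k * m)) - G ?a (V (k * m)) - (b k j / h) *\<^sub>R (G (?a + h) (V (k * m)) - G ?a (V (k * m)))))
             \<le> B * (\<delta> * ((b k j)\<^sup>2 + \<bar>b k j\<bar> * h))"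
            using mult_left_mono[OF B(2)[OF Vreg h(1), of ?a "b k j"], of \<delta>] \<delta>(1) by (simp add: mult.left_commute)
        qed
        then show ?thesis unfolding rem_def by (simp add: sum_distrib_left)
      qed
      moreover have "norm x4 \<le> h * KF * e k"
        unfolding x4_def e_def using mult_left_mono[OF G_lip[of ?a "V (k * m)" "v k"], of h] h by (simp add: mult.assoc)
      moreover have "norm x5 \<le> S * h\<^sup>2" unfolding x5_def by (rule vinc)
      ultimately show ?thesis unfolding E_def by (simp add: algebra_simps)
    qed
    have "V (n * m) - v n = (\<Sum>k<n. (V (Suc k * m) - V (k * m)) - (v (Suc k) - v k))"
      using sum_lessThan_telescope[of "\<lambda>k. V (k * m) - v k" n] by (simp add: V_def v_def algebra_simps)
    also have "\<dots> = (\<Sum>k<n. (V (Suc k * m) - V (k * m)) - (v (Suc k) - v k) - I k *\<^sub>R A k) + (\<Sum>k<n. I k *\<^sub>R A k)"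
      by (simp add: sum.distrib[symmetric])
    finally have "e n = norm ((\<Sum>k<n. (V (Suc k * m) - V (k * m)) - (v (Suc k) - v k) - I k *\<^sub>R A k) + (\<Sum>k<n. I k *\<^sub>R A k))"
      unfolding e_def by (rule arg_cong)
    also have "\<dots> \<le> norm (\<Sum>k<n. (V (Suc k * m) - V (k * m)) - (v (Suc k) - v k) - I k *\<^sub>R A k) + norm (\<Sum>k<n. I k *\<^sub>R A k)"
      by (rule norm_triangle_ineq)
    also have "norm (\<Sum>k<n. (V (Suc k * m) - V (k * m)) - (v (Suc k) - v k) - I k *\<^sub>R A k)
        \<le> (\<Sum>k<n. E * h\<^sup>2 + B * rem k + h * KF * e k)"
      by (rule sum_norm_le) (use D in simp)
    also have "\<dots> = real n * (E * h\<^sup>2) + B * (\<Sum>k<n. rem k) + h * KF * (\<Sum>k<n. e k)"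
      by (simp add: sum.distrib sum_distrib_left)
    also have "\<dots> \<le> C * h + C * (\<Sum>k<n. rem k) + C * h * (\<Sum>k<n. e k)"
    proof -
      have "real n * (E * h\<^sup>2) = E * (real n * h) * h" by (simp add: power2_eq_square)
      also have "\<dots> \<le> E * T * h" using nh E h by (intro mult_right_mono mult_left_mono) auto
      also have "\<dots> \<le> C * h" using C(3) h by (intro mult_right_mono) auto
      finally have 1: "real n * (E * h\<^sup>2) \<le> C * h" .
      have "0 \<le> (\<Sum>k<n. rem k)" unfolding rem_def using \<delta> h by (intro sum_nonneg mult_nonneg_nonneg add_nonneg_nonneg) auto
      then have 2: "B * (\<Sum>k<n. rem k) \<le> C * (\<Sum>k<n. rem k)" using C(4) by (intro mult_right_mono) auto
      have "0 \<le> (\<Sum>k<n. e k)" unfolding e_def by (intro sum_nonneg) auto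
      then have 3: "h * KF * (\<Sum>k<n. e k) \<le> C * h * (\<Sum>k<n. e k)"
        using C(2) h by (intro mult_right_mono) (auto simp: mult.commute)
      show ?thesis using 1 2 3 by linarith
    qed
    finally have "e n \<le> C * h * (\<Sum>k<n. e k) + C * h + C * (\<Sum>k<n. rem k) + norm (\<Sum>k<n. I k *\<^sub>R A k)" by simp
    then show "norm (tw (h / real m) w u0 (n * m) - tw h (\<lambda>k. w (k * m)) u0 n)
       \<le> C * h * (\<Sum>k<n. norm (tw (h / real m) w u0 (k * m) - tw h (\<lambda>k. w (k * m)) u0 k))
         + C * h + C * (\<Sum>k<n. \<Sum>j<m. h / real m * ((w (k * m + j) - w (k * m))\<^sup>2 + \<bar>w (k * m + j) - w (k * m)\<bar> * h))
         + norm (\<Sum>k<n. (\<Sum>j<m. h / real m * (w (k * m + j) - w (k * m))) *\<^sub>R Adr h (w (k * m)) (tw (h / real m) w u0 (k * m)))"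
      unfolding e_def rem_def I_def A_def V_def v_def b_def \<delta>_def .
  qed
qed

end

section \<open>Mean square comparison of two step sizes\<close>

lemma discrete_gronwall:
  fixes a :: "nat \<Rightarrow> real"
  assumes a: "\<And>n. n \<le> N \<Longrightarrow> a n \<le> A + c * (\<Sum>k<n. a k)" and c: "0 \<le> c" and A: "0 \<le> A" and n: "n \<le> N"
  shows "a n \<le> A * exp (c * real n)"
proof -
  \<comment> \<open>The comparison sequence satisfies the recursion with equality.\<close>
  have geo: "A + c * (\<Sum>k<n. A * (1 + c) ^ k) = A * (1 + c) ^ n" for n
    by (induction n) (simp_all add: algebra_simps)
  have "n \<le> N \<Longrightarrow> a n \<le> A * (1 + c) ^ n" for n
  proof (induction n rule: less_induct)
    case (less n)
    have "a n \<le> A + c * (\<Sum>k<n. a k)" by (rule a[OF less(2)])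
    also have "\<dots> \<le> A + c * (\<Sum>k<n. A * (1 + c) ^ k)"
      using less c by (intro add_left_mono mult_left_mono sum_mono) auto
    finally show ?case by (simp only: geo)
  qed
  then have "a n \<le> A * (1 + c) ^ n" using n by blast
  also have "\<dots> \<le> A * exp c ^ n" using c A by (intro mult_left_mono power_mono) auto
  also have "exp c ^ n = exp (c * real n)" by (simp add: exp_of_nat_mult[symmetric] mult.commute)
  finally show ?thesis .
qed

lemma sum_sq_le:
  fixes p x :: "'a \<Rightarrow> real"
  assumes "finite S" "\<And>i. i \<in> S \<Longrightarrow> 0 \<le> p i"
  shows "(\<Sum>i\<in>S. p i * x i)\<^sup>2 \<le> (\<Sum>i\<in>S. p i) * (\<Sum>i\<in>S. p i * (x i)\<^sup>2)"
proof -
  have "(\<Sum>i\<in>S. sqrt (p i) * (sqrt (p i) * x i))\<^sup>2 \<le> (\<Sum>i\<in>S. (sqrt (p i))\<^sup>2) * (\<Sum>i\<in>S. (sqrt (p i) * x i)\<^sup>2)"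
    by (rule Cauchy_Schwarz_ineq_sum)
  moreover have "(\<Sum>i\<in>S. sqrt (p i) * (sqrt (p i) * x i)) = (\<Sum>i\<in>S. p i * x i)"
    by (rule sum.cong) (use assms in \<open>simp_all add: mult.assoc[symmetric]\<close>)
  moreover have "(\<Sum>i\<in>S. (sqrt (p i))\<^sup>2) = (\<Sum>i\<in>S. p i)"
    by (rule sum.cong) (use assms in simp_all)
  moreover have "(\<Sum>i\<in>S. (sqrt (p i) * x i)\<^sup>2) = (\<Sum>i\<in>S. p i * (x i)\<^sup>2)"
    by (rule sum.cong) (use assms in \<open>simp_all add: power_mult_distrib\<close>)
  ultimately show ?thesis by simp
qed

lemma norm_add_scaleR_sq:
  "(norm (x + r *\<^sub>R y))\<^sup>2 = (norm x)\<^sup>2 + 2 * (r * inner x y) + r\<^sup>2 * (norm y)\<^sup>2"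
  for x y :: "'a::real_inner"
proof -
  have "inner (x + r *\<^sub>R y) (x + r *\<^sub>R y) = inner x x + 2 * (r * inner x y) + r * (r * inner y y)"
    by (simp add: inner_add_left inner_add_right inner_commute[of y x] algebra_simps)
  then show ?thesis by (simp only: power2_norm_eq_inner) (simp add: power2_eq_square algebra_simps)
qed

context brownian_motion
begin

lemma F_measurable_mono: "r \<le> t \<Longrightarrow> f \<in> borel_measurable (F r) \<Longrightarrow> f \<in> borel_measurable (F t)"
  using sets_F_mono[of r t] space_F[of r] space_F[of t] unfolding measurable_def by auto

lemma F_measurable: "f \<in> borel_measurable (F r) \<Longrightarrow> f \<in> borel_measurable M"
  by (rule measurable_from_subalg[OF subalgebra_F])

lemma W_measurable: "0 \<le> t \<Longrightarrow> W t \<in> borel_measurable M"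
  by (rule F_measurable[OF adapted])

lemma increment_moment:
  assumes "0 \<le> r" "r \<le> t"
  shows "integrable M (\<lambda>\<omega>. (W t \<omega> - W r \<omega>) ^ k)"
    and "expectation (\<lambda>\<omega>. W t \<omega> - W r \<omega>) = 0"
    and "expectation (\<lambda>\<omega>. (W t \<omega> - W r \<omega>)\<^sup>2) = t - r"
    and "expectation (\<lambda>\<omega>. (W t \<omega> - W r \<omega>) ^ 4) = 3 * (t - r)\<^sup>2"
proof -
  have "integrable M (\<lambda>\<omega>. (W t \<omega> - W r \<omega>) ^ k) \<and> expectation (\<lambda>\<omega>. W t \<omega> - W r \<omega>) = 0 \<and>
    expectation (\<lambda>\<omega>. (W t \<omega> - W r \<omega>)\<^sup>2) = t - r \<and> expectation (\<lambda>\<omega>. (W t \<omega> - W r \<omega>) ^ 4) = 3 * (t - r)\<^sup>2"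
  \<comment> \<open>The Gaussian law is available only for r < t, but the trivial increment occurs
    later at the left end of each coarse step.\<close>
  proof (cases "r = t")
    case True
    then show ?thesis by (cases k) simp_all
  next
    case False
    then have rt: "r < t" using assms by simp
    define \<rho> where "\<rho> = sqrt (t - r)"
    have \<rho>: "0 < \<rho>" "\<rho>\<^sup>2 = t - r" unfolding \<rho>_def using rt by auto
    have d: "distributed M lborel (\<lambda>\<omega>. W t \<omega> - W r \<omega>) (normal_density 0 \<rho>)"
      unfolding \<rho>_def by (rule gaussian_increments[OF assms(1) rt])
    have E: "expectation (\<lambda>\<omega>. (W t \<omega> - W r \<omega>) ^ j) = (\<integral>x. normal_density 0 \<rho> x * x ^ j \<partial>lborel)" for j
      by (rule distributed_integral[OF d, symmetric]) auto
    have int: "integrable M (\<lambda>\<omega>. (W t \<omega> - W r \<omega>) ^ k)"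
      using distributed_integrable[OF d, of "\<lambda>x. x ^ k"] integrable_normal_moment[OF \<rho>(1), of 0 k] by simp
    have 1: "expectation (\<lambda>\<omega>. W t \<omega> - W r \<omega>) = 0"
      using E[of 1] integral_normal_moment_odd[OF \<rho>(1), of 0 0] by simp
    have 2: "expectation (\<lambda>\<omega>. (W t \<omega> - W r \<omega>)\<^sup>2) = t - r"
      using E[of 2] integral_normal_moment_even[OF \<rho>(1), of 0 1] \<rho> by (simp add: fact_numeral)
    have 4: "expectation (\<lambda>\<omega>. (W t \<omega> - W r \<omega>) ^ 4) = 3 * (t - r)\<^sup>2"
      using E[of 4] integral_normal_moment_even[OF \<rho>(1), of 0 2] \<rho> by (simp add: fact_numeral power_divide)
    show ?thesis using int 1 2 4 by blast
  qed
  then show "integrable M (\<lambda>\<omega>. (W t \<omega> - W r \<omega>) ^ k)" "expectation (\<lambda>\<omega>. W t \<omega> - W r \<omega>) = 0"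
    "expectation (\<lambda>\<omega>. (W t \<omega> - W r \<omega>)\<^sup>2) = t - r" "expectation (\<lambda>\<omega>. (W t \<omega> - W r \<omega>) ^ 4) = 3 * (t - r)\<^sup>2"
    by blast+
qed

text \<open>An increment is centred and independent of the past. Y will be an inner product of
  vector valued quantities, so orthogonality in the Hilbert space reduces to this scalar fact and no
  vector valued conditional expectation appears.\<close>

lemma increment_mult:
  assumes rt: "0 \<le> r" "r \<le> t" and Y: "Y \<in> borel_measurable (F r)" "integrable M Y"
  shows "integrable M (\<lambda>\<omega>. (W t \<omega> - W r \<omega>) * Y \<omega>)" "expectation (\<lambda>\<omega>. (W t \<omega> - W r \<omega>) * Y \<omega>) = 0"
proof -
  have "integrable M (\<lambda>\<omega>. (W t \<omega> - W r \<omega>) * Y \<omega>) \<and> expectation (\<lambda>\<omega>. (W t \<omega> - W r \<omega>) * Y \<omega>) = 0"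
  proof (cases "r = t")
    case False
    then have lt: "r < t" using rt by simp
    let ?b = "\<lambda>\<omega>. W t \<omega> - W r \<omega>"
    have bm: "?b \<in> borel_measurable M" using W_measurable[of t] W_measurable[of r] rt by auto
    have int_b: "integrable M ?b" using increment_moment(1)[OF rt, of 1] by simp
    have ind: "indep_set (sets (F r)) (sets (vimage_algebra (space M) ?b borel))"
      by (rule independent_increments[OF rt(1) lt])
    have Ym: "Y \<in> borel_measurable M" by (rule F_measurable[OF Y(1)])
    have "sigma_sets (space M) {Y -` A \<inter> space M |A. A \<in> sets borel} \<subseteq> sets (F r)"
    proof -
      have "{Y -` A \<inter> space M |A. A \<in> sets borel} \<subseteq> sets (F r)"
        using measurable_sets[OF Y(1)] space_F by auto
      then show ?thesis using sets.sigma_sets_subset[of _ "F r"] space_F by simp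
    qed
    then have "indep_set (sigma_sets (space M) {Y -` A \<inter> space M |A. A \<in> sets borel})
        (sigma_sets (space M) {?b -` A \<inter> space M |A. A \<in> sets borel})"
      using ind unfolding sets_vimage_algebra indep_sets2_eq by blast
    then have iv: "indep_var borel Y borel ?b"
      unfolding indep_var_eq using Ym bm by blast
    have "integrable M (\<lambda>\<omega>. Y \<omega> * ?b \<omega>)" by (rule indep_var_integrable[OF iv Y(2) int_b])
    moreover have "expectation (\<lambda>\<omega>. Y \<omega> * ?b \<omega>) = expectation Y * expectation ?b"
      by (rule indep_var_lebesgue_integral[OF iv Y(2) int_b])
    ultimately show ?thesis using increment_moment(2)[OF rt] by (simp add: mult.commute)
  qed simp
  then show "integrable M (\<lambda>\<omega>. (W t \<omega> - W r \<omega>) * Y \<omega>)" "expectation (\<lambda>\<omega>. (W t \<omega> - W r \<omega>) * Y \<omega>) = 0" by auto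
qed

text \<open>A functional continuous in the product topology is Borel, and by locality the
  coordinates beyond n may be set to 0. What is left involves only path values up to time n
  \<delta>.\<close>

lemma path_functional_measurable:
  fixes \<Psi> :: "(nat \<Rightarrow> real) \<Rightarrow> real"
  assumes \<Psi>: "continuous_on UNIV \<Psi>" and \<delta>: "0 \<le> \<delta>"
    and loc: "\<And>w w'. (\<And>i. i \<le> n \<Longrightarrow> w i = w' i) \<Longrightarrow> \<Psi> w = \<Psi> w'"
  shows "(\<lambda>\<omega>. \<Psi> (\<lambda>j. W (real j * \<delta>) \<omega>)) \<in> borel_measurable (F (real n * \<delta>))"
proof -
  have "(\<lambda>\<omega> j. if j \<le> n then W (real j * \<delta>) \<omega> else 0) \<in> borel_measurable (F (real n * \<delta>))"
  proof (rule measurable_coordinatewise_then_product)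
    fix j
    show "(\<lambda>\<omega>. if j \<le> n then W (real j * \<delta>) \<omega> else 0) \<in> borel_measurable (F (real n * \<delta>))"
    proof (cases "j \<le> n")
      case True
      have "W (real j * \<delta>) \<in> borel_measurable (F (real n * \<delta>))"
        by (rule F_measurable_mono[OF _ adapted]) (use True \<delta> in \<open>auto intro: mult_right_mono\<close>)
      then show ?thesis using True by simp
    qed simp
  qed
  then have "(\<lambda>\<omega>. \<Psi> (\<lambda>j. if j \<le> n then W (real j * \<delta>) \<omega> else 0)) \<in> borel_measurable (F (real n * \<delta>))"
    by (rule measurable_compose[OF _ borel_measurable_continuous_onI[OF \<Psi>]])
  moreover have "\<Psi> (\<lambda>j. if j \<le> n then W (real j * \<delta>) \<omega> else 0) = \<Psi> (\<lambda>j. W (real j * \<delta>) \<omega>)" for \<omega>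
    by (rule loc) simp
  ultimately show ?thesis by simp
qed

end

context truncated_nls
begin

lemma G_continuous: 
  fixes f :: "'a::{first_countable_topology,t2_space} \<Rightarrow> real"
  assumes "continuous_on UNIV f" "continuous_on UNIV g"
  shows "continuous_on UNIV (\<lambda>x. G (f x) (g x))"
  unfolding G_def
  by (intro continuous_intros assms continuous_on_compose2[OF TF_continuous]) auto

lemma Adr_continuous:
  fixes f :: "'a::{first_countable_topology,t2_space} \<Rightarrow> real"
  assumes "continuous_on UNIV f" "continuous_on UNIV g"
  shows "continuous_on UNIV (\<lambda>x. Adr h (f x) (g x))"
  unfolding Adr_def by (intro continuous_intros G_continuous assms)

text \<open>The outer 4 comes from squaring a sum of four terms. Inside stand the Euler defects C^2,
  the expansion remainders, C^2 times their second moment divided by h^2, and the martingale sum T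
  C^2. The exponential is the Gronwall factor.\<close>

definition rate_const :: "real \<Rightarrow> real \<Rightarrow> real" where
  "rate_const T C = 4 * (C\<^sup>2 + C\<^sup>2 * (T\<^sup>2 * (2 * (3 + T))) + T * C\<^sup>2) * exp (4 * C\<^sup>2 * T\<^sup>2)"

text \<open>The pathwise estimate enters as the hypothesis \<open>cmp\<close>, so that the
  probability is collected here. The bound is uniform in m, which allows the refinement to tend to
  infinity.\<close>

lemma scheme_rate:
  fixes M :: "'w measure"
  assumes bm: "brownian_motion M F W" and h: "0 < h" "h \<le> T" and m: "1 \<le> m" and Nh: "real N * h \<le> T"
    and C: "0 \<le> C"
    and cmp: "\<And>w n. n \<le> N \<Longrightarrow>
       norm (tw (h / real m) w u0 (n * m) - tw h (\<lambda>k. w (k * m)) u0 n)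
       \<le> C * h * (\<Sum>k<n. norm (tw (h / real m) w u0 (k * m) - tw h (\<lambda>k. w (k * m)) u0 k))
         + C * h + C * (\<Sum>k<n. \<Sum>j<m. h / real m * ((w (k * m + j) - w (k * m))\<^sup>2 + \<bar>w (k * m + j) - w (k * m)\<bar> * h))
         + norm (\<Sum>k<n. (\<Sum>j<m. h / real m * (w (k * m + j) - w (k * m))) *\<^sub>R Adr h (w (k * m)) (tw (h / real m) w u0 (k * m)))"
    and AC: "\<And>w k. k \<le> N \<Longrightarrow> norm (Adr h (w (k * m)) (tw (h / real m) w u0 (k * m))) \<le> C"
    and twC: "\<And>w k. k \<le> N \<Longrightarrow> norm (tw h w u0 k) \<le> C" "\<And>w k. k \<le> N \<Longrightarrow> norm (tw (h / real m) w u0 (k * m)) \<le> C"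
    and n: "n \<le> N"
  defines "w \<equiv> \<lambda>\<omega> j. W (real j * (h / real m)) \<omega>"
  shows "(\<lambda>\<omega>. (norm (tw (h / real m) (w \<omega>) u0 (n * m) - tw h (\<lambda>k. w \<omega> (k * m)) u0 n))\<^sup>2) \<in> borel_measurable M"
    and "(\<integral>\<omega>. (norm (tw (h / real m) (w \<omega>) u0 (n * m) - tw h (\<lambda>k. w \<omega> (k * m)) u0 n))\<^sup>2 \<partial>M) \<le> rate_const T C * h\<^sup>2"
proof -
  interpret B: brownian_motion M F W by (rule bm)
  define \<delta> where "\<delta> = h / real m"
  have \<delta>: "0 < \<delta>" "real m * \<delta> = h" unfolding \<delta>_def using h m by auto
  have T: "0 < T" using h by simp
  define Ve where "Ve k w = tw \<delta> w u0 (k * m)" for k w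
  define ve where "ve k w = tw h (\<lambda>k. w (k * m)) u0 k" for k and w :: "nat \<Rightarrow> real"
  define Ae where "Ae k w = Adr h (w (k * m)) (Ve k w)" for k w
  define b where "b k j w = w (k * m + j) - w (k * m)" for k j and w :: "nat \<Rightarrow> real"
  define Ie where "Ie k w = (\<Sum>j<m. \<delta> * b k j w)" for k w
  define Se where "Se n w = (\<Sum>k<n. Ie k w *\<^sub>R Ae k w)" for n w
  define Re where "Re n w = (\<Sum>k<n. \<Sum>j<m. \<delta> * ((b k j w)\<^sup>2 + \<bar>b k j w\<bar> * h))" for n w
  define e where "e n w = norm (Ve n w - ve n w)" for n w
  note coord = continuous_on_product_coordinates
  have cVe: "continuous_on UNIV (Ve k)" for k unfolding Ve_def[abs_def] by (rule tw_continuous)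
  have cve: "continuous_on UNIV (ve k)" for k unfolding ve_def[abs_def]
    by (rule continuous_on_compose2[OF tw_continuous[of h u0 k]])
      (auto intro!: continuous_on_coordinatewise_then_product coord)
  have cAe: "continuous_on UNIV (Ae k)" for k unfolding Ae_def[abs_def]
    by (intro Adr_continuous coord cVe)
  have cb: "continuous_on UNIV (b k j)" for k j unfolding b_def[abs_def] by (intro continuous_intros coord)
  have cIe: "continuous_on UNIV (Ie k)" for k unfolding Ie_def[abs_def] by (intro continuous_intros cb)
  have cSe: "continuous_on UNIV (Se k)" for k unfolding Se_def[abs_def] by (intro continuous_intros cIe cAe)
  \<comment> \<open>Locality records how much of the path each functional sees: \<open>Ve k\<close>
    and \<open>Ae k\<close> stop at \<open>k * m\<close>, \<open>Ie k\<close> at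
    \<open>Suc k * m\<close>. Together with continuity this yields adaptedness.\<close>
  have Veloc: "Ve k w = Ve k w'" if "\<And>i. i \<le> k * m \<Longrightarrow> w i = w' i" for k w w'
    unfolding Ve_def by (rule tw_cong) (rule that)
  have Aeloc: "Ae k w = Ae k w'" if "\<And>i. i \<le> k * m \<Longrightarrow> w i = w' i" for k w w'
    unfolding Ae_def using Veloc[OF that] that[of "k * m"] by simp
  have bloc: "b k j w = b k j w'" if "\<And>i. i \<le> k * m + j \<Longrightarrow> w i = w' i" for k j w w'
    unfolding b_def using that[of "k * m"] that[of "k * m + j"] by simp
  have Ieloc: "Ie k w = Ie k w'" if "\<And>i. i \<le> Suc k * m \<Longrightarrow> w i = w' i" for k w w'
    unfolding Ie_def by (intro sum.cong refl arg_cong2[where f="(*)"] bloc that) auto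
  have km: "k < l \<Longrightarrow> Suc k * m \<le> l * m" for k l by (rule mult_right_mono) auto
  have Seloc: "Se l w = Se l w'" if loc: "\<And>i. i \<le> l * m \<Longrightarrow> w i = w' i" for l w w'
    unfolding Se_def
  proof (rule sum.cong[OF refl])
    fix k assume "k \<in> {..<l}"
    then have k: "Suc k * m \<le> l * m" using km[of k l] by simp
    have "Ie k w = Ie k w'" by (rule Ieloc) (use k in \<open>auto intro: loc\<close>)
    moreover have "Ae k w = Ae k w'" by (rule Aeloc) (use k in \<open>auto intro: loc\<close>)
    ultimately show "Ie k w *\<^sub>R Ae k w = Ie k w' *\<^sub>R Ae k w'" by simp
  qed
  have w_def': "w \<omega> = (\<lambda>j. W (real j * \<delta>) \<omega>)" for \<omega> unfolding w_def \<delta>_def ..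
  have pm: "(\<lambda>\<omega>. \<Psi> (w \<omega>)) \<in> borel_measurable (F (real l * \<delta>))"
    if "continuous_on UNIV \<Psi>" "\<And>w w'. (\<And>i. i \<le> l \<Longrightarrow> w i = w' i) \<Longrightarrow> \<Psi> w = \<Psi> w'" for \<Psi> :: "(nat \<Rightarrow> real) \<Rightarrow> real" and l
    unfolding w_def' by (rule B.path_functional_measurable[OF that(1) _ that(2)]) (use \<delta> in auto)
  have e_meas: "(\<lambda>\<omega>. e k (w \<omega>)) \<in> borel_measurable M" for k
  proof (rule B.F_measurable[OF pm[of "e k" "k * m"]])
    show "continuous_on UNIV (e k)" unfolding e_def[abs_def] by (intro continuous_intros cVe cve)
    show "e k w = e k w'" if "\<And>i. i \<le> k * m \<Longrightarrow> w i = w' i" for w w'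
    proof -
      have "ve k w = ve k w'" unfolding ve_def
        by (rule tw_cong) (use that in \<open>auto intro: mult_right_mono\<close>)
      then show ?thesis unfolding e_def using Veloc[OF that] by simp
    qed
  qed
  then show "(\<lambda>\<omega>. (norm (tw (h / real m) (w \<omega>) u0 (n * m) - tw h (\<lambda>k. w \<omega> (k * m)) u0 n))\<^sup>2) \<in> borel_measurable M"
    unfolding e_def Ve_def ve_def \<delta>_def by measurable
  have tdiff: "real (k * m + j) * \<delta> - real (k * m) * \<delta> = real j * \<delta>" for k j by (simp add: algebra_simps)
  have b_eq: "b k j (w \<omega>) = W (real (k * m + j) * \<delta>) \<omega> - W (real (k * m) * \<delta>) \<omega>" for k j \<omega>
    unfolding b_def w_def' ..
  have t0: "0 \<le> real (k * m) * \<delta>" "real (k * m) * \<delta> \<le> real (k * m + j) * \<delta>" for k j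
    using \<delta> by (auto intro: mult_right_mono)
  have b_int: "integrable M (\<lambda>\<omega>. (b k j (w \<omega>)) ^ p)" for k j p
    unfolding b_eq by (rule B.increment_moment(1)[OF t0])
  have jh: "j < m \<Longrightarrow> real j * \<delta> \<le> h" for j using \<delta> by (metis less_eq_real_def mult_right_mono of_nat_less_iff)
  have b2: "(\<integral>\<omega>. (b k j (w \<omega>))\<^sup>2 \<partial>M) \<le> h" if "j < m" for k j
    unfolding b_eq B.increment_moment(3)[OF t0] tdiff using jh[OF that] .
  have b4: "(\<integral>\<omega>. (b k j (w \<omega>)) ^ 4 \<partial>M) \<le> 3 * h\<^sup>2" if "j < m" for k j
    unfolding b_eq B.increment_moment(4)[OF t0] tdiff using jh[OF that] \<delta> by (auto intro!: power_mono)
  have bmeas[measurable]: "(\<lambda>\<omega>. b k j (w \<omega>)) \<in> borel_measurable M" for k j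
    using b_int[of k j 1] by auto
  \<comment> \<open>Weighted Cauchy-Schwarz with total weight h; second moments of the increments of
    at most h then make the expectation of order h^3.\<close>
  have Ie2_le: "(Ie k w)\<^sup>2 \<le> h * (\<Sum>j<m. \<delta> * (b k j w)\<^sup>2)" for k w
    using sum_sq_le[of "{..<m}" "\<lambda>_. \<delta>" "\<lambda>j. b k j w"] \<delta> unfolding Ie_def by simp
  have Imeas[measurable]: "(\<lambda>\<omega>. Ie k (w \<omega>)) \<in> borel_measurable M" for k unfolding Ie_def by measurable
  have Ibd_int: "integrable M (\<lambda>\<omega>. h * (\<Sum>j<m. \<delta> * (b k j (w \<omega>))\<^sup>2))" for k
    by (intro integrable_mult_right Bochner_Integration.integrable_sum b_int)
  have I2_int: "integrable M (\<lambda>\<omega>. (Ie k (w \<omega>))\<^sup>2)" for k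
    by (rule Bochner_Integration.integrable_bound[OF Ibd_int[of k]])
      (use Ie2_le[of k] in \<open>auto intro: order_trans[OF _ abs_ge_self]\<close>)
  have I2: "(\<integral>\<omega>. (Ie k (w \<omega>))\<^sup>2 \<partial>M) \<le> h ^ 3" for k
  proof -
    have "(\<integral>\<omega>. (Ie k (w \<omega>))\<^sup>2 \<partial>M) \<le> (\<integral>\<omega>. h * (\<Sum>j<m. \<delta> * (b k j (w \<omega>))\<^sup>2) \<partial>M)"
      by (rule integral_mono[OF I2_int Ibd_int Ie2_le])
    also have "\<dots> = h * (\<Sum>j<m. \<delta> * (\<integral>\<omega>. (b k j (w \<omega>))\<^sup>2 \<partial>M))"
      using b_int[of k _ 2] by (simp add: Bochner_Integration.integral_sum)
    also have "\<dots> \<le> h * (\<Sum>j<m. \<delta> * h)"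
      using h \<delta> b2 by (intro mult_left_mono sum_mono) auto
    also have "\<dots> = h ^ 3" using \<delta> by (simp add: power3_eq_cube mult.assoc[symmetric])
    finally show ?thesis .
  qed
  have AC': "norm (Ae k w) \<le> C" if "k \<le> N" for k w
    unfolding Ae_def Ve_def \<delta>_def using AC[OF that] .
  have S2: "integrable M (\<lambda>\<omega>. (norm (Se l (w \<omega>)))\<^sup>2) \<and> (\<integral>\<omega>. (norm (Se l (w \<omega>)))\<^sup>2 \<partial>M) \<le> real l * (C\<^sup>2 * h ^ 3)"
    if "l \<le> N" for l
    using that
  proof (induction l)
    case 0
    show ?case by (simp add: Se_def)
  next
    case (Suc l)
    then have IH: "integrable M (\<lambda>\<omega>. (norm (Se l (w \<omega>)))\<^sup>2)" "(\<integral>\<omega>. (norm (Se l (w \<omega>)))\<^sup>2 \<partial>M) \<le> real l * (C\<^sup>2 * h ^ 3)" and l: "l \<le> N"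
      by auto
    \<comment> \<open>The cross term in the square of \<open>Se l + Ie l *\<^sub>R Ae l\<close> is
      twice \<open>Ie l\<close> times Y. Here Y sees the path only up to \<open>l * m\<close>, while
      every \<open>b l j\<close> is an increment starting there, so the cross term has expectation
      0.\<close>
    define Y where "Y w = inner (Se l w) (Ae l w)" for w
    have Ym: "(\<lambda>\<omega>. Y (w \<omega>)) \<in> borel_measurable (F (real (l * m) * \<delta>))"
    proof (rule pm)
      show "continuous_on UNIV Y" unfolding Y_def[abs_def] by (intro continuous_intros cSe cAe)
      show "Y w = Y w'" if "\<And>i. i \<le> l * m \<Longrightarrow> w i = w' i" for w w'
        unfolding Y_def using Seloc[OF that] Aeloc[OF that] by simp
    qed
    have Ym': "(\<lambda>\<omega>. Y (w \<omega>)) \<in> borel_measurable M" by (rule B.F_measurable[OF Ym])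
    have nS: "(\<lambda>\<omega>. norm (Se l (w \<omega>))) \<in> borel_measurable M" "(\<lambda>\<omega>. norm (Ae l (w \<omega>))) \<in> borel_measurable M"
      by (rule B.F_measurable[OF pm[of _ "l * m"]], intro continuous_intros cSe, rule arg_cong[OF Seloc], assumption)
        (rule B.F_measurable[OF pm[of _ "l * m"]], intro continuous_intros cAe, rule arg_cong[OF Aeloc], assumption)
    have Y_int: "integrable M (\<lambda>\<omega>. Y (w \<omega>))"
    proof (rule Bochner_Integration.integrable_bound[where f="\<lambda>\<omega>. (norm (Se l (w \<omega>)))\<^sup>2 + C\<^sup>2"])
      show "integrable M (\<lambda>\<omega>. (norm (Se l (w \<omega>)))\<^sup>2 + C\<^sup>2)" using IH(1) by simp
      show "AE \<omega> in M. norm (Y (w \<omega>)) \<le> norm ((norm (Se l (w \<omega>)))\<^sup>2 + C\<^sup>2)"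
      proof (rule AE_I2)
        fix \<omega>
        have "\<bar>Y (w \<omega>)\<bar> \<le> norm (Se l (w \<omega>)) * norm (Ae l (w \<omega>))" unfolding Y_def by (rule Cauchy_Schwarz_ineq2)
        also have "\<dots> \<le> norm (Se l (w \<omega>)) * C" by (intro mult_left_mono AC' l) simp
        also have "\<dots> \<le> (norm (Se l (w \<omega>)))\<^sup>2 + C\<^sup>2"
        proof -
          have "0 \<le> norm (Se l (w \<omega>)) * C" using C by simp
          then show ?thesis using sum_squares_bound[of "norm (Se l (w \<omega>))" C] by linarith
        qed
        finally show "norm (Y (w \<omega>)) \<le> norm ((norm (Se l (w \<omega>)))\<^sup>2 + C\<^sup>2)" by simp
      qed
    qed (rule Ym')
    have bY: "integrable M (\<lambda>\<omega>. b l j (w \<omega>) * Y (w \<omega>))" "(\<integral>\<omega>. b l j (w \<omega>) * Y (w \<omega>) \<partial>M) = 0" for j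
      unfolding b_eq by (rule B.increment_mult[OF t0 Ym Y_int])+
    have IY: "Ie l w * Y w = (\<Sum>j<m. \<delta> * (b l j w * Y w))" for w
      unfolding Ie_def by (simp add: sum_distrib_right mult.assoc)
    have IY_int: "integrable M (\<lambda>\<omega>. Ie l (w \<omega>) * Y (w \<omega>))"
      unfolding IY by (intro Bochner_Integration.integrable_sum integrable_mult_right bY)
    have IY0: "(\<integral>\<omega>. Ie l (w \<omega>) * Y (w \<omega>) \<partial>M) = 0"
      unfolding IY using bY by (simp add: Bochner_Integration.integral_sum)
    have sq: "(norm (Se (Suc l) w))\<^sup>2 = (norm (Se l w))\<^sup>2 + 2 * (Ie l w * Y w) + (Ie l w)\<^sup>2 * (norm (Ae l w))\<^sup>2" for w
      unfolding Se_def sum.lessThan_Suc Y_def by (rule norm_add_scaleR_sq)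
    have IA_le: "(Ie l w)\<^sup>2 * (norm (Ae l w))\<^sup>2 \<le> C\<^sup>2 * (Ie l w)\<^sup>2" for w
    proof -
      have "(norm (Ae l w))\<^sup>2 \<le> C\<^sup>2" using AC'[OF l, of w] by (rule power_mono) simp
      then have "(norm (Ae l w))\<^sup>2 * (Ie l w)\<^sup>2 \<le> C\<^sup>2 * (Ie l w)\<^sup>2" by (rule mult_right_mono) simp
      then show ?thesis by (simp add: mult.commute)
    qed
    have IA_int: "integrable M (\<lambda>\<omega>. (Ie l (w \<omega>))\<^sup>2 * (norm (Ae l (w \<omega>)))\<^sup>2)"
      by (rule Bochner_Integration.integrable_bound[OF integrable_mult_right[OF I2_int[of l], of "C\<^sup>2"]])
        (use nS IA_le in \<open>auto\<close>)
    have "(\<integral>\<omega>. (Ie l (w \<omega>))\<^sup>2 * (norm (Ae l (w \<omega>)))\<^sup>2 \<partial>M) \<le> (\<integral>\<omega>. C\<^sup>2 * (Ie l (w \<omega>))\<^sup>2 \<partial>M)"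
      by (rule integral_mono[OF IA_int _ IA_le]) (intro integrable_mult_right I2_int)
    also have "\<dots> \<le> C\<^sup>2 * h ^ 3" using I2[of l] by (simp add: mult_left_mono)
    finally have IA: "(\<integral>\<omega>. (Ie l (w \<omega>))\<^sup>2 * (norm (Ae l (w \<omega>)))\<^sup>2 \<partial>M) \<le> C\<^sup>2 * h ^ 3" .
    have "integrable M (\<lambda>\<omega>. (norm (Se (Suc l) (w \<omega>)))\<^sup>2)"
      unfolding sq by (intro Bochner_Integration.integrable_add integrable_mult_right IH IY_int IA_int)
    moreover have "(\<integral>\<omega>. (norm (Se (Suc l) (w \<omega>)))\<^sup>2 \<partial>M)
        = (\<integral>\<omega>. (norm (Se l (w \<omega>)))\<^sup>2 \<partial>M) + 2 * 0 + (\<integral>\<omega>. (Ie l (w \<omega>))\<^sup>2 * (norm (Ae l (w \<omega>)))\<^sup>2 \<partial>M)"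
      unfolding sq IY0[symmetric] using IH(1) IY_int IA_int by simp
    ultimately show ?case using IH(2) IA by (simp add: algebra_simps)
  qed
  \<comment> \<open>Cauchy-Schwarz over all pairs (k, j) with weights \<delta> of total at most T.
    What remains are fourth moments and h^2 times second moments, each at most a constant times
    h^2.\<close>
  have R_sq_le: "(Re l w)\<^sup>2 \<le> T * (\<Sum>k<l. \<Sum>j<m. \<delta> * (2 * (b k j w) ^ 4 + 2 * h\<^sup>2 * (b k j w)\<^sup>2))" if l: "l \<le> N" for l w
  proof -
    let ?x = "\<lambda>k j. (b k j w)\<^sup>2 + \<bar>b k j w\<bar> * h"
    have tot: "(\<Sum>p\<in>{..<l} \<times> {..<m}. \<delta>) \<le> T"
    proof -
      have "(\<Sum>p\<in>{..<l} \<times> {..<m}. \<delta>) = real l * h" using \<delta> by (simp add: mult.assoc)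
      also have "\<dots> \<le> real N * h" using l h by (intro mult_right_mono) auto
      finally show ?thesis using Nh by simp
    qed
    have "Re l w = (\<Sum>p\<in>{..<l} \<times> {..<m}. \<delta> * ?x (fst p) (snd p))"
      unfolding Re_def by (simp add: sum.cartesian_product split_def)
    then have "(Re l w)\<^sup>2 \<le> (\<Sum>p\<in>{..<l} \<times> {..<m}. \<delta>) * (\<Sum>p\<in>{..<l} \<times> {..<m}. \<delta> * (?x (fst p) (snd p))\<^sup>2)"
      using sum_sq_le[of "{..<l} \<times> {..<m}" "\<lambda>_. \<delta>" "\<lambda>p. ?x (fst p) (snd p)"] \<delta> by simp
    also have "\<dots> \<le> T * (\<Sum>p\<in>{..<l} \<times> {..<m}. \<delta> * (?x (fst p) (snd p))\<^sup>2)"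
      using \<delta> by (intro mult_right_mono tot sum_nonneg) auto
    also have "(\<Sum>p\<in>{..<l} \<times> {..<m}. \<delta> * (?x (fst p) (snd p))\<^sup>2) = (\<Sum>k<l. \<Sum>j<m. \<delta> * (?x k j)\<^sup>2)"
      by (simp add: sum.cartesian_product split_def)
    also have "T * \<dots> \<le> T * (\<Sum>k<l. \<Sum>j<m. \<delta> * (2 * (b k j w) ^ 4 + 2 * h\<^sup>2 * (b k j w)\<^sup>2))"
    proof (intro mult_left_mono sum_mono)
      fix k j
      have "(?x k j)\<^sup>2 \<le> 2 * ((b k j w)\<^sup>2)\<^sup>2 + 2 * (\<bar>b k j w\<bar> * h)\<^sup>2"
        using sum_squares_bound[of "(b k j w)\<^sup>2" "\<bar>b k j w\<bar> * h"] unfolding power2_sum by linarith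
      also have "\<dots> = 2 * (b k j w) ^ 4 + 2 * h\<^sup>2 * (b k j w)\<^sup>2"
        by (simp add: power_mult_distrib mult.commute flip: power_mult)
      finally show "(?x k j)\<^sup>2 \<le> 2 * (b k j w) ^ 4 + 2 * h\<^sup>2 * (b k j w)\<^sup>2" .
    qed (use \<delta> T in auto)
    finally show ?thesis .
  qed
  have Rbd_int: "integrable M (\<lambda>\<omega>. T * (\<Sum>k<l. \<Sum>j<m. \<delta> * (2 * (b k j (w \<omega>)) ^ 4 + 2 * h\<^sup>2 * (b k j (w \<omega>))\<^sup>2)))" for l
    by (intro integrable_mult_right Bochner_Integration.integrable_sum Bochner_Integration.integrable_add b_int)
  have R2_int: "integrable M (\<lambda>\<omega>. (Re l (w \<omega>))\<^sup>2)" if "l \<le> N" for l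
  proof (rule Bochner_Integration.integrable_bound[OF Rbd_int[of l]])
    show "(\<lambda>\<omega>. (Re l (w \<omega>))\<^sup>2) \<in> borel_measurable M" unfolding Re_def by measurable
    show "AE \<omega> in M. norm ((Re l (w \<omega>))\<^sup>2) \<le> norm (T * (\<Sum>k<l. \<Sum>j<m. \<delta> * (2 * (b k j (w \<omega>)) ^ 4 + 2 * h\<^sup>2 * (b k j (w \<omega>))\<^sup>2)))"
      by (rule AE_I2) (use R_sq_le[OF that] in \<open>auto intro: order_trans[OF _ abs_ge_self]\<close>)
  qed
  have R2: "(\<integral>\<omega>. (Re l (w \<omega>))\<^sup>2 \<partial>M) \<le> T\<^sup>2 * (2 * (3 + T)) * h\<^sup>2" if l: "l \<le> N" for l
  proof -
    have "(\<integral>\<omega>. (Re l (w \<omega>))\<^sup>2 \<partial>M) \<le> (\<integral>\<omega>. T * (\<Sum>k<l. \<Sum>j<m. \<delta> * (2 * (b k j (w \<omega>)) ^ 4 + 2 * h\<^sup>2 * (b k j (w \<omega>))\<^sup>2)) \<partial>M)"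
      by (rule integral_mono[OF R2_int[OF l] Rbd_int R_sq_le[OF l]])
    also have "\<dots> = T * (\<Sum>k<l. \<Sum>j<m. \<delta> * (2 * (\<integral>\<omega>. (b k j (w \<omega>)) ^ 4 \<partial>M) + 2 * h\<^sup>2 * (\<integral>\<omega>. (b k j (w \<omega>))\<^sup>2 \<partial>M)))"
      using b_int by (simp add: Bochner_Integration.integral_sum)
    also have "\<dots> \<le> T * (\<Sum>k<l. \<Sum>j<m. \<delta> * (2 * (3 * h\<^sup>2) + 2 * h\<^sup>2 * T))"
      using T \<delta> h b4 order_trans[OF b2 h(2)]
      by (intro mult_left_mono sum_mono add_mono) auto
    also have "\<dots> = T * (real l * (real m * \<delta>)) * (2 * (3 + T) * h\<^sup>2)"
      by (simp add: algebra_simps)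
    also have "\<dots> = T * (real l * h) * (2 * (3 + T) * h\<^sup>2)"
      by (simp only: \<delta>(2))
    also have "\<dots> \<le> T * T * (2 * (3 + T) * h\<^sup>2)"
    proof -
      have "real l * h \<le> real N * h" using l h by (intro mult_right_mono) auto
      then show ?thesis using Nh T by (intro mult_right_mono mult_left_mono) auto
    qed
    finally show ?thesis by (simp add: power2_eq_square mult_ac)
  qed
  \<comment> \<open>A crude bound, which serves for the integrability of the squared error.\<close>
  have e_le: "e k w \<le> 2 * C" if "k \<le> N" for k w
    using norm_triangle_ineq4[of "Ve k w" "ve k w"] twC(2)[OF that, of w] twC(1)[OF that, of "\<lambda>k. w (k * m)"]
    unfolding e_def Ve_def ve_def \<delta>_def by simp
  have e0: "0 \<le> e k w" for k w unfolding e_def by simp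
  have e2_int: "integrable M (\<lambda>\<omega>. (e k (w \<omega>))\<^sup>2)" if "k \<le> N" for k
  proof (rule B.integrable_const_bound[where B="(2 * C)\<^sup>2"])
    have "(e k w)\<^sup>2 \<le> (2 * C)\<^sup>2" for w by (rule power_mono[OF e_le[OF that] e0])
    then show "AE \<omega> in M. norm ((e k (w \<omega>))\<^sup>2) \<le> (2 * C)\<^sup>2" by simp
    show "(\<lambda>\<omega>. (e k (w \<omega>))\<^sup>2) \<in> borel_measurable M" using e_meas[of k] by measurable
  qed
  define a where "a k = (\<integral>\<omega>. (e k (w \<omega>))\<^sup>2 \<partial>M)" for k
  define K where "K = 4 * (C\<^sup>2 + C\<^sup>2 * (T\<^sup>2 * (2 * (3 + T))) + T * C\<^sup>2)"
  have rec: "a l \<le> K * h\<^sup>2 + (4 * C\<^sup>2 * T * h) * (\<Sum>k<l. a k)" if l: "l \<le> N" for l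
  proof -
    have lT: "real l * h \<le> T"
    proof -
      have "real l * h \<le> real N * h" using l h by (intro mult_right_mono) auto
      then show ?thesis using Nh by simp
    qed
    have pw: "(e l w)\<^sup>2 \<le> 4 * (C\<^sup>2 * T * h * (\<Sum>k<l. (e k w)\<^sup>2) + C\<^sup>2 * h\<^sup>2 + C\<^sup>2 * (Re l w)\<^sup>2 + (norm (Se l w))\<^sup>2)" for w
    proof -
      have "e l w \<le> C * h * (\<Sum>k<l. e k w) + C * h + C * Re l w + norm (Se l w)"
        using cmp[OF l, of w] unfolding e_def Ve_def ve_def Re_def Se_def Ie_def Ae_def b_def \<delta>_def .
      then have "(e l w)\<^sup>2 \<le> (C * h * (\<Sum>k<l. e k w) + C * h + C * Re l w + norm (Se l w))\<^sup>2"
        by (rule power_mono) (rule e0)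
      also have "\<dots> \<le> 4 * ((C * h * (\<Sum>k<l. e k w))\<^sup>2 + (C * h)\<^sup>2 + (C * Re l w)\<^sup>2 + (norm (Se l w))\<^sup>2)"
      proof -
        have "(p + q + r + t)\<^sup>2 \<le> 4 * (p\<^sup>2 + q\<^sup>2 + r\<^sup>2 + t\<^sup>2)" for p q r t :: real
          by (smt (verit) power2_sum sum_squares_bound)
        then show ?thesis .
      qed
      \<comment> \<open>Cauchy-Schwarz produces the factor h^2 l; since l h is at most T, this
        becomes T h, the form that the discrete Gronwall inequality accepts.\<close>
      also have "(C * h * (\<Sum>k<l. e k w))\<^sup>2 \<le> C\<^sup>2 * T * h * (\<Sum>k<l. (e k w)\<^sup>2)"
      proof -
        have "(C * h * (\<Sum>k<l. e k w))\<^sup>2 = C\<^sup>2 * h\<^sup>2 * (\<Sum>k<l. 1 * e k w)\<^sup>2" by (simp add: power_mult_distrib)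
        also have "\<dots> \<le> C\<^sup>2 * h\<^sup>2 * (real l * (\<Sum>k<l. (e k w)\<^sup>2))"
          using sum_sq_le[of "{..<l}" "\<lambda>_. 1" "\<lambda>k. e k w"] by (intro mult_left_mono) auto
        also have "\<dots> = C\<^sup>2 * (real l * h) * (h * (\<Sum>k<l. (e k w)\<^sup>2))" by (simp add: power2_eq_square mult_ac)
        also have "\<dots> \<le> C\<^sup>2 * T * (h * (\<Sum>k<l. (e k w)\<^sup>2))"
          using lT h by (intro mult_right_mono mult_left_mono mult_nonneg_nonneg sum_nonneg) auto
        finally show ?thesis by (simp add: mult_ac)
      qed
      finally show ?thesis by (simp add: power_mult_distrib)
    qed
    have i1: "integrable M (\<lambda>\<omega>. \<Sum>k<l. (e k (w \<omega>))\<^sup>2)"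
      by (rule Bochner_Integration.integrable_sum) (use e2_int l in auto)
    have "a l \<le> (\<integral>\<omega>. 4 * (C\<^sup>2 * T * h * (\<Sum>k<l. (e k (w \<omega>))\<^sup>2) + C\<^sup>2 * h\<^sup>2 + C\<^sup>2 * (Re l (w \<omega>))\<^sup>2 + (norm (Se l (w \<omega>)))\<^sup>2) \<partial>M)"
      unfolding a_def
      by (rule integral_mono[OF e2_int[OF l] _ pw])
        (intro integrable_mult_right Bochner_Integration.integrable_add i1 R2_int l conjunct1[OF S2[OF l]] B.integrable_const)
    also have "\<dots> = 4 * (C\<^sup>2 * T * h * (\<Sum>k<l. a k) + C\<^sup>2 * h\<^sup>2 + C\<^sup>2 * (\<integral>\<omega>. (Re l (w \<omega>))\<^sup>2 \<partial>M) + (\<integral>\<omega>. (norm (Se l (w \<omega>)))\<^sup>2 \<partial>M))"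
    proof -
      have "(\<integral>\<omega>. (\<Sum>k<l. (e k (w \<omega>))\<^sup>2) \<partial>M) = (\<Sum>k<l. a k)"
        unfolding a_def by (rule Bochner_Integration.integral_sum) (use e2_int l in auto)
      then show ?thesis using i1 R2_int[OF l] conjunct1[OF S2[OF l]] by (simp add: B.prob_space)
    qed
    also have "\<dots> \<le> 4 * (C\<^sup>2 * T * h * (\<Sum>k<l. a k) + C\<^sup>2 * h\<^sup>2 + C\<^sup>2 * (T\<^sup>2 * (2 * (3 + T)) * h\<^sup>2) + T * C\<^sup>2 * h\<^sup>2)"
    proof (intro mult_left_mono add_mono order_refl R2[OF l])
      have "(\<integral>\<omega>. (norm (Se l (w \<omega>)))\<^sup>2 \<partial>M) \<le> real l * (C\<^sup>2 * h ^ 3)" using S2[OF l] by blast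
      also have "\<dots> = (real l * h) * (C\<^sup>2 * h\<^sup>2)" by (simp add: power3_eq_cube power2_eq_square)
      also have "\<dots> \<le> T * (C\<^sup>2 * h\<^sup>2)" using lT by (intro mult_right_mono) auto
      finally show "(\<integral>\<omega>. (norm (Se l (w \<omega>)))\<^sup>2 \<partial>M) \<le> T * C\<^sup>2 * h\<^sup>2" by simp
    qed (use T h in auto)
    also have "\<dots> = K * h\<^sup>2 + (4 * C\<^sup>2 * T * h) * (\<Sum>k<l. a k)" unfolding K_def by (simp add: algebra_simps)
    finally show ?thesis .
  qed
  have K0: "0 \<le> K" unfolding K_def using T by (intro mult_nonneg_nonneg add_nonneg_nonneg) auto
  have "a n \<le> (K * h\<^sup>2) * exp ((4 * C\<^sup>2 * T * h) * real n)"
    by (rule discrete_gronwall[OF rec _ _ n]) (use T h K0 in auto)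
  also have "\<dots> \<le> (K * h\<^sup>2) * exp (4 * C\<^sup>2 * T\<^sup>2)"
  proof -
    have "real n * h \<le> real N * h" using n h by (intro mult_right_mono) auto
    then have "(4 * C\<^sup>2 * T) * (real n * h) \<le> (4 * C\<^sup>2 * T) * T" using Nh T by (intro mult_left_mono) auto
    then show ?thesis using K0 by (intro mult_left_mono) (auto simp: power2_eq_square mult_ac)
  qed
  also have "\<dots> = rate_const T C * h\<^sup>2" unfolding rate_const_def K_def by (simp add: mult_ac)
  finally show "(\<integral>\<omega>. (norm (tw (h / real m) (w \<omega>) u0 (n * m) - tw h (\<lambda>k. w \<omega> (k * m)) u0 n))\<^sup>2 \<partial>M) \<le> rate_const T C * h\<^sup>2"
    unfolding a_def e_def Ve_def ve_def \<delta>_def .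
qed

end

section \<open>Pathwise convergence to the mild solution\<close>

text \<open>The approximating simple functions take values among plain functions of x, a space
  without a norm. Post-composition with an arbitrary g yields from one formula both the pointwise
  integrals, with g an evaluation, and the integrals of inner products.\<close>

lemma simple_function_integral:
  fixes g :: "'c \<Rightarrow> 'b :: {banach, second_countable_topology}"
  assumes "finite_measure M" and \<phi>: "simple_function M \<phi>"
  shows "integrable M (\<lambda>r. g (\<phi> r))"
    and "(\<integral>r. g (\<phi> r) \<partial>M) = (\<Sum>y\<in>\<phi> ` space M. measure M (\<phi> -` {y} \<inter> space M) *\<^sub>R g y)"
proof -
  interpret finite_measure M by fact
  have fin: "finite (\<phi> ` space M)" and ms: "\<And>y. y \<in> \<phi> ` space M \<Longrightarrow> \<phi> -` {y} \<inter> space M \<in> sets M"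
    using \<phi> unfolding simple_function_def by auto
  have eq: "g (\<phi> r) = (\<Sum>y\<in>\<phi> ` space M. indicator (\<phi> -` {y} \<inter> space M) r *\<^sub>R g y)" if "r \<in> space M" for r
  proof -
    have "(\<Sum>y\<in>\<phi> ` space M. indicator (\<phi> -` {y} \<inter> space M) r *\<^sub>R g y) = (\<Sum>y\<in>{\<phi> r}. indicator (\<phi> -` {y} \<inter> space M) r *\<^sub>R g y)"
      using fin that by (intro sum.mono_neutral_right) (auto simp: indicator_def)
    then show ?thesis using that by simp
  qed
  have i: "integrable M (\<lambda>r. indicator (\<phi> -` {y} \<inter> space M) r *\<^sub>R g y)" if "y \<in> \<phi> ` space M" for y
    using ms[OF that] by (intro integrable_scaleR_left integrable_real_indicator) (auto simp: emeasure_eq_measure)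
  have "integrable M (\<lambda>r. \<Sum>y\<in>\<phi> ` space M. indicator (\<phi> -` {y} \<inter> space M) r *\<^sub>R g y)"
    by (intro Bochner_Integration.integrable_sum i)
  then show "integrable M (\<lambda>r. g (\<phi> r))"
    by (rule Bochner_Integration.integrable_cong[THEN iffD1, rotated 2]) (simp_all add: eq)
  have "(\<integral>r. g (\<phi> r) \<partial>M) = (\<integral>r. (\<Sum>y\<in>\<phi> ` space M. indicator (\<phi> -` {y} \<inter> space M) r *\<^sub>R g y) \<partial>M)"
    by (rule Bochner_Integration.integral_cong) (simp_all add: eq)
  also have "\<dots> = (\<Sum>y\<in>\<phi> ` space M. measure M (\<phi> -` {y} \<inter> space M) *\<^sub>R g y)"
  proof (subst Bochner_Integration.integral_sum[OF i], assumption, rule sum.cong[OF refl])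
    fix y assume "y \<in> \<phi> ` space M"
    then have "integrable M (indicator (\<phi> -` {y} \<inter> space M) :: _ \<Rightarrow> real)"
      using ms by (intro integrable_real_indicator) (auto simp: emeasure_eq_measure)
    then show "(\<integral>r. indicator (\<phi> -` {y} \<inter> space M) r *\<^sub>R g y \<partial>M) = measure M (\<phi> -` {y} \<inter> space M) *\<^sub>R g y"
      by (subst integral_scaleR_left) auto
  qed
  finally show "(\<integral>r. g (\<phi> r) \<partial>M) = (\<Sum>y\<in>\<phi> ` space M. measure M (\<phi> -` {y} \<inter> space M) *\<^sub>R g y)" .
qed

section \<open>Riemann sums for integrals with values in the Sobolev space\<close>

lemma riemann_sum_bound:
  fixes f :: "real \<Rightarrow> real"
  assumes \<delta>: "0 \<le> \<delta>" and f: "continuous_on {0..real n * \<delta>} f"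
    and close: "\<And>k r. k < n \<Longrightarrow> real k * \<delta> \<le> r \<Longrightarrow> r \<le> real (Suc k) * \<delta> \<Longrightarrow> \<bar>f r - f (real k * \<delta>)\<bar> \<le> \<epsilon>"
  shows "\<bar>integral {0..real n * \<delta>} f - (\<Sum>k<n. \<delta> * f (real k * \<delta>))\<bar> \<le> real n * \<delta> * \<epsilon>"
  using f close
proof (induction n)
  case 0
  then show ?case by simp
next
  case (Suc n)
  let ?a = "real n * \<delta>" and ?b = "real (Suc n) * \<delta>"
  have ab: "0 \<le> ?a" "?a \<le> ?b" using \<delta> by (auto intro: mult_right_mono)
  have i: "f integrable_on {0..?b}" by (rule integrable_continuous_interval[OF Suc.prems(1)])
  have c1: "continuous_on {0..?a} f" and c2: "continuous_on {?a..?b} f"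
    using ab by (auto intro: continuous_on_subset[OF Suc.prems(1)])
  have i2: "f integrable_on {?a..?b}" by (rule integrable_continuous_interval[OF c2])
  have "integral {0..?b} f = integral {0..?a} f + integral {?a..?b} f"
    by (rule Henstock_Kurzweil_Integration.integral_combine[OF ab i, symmetric])
  moreover have "\<bar>integral {?a..?b} f - \<delta> * f ?a\<bar> \<le> \<epsilon> * \<delta>"
  proof -
    have len: "?b - ?a = \<delta>" by (simp add: algebra_simps)
    have "integral {?a..?b} f - \<delta> * f ?a = integral {?a..?b} (\<lambda>r. f r - f ?a)"
      using i2 ab len by (subst Henstock_Kurzweil_Integration.integral_diff) auto
    moreover have "norm (integral {?a..?b} (\<lambda>r. f r - f ?a)) \<le> \<epsilon> * (?b - ?a)"
      by (rule integral_bound) (use ab Suc.prems(2)[of n] c2 in \<open>auto intro!: continuous_intros\<close>)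
    ultimately show ?thesis using len by simp
  qed
  moreover have "\<bar>integral {0..?a} f - (\<Sum>k<n. \<delta> * f (real k * \<delta>))\<bar> \<le> real n * \<delta> * \<epsilon>"
    using Suc.IH[OF c1] Suc.prems(2) by simp
  ultimately show ?case by (simp add: algebra_simps)
qed

context sobolev
begin

text \<open>The \<open>H\<^sup>s\<close>-valued integral is only used through its scalar products with fixed vectors, which are
  ordinary integrals.\<close>

lemma has_Hs_integral_inner:
  assumes I: "has_Hs_integral s a b \<Phi> Jv" and cont: "continuous_on {a..b} (\<lambda>r. sob (\<Phi> r))"
  shows "inner (sob Jv) z = integral {a..b} (\<lambda>r. inner (sob (\<Phi> r)) z)"
proof -
  define N where "N = restrict_space lborel {a..b}"
  have spN: "space N = {a..b}" unfolding N_def by (simp add: space_restrict_space)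
  have fN: "finite_measure N"
    by (rule finite_measureI)
      (simp add: N_def emeasure_restrict_space space_restrict_space emeasure_lborel_Icc_eq)
  interpret N: finite_measure N by (rule fN)
  obtain \<phi> where \<Phi>: "\<And>r. r \<in> {a..b} \<Longrightarrow> \<Phi> r \<in> Hs s" and Jv: "Jv \<in> Hs s"
    and sf: "\<And>k. simple_function N (\<phi> k)" and \<phi>: "\<And>k r. r \<in> {a..b} \<Longrightarrow> \<phi> k r \<in> Hs s"
    and meas: "\<And>k. (\<lambda>r. Hs_norm s (\<lambda>x. \<Phi> r x - \<phi> k r x)) \<in> borel_measurable N"
    and lim1: "(\<lambda>k. \<integral>\<^sup>+r. ennreal (Hs_norm s (\<lambda>x. \<Phi> r x - \<phi> k r x)) \<partial>N) \<longlonglongrightarrow> 0"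
    and lim2: "(\<lambda>k. Hs_norm s (\<lambda>x. Jv x - (\<integral>r. \<phi> k r x \<partial>N))) \<longlonglongrightarrow> 0"
    using I unfolding has_Hs_integral_def N_def[symmetric] by blast
  define Y where "Y r = sob (\<Phi> r)" for r
  have Yc: "continuous_on {a..b} (\<lambda>r. inner (Y r) z)" unfolding Y_def by (intro continuous_intros cont)
  have Ym: "(\<lambda>r. inner (Y r) z) \<in> borel_measurable N"
    using borel_measurable_continuous_on_restrict[OF Yc]
    unfolding N_def by (simp add: measurable_def space_restrict_space sets_restrict_space)
  have Y_int: "integrable N (\<lambda>r. inner (Y r) z)"
  proof -
    have "compact ((\<lambda>r. inner (Y r) z) ` {a..b})" by (rule compact_continuous_image[OF Yc]) simp
    then obtain B where "\<And>r. r \<in> {a..b} \<Longrightarrow> norm (inner (Y r) z) \<le> B"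
      using compact_imp_bounded bounded_iff by (metis imageI)
    then show ?thesis by (intro N.integrable_const_bound[where B=B] Ym AE_I2) (auto simp: spN)
  qed
  have Y_eq: "(\<integral>r. inner (Y r) z \<partial>N) = integral {a..b} (\<lambda>r. inner (Y r) z)"
  proof -
    have "set_integrable lborel {a..b} (\<lambda>r. inner (Y r) z)"
      using Y_int unfolding N_def set_integrable_def by (subst (asm) integrable_restrict_space) auto
    then have "set_lebesgue_integral lborel {a..b} (\<lambda>r. inner (Y r) z) = integral {a..b} (\<lambda>r. inner (Y r) z)"
      by (rule set_borel_integral_eq_integral(2))
    then show ?thesis unfolding N_def set_lebesgue_integral_def by (subst integral_restrict_space) auto
  qed
  define Jk where "Jk k x = (\<integral>r. \<phi> k r x \<partial>N)" for k x
  have Jk: "Jk k \<in> Hs s \<and> inner (sob (Jk k)) z = (\<integral>r. inner (sob (\<phi> k r)) z \<partial>N)" for k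
  proof -
    define \<mu> where "\<mu> y = measure N (\<phi> k -` {y} \<inter> space N)" for y
    have fin: "finite (\<phi> k ` space N)" using sf[of k] unfolding simple_function_def by auto
    have yH: "y \<in> Hs s" if "y \<in> \<phi> k ` space N" for y using that \<phi> by (auto simp: spN)
    have eq: "Jk k x = (\<Sum>y\<in>\<phi> k ` space N. \<mu> y *\<^sub>R y x)" for x
      unfolding Jk_def \<mu>_def by (rule simple_function_integral(2)[OF fN sf, of "\<lambda>y. y x"])
    have m: "Jk k \<in> borel_measurable borel"
    proof -
      have "(\<lambda>x. \<Sum>y\<in>\<phi> k ` space N. \<mu> y *\<^sub>R y x) \<in> borel_measurable borel"
        using Hs_measurable[OF yH] by (intro borel_measurable_sum borel_measurable_scaleR) auto
      then show ?thesis unfolding eq[abs_def] .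
    qed
    \<comment> \<open>A simple function has finitely many values, so one null set serves all of
      them.\<close>
    have "AE x in lborel. \<forall>y\<in>\<phi> k ` space N. ev (sob y) x = y x"
      by (rule AE_finite_allI[OF fin ev_sob[OF yH]])
    then have ae: "AE x in lborel. ev (\<Sum>y\<in>\<phi> k ` space N. \<mu> y *\<^sub>R sob y) x = Jk k x"
    proof eventually_elim
      case (elim x)
      interpret e: bounded_linear "\<lambda>V. ev V x" by (rule bounded_linear_ev)
      show ?case unfolding e.sum eq using elim by (intro sum.cong) (auto simp: e.scaleR)
    qed
    have "inner (sob (Jk k)) z = (\<Sum>y\<in>\<phi> k ` space N. \<mu> y *\<^sub>R inner (sob y) z)"
      unfolding ev_Hs(2)[OF m ae] by (simp add: inner_sum_left)
    also have "\<dots> = (\<integral>r. inner (sob (\<phi> k r)) z \<partial>N)"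
      unfolding \<mu>_def by (rule simple_function_integral(2)[OF fN sf, of "\<lambda>y. inner (sob y) z", symmetric])
    finally show ?thesis using ev_Hs(1)[OF m ae] by blast
  qed
  have "(\<lambda>k. norm (sob Jv - sob (Jk k))) \<longlonglongrightarrow> 0"
    using lim2 Hs_norm_diff[OF Jv] Jk unfolding Jk_def[symmetric] by simp
  then have "(\<lambda>k. sob Jv - sob (Jk k)) \<longlonglongrightarrow> 0" by (rule tendsto_norm_zero_cancel)
  then have "(\<lambda>k. sob Jv - (sob Jv - sob (Jk k))) \<longlonglongrightarrow> sob Jv - 0" by (intro tendsto_diff tendsto_const)
  then have "(\<lambda>k. sob (Jk k)) \<longlonglongrightarrow> sob Jv" by simp
  then have L1: "(\<lambda>k. inner (sob (Jk k)) z) \<longlonglongrightarrow> inner (sob Jv) z" by (intro tendsto_intros)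
  \<comment> \<open>Cauchy-Schwarz bounds the defect by the norm of z times the L1 error in the
    definition of the integral.\<close>
  have "(\<lambda>k. ennreal (norm (inner (sob (Jk k)) z - (\<integral>r. inner (Y r) z \<partial>N)))) \<longlonglongrightarrow> 0"
  proof (rule tendsto_sandwich[OF _ _ tendsto_const])
    have "(\<lambda>k. ennreal (norm z) * (\<integral>\<^sup>+r. ennreal (Hs_norm s (\<lambda>x. \<Phi> r x - \<phi> k r x)) \<partial>N)) \<longlonglongrightarrow> ennreal (norm z) * 0"
      by (rule ennreal_tendsto_cmult[OF _ lim1]) simp
    then show "(\<lambda>k. ennreal (norm z) * (\<integral>\<^sup>+r. ennreal (Hs_norm s (\<lambda>x. \<Phi> r x - \<phi> k r x)) \<partial>N)) \<longlonglongrightarrow> 0" by simp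
    show "\<forall>\<^sub>F k in sequentially. ennreal (norm (inner (sob (Jk k)) z - (\<integral>r. inner (Y r) z \<partial>N)))
        \<le> ennreal (norm z) * (\<integral>\<^sup>+r. ennreal (Hs_norm s (\<lambda>x. \<Phi> r x - \<phi> k r x)) \<partial>N)"
    proof (intro always_eventually allI)
      fix k
      have i: "integrable N (\<lambda>r. inner (sob (\<phi> k r)) z)"
        by (rule simple_function_integral(1)[OF fN sf, of "\<lambda>y. inner (sob y) z"])
      have "inner (sob (Jk k)) z - (\<integral>r. inner (Y r) z \<partial>N) = (\<integral>r. inner (sob (\<phi> k r)) z - inner (Y r) z \<partial>N)"
        using Jk[of k] i Y_int by simp
      then have "ennreal (norm (inner (sob (Jk k)) z - (\<integral>r. inner (Y r) z \<partial>N)))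
          \<le> (\<integral>\<^sup>+r. ennreal (norm (inner (sob (\<phi> k r)) z - inner (Y r) z)) \<partial>N)"
        using norm_integral_le_nn[of N "\<lambda>r. inner (sob (\<phi> k r)) z - inner (Y r) z"] by simp
      also have "\<dots> \<le> (\<integral>\<^sup>+r. ennreal (norm z) * ennreal (Hs_norm s (\<lambda>x. \<Phi> r x - \<phi> k r x)) \<partial>N)"
      proof (rule nn_integral_mono)
        fix r assume "r \<in> space N"
        then have r: "r \<in> {a..b}" by (simp add: spN)
        have "norm (inner (sob (\<phi> k r)) z - inner (Y r) z) \<le> norm (sob (\<phi> k r) - Y r) * norm z"
          unfolding inner_diff_left[symmetric] real_norm_def by (rule Cauchy_Schwarz_ineq2)
        also have "\<dots> = norm z * Hs_norm s (\<lambda>x. \<Phi> r x - \<phi> k r x)"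
          unfolding Hs_norm_diff[OF \<Phi>[OF r] \<phi>[OF r]] Y_def by (simp add: norm_minus_commute mult.commute)
        finally show "ennreal (norm (inner (sob (\<phi> k r)) z - inner (Y r) z))
           \<le> ennreal (norm z) * ennreal (Hs_norm s (\<lambda>x. \<Phi> r x - \<phi> k r x))"
          unfolding Hs_norm_diff[OF \<Phi>[OF r] \<phi>[OF r]] by (simp add: ennreal_leI flip: ennreal_mult)
      qed
      also have "\<dots> = ennreal (norm z) * (\<integral>\<^sup>+r. ennreal (Hs_norm s (\<lambda>x. \<Phi> r x - \<phi> k r x)) \<partial>N)"
        by (rule nn_integral_cmult) (use meas[of k] in simp)
      finally show "ennreal (norm (inner (sob (Jk k)) z - (\<integral>r. inner (Y r) z \<partial>N)))
        \<le> ennreal (norm z) * (\<integral>\<^sup>+r. ennreal (Hs_norm s (\<lambda>x. \<Phi> r x - \<phi> k r x)) \<partial>N)" .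
    qed
  qed simp
  then have "(\<lambda>k. norm (inner (sob (Jk k)) z - (\<integral>r. inner (Y r) z \<partial>N))) \<longlonglongrightarrow> 0"
    by (subst (asm) ennreal_0[symmetric], subst (asm) tendsto_ennreal_iff) auto
  then have "(\<lambda>k. inner (sob (Jk k)) z) \<longlonglongrightarrow> (\<integral>r. inner (Y r) z \<partial>N)"
    by (rule LIM_zero_cancel[OF tendsto_norm_zero_cancel])
  then show ?thesis using LIMSEQ_unique[OF L1] Y_eq unfolding Y_def by simp
qed

lemma has_Hs_integral_riemann:
  assumes I: "has_Hs_integral s 0 (real n * \<delta>) \<Phi> Jv" and \<delta>: "0 \<le> \<delta>"
    and cont: "continuous_on {0..real n * \<delta>} (\<lambda>r. sob (\<Phi> r))"
    and close: "\<And>k r. k < n \<Longrightarrow> real k * \<delta> \<le> r \<Longrightarrow> r \<le> real (Suc k) * \<delta> \<Longrightarrow>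
      norm (sob (\<Phi> r) - sob (\<Phi> (real k * \<delta>))) \<le> \<epsilon>"
  shows "norm (sob Jv - (\<Sum>k<n. \<delta> *\<^sub>R sob (\<Phi> (real k * \<delta>)))) \<le> real n * \<delta> * \<epsilon>"
proof -
  \<comment> \<open>Testing with the error itself turns the scalar estimate into a bound for its
    norm.\<close>
  define z where "z = sob Jv - (\<Sum>k<n. \<delta> *\<^sub>R sob (\<Phi> (real k * \<delta>)))"
  have "(norm z)\<^sup>2 = inner (sob Jv) z - (\<Sum>k<n. \<delta> * inner (sob (\<Phi> (real k * \<delta>))) z)"
    unfolding power2_norm_eq_inner by (subst (1) z_def) (simp add: inner_diff_left inner_sum_left)
  also have "\<dots> = integral {0..real n * \<delta>} (\<lambda>r. inner (sob (\<Phi> r)) z) - (\<Sum>k<n. \<delta> * inner (sob (\<Phi> (real k * \<delta>))) z)"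
    unfolding has_Hs_integral_inner[OF I cont] ..
  also have "\<dots> \<le> \<bar>\<dots>\<bar>" by (rule abs_ge_self)
  also have "\<dots> \<le> real n * \<delta> * (\<epsilon> * norm z)"
  proof (rule riemann_sum_bound[OF \<delta>])
    show "continuous_on {0..real n * \<delta>} (\<lambda>r. inner (sob (\<Phi> r)) z)" by (intro continuous_intros cont)
    fix k r assume a: "k < n" "real k * \<delta> \<le> r" "r \<le> real (Suc k) * \<delta>"
    have "\<bar>inner (sob (\<Phi> r)) z - inner (sob (\<Phi> (real k * \<delta>))) z\<bar> \<le> norm (sob (\<Phi> r) - sob (\<Phi> (real k * \<delta>))) * norm z"
      unfolding inner_diff_left[symmetric] by (rule Cauchy_Schwarz_ineq2)
    also have "\<dots> \<le> \<epsilon> * norm z" by (intro mult_right_mono close a) auto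
    finally show "\<bar>inner (sob (\<Phi> r)) z - inner (sob (\<Phi> (real k * \<delta>))) z\<bar> \<le> \<epsilon> * norm z" .
  qed
  finally have "norm z * norm z \<le> (real n * \<delta> * \<epsilon>) * norm z" by (simp add: power2_eq_square mult_ac)
  show ?thesis
  proof (cases "norm z = 0")
    case True
    have "0 \<le> real n * \<delta> * \<epsilon>"
    proof (cases "n = 0")
      case False
      then have "0 \<le> \<epsilon>" using close[of 0 0] \<delta> by (auto intro: order_trans[OF norm_ge_zero])
      then show ?thesis using \<delta> by simp
    qed simp
    then show ?thesis using True unfolding z_def by simp
  next
    case False
    then show ?thesis using \<open>norm z * norm z \<le> (real n * \<delta> * \<epsilon>) * norm z\<close> unfolding z_def[symmetric]
      by (simp add: mult_le_cancel_right)
  qed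
qed

end

section \<open>Convergence of the refined scheme to the mild solution along a path\<close>

context truncated_nls
begin

lemma NL_Hs:
  assumes v: "v \<in> Hs s"
  shows "(\<lambda>x. complex_of_real (theta_R s \<theta> R v * cmod (v x) ^ (2 * \<sigma>)) * v x) \<in> Hs s"
    and "sob (\<lambda>x. complex_of_real (theta_R s \<theta> R v * cmod (v x) ^ (2 * \<sigma>)) * v x) = th (sob v) *\<^sub>R NL (sob v)"
proof -
  have [measurable]: "v \<in> borel_measurable borel" by (rule Hs_measurable[OF v])
  have th: "theta_R s \<theta> R v = th (sob v)" unfolding theta_R_def th_def Hs_norm_sob[OF v] ..
  have m: "(\<lambda>x. complex_of_real (theta_R s \<theta> R v * cmod (v x) ^ (2 * \<sigma>)) * v x) \<in> borel_measurable borel"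
    by measurable
  have ae: "AE x in lborel. ev (th (sob v) *\<^sub>R NL (sob v)) x = complex_of_real (theta_R s \<theta> R v * cmod (v x) ^ (2 * \<sigma>)) * v x"
    using ev_sob[OF v] by eventually_elim (simp add: ev_scaleR ev_NL th)
  show "(\<lambda>x. complex_of_real (theta_R s \<theta> R v * cmod (v x) ^ (2 * \<sigma>)) * v x) \<in> Hs s"
    and "sob (\<lambda>x. complex_of_real (theta_R s \<theta> R v * cmod (v x) ^ (2 * \<sigma>)) * v x) = th (sob v) *\<^sub>R NL (sob v)"
    by (rule ev_Hs[OF m ae])+
qed

text \<open>The path is merely continuous, so no rate can be expected: the modulus of continuity of
  the integrand bounds the quadrature error, and the discrete Gronwall inequality propagates it.
  Uniqueness of the mild solution is implicit here, as every solution is the limit of the same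
  iterates.\<close>

lemma path_convergence:
  fixes w :: "real \<Rightarrow> real" and u :: "real \<Rightarrow> real \<Rightarrow> complex"
  assumes T: "0 < T" and w: "continuous_on {0..T} w" and u0: "u0 \<in> Hs s" and u: "\<And>t. t \<in> {0..T} \<Longrightarrow> u t \<in> Hs s"
    and uc: "\<And>t. t \<in> {0..T} \<Longrightarrow> ((\<lambda>r. Hs_norm s (\<lambda>x. u r x - u t x)) \<longlongrightarrow> 0) (at t within {0..T})"
    and mild: "\<And>t. t \<in> {0..T} \<Longrightarrow> \<exists>J. has_Hs_integral s 0 t
             (\<lambda>r. free_flow (w t - w r) (\<lambda>x. complex_of_real (theta_R s \<theta> R (u r) * cmod (u r x) ^ (2 * \<sigma>)) * u r x)) J \<and>
           (AE x in lborel. u t x = free_flow (w t - w 0) u0 x + \<i> * J x)"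
    and h: "0 < h" and kh: "real k * h \<le> T"
  shows "(\<lambda>m. tw (h / real (Suc m)) (\<lambda>j. w (real j * (h / real (Suc m)))) (sob u0) (k * Suc m)) \<longlonglongrightarrow> U (- w (real k * h)) (sob (u (real k * h)))"
proof -
  define x where "x t = sob (u t)" for t
  define y where "y t = U (- w t) (x t)" for t
  \<comment> \<open>The integrand of the mild equation pulled back by \<open>U (- w t)\<close>,
    which removes its dependence on the end point t. Apart from the factor \<i> it is
    \<open>G (w r) (y r)\<close>.\<close>
  define q where "q r = U (- w r) (th (x r) *\<^sub>R NL (x r))" for r
  have xc: "continuous_on {0..T} x"
    unfolding continuous_on_def
  proof
    fix t assume t: "t \<in> {0..T}"
    have "((\<lambda>r. norm (x r - x t)) \<longlongrightarrow> 0) (at t within {0..T})"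
    proof (rule Lim_transform_eventually[OF uc[OF t]])
      show "\<forall>\<^sub>F r in at t within {0..T}. Hs_norm s (\<lambda>x. u r x - u t x) = norm (x r - x t)"
        unfolding eventually_at_filter x_def by (intro always_eventually allI impI Hs_norm_diff u t)
    qed
    then show "(x \<longlongrightarrow> x t) (at t within {0..T})" by (simp add: tendsto_norm_zero_iff LIM_zero_iff)
  qed
  have qc: "continuous_on {0..T} q"
    unfolding q_def
    by (intro continuous_intros w continuous_on_compose2[OF th_continuous xc] continuous_on_compose2[OF pol_continuous[OF pol_NL] xc]) auto
  then have uq: "uniformly_continuous_on {0..T} q" by (intro compact_uniformly_continuous) auto
  have Gq: "G (w r) (y r) = iV (q r)" for r
    unfolding G_def y_def q_def TF_def by (simp add: U_iV[symmetric] U_scaleR iV_scaleR)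
  obtain S where S: "0 \<le> S" "\<And>\<tau> V. 0 \<le> \<tau> \<Longrightarrow> \<tau> \<le> T \<Longrightarrow> norm (step \<tau> V - V - \<tau> *\<^sub>R TF V) \<le> S * \<tau>\<^sup>2"
    using step_taylor[of T] by blast
  have bound: "norm (y (real n * \<delta>) - tw \<delta> (\<lambda>j. w (real j * \<delta>)) (sob u0) n) \<le> (T * \<epsilon> + S * T * \<delta>) * exp (KF * T)"
    if \<delta>: "0 < \<delta>" and n: "real n * \<delta> \<le> T" and \<epsilon>: "\<And>r r'. r \<in> {0..T} \<Longrightarrow> r' \<in> {0..T} \<Longrightarrow> \<bar>r - r'\<bar> \<le> \<delta> \<Longrightarrow> norm (q r - q r') \<le> \<epsilon>"
    for n \<delta> \<epsilon>
  proof -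
    define V where "V n = tw \<delta> (\<lambda>j. w (real j * \<delta>)) (sob u0) n" for n
    define e where "e n = norm (y (real n * \<delta>) - V n)" for n
    have \<epsilon>0: "0 \<le> \<epsilon>" using \<epsilon>[of 0 0] T \<delta> by simp
    have Vsum: "norm (V l - U (- w 0) (sob u0) - (\<Sum>k<l. \<delta> *\<^sub>R G (w (real k * \<delta>)) (V k))) \<le> real l * (S * \<delta>\<^sup>2)" if "l \<le> n" for l
      using that
    proof (induction l)
      case 0
      show ?case unfolding V_def by simp
    next
      case (Suc l)
      have "real 1 * \<delta> \<le> real n * \<delta>" using Suc \<delta> by (intro mult_right_mono) auto
      then have "\<delta> \<le> T" using n by simp
      then have "norm (V (Suc l) - V l - \<delta> *\<^sub>R G (w (real l * \<delta>)) (V l)) \<le> S * \<delta>\<^sup>2"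
        unfolding V_def using \<delta> by (intro tw_increment[of \<delta> S "\<lambda>j. w (real j * \<delta>)"] S(2)) auto
      moreover have "V (Suc l) - U (- w 0) (sob u0) - (\<Sum>k<Suc l. \<delta> *\<^sub>R G (w (real k * \<delta>)) (V k))
          = (V (Suc l) - V l - \<delta> *\<^sub>R G (w (real l * \<delta>)) (V l)) + (V l - U (- w 0) (sob u0) - (\<Sum>k<l. \<delta> *\<^sub>R G (w (real k * \<delta>)) (V k)))"
        by simp
      ultimately show ?case using Suc norm_triangle_ineq[of "V (Suc l) - V l - \<delta> *\<^sub>R G (w (real l * \<delta>)) (V l)"
          "V l - U (- w 0) (sob u0) - (\<Sum>k<l. \<delta> *\<^sub>R G (w (real k * \<delta>)) (V k))"]
        by (simp only: of_nat_Suc distrib_right) simp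
    qed
    \<comment> \<open>In the interaction picture, the mild equation at time l \<delta> is a Riemann
      sum of \<open>G\<close> along the exact solution up to the quadrature error, and so takes the
      form of the summed Euler scheme.\<close>
    have ysum: "norm (y (real l * \<delta>) - U (- w 0) (sob u0) - (\<Sum>k<l. \<delta> *\<^sub>R G (w (real k * \<delta>)) (y (real k * \<delta>)))) \<le> T * \<epsilon>"
      if l: "l \<le> n" for l
    proof -
      define t where "t = real l * \<delta>"
      have tT: "t \<le> T"
      proof -
        have "real l * \<delta> \<le> real n * \<delta>" using l \<delta> by (intro mult_right_mono) auto
        then show ?thesis unfolding t_def using n by simp
      qed
      have t: "t \<in> {0..T}" using tT \<delta> unfolding t_def by simp
      let ?N = "\<lambda>r x. complex_of_real (theta_R s \<theta> R (u r) * cmod (u r x) ^ (2 * \<sigma>)) * u r x"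
      obtain Jv where I: "has_Hs_integral s 0 t (\<lambda>r. free_flow (w t - w r) (?N r)) Jv"
        and ut: "AE x in lborel. u t x = free_flow (w t - w 0) u0 x + \<i> * Jv x"
        using mild[OF t] by blast
      have Jv: "Jv \<in> Hs s" using I unfolding has_Hs_integral_def by blast
      have sobN: "sob (free_flow (w t - w r) (?N r)) = U (w t) (q r)" if "r \<in> {0..T}" for r
        using free_flow_Hs(2)[OF NL_Hs(1)[OF u[OF that]], of "w t - w r"] NL_Hs(2)[OF u[OF that]]
        unfolding q_def x_def by (simp add: U_U)
      have inT: "r \<in> {0..T}" if "r \<in> {0..real l * \<delta>}" for r using that tT unfolding t_def by auto
      have cc: "continuous_on {0..real l * \<delta>} (\<lambda>r. sob (free_flow (w t - w r) (?N r)))"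
      proof -
        have "continuous_on {0..real l * \<delta>} (\<lambda>r. U (w t) (q r))"
          by (intro continuous_intros continuous_on_subset[OF qc]) (use inT in auto)
        then show ?thesis by (rule continuous_on_eq) (use inT sobN in auto)
      qed
      have kT: "real k * \<delta> \<in> {0..T}" if "k < l" for k
      proof -
        have "real k * \<delta> \<le> real l * \<delta>" using that \<delta> by (intro mult_right_mono) auto
        then have "real k * \<delta> \<le> T" using tT unfolding t_def by linarith
        then show ?thesis using \<delta> by simp
      qed
      have "norm (sob Jv - (\<Sum>k<l. \<delta> *\<^sub>R sob (free_flow (w t - w (real k * \<delta>)) (?N (real k * \<delta>))))) \<le> t * \<epsilon>"
      proof (rule has_Hs_integral_riemann[of l \<delta>, folded t_def, OF I _ cc[folded t_def]])
        fix k r assume a: "k < l" "real k * \<delta> \<le> r" "r \<le> real (Suc k) * \<delta>"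
        have "real (Suc k) * \<delta> \<le> real l * \<delta>" using a \<delta> by (intro mult_right_mono) auto
        then have r: "r \<in> {0..T}" using a kT[OF a(1)] tT unfolding t_def by auto
        have "\<bar>r - real k * \<delta>\<bar> \<le> \<delta>" using a by (simp add: algebra_simps)
        then show "norm (sob (free_flow (w t - w r) (?N r)) - sob (free_flow (w t - w (real k * \<delta>)) (?N (real k * \<delta>)))) \<le> \<epsilon>"
          unfolding sobN[OF r] sobN[OF kT[OF a(1)]] using \<epsilon>[OF r kT[OF a(1)]] by (simp flip: U_diff)
      qed (use \<delta> in simp)
      also have "(\<Sum>k<l. \<delta> *\<^sub>R sob (free_flow (w t - w (real k * \<delta>)) (?N (real k * \<delta>)))) = (\<Sum>k<l. \<delta> *\<^sub>R U (w t) (q (real k * \<delta>)))"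
        using sobN kT by (intro sum.cong) auto
      also have "t * \<epsilon> \<le> T * \<epsilon>" using tT \<epsilon>0 by (rule mult_right_mono)
      finally have 1: "norm (sob Jv - (\<Sum>k<l. \<delta> *\<^sub>R U (w t) (q (real k * \<delta>)))) \<le> T * \<epsilon>" .
      have "AE z in lborel. ev (U (w t - w 0) (sob u0) + iV (sob Jv)) z = u t z"
        using ut ev_sob[OF free_flow_Hs(1)[OF u0, of "w t - w 0"]] ev_sob[OF Jv]
        by eventually_elim (simp add: ev_add ev_iV free_flow_Hs(2)[OF u0])
      then have "x t = U (w t - w 0) (sob u0) + iV (sob Jv)"
        unfolding x_def by (rule ev_Hs(2)[OF Hs_measurable[OF u[OF t]]])
      then have yt: "y t = U (- w 0) (sob u0) + U (- w t) (iV (sob Jv))"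
        unfolding y_def by (simp add: U_add U_U)
      interpret Ul: bounded_linear "\<lambda>V. U (- w t) (iV V)"
        by (rule bounded_linear_compose[OF _ bounded_linear_iV]) (unfold U_def, rule bounded_linear_mop[OF bdd_ek])
      have "U (- w t) (iV (\<Sum>k<l. \<delta> *\<^sub>R U (w t) (q (real k * \<delta>)))) = (\<Sum>k<l. \<delta> *\<^sub>R G (w (real k * \<delta>)) (y (real k * \<delta>)))"
        unfolding Ul.sum Ul.scaleR Gq by (simp add: U_iV[symmetric])
      then have "y t - U (- w 0) (sob u0) - (\<Sum>k<l. \<delta> *\<^sub>R G (w (real k * \<delta>)) (y (real k * \<delta>)))
          = U (- w t) (iV (sob Jv - (\<Sum>k<l. \<delta> *\<^sub>R U (w t) (q (real k * \<delta>)))))"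
        unfolding yt Ul.diff by simp
      then show ?thesis using 1 unfolding t_def by simp
    qed
    have rec: "e l \<le> (T * \<epsilon> + S * T * \<delta>) + (KF * \<delta>) * (\<Sum>k<l. e k)" if l: "l \<le> n" for l
    proof -
      have lT: "real l * \<delta> \<le> T"
      proof -
        have "real l * \<delta> \<le> real n * \<delta>" using l \<delta> by (intro mult_right_mono) auto
        then show ?thesis using n by simp
      qed
      let ?a = "y (real l * \<delta>) - U (- w 0) (sob u0) - (\<Sum>k<l. \<delta> *\<^sub>R G (w (real k * \<delta>)) (y (real k * \<delta>)))"
      let ?b = "V l - U (- w 0) (sob u0) - (\<Sum>k<l. \<delta> *\<^sub>R G (w (real k * \<delta>)) (V k))"
      let ?c = "\<Sum>k<l. \<delta> *\<^sub>R (G (w (real k * \<delta>)) (y (real k * \<delta>)) - G (w (real k * \<delta>)) (V k))"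
      have tri: "norm (p - q + r) \<le> norm p + norm q + norm r" for p q r :: l2
        using norm_triangle_ineq[of "p - q" r] norm_triangle_ineq4[of p q] by linarith
      have "y (real l * \<delta>) - V l = ?a - ?b + ?c" by (simp add: scaleR_diff_right sum_subtractf)
      then have "e l = norm (?a - ?b + ?c)" unfolding e_def by (rule arg_cong)
      also have "\<dots> \<le> norm ?a + norm ?b + norm ?c" by (rule tri)
      finally have "e l \<le> norm ?a + norm ?b + norm ?c" .
      moreover have "norm ?b \<le> S * T * \<delta>"
      proof -
        have "real l * (S * \<delta>\<^sup>2) = S * (real l * \<delta>) * \<delta>" by (simp add: power2_eq_square)
        also have "\<dots> \<le> S * T * \<delta>" using lT S(1) \<delta> by (intro mult_right_mono mult_left_mono) auto
        finally show ?thesis using Vsum[OF l] by simp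
      qed
      moreover have "norm ?c \<le> (\<Sum>k<l. KF * \<delta> * e k)"
      proof (rule sum_norm_le)
        fix k
        show "norm (\<delta> *\<^sub>R (G (w (real k * \<delta>)) (y (real k * \<delta>)) - G (w (real k * \<delta>)) (V k))) \<le> KF * \<delta> * e k"
          using mult_left_mono[OF G_lip[of "w (real k * \<delta>)" "y (real k * \<delta>)" "V k"], of \<delta>] \<delta> unfolding e_def by (simp add: mult_ac)
      qed
      ultimately show ?thesis using ysum[OF l] by (simp add: sum_distrib_left)
    qed
    have "e n \<le> (T * \<epsilon> + S * T * \<delta>) * exp ((KF * \<delta>) * real n)"
      by (rule discrete_gronwall[OF rec]) (use KF(1) \<delta> T S(1) \<epsilon>0 in auto)
    also have "\<dots> \<le> (T * \<epsilon> + S * T * \<delta>) * exp (KF * T)"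
    proof -
      have "KF * (real n * \<delta>) \<le> KF * T" by (rule mult_left_mono[OF n KF(1)])
      then show ?thesis using T S(1) \<epsilon>0 \<delta> by (intro mult_left_mono) (auto simp: mult_ac)
    qed
    finally show ?thesis unfolding e_def V_def .
  qed
  show ?thesis
  proof (rule LIMSEQ_I)
    fix e0 :: real assume e0: "0 < e0"
    define E where "E = exp (KF * T)"
    have E: "0 < E" unfolding E_def by simp
    \<comment> \<open>This choice and the bound d' for the step keep each of the two error
      contributions at most e0 / 4. In d' the factor S + 1 prevents a division by zero.\<close>
    define \<epsilon> where "\<epsilon> = e0 / (4 * T * E)"
    have \<epsilon>: "0 < \<epsilon>" unfolding \<epsilon>_def using e0 T E by simp
    obtain d where "0 < d" "\<forall>r\<in>{0..T}. \<forall>r'\<in>{0..T}. dist r' r < d \<longrightarrow> dist (q r') (q r) < \<epsilon>"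
      using uq \<epsilon> unfolding uniformly_continuous_on_def by blast
    then have d: "0 < d" "\<And>r r'. r \<in> {0..T} \<Longrightarrow> r' \<in> {0..T} \<Longrightarrow> dist r' r < d \<Longrightarrow> dist (q r') (q r) < \<epsilon>"
      by auto
    define d' where "d' = min d (e0 / (4 * (S + 1) * T * E))"
    have d': "0 < d'" "d' \<le> d" "d' \<le> e0 / (4 * (S + 1) * T * E)" unfolding d'_def using d e0 S(1) T E by auto
    have "(\<lambda>m. h / real (Suc m)) \<longlonglongrightarrow> 0" by (rule LIMSEQ_Suc[OF lim_const_over_n])
    then obtain m0 where m0: "\<And>m. m \<ge> m0 \<Longrightarrow> h / real (Suc m) < d'"
      using LIMSEQ_D[of "\<lambda>m. h / real (Suc m)" 0 d'] d' h by auto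
    have "norm (tw (h / real (Suc m)) (\<lambda>j. w (real j * (h / real (Suc m)))) (sob u0) (k * Suc m) - U (- w (real k * h)) (sob (u (real k * h)))) < e0"
      if m: "m \<ge> m0" for m
    proof -
      define \<delta> where "\<delta> = h / real (Suc m)"
      have \<delta>: "0 < \<delta>" "\<delta> < d'" unfolding \<delta>_def using h m0[OF m] by auto
      have "real (Suc m) * \<delta> = h" unfolding \<delta>_def by (simp del: of_nat_Suc)
      then have kd: "real (k * Suc m) * \<delta> = real k * h" by (simp only: of_nat_mult mult.assoc)
      have "norm (y (real (k * Suc m) * \<delta>) - tw \<delta> (\<lambda>j. w (real j * \<delta>)) (sob u0) (k * Suc m)) \<le> (T * \<epsilon> + S * T * \<delta>) * exp (KF * T)"
      proof (rule bound[OF \<delta>(1), where n="k * Suc m" and \<epsilon>=\<epsilon>])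
        show "real (k * Suc m) * \<delta> \<le> T" using kh by (simp only: kd)
        fix r r' assume a: "r \<in> {0..T}" "r' \<in> {0..T}" "\<bar>r - r'\<bar> \<le> \<delta>"
        then have "dist r r' < d" using \<delta>(2) d'(2) by (simp only: dist_real_def)
        then show "norm (q r - q r') \<le> \<epsilon>" using d(2)[OF a(2,1)] by (simp add: dist_norm)
      qed
      also have "\<dots> = T * \<epsilon> * E + S * \<delta> * (T * E)" unfolding E_def by (simp add: algebra_simps)
      also have "\<dots> \<le> e0 / 4 + e0 / 4"
      proof (rule add_mono)
        show "T * \<epsilon> * E \<le> e0 / 4" unfolding \<epsilon>_def using T E by simp
        have "S * \<delta> \<le> (S + 1) * (e0 / (4 * (S + 1) * T * E))"
          using S(1) \<delta> d'(3) by (intro mult_mono) auto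
        also have "\<dots> = e0 / (4 * T * E)"
        proof -
          have "c * (e0 / (4 * c * T * E)) = e0 / (4 * T * E)" if "0 < c" for c using that by simp
          from this[of "S + 1"] show ?thesis using S(1) by linarith
        qed
        finally have "S * \<delta> * (T * E) \<le> e0 / (4 * T * E) * (T * E)" using T E by (intro mult_right_mono) auto
        moreover have "e0 / (4 * T * E) * (T * E) = e0 / 4" using T E by simp
        ultimately show "S * \<delta> * (T * E) \<le> e0 / 4" by (simp only:)
      qed
      also have "\<dots> < e0" using e0 by simp
      finally have "norm (y (real k * h) - tw \<delta> (\<lambda>j. w (real j * \<delta>)) (sob u0) (k * Suc m)) < e0"
        unfolding kd .
      then show ?thesis unfolding y_def x_def \<delta>_def by (subst norm_minus_commute)
    qed
    then show "\<exists>no. \<forall>m\<ge>no. norm (tw (h / real (Suc m)) (\<lambda>j. w (real j * (h / real (Suc m)))) (sob u0) (k * Suc m) - U (- w (real k * h)) (sob (u (real k * h)))) < e0"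
      by (intro exI[of _ m0] allI impI)
  qed
qed

section \<open>Passage to the limit\<close>

text \<open>The correspondence with the twisted iteration is exact: the phase of one step cancels
  the inverse phase of the frame at its left end and leaves the phase at its right end.\<close>

lemma splitting_tw:
  assumes u0: "u0 \<in> Hs s"
  shows "splitting s \<sigma> \<theta> R h w u0 n \<in> Hs s"
    and "sob (splitting s \<sigma> \<theta> R h w u0 n) = U (w (real n * h)) (tw h (\<lambda>k. w (real k * h)) (sob u0) n)"
proof -
  have "splitting s \<sigma> \<theta> R h w u0 n \<in> Hs s \<and>
    sob (splitting s \<sigma> \<theta> R h w u0 n) = U (w (real n * h)) (tw h (\<lambda>k. w (real k * h)) (sob u0) n)"
  proof (induction n)
    case 0
    show ?case using u0 by simp
  next
    case (Suc n)
    define v where "v = splitting s \<sigma> \<theta> R h w u0 n"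
    define v' where "v' x = exp (\<i> * complex_of_real (h * theta_R s \<theta> R v * cmod (v x) ^ (2 * \<sigma>))) * v x" for x
    have v: "v \<in> Hs s" "sob v = U (w (real n * h)) (tw h (\<lambda>k. w (real k * h)) (sob u0) n)"
      using Suc unfolding v_def by auto
    have [measurable]: "v \<in> borel_measurable borel" by (rule Hs_measurable[OF v(1)])
    have th: "theta_R s \<theta> R v = th (sob v)" unfolding theta_R_def th_def Hs_norm_sob[OF v(1)] ..
    have m: "v' \<in> borel_measurable borel" unfolding v'_def by measurable
    have ae: "AE x in lborel. ev (step h (sob v)) x = v' x"
      using ev_sob[OF v(1)] by eventually_elim (simp add: ev_step v'_def th)
    note v' = ev_Hs[OF m ae]
    have eq: "splitting s \<sigma> \<theta> R h w u0 (Suc n) = free_flow (w (real (Suc n) * h) - w (real n * h)) v'"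
      unfolding splitting.simps Let_def v_def[symmetric] v'_def ..
    have "sob (splitting s \<sigma> \<theta> R h w u0 (Suc n)) = U (w (real (Suc n) * h) - w (real n * h)) (step h (sob v))"
      unfolding eq using free_flow_Hs(2)[OF v'(1)] v'(2) by simp
    also have "\<dots> = U (w (real (Suc n) * h)) (tw h (\<lambda>k. w (real k * h)) (sob u0) (Suc n))"
      unfolding v(2) by (simp add: U_U)
    finally show ?case unfolding eq using free_flow_Hs(1)[OF v'(1)] by blast
  qed
  then show "splitting s \<sigma> \<theta> R h w u0 n \<in> Hs s"
    and "sob (splitting s \<sigma> \<theta> R h w u0 n) = U (w (real n * h)) (tw h (\<lambda>k. w (real k * h)) (sob u0) n)"
    by blast+
qed

text \<open>The solution is only known to have measurable distances to fixed elements, so the random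
  second argument is approximated by functions with countable range.\<close>

lemma distance_measurable:
  fixes M :: "'w measure" and \<Psi> :: "(nat \<Rightarrow> real) \<Rightarrow> l2" and X :: "'w \<Rightarrow> l2"
  assumes X: "\<And>V. (\<lambda>\<omega>. norm (X \<omega> - V)) \<in> borel_measurable M"
    and \<Psi>: "continuous_on UNIV \<Psi>" and loc: "\<And>w w'. (\<And>i. i \<le> n \<Longrightarrow> w i = w' i) \<Longrightarrow> \<Psi> w = \<Psi> w'"
    and W: "\<And>j. j \<le> n \<Longrightarrow> (\<lambda>\<omega>. W j \<omega>) \<in> borel_measurable M"
  shows "(\<lambda>\<omega>. norm (X \<omega> - \<Psi> (\<lambda>j. W j \<omega>))) \<in> borel_measurable M"
proof -
  \<comment> \<open>Dyadic rounding of the path values up to n produces a list of integers. As this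
    type is countable, measurability of \<open>norm (X \<omega> - V)\<close> at each fixed V is
    enough.\<close>
  define g where "g p \<omega> = map (\<lambda>j. \<lfloor>2 ^ p * W j \<omega>\<rfloor>) [0..<Suc n]" for p :: nat and \<omega>
  define dec where "dec p l = (\<lambda>j. if j \<le> n then real_of_int (l ! j) / 2 ^ p else 0)" for p :: nat and l :: "int list"
  have g_meas: "g p \<in> measurable M (count_space UNIV)" for p
  proof -
    have "{\<omega> \<in> space M. g p \<omega> = l} \<in> sets M" for l
    proof -
      have "{\<omega> \<in> space M. g p \<omega> = l} = {\<omega> \<in> space M. length l = Suc n \<and> (\<forall>j\<in>{..n}. \<lfloor>2 ^ p * W j \<omega>\<rfloor> = l ! j)}"
        unfolding g_def by (auto simp: list_eq_iff_nth_eq less_Suc_eq_le simp del: upt_Suc)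
      also have "\<dots> \<in> sets M"
      proof -
        have "{\<omega> \<in> space M. \<lfloor>2 ^ p * W j \<omega>\<rfloor> = l ! j} \<in> sets M" if "j \<in> {..n}" for j
        proof -
          have [measurable]: "(\<lambda>\<omega>. W j \<omega>) \<in> borel_measurable M" using W[of j] that by simp
          show ?thesis by measurable
        qed
        then have "{\<omega> \<in> space M. \<forall>j\<in>{..n}. \<lfloor>2 ^ p * W j \<omega>\<rfloor> = l ! j} \<in> sets M"
          by (intro sets.sets_Collect_finite_All) simp_all
        then show ?thesis by (cases "length l = Suc n") simp_all
      qed
      finally show ?thesis .
    qed
    then show ?thesis by (subst measurable_count_space_eq_countable) (auto simp: vimage_def Int_def conj_commute)
  qed
  have meas: "(\<lambda>\<omega>. norm (X \<omega> - \<Psi> (dec p (g p \<omega>)))) \<in> borel_measurable M" for p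
    by (rule measurable_compose_countable[OF X g_meas])
  show ?thesis
  proof (rule borel_measurable_LIMSEQ_real[OF _ meas])
    fix \<omega>
    define w' where "w' j = (if j \<le> n then W j \<omega> else 0)" for j
    have "(\<lambda>p. dec p (g p \<omega>)) \<longlonglongrightarrow> w'"
    proof -
      have comp: "(\<lambda>p. dec p (g p \<omega>) j) \<longlonglongrightarrow> w' j" for j
      proof (cases "j \<le> n")
        case True
        have eq: "dec p (g p \<omega>) j = real_of_int \<lfloor>2 ^ p * W j \<omega>\<rfloor> / 2 ^ p" for p
          using True unfolding dec_def g_def by (simp del: upt_Suc)
        have "(\<lambda>p. real_of_int \<lfloor>2 ^ p * W j \<omega>\<rfloor> / 2 ^ p) \<longlonglongrightarrow> W j \<omega>"
        proof (rule tendsto_sandwich[OF _ _ _ tendsto_const])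
          have "(\<lambda>p. W j \<omega> - (1/2) ^ p) \<longlonglongrightarrow> W j \<omega> - 0"
            by (intro tendsto_intros LIMSEQ_power_zero) simp
          then show "(\<lambda>p. W j \<omega> - (1/2) ^ p) \<longlonglongrightarrow> W j \<omega>" by simp
          show "\<forall>\<^sub>F p in sequentially. W j \<omega> - (1/2) ^ p \<le> real_of_int \<lfloor>2 ^ p * W j \<omega>\<rfloor> / 2 ^ p"
          proof (intro always_eventually allI)
            fix p :: nat
            have "2 ^ p * W j \<omega> - 1 \<le> real_of_int \<lfloor>2 ^ p * W j \<omega>\<rfloor>" by linarith
            then have "(2 ^ p * W j \<omega> - 1) / 2 ^ p \<le> real_of_int \<lfloor>2 ^ p * W j \<omega>\<rfloor> / 2 ^ p"
              by (rule divide_right_mono) simp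
            then show "W j \<omega> - (1/2) ^ p \<le> real_of_int \<lfloor>2 ^ p * W j \<omega>\<rfloor> / 2 ^ p"
              by (simp add: diff_divide_distrib power_one_over)
          qed
          show "\<forall>\<^sub>F p in sequentially. real_of_int \<lfloor>2 ^ p * W j \<omega>\<rfloor> / 2 ^ p \<le> W j \<omega>"
          proof (intro always_eventually allI)
            fix p :: nat
            have "real_of_int \<lfloor>2 ^ p * W j \<omega>\<rfloor> \<le> 2 ^ p * W j \<omega>" by linarith
            then show "real_of_int \<lfloor>2 ^ p * W j \<omega>\<rfloor> / 2 ^ p \<le> W j \<omega>"
              by (simp add: divide_le_eq mult.commute)
          qed
        qed
        then show ?thesis using True unfolding eq w'_def by simp
      next
        case False
        then show ?thesis unfolding dec_def w'_def by simp
      qed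
      have "limitin (product_topology (\<lambda>i. euclidean) UNIV) (\<lambda>p. dec p (g p \<omega>)) w' sequentially"
        unfolding limitin_componentwise using comp by simp
      then show ?thesis unfolding euclidean_product_topology by simp
    qed
    then have "(\<lambda>p. \<Psi> (dec p (g p \<omega>))) \<longlonglongrightarrow> \<Psi> w'"
      by (rule continuous_on_tendsto_compose[OF \<Psi>]) simp_all
    moreover have "\<Psi> w' = \<Psi> (\<lambda>j. W j \<omega>)" by (rule loc) (simp add: w'_def)
    ultimately show "(\<lambda>p. norm (X \<omega> - \<Psi> (dec p (g p \<omega>)))) \<longlonglongrightarrow> norm (X \<omega> - \<Psi> (\<lambda>j. W j \<omega>))"
      by (intro tendsto_intros) simp
  qed
qed

text \<open>The rate between coarse and fine scheme is uniform in m. The fine scheme converges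
  almost surely, and a deterministic bound permits dominated convergence. The constant is fixed
  before the probability space, the initial value of norm \<nu>, the solution and N.\<close>

lemma mean_square_rate:
  assumes T: "0 < T"
  shows "\<exists>K. \<forall>(M :: 'w measure) F W u0 u N. brownian_motion M F W \<longrightarrow> u0 \<in> Hs (s + 4) \<longrightarrow> Hs_norm (s + 4) u0 = \<nu> \<longrightarrow>
      mild_solution M F W s \<sigma> \<theta> R T u0 u \<longrightarrow> 1 \<le> N \<longrightarrow>
      (\<forall>n\<in>{0..N}. integrable M (\<lambda>\<omega>. (Hs_norm s (\<lambda>x. splitting s \<sigma> \<theta> R (T / real N) (\<lambda>t. W t \<omega>) u0 n x - u (real n * (T / real N)) \<omega> x))\<^sup>2) \<and>
        (\<integral>\<omega>. (Hs_norm s (\<lambda>x. splitting s \<sigma> \<theta> R (T / real N) (\<lambda>t. W t \<omega>) u0 n x - u (real n * (T / real N)) \<omega> x))\<^sup>2 \<partial>M) \<le> K * (T / real N)\<^sup>2)"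
proof -
  obtain C where C: "0 \<le> C"
    and cmp: "\<And>w u0 h m n. reg 4 \<nu> u0 \<Longrightarrow> 0 < h \<Longrightarrow> h \<le> T \<Longrightarrow> 1 \<le> m \<Longrightarrow> real n * h \<le> T \<Longrightarrow>
       norm (tw (h / real m) w u0 (n * m) - tw h (\<lambda>k. w (k * m)) u0 n)
       \<le> C * h * (\<Sum>k<n. norm (tw (h / real m) w u0 (k * m) - tw h (\<lambda>k. w (k * m)) u0 k))
         + C * h + C * (\<Sum>k<n. \<Sum>j<m. h / real m * ((w (k * m + j) - w (k * m))\<^sup>2 + \<bar>w (k * m + j) - w (k * m)\<bar> * h))
         + norm (\<Sum>k<n. (\<Sum>j<m. h / real m * (w (k * m + j) - w (k * m))) *\<^sub>R Adr h (w (k * m)) (tw (h / real m) w u0 (k * m)))"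
    and AC: "\<And>w u0 h m k. reg 4 \<nu> u0 \<Longrightarrow> 0 < h \<Longrightarrow> 1 \<le> m \<Longrightarrow> real k * h \<le> T \<Longrightarrow>
       norm (Adr h (w (k * m)) (tw (h / real m) w u0 (k * m))) \<le> C"
    and twC: "\<And>w u0 h n. reg 4 \<nu> u0 \<Longrightarrow> 0 < h \<Longrightarrow> real n * h \<le> T \<Longrightarrow> norm (tw h w u0 n) \<le> C"
    by (rule scheme_compare[OF T, of \<nu>]) blast
  show ?thesis
  proof (intro exI[of _ "rate_const T C"] allI impI)
    fix M :: "'w measure" and F W u0 u and N :: nat
    assume bm: "brownian_motion M F W" and u0: "u0 \<in> Hs (s + 4)" and \<nu>: "Hs_norm (s + 4) u0 = \<nu>"
      and mild: "mild_solution M F W s \<sigma> \<theta> R T u0 u" and N: "1 \<le> N"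
    interpret B: brownian_motion M F W by (rule bm)
    define h where "h = T / real N"
    have h: "0 < h" "h \<le> T" "real N * h = T"
    proof -
      have "T / real N \<le> T / 1" using N T by (intro divide_left_mono) auto
      then show "0 < h" "h \<le> T" "real N * h = T" unfolding h_def using T N by auto
    qed
    have nh: "real n * h \<le> T" if "n \<le> N" for n
    proof -
      have "real n * h \<le> real N * h" using that h by (intro mult_right_mono) auto
      then show ?thesis using h(3) by simp
    qed
    have u0s: "u0 \<in> Hs s" and r: "reg 4 \<nu> (sob u0)"
      using Hs_reg[OF _ u0] \<nu> by auto
    have uH: "u t \<omega> \<in> Hs s" if "t \<in> {0..T}" "\<omega> \<in> space M" for t \<omega>
      using mild that unfolding mild_solution_def by blast
    have um: "(\<lambda>\<omega>. Hs_norm s (\<lambda>x. u t \<omega> x - v x)) \<in> borel_measurable (F t)" if "t \<in> {0..T}" "v \<in> Hs s" for t v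
      using mild that unfolding mild_solution_def by blast
    show "\<forall>n\<in>{0..N}. integrable M (\<lambda>\<omega>. (Hs_norm s (\<lambda>x. splitting s \<sigma> \<theta> R (T / real N) (\<lambda>t. W t \<omega>) u0 n x - u (real n * (T / real N)) \<omega> x))\<^sup>2) \<and>
        (\<integral>\<omega>. (Hs_norm s (\<lambda>x. splitting s \<sigma> \<theta> R (T / real N) (\<lambda>t. W t \<omega>) u0 n x - u (real n * (T / real N)) \<omega> x))\<^sup>2 \<partial>M) \<le> rate_const T C * (T / real N)\<^sup>2"
      unfolding h_def[symmetric]
    proof
      fix n assume "n \<in> {0..N}"
      then have n: "n \<le> N" by simp
      define t where "t = real n * h"
      have t: "t \<in> {0..T}" unfolding t_def using nh[OF n] h by simp
      define X where "X \<omega> = sob (u t \<omega>)" for \<omega>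
      define vn where "vn \<omega> = tw h (\<lambda>k. W (real k * h) \<omega>) (sob u0) n" for \<omega>
      define err where "err \<omega> = (Hs_norm s (\<lambda>x. splitting s \<sigma> \<theta> R h (\<lambda>t. W t \<omega>) u0 n x - u (real n * h) \<omega> x))\<^sup>2" for \<omega>
      have err_eq: "err \<omega> = (norm (X \<omega> - U (W t \<omega>) (vn \<omega>)))\<^sup>2" if "\<omega> \<in> space M" for \<omega>
        unfolding err_def t_def[symmetric] Hs_norm_diff[OF splitting_tw(1)[OF u0s] uH[OF t that]]
          splitting_tw(2)[OF u0s] X_def vn_def by (simp add: norm_minus_commute t_def)
      have Xm: "(\<lambda>\<omega>. norm (X \<omega> - V)) \<in> borel_measurable M" for V
      proof -
        have "(\<lambda>\<omega>. Hs_norm s (\<lambda>x. u t \<omega> x - ev V x)) \<in> borel_measurable M"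
          by (rule B.F_measurable[OF um[OF t ev_in_Hs]])
        moreover have "Hs_norm s (\<lambda>x. u t \<omega> x - ev V x) = norm (X \<omega> - V)" if "\<omega> \<in> space M" for \<omega>
          unfolding X_def Hs_norm_diff[OF uH[OF t that] ev_in_Hs] sob_ev ..
        ultimately show ?thesis by (simp cong: measurable_cong)
      qed
      have nm: "(\<lambda>\<omega>. norm (X \<omega> - U (W t \<omega>) (vn \<omega>))) \<in> borel_measurable M"
        unfolding vn_def t_def
      proof (rule distance_measurable[OF Xm, where n=n and W="\<lambda>j. W (real j * h)" and \<Psi>="\<lambda>w. U (w n) (tw h w (sob u0) n)"])
        show "continuous_on UNIV (\<lambda>w. U (w n) (tw h w (sob u0) n))"
          by (intro continuous_intros continuous_on_product_coordinates tw_continuous)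
        show "U (w n) (tw h w (sob u0) n) = U (w' n) (tw h w' (sob u0) n)" if "\<And>i. i \<le> n \<Longrightarrow> w i = w' i" for w w'
          using tw_cong[of n w w' h "sob u0"] that by simp
        show "W (real j * h) \<in> borel_measurable M" for j by (rule B.W_measurable) (use h in simp)
      qed
      have err_meas: "err \<in> borel_measurable M"
      proof (rule measurable_cong[OF err_eq, THEN iffD2])
        show "(\<lambda>\<omega>. (norm (X \<omega> - U (W t \<omega>) (vn \<omega>)))\<^sup>2) \<in> borel_measurable M"
          by (rule borel_measurable_power[OF nm])
      qed
      \<comment> \<open>Indexing by \<open>Suc m\<close> avoids a refinement into zero
        parts.\<close>
      define em where "em m \<omega> = (norm (tw (h / real (Suc m)) (\<lambda>j. W (real j * (h / real (Suc m))) \<omega>) (sob u0) (n * Suc m) - vn \<omega>))\<^sup>2" for m \<omega>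
      \<comment> \<open>Every \<open>Suc m\<close>-th point of the fine grid is a coarse point, so
        the coarse scheme reads the same path values for all m.\<close>
      have vn_eq: "vn \<omega> = tw h (\<lambda>k. W (real (k * Suc m) * (h / real (Suc m))) \<omega>) (sob u0) n" for m \<omega>
      proof -
        have "real (Suc m) * (h / real (Suc m)) = h" by (simp del: of_nat_Suc)
        then have "real (k * Suc m) * (h / real (Suc m)) = real k * h" for k by (simp only: of_nat_mult mult.assoc)
        then show ?thesis unfolding vn_def by (simp only:)
      qed
      have twm: "norm (tw (h / real (Suc m)) w (sob u0) (k * Suc m)) \<le> C" if "k \<le> N" for k m w
      proof (rule twC[OF r])
        have "real (Suc m) * (h / real (Suc m)) = h" by (simp del: of_nat_Suc)
        then have "real (k * Suc m) * (h / real (Suc m)) = real k * h" by (simp only: of_nat_mult mult.assoc)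
        then show "real (k * Suc m) * (h / real (Suc m)) \<le> T" using nh[OF that] by simp
      qed (use h in simp)
      have rate: "em m \<in> borel_measurable M" "(\<integral>\<omega>. em m \<omega> \<partial>M) \<le> rate_const T C * h\<^sup>2" for m
      proof -
        have m: "1 \<le> Suc m" and Nh: "real N * h \<le> T" using h(3) by simp_all
        note R = scheme_rate[where m="Suc m" and N=N and ?u0.0="sob u0", OF bm h(1,2) m Nh C _ _ _ _ n]
        show "em m \<in> borel_measurable M"
          unfolding em_def vn_eq[of _ m]
          by (rule R(1); (rule cmp[OF r h(1,2) m nh] | rule AC[OF r h(1) m nh] | rule twC[OF r h(1) nh] | rule twm); assumption)
        show "(\<integral>\<omega>. em m \<omega> \<partial>M) \<le> rate_const T C * h\<^sup>2"
          unfolding em_def vn_eq[of _ m]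
          by (rule R(2); (rule cmp[OF r h(1,2) m nh] | rule AC[OF r h(1) m nh] | rule twC[OF r h(1) nh] | rule twm); assumption)
      qed
      have conv: "AE \<omega> in M. (\<lambda>m. em m \<omega>) \<longlonglongrightarrow> err \<omega>"
      proof -
        have 1: "AE \<omega> in M. (\<forall>t\<in>{0..T}. ((\<lambda>r. Hs_norm s (\<lambda>x. u r \<omega> x - u t \<omega> x)) \<longlongrightarrow> 0) (at t within {0..T})) \<and>
          (\<forall>t\<in>{0..T}. \<exists>J. has_Hs_integral s 0 t
             (\<lambda>r. free_flow (W t \<omega> - W r \<omega>)
                (\<lambda>x. complex_of_real (theta_R s \<theta> R (u r \<omega>) * cmod (u r \<omega> x) ^ (2 * \<sigma>)) * u r \<omega> x)) J \<and>
           (AE x in lborel. u t \<omega> x = free_flow (W t \<omega> - W 0 \<omega>) u0 x + \<i> * J x))"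
          using mild unfolding mild_solution_def by blast
        show ?thesis
          using 1 B.continuous_paths AE_space
        proof eventually_elim
          case (elim \<omega>)
          have wc: "continuous_on {0..T} (\<lambda>t. W t \<omega>)" by (rule continuous_on_subset[OF elim(2)]) auto
          have "(\<lambda>m. tw (h / real (Suc m)) (\<lambda>j. W (real j * (h / real (Suc m))) \<omega>) (sob u0) (n * Suc m)) \<longlonglongrightarrow> U (- W (real n * h) \<omega>) (sob (u (real n * h) \<omega>))"
            by (rule path_convergence[OF T wc u0s _ _ _ h(1) nh[OF n], where u="\<lambda>t. u t \<omega>"])
              (use elim uH in auto)
          then have "(\<lambda>m. em m \<omega>) \<longlonglongrightarrow> (norm (U (- W t \<omega>) (X \<omega>) - vn \<omega>))\<^sup>2"
            unfolding em_def t_def X_def by (intro tendsto_intros)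
          moreover have "norm (U (- W t \<omega>) (X \<omega>) - vn \<omega>) = norm (X \<omega> - U (W t \<omega>) (vn \<omega>))"
            using norm_U[of "W t \<omega>" "U (- W t \<omega>) (X \<omega>) - vn \<omega>"] by (simp add: U_diff)
          ultimately show ?case using err_eq[OF elim(3)] by simp
        qed
      qed
      \<comment> \<open>The propagated regularity bounds both schemes by C uniformly in the path and
        in m, which gives a constant as dominating function.\<close>
      have em_bd: "norm (em m \<omega>) \<le> (2 * C)\<^sup>2" for m \<omega>
      proof -
        have "norm (vn \<omega>) \<le> C" unfolding vn_def by (rule twC[OF r h(1) nh[OF n]])
        then have "norm (tw (h / real (Suc m)) (\<lambda>j. W (real j * (h / real (Suc m))) \<omega>) (sob u0) (n * Suc m) - vn \<omega>) \<le> 2 * C"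
          using norm_triangle_ineq4[of "tw (h / real (Suc m)) (\<lambda>j. W (real j * (h / real (Suc m))) \<omega>) (sob u0) (n * Suc m)" "vn \<omega>"]
            twm[OF n, of m "\<lambda>j. W (real j * (h / real (Suc m))) \<omega>"] by linarith
        then have "em m \<omega> \<le> (2 * C)\<^sup>2" unfolding em_def by (rule power_mono) simp
        then show ?thesis unfolding em_def by simp
      qed
      have w_int: "integrable M (\<lambda>_. (2 * C)\<^sup>2)" by simp
      have dom: "AE \<omega> in M. norm (em m \<omega>) \<le> (2 * C)\<^sup>2" for m using em_bd by simp
      have "integrable M err"
        by (rule integrable_dominated_convergence[OF err_meas rate(1) w_int conv dom])
      moreover have "(\<lambda>m. \<integral>\<omega>. em m \<omega> \<partial>M) \<longlonglongrightarrow> (\<integral>\<omega>. err \<omega> \<partial>M)"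
        by (rule integral_dominated_convergence[OF err_meas rate(1) w_int conv dom])
      then have "(\<integral>\<omega>. err \<omega> \<partial>M) \<le> rate_const T C * h\<^sup>2"
        by (rule LIMSEQ_le_const2) (use rate(2) in auto)
      ultimately show "integrable M (\<lambda>\<omega>. (Hs_norm s (\<lambda>x. splitting s \<sigma> \<theta> R h (\<lambda>t. W t \<omega>) u0 n x - u (real n * h) \<omega> x))\<^sup>2) \<and>
        (\<integral>\<omega>. (Hs_norm s (\<lambda>x. splitting s \<sigma> \<theta> R h (\<lambda>t. W t \<omega>) u0 n x - u (real n * h) \<omega> x))\<^sup>2 \<partial>M) \<le> rate_const T C * h\<^sup>2"
        unfolding err_def[abs_def] by blast
    qed
  qed
qed

end

section \<open>From the cut-off function to the constant of the theorem\<close>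

lemma smooth_halfline_lipschitz:
  assumes "smooth_halfline \<theta>" and supp: "\<And>x. 2 < x \<Longrightarrow> \<theta> x = 0"
  shows "\<exists>L. \<forall>x\<ge>0. \<forall>y\<ge>0. \<bar>\<theta> x - \<theta> y\<bar> \<le> L * \<bar>x - y\<bar>"
proof -
  obtain D :: "nat \<Rightarrow> real \<Rightarrow> real" where D0: "\<And>x. x \<ge> 0 \<Longrightarrow> D 0 x = \<theta> x"
    and D: "\<And>k x. x \<ge> 0 \<Longrightarrow> (D k has_real_derivative D (Suc k) x) (at x within {0..})"
    using assms(1) unfolding smooth_halfline_def by blast
  have "continuous_on {0..} (D 1)"
    by (rule DERIV_continuous_on[of _ _ "D (Suc 1)"]) (use D[of _ 1] in auto)
  \<comment> \<open>The interval ends at 3 because \<open>supp\<close> makes \<theta> vanish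
    strictly beyond 2; clipping arguments at 3 therefore leaves the values of \<theta>
    unchanged.\<close>
  then have "continuous_on {0..3} (D 1)" by (rule continuous_on_subset) auto
  then have "compact (D 1 ` {0..3})" by (rule compact_continuous_image) simp
  then obtain B where B: "\<And>x. x \<in> {0..3} \<Longrightarrow> \<bar>D 1 x\<bar> \<le> B"
    using compact_imp_bounded bounded_iff real_norm_def by (metis imageI)
  have B0: "0 \<le> B" using B[of 0] by simp
  have near: "\<bar>\<theta> x - \<theta> y\<bar> \<le> B * \<bar>x - y\<bar>" if "x \<in> {0..3}" "y \<in> {0..3}" for x y
  proof -
    have "norm (D 0 x - D 0 y) \<le> B * norm (x - y)"
    proof (rule field_differentiable_bound[of "{0..3}" "D 0" "D 1"])
      show "(D 0 has_field_derivative D 1 z) (at z within {0..3})" if "z \<in> {0..3}" for z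
        using DERIV_subset[OF D[of z 0]] that by auto
    qed (use that B in auto)
    then show ?thesis using that D0 by simp
  qed
  have clip: "\<theta> x = \<theta> (min x 3)" for x using supp[of x] supp[of 3] by (auto simp: min_def)
  have "\<bar>\<theta> x - \<theta> y\<bar> \<le> B * \<bar>x - y\<bar>" if "0 \<le> x" "0 \<le> y" for x y
  proof -
    have "\<bar>\<theta> x - \<theta> y\<bar> \<le> B * \<bar>min x 3 - min y 3\<bar>"
      using near[of "min x 3" "min y 3"] that unfolding clip[symmetric] by auto
    also have "\<dots> \<le> B * \<bar>x - y\<bar>" by (intro mult_left_mono B0) (auto simp: min_def)
    finally show ?thesis .
  qed
  then show ?thesis by blast
qed

theorem proposition3p4:
  fixes s :: real and \<sigma> :: nat and \<theta> :: "real \<Rightarrow> real"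
  assumes "s > 1 / 2" and "1 \<le> \<sigma>" and "\<sigma> \<le> 2"
    and "smooth_halfline \<theta>"
    and "closure {x. 0 \<le> x \<and> \<theta> x \<noteq> 0} \<subseteq> {0..2}"
    and "\<forall>x\<in>{0..1}. \<theta> x = 1"
  shows "\<exists>C :: real \<Rightarrow> real \<Rightarrow> real \<Rightarrow> real.
    \<forall>(M :: 'w measure) F W T R u0 u (N :: nat).
      brownian_motion M F W \<longrightarrow> T > 0 \<longrightarrow> R > 0 \<longrightarrow> u0 \<in> Hs (s + 4) \<longrightarrow>
      mild_solution M F W s \<sigma> \<theta> R T u0 u \<longrightarrow> N \<ge> 1 \<longrightarrow>
      (let \<delta>t = T / real N;
           err = (\<lambda>n \<omega>. (Hs_norm s (\<lambda>x. splitting s \<sigma> \<theta> R \<delta>t (\<lambda>t. W t \<omega>) u0 n x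
                                       - u (real n * \<delta>t) \<omega> x))\<^sup>2)
       in (\<forall>n\<in>{0..N}. integrable M (err n)) \<and>
          (SUP n\<in>{0..N}. prob_space.expectation M (err n)) \<le> C T R (Hs_norm (s + 4) u0) * \<delta>t\<^sup>2)"
proof -
  have supp: "\<theta> x = 0" if "2 < x" for x
  proof (rule ccontr)
    assume "\<theta> x \<noteq> 0"
    then have "x \<in> closure {x. 0 \<le> x \<and> \<theta> x \<noteq> 0}" using that by (intro closure_subset[THEN subsetD]) simp
    then show False using assms(5) that by auto
  qed
  obtain L where L: "\<And>x y. 0 \<le> x \<Longrightarrow> 0 \<le> y \<Longrightarrow> \<bar>\<theta> x - \<theta> y\<bar> \<le> L * \<bar>x - y\<bar>"
    using smooth_halfline_lipschitz[OF assms(4) supp] by blast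
  define P where "P T R \<nu> K \<longleftrightarrow> (\<forall>(M :: 'w measure) F W u0 u N. brownian_motion M F W \<longrightarrow> u0 \<in> Hs (s + 4) \<longrightarrow> Hs_norm (s + 4) u0 = \<nu> \<longrightarrow>
      mild_solution M F W s \<sigma> \<theta> R T u0 u \<longrightarrow> 1 \<le> N \<longrightarrow>
      (\<forall>n\<in>{0..N}. integrable M (\<lambda>\<omega>. (Hs_norm s (\<lambda>x. splitting s \<sigma> \<theta> R (T / real N) (\<lambda>t. W t \<omega>) u0 n x - u (real n * (T / real N)) \<omega> x))\<^sup>2) \<and>
        (\<integral>\<omega>. (Hs_norm s (\<lambda>x. splitting s \<sigma> \<theta> R (T / real N) (\<lambda>t. W t \<omega>) u0 n x - u (real n * (T / real N)) \<omega> x))\<^sup>2 \<partial>M) \<le> K * (T / real N)\<^sup>2))"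
    for T R \<nu> K
  have ex: "\<exists>K. P T R \<nu> K" if "0 < T" "0 < R" for T R \<nu>
  proof -
    interpret truncated_nls s \<sigma> \<theta> L R
      by unfold_locales (use assms(1,2) that L supp in auto)
    show ?thesis unfolding P_def by (rule mean_square_rate[OF that(1)])
  qed
  \<comment> \<open>The rate is proved in a locale interpreted separately for each R, so the
    constant is selected by choice for each triple of arguments. The quantifiers inside
    \<open>P\<close> make it independent of the probability space, the solution and N; outside T, R
    > 0 its value is arbitrary.\<close>
  define C where "C T R \<nu> = (SOME K. P T R \<nu> K)" for T R \<nu>
  show ?thesis
    unfolding Let_def
  proof (rule exI[of _ C], intro allI impI)
    fix M :: "'w measure" and F W T R u0 u and N :: nat
    assume a: "brownian_motion M F W" "T > 0" "R > 0" "u0 \<in> Hs (s + 4)" "mild_solution M F W s \<sigma> \<theta> R T u0 u" "N \<ge> 1"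
    have "P T R (Hs_norm (s + 4) u0) (C T R (Hs_norm (s + 4) u0))"
      unfolding C_def by (rule someI_ex[OF ex[OF a(2,3)]])
    from this[unfolded P_def, rule_format, OF a(1,4) refl a(5,6)]
    show "(\<forall>n\<in>{0..N}. integrable M (\<lambda>\<omega>. (Hs_norm s (\<lambda>x. splitting s \<sigma> \<theta> R (T / real N) (\<lambda>t. W t \<omega>) u0 n x - u (real n * (T / real N)) \<omega> x))\<^sup>2)) \<and>
        (SUP n\<in>{0..N}. prob_space.expectation M (\<lambda>\<omega>. (Hs_norm s (\<lambda>x. splitting s \<sigma> \<theta> R (T / real N) (\<lambda>t. W t \<omega>) u0 n x - u (real n * (T / real N)) \<omega> x))\<^sup>2))
          \<le> C T R (Hs_norm (s + 4) u0) * (T / real N)\<^sup>2"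
      by (intro conjI ballI cSUP_least) auto
  qed
qed

end
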